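(* Let $s\in(0,1/2)$ and let $\mathcal{N}\subset\mathbb{R}^d$ be a compact smooth submanifold without boundary. There exist constants $r_0=r_0(s,\mathcal{N})\in(0,1/2)$ and $\varepsilon_2=\varepsilon_2(s,\mathcal{N})>0$ such that the following holds: if $v\in H^1(B_1^+;\mathbb{R}^d,y^ad\mathbf{x})$ is a minimizing weighted harmonic map with free boundary in $B_1^+$ satisfying $\mathbf{E}_s(v,B_1^+)\le\varepsilon_2^2$, then $$\frac{1}{r_0^{1-2s}}\mathbf{E}_s(v,B_{r_0}^+)<\frac12\mathbf{E}_s(v,B_1^+).$$
   Context: Set $a:=1-2s\in(0,1)$. Write $\mathbb{R}^2_+=\{(x,y):y>0\}$, identify $\mathbb{R}$ with $\mathbb{R}\times\{0\}$, let $B_r(\mathbf{x})$ be the open disc of radius $r$ centered at $\mathbf{x}$, $B_r=B_r(0)$, $B_r^+(\mathbf{x})=B_r(\mathbf{x})\cap\mathbb{R}^2_+$, and for a point $\mathbf{x}_0=(x_0,0)$, $\partial^0B_r^+(\mathbf{x}_0):=(x_0-r,x_0+r)\times\{0\}$. For a bounded open $\Omega\subset\mathbb{R}^2_+$, $H^1(\Omega;\mathbb{R}^d,y^ad\mathbf{x})$ is the space of $v\in L^1_{\rm loc}(\Omega;\mathbb{R}^d)$ with $\int_\Omega y^a(|v|^2+|\nabla v|^2)\,d\mathbf{x}<\infty$; such maps have a well-defined trace on the flat part of the boundary. The weighted energy is $\mathbf{E}_s(v,\Omega):=\frac12\int_\Omega y^a|\nabla v|^2d\mathbf{x}$. A map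 $v\in H^1(B_1^+;\mathbb{R}^d,y^ad\mathbf{x})$ with $v\in\mathcal{N}$ a.e. on $\partial^0B_1^+$ is a minimizing weighted harmonic map with free boundary in $B_1^+$ if $\mathbf{E}_s(v,B_1^+)\le\mathbf{E}_s(w,B_1^+)$ for every $w\in H^1(B_1^+;\mathbb{R}^d,y^ad\mathbf{x})$ with $w\in\mathcal{N}$ a.e. on $\partial^0B_1^+$ and ${\rm spt}(w-v)\subset B_1^+\cup\partial^0B_1^+$.
   Formalization: The formal statement also assumes E_s(v,B_1^+) > 0: for a constant map v with value in N both energies vanish and the strict inequality, as stated, would read 0 < 0. *)

theory Defs
  imports "HOL-Analysis.Analysis"
begin

fun Ck_on :: "nat \<Rightarrow> 'a::euclidean_space set \<Rightarrow> ('a \<Rightarrow> 'b::real_normed_vector) \<Rightarrow> bool" where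
  "Ck_on 0 S f = continuous_on S f"
| "Ck_on (Suc k) S f =
     ((\<forall>x\<in>S. f differentiable (at x)) \<and>
      (\<forall>e\<in>Basis. Ck_on k S (\<lambda>x. frechet_derivative f (at x) e)))"

definition smooth_on :: "'a::euclidean_space set \<Rightarrow> ('a \<Rightarrow> 'b::real_normed_vector) \<Rightarrow> bool" where
  "smooth_on S f \<longleftrightarrow> (\<forall>k. Ck_on k S f)"

definition smooth_submanifold :: "(real^'d) set \<Rightarrow> bool" where
  "smooth_submanifold N \<longleftrightarrow>
    (\<forall>p\<in>N. \<exists>U V (\<phi>::real^'d \<Rightarrow> real^'d) (\<psi>::real^'d \<Rightarrow> real^'d) (L::'d set).
        open U \<and> p \<in> U \<and> open V \<and> smooth_on U \<phi> \<and> smooth_on V \<psi> \<and>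
        \<phi> ` U = V \<and> (\<forall>x\<in>U. \<psi> (\<phi> x) = x) \<and> (\<forall>z\<in>V. \<phi> (\<psi> z) = z) \<and>
        \<phi> ` (N \<inter> U) = {z\<in>V. \<forall>i. i \<notin> L \<longrightarrow> z $ i = 0})"

definition half_ball :: "real \<times> real \<Rightarrow> real \<Rightarrow> (real \<times> real) set" where
  "half_ball c r = ball c r \<inter> {p. snd p > 0}"

definition flat_part :: "real \<Rightarrow> real \<Rightarrow> (real \<times> real) set" where
  "flat_part x0 r = {x0 - r<..<x0 + r} \<times> {0}"

definition locally_integrable_on :: "(real \<times> real) set \<Rightarrow> (real \<times> real \<Rightarrow> real^'d) \<Rightarrow> bool" where
  "locally_integrable_on \<Omega> f \<longleftrightarrow>
     (\<forall>K. compact K \<and> K \<subseteq> \<Omega> \<longrightarrow> set_integrable lebesgue K f)"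

definition test_function :: "(real \<times> real) set \<Rightarrow> (real \<times> real \<Rightarrow> real) \<Rightarrow> bool" where
  "test_function \<Omega> \<phi> \<longleftrightarrow>
     smooth_on UNIV \<phi> \<and> compact (closure {p. \<phi> p \<noteq> 0}) \<and> closure {p. \<phi> p \<noteq> 0} \<subseteq> \<Omega>"

definition is_weak_grad ::
  "(real \<times> real) set \<Rightarrow> (real \<times> real \<Rightarrow> real^'d) \<Rightarrow> (real \<times> real \<Rightarrow> real^'d) \<Rightarrow> (real \<times> real \<Rightarrow> real^'d) \<Rightarrow> bool" where
  "is_weak_grad \<Omega> v g1 g2 \<longleftrightarrow>
     locally_integrable_on \<Omega> v \<and> locally_integrable_on \<Omega> g1 \<and> locally_integrable_on \<Omega> g2 \<and>
     (\<forall>\<phi>. test_function \<Omega> \<phi> \<longrightarrow>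
        (LINT p:\<Omega>|lebesgue. (frechet_derivative \<phi> (at p) (1, 0) *\<^sub>R v p))
          = - (LINT p:\<Omega>|lebesgue. (\<phi> p *\<^sub>R g1 p)) \<and>
        (LINT p:\<Omega>|lebesgue. (frechet_derivative \<phi> (at p) (0, 1) *\<^sub>R v p))
          = - (LINT p:\<Omega>|lebesgue. (\<phi> p *\<^sub>R g2 p)))"

definition weighted_H1 :: "real \<Rightarrow> (real \<times> real) set \<Rightarrow> (real \<times> real \<Rightarrow> real^'d) \<Rightarrow> bool" where
  "weighted_H1 a \<Omega> v \<longleftrightarrow>
     (\<exists>g1 g2. is_weak_grad \<Omega> v g1 g2 \<and>
        (\<integral>\<^sup>+ p\<in>\<Omega>. ennreal (snd p powr a * ((norm (v p))\<^sup>2 + (norm (g1 p))\<^sup>2 + (norm (g2 p))\<^sup>2)) \<partial>lebesgue) < \<infinity>)"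

definition weak_grad ::
  "(real \<times> real) set \<Rightarrow> (real \<times> real \<Rightarrow> real^'d) \<Rightarrow> (real \<times> real \<Rightarrow> real^'d) \<times> (real \<times> real \<Rightarrow> real^'d)" where
  "weak_grad \<Omega> v = (SOME g. is_weak_grad \<Omega> v (fst g) (snd g))"

definition energy_s :: "real \<Rightarrow> (real \<times> real \<Rightarrow> real^'d) \<Rightarrow> (real \<times> real) set \<Rightarrow> real" where
  "energy_s s v \<Omega> =
     1/2 * (LINT p:\<Omega>|lebesgue. (snd p powr (1 - 2 * s) *
        ((norm (fst (weak_grad \<Omega> v) p))\<^sup>2 + (norm (snd (weak_grad \<Omega> v) p))\<^sup>2)))"

text \<open>g is the trace of v on the flat part (x0-r,x0+r) x {0}: the strip averages
  (1/h) int_{(x0-rho,x0+rho) x (0,h)} |v(x,y) - g(x)| tend to 0 as h -> 0+, for every rho < r.\<close>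

definition trace_in :: "(real^'d) set \<Rightarrow> (real \<times> real \<Rightarrow> real^'d) \<Rightarrow> real \<Rightarrow> real \<Rightarrow> bool" where
  "trace_in N v x0 r \<longleftrightarrow>
     (\<exists>g::real \<Rightarrow> real^'d. g \<in> borel_measurable lebesgue \<and>
        (AE x in lebesgue. x \<in> {x0 - r<..<x0 + r} \<longrightarrow> g x \<in> N) \<and>
        (\<forall>\<rho>. 0 < \<rho> \<and> \<rho> < r \<longrightarrow>
           ((\<lambda>h. ennreal (1 / h) *
               (\<integral>\<^sup>+ p\<in>{x0 - \<rho><..<x0 + \<rho>} \<times> {0<..<h}. ennreal (norm (v p - g (fst p))) \<partial>lebesgue))
             \<longlongrightarrow> 0) (at_right 0)))"

definition minimizing_whm_free_boundary :: "real \<Rightarrow> (real^'d) set \<Rightarrow> (real \<times> real \<Rightarrow> real^'d) \<Rightarrow> bool" where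
  "minimizing_whm_free_boundary s N v \<longleftrightarrow>
     weighted_H1 (1 - 2 * s) (half_ball (0,0) 1) v \<and> trace_in N v 0 1 \<and>
     (\<forall>w. weighted_H1 (1 - 2 * s) (half_ball (0,0) 1) w \<and> trace_in N w 0 1 \<and>
          (\<exists>K. compact K \<and> K \<subseteq> half_ball (0,0) 1 \<union> flat_part 0 1 \<and>
               (AE p in lebesgue. p \<in> half_ball (0,0) 1 - K \<longrightarrow> w p = v p))
        \<longrightarrow> energy_s s v (half_ball (0,0) 1) \<le> energy_s s w (half_ball (0,0) 1))"

end

theory Submission
  imports Defs "HOL-Analysis.Analysis"
begin

text \<open>
In the coordinates \<open>\<sigma> = x\<^sup>2 + y\<^sup>2\<close>, \<open>c = x / y\<close> a half disc centred at the origin becomes a strip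
\<open>(0, r\<^sup>2) \<times> \<real>\<close>, and a weakly differentiable map becomes absolutely continuous on almost every
coordinate line. For almost every \<open>S\<close> the slice \<open>\<phi> = v(S, \<cdot>)\<close> has limits \<open>p, q \<in> N\<close> as
\<open>c \<rightarrow> \<plusminus>\<infinity>\<close> (the traces at the two ends of the half circle), and \<open>|q - p|\<^sup>2\<close> is bounded by the
angular energy of the slice because \<open>a < 1\<close>.

If this angular energy is small, \<open>p\<close> and \<open>q\<close> are joined by a nearly straight curve \<open>\<gamma>\<close> in \<open>N\<close>, and
\<open>p + T (\<phi> - p) + \<zeta>(c) (\<gamma>(T) - p - T (q - p))\<close> with \<open>T = (\<sigma> / S)\<^sup>\<beta>\<close> and a cut-off \<open>\<zeta>\<close> running from
\<open>1\<close> at \<open>-\<infinity>\<close> to \<open>0\<close> at \<open>+\<infinity>\<close> extends the slice to an admissible competitor inside the half disc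
\<open>\<sigma> < S\<close>. Comparing energies gives \<open>(a/2 + \<beta>) E(S) \<le> S E'(S)\<close> for the energy \<open>E(S)\<close> of that half
disc. If the angular energy is not small, the same inequality is immediate from \<open>E \<le> \<epsilon>\<^sup>2\<close>.
Integration yields \<open>E(r\<^sup>2) \<le> r\<^bsup>a + 2\<beta>\<^esup> E(1)\<close>, and \<open>r\<close> is chosen with \<open>r\<^bsup>2\<beta>\<^esup> = 1/4\<close>. No compactness
argument is needed.
\<close>

section \<open>Smooth functions and bumps\<close>

text \<open>The exponent a/2 is what scaling alone gives: extending a slice of angular energy e
  constantly along rays costs (1/2) e S^(a/2) / (a/2), while S E'(S) is at least (1/2) e S^(a/2), so
  E(S) / S^(a/2) need not shrink. Contracting towards p with T = (\<sigma>/S)^\<beta> replaces the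
  denominator by a/2 + 2 \<beta>, a gain linear in \<beta>. The price is quadratic, 16 \<beta>^2
  C0^2, for the radial derivative, and a multiple of \<tau> for the bending of \<gamma>, where
  \<tau> is the relative deviation of its velocity from the chord. Choosing \<beta> small, and then
  \<tau> small compared with \<beta>, leaves the net exponent a/2 + \<beta>. The obstacle is the
  free boundary: contraction along chords would push the trace off N on the side c -> -\<infinity>,
  so there it has to follow \<gamma>; the cut-off spreads this correction over the angles. C0 is the
  integral of (1 + c^2)^(a/2 - 1); by Cauchy-Schwarz it bounds the squared length of a slice by its
  angular energy. The comparison is available only for almost every S, and E is only absolutely
  continuous, so the differential inequality is integrated by parts.\<close>

lemma Ck_on_cong:
  assumes "open S" "\<And>x. x \<in> S \<Longrightarrow> f x = g x" "Ck_on k S f"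
  shows "Ck_on k S g"
  using assms
proof (induction k arbitrary: f g)
  case 0
  then show ?case by (metis Ck_on.simps(1) continuous_on_cong)
next
  case (Suc k)
  have d: "(f has_derivative F) (at x) \<longleftrightarrow> (g has_derivative F) (at x)" if "x \<in> S" for x F
    using Suc.prems(1,2) that
    by (metis has_derivative_transform_within_open)
  have fd: "frechet_derivative f (at x) = frechet_derivative g (at x)" if "x \<in> S" for x
    unfolding frechet_derivative_def using d[OF that] by simp
  have "\<forall>x\<in>S. g differentiable at x"
  proof
    fix x assume x: "x \<in> S"
    then obtain F where "(f has_derivative F) (at x)" using Suc.prems(3) by (auto simp: differentiable_def)
    then show "g differentiable at x" using d[OF x] unfolding differentiable_def by blast
  qed
  moreover have "Ck_on k S (\<lambda>x. frechet_derivative g (at x) e)" if "e \<in> Basis" for e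
    using Suc.IH[of "\<lambda>x. frechet_derivative f (at x) e" "\<lambda>x. frechet_derivative g (at x) e"] Suc.prems fd that by auto
  ultimately show ?case by auto
qed

text \<open>\<open>Ck_on\<close> recurses through \<open>frechet_derivative\<close>, which is
  awkward to compute with; by uniqueness of derivatives any explicit derivative may stand in for it.
  Most closure properties below use this rule for the successor step.\<close>

lemma Ck_on_SucI:
  assumes "open S" "\<And>x. x \<in> S \<Longrightarrow> (f has_derivative f' x) (at x)"
    and "\<And>e. e \<in> Basis \<Longrightarrow> Ck_on k S (\<lambda>x. f' x e)"
  shows "Ck_on (Suc k) S f"
proof -
  have fd: "frechet_derivative f (at x) = f' x" if "x \<in> S" for x
    using assms(2)[OF that] frechet_derivative_at by metis
  have "Ck_on k S (\<lambda>x. frechet_derivative f (at x) e)" if "e \<in> Basis" for e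
    by (rule Ck_on_cong[OF assms(1) _ assms(3)[OF that]]) (simp add: fd)
  then show ?thesis using assms(2) by (auto simp: differentiable_def)
qed

lemma Ck_on_SucD:
  assumes "Ck_on (Suc k) S f" and "x \<in> S"
  shows "(f has_derivative frechet_derivative f (at x)) (at x)"
  using assms by (auto simp: frechet_derivative_works)

lemma Ck_on_mono_Suc: "Ck_on (Suc k) S f \<Longrightarrow> Ck_on k S f"
proof (induction k arbitrary: f)
  case 0
  then show ?case
    by (auto intro!: continuous_at_imp_continuous_on differentiable_imp_continuous_within)
next
  case (Suc k)
  then show ?case by auto
qed

lemma Ck_on_subset:
  assumes "Ck_on k S f" "T \<subseteq> S"
  shows "Ck_on k T f"
  using assms by (induction k arbitrary: f) (auto intro: continuous_on_subset)

lemma Ck_on_const: "open S \<Longrightarrow> Ck_on k S (\<lambda>_. c)"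
proof (induction k arbitrary: c)
  case (Suc k)
  show ?case
    by (rule Ck_on_SucI[OF \<open>open S\<close>, where f' = "\<lambda>_ _. 0"]) (auto intro: Suc)
qed auto

lemma Ck_on_bounded_linear:
  assumes "open S" "bounded_linear f"
  shows "Ck_on k S f"
proof (cases k)
  case 0
  then show ?thesis using assms by (simp add: linear_continuous_on)
next
  case (Suc m)
  show ?thesis unfolding Suc
    by (rule Ck_on_SucI[OF assms(1), where f' = "\<lambda>_. f"])
       (auto intro: bounded_linear_imp_has_derivative Ck_on_const assms)
qed

lemma Ck_on_add:
  assumes "open S" "Ck_on k S f" "Ck_on k S g"
  shows "Ck_on k S (\<lambda>x. f x + g x)"
  using assms(2,3)
proof (induction k arbitrary: f g)
  case 0
  then show ?case by (auto intro: continuous_intros)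
next
  case (Suc k)
  show ?case
    by (rule Ck_on_SucI[OF assms(1), where f' = "\<lambda>x e. frechet_derivative f (at x) e + frechet_derivative g (at x) e"])
      (use Suc Ck_on_SucD[OF Suc.prems(1)] Ck_on_SucD[OF Suc.prems(2)] in \<open>auto intro!: has_derivative_add\<close>)
qed

lemma Ck_on_mult:
  fixes f g :: "'a::euclidean_space \<Rightarrow> real"
  assumes "open S" "Ck_on k S f" "Ck_on k S g"
  shows "Ck_on k S (\<lambda>x. f x * g x)"
  using assms(2,3)
proof (induction k arbitrary: f g)
  case 0
  then show ?case by (auto intro: continuous_intros)
next
  case (Suc k)
  have m: "Ck_on k S f" "Ck_on k S g" using Suc.prems Ck_on_mono_Suc by auto
  show ?case
  proof (rule Ck_on_SucI[OF assms(1), where f' = "\<lambda>x e. f x * frechet_derivative g (at x) e + frechet_derivative f (at x) e * g x"])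
    show "((\<lambda>x. f x * g x) has_derivative (\<lambda>e. f x * frechet_derivative g (at x) e + frechet_derivative f (at x) e * g x)) (at x)"
      if "x \<in> S" for x
      using Ck_on_SucD[OF Suc.prems(1) that] Ck_on_SucD[OF Suc.prems(2) that] by (rule has_derivative_mult)
    show "Ck_on k S (\<lambda>x. f x * frechet_derivative g (at x) e + frechet_derivative f (at x) e * g x)"
      if "e \<in> Basis" for e
      using Suc.prems that by (intro Ck_on_add assms(1) Suc.IH m) auto
  qed
qed

text \<open>The outer function is scalar, so the derivative of the composite is h'(f x) times that
  of f. Its first factor is a composite of the same kind one order lower, which is why the induction
  keeps f and varies h.\<close>

lemma Ck_on_compose_real:
  fixes f :: "'a::euclidean_space \<Rightarrow> real" and h :: "real \<Rightarrow> real"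
  assumes "open S" "open T" "f ` S \<subseteq> T" "Ck_on k T h" "Ck_on k S f"
  shows "Ck_on k S (\<lambda>x. h (f x))"
  using assms(4,5)
proof (induction k arbitrary: h)
  case 0
  then show ?case using assms(3) by (auto intro: continuous_on_compose2)
next
  case (Suc k)
  let ?h = "\<lambda>t. frechet_derivative h (at t) 1"
  show ?case
  proof (rule Ck_on_SucI[OF assms(1), where f' = "\<lambda>x e. ?h (f x) * frechet_derivative f (at x) e"])
    fix x assume x: "x \<in> S"
    then have fx: "f x \<in> T" using assms(3) by auto
    have "((\<lambda>x. h (f x)) has_derivative (\<lambda>e. frechet_derivative h (at (f x)) (frechet_derivative f (at x) e))) (at x)"
      using has_derivative_compose[OF Ck_on_SucD[OF Suc.prems(2) x] Ck_on_SucD[OF Suc.prems(1) fx]] .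
    then show "((\<lambda>x. h (f x)) has_derivative (\<lambda>e. ?h (f x) * frechet_derivative f (at x) e)) (at x)"
    proof (rule has_derivative_eq_rhs, intro ext)
      fix e
      have l: "linear (frechet_derivative h (at (f x)))"
        using Ck_on_SucD[OF Suc.prems(1) fx] has_derivative_linear by blast
      show "frechet_derivative h (at (f x)) (frechet_derivative f (at x) e) = ?h (f x) * frechet_derivative f (at x) e"
        using linear_scale[OF l, of "frechet_derivative f (at x) e" 1, unfolded real_scaleR_def mult_1_right] by (simp only: mult.commute)
    qed
  next
    fix e :: 'a assume e: "e \<in> Basis"
    have "Ck_on k S f" using Suc.prems Ck_on_mono_Suc by auto
    then show "Ck_on k S (\<lambda>x. ?h (f x) * frechet_derivative f (at x) e)"
      using Suc.prems e by (intro Ck_on_mult[OF assms(1) Suc.IH[of ?h]]) auto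
  qed
qed

lemma Ck_on_inverse: "Ck_on k (- {0::real}) inverse"
proof (induction k)
  case 0
  show ?case by (auto intro!: continuous_intros)
next
  case (Suc k)
  have o: "open (- {0::real})" by auto
  show ?case
  proof (rule Ck_on_SucI[OF o, where f' = "\<lambda>x e. - 1 * (inverse x * inverse x) * e"])
    show "(inverse has_derivative (\<lambda>e. - 1 * (inverse x * inverse x) * e)) (at x)" if "x \<in> - {0}" for x :: real
      using that by (auto intro!: derivative_eq_intros simp: fun_eq_iff)
    show "Ck_on k (- {0}) (\<lambda>x. - 1 * (inverse x * inverse x) * e)" for e :: real
      by (intro Ck_on_mult o Ck_on_const Suc)
  qed
qed

text \<open>Differentiability \<open>at x\<close> is local, so regularity glues over open sets. In
  use: an explicit formula on one open set and the constant 0 off a compact set.\<close>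

lemma Ck_on_Un:
  assumes "open S" "open T" "Ck_on k S f" "Ck_on k T f"
  shows "Ck_on k (S \<union> T) f"
  using assms(3,4)
  by (induction k arbitrary: f) (use assms(1,2) in \<open>auto intro: continuous_on_open_Un\<close>)

lemma Ck_on_real_SucI:
  fixes f f' :: "real \<Rightarrow> real"
  assumes "\<And>x. (f has_real_derivative f' x) (at x)" "Ck_on k UNIV f'"
  shows "Ck_on (Suc k) UNIV f"
  by (rule Ck_on_SucI[where f' = "\<lambda>x e. f' x * e"])
    (use assms in \<open>auto simp: has_field_derivative_def\<close>)

text \<open>The classical flat function exp(-1/t) times powers of 1/t. The index n closes the family
  under differentiation, so that smoothness follows by induction on the order for all n at
  once.\<close>

definition flat_exp :: "nat \<Rightarrow> real \<Rightarrow> real" where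
  "flat_exp n t = (if t \<le> 0 then 0 else (1/t) ^ n * exp (- (1/t)))"

lemma flat_exp_has_derivative:
  "(flat_exp n has_real_derivative (flat_exp (n+2) t - n * flat_exp (n+1) t)) (at t)"
proof (cases t "0::real" rule: linorder_cases)
  case less
  have "((\<lambda>_. 0) has_real_derivative 0) (at t)" by simp
  then have "(flat_exp n has_real_derivative 0) (at t)"
    by (rule has_field_derivative_transform_within_open[where S = "{..<0}"])
       (use less in \<open>auto simp: flat_exp_def\<close>)
  then show ?thesis using less by (simp add: flat_exp_def)
next
  case greater
  have "((\<lambda>t. 1/t) has_real_derivative - ((1/t) * (1/t))) (at t)"
    using greater by (auto intro!: derivative_eq_intros)
  note d1 = this
  have d2: "((\<lambda>t. (1/t) ^ n) has_real_derivative - (real n * (1/t) ^ (n+1))) (at t)"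
  proof (induction n)
    case (Suc n)
    from DERIV_mult[OF d1 Suc] show ?case by (simp add: algebra_simps add_divide_distrib)
  qed simp
  have d3: "((\<lambda>t. exp (- (1/t))) has_real_derivative exp (- (1/t)) * ((1/t) * (1/t))) (at t)"
    using DERIV_chain2[OF DERIV_exp DERIV_minus[OF d1]] by simp
  have "(1/t) ^ n * (exp (- (1/t)) * ((1/t) * (1/t))) + (- (real n * (1/t) ^ (n+1))) * exp (- (1/t))
     = flat_exp (n+2) t - n * flat_exp (n+1) t"
    using greater by (simp add: flat_exp_def algebra_simps)
  with DERIV_mult[OF d2 d3] have "((\<lambda>t. (1/t) ^ n * exp (- (1/t))) has_real_derivative
      (flat_exp (n+2) t - n * flat_exp (n+1) t)) (at t)"
    by (simp only: add.commute mult.commute)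
  then show ?thesis
    by (rule has_field_derivative_transform_within_open[where S = "{0<..}"])
       (use greater in \<open>auto simp: flat_exp_def\<close>)
next
  case equal
  \<comment> \<open>At 0 the difference quotient from the right is x^(n+1) exp(-x) with x = 1/h,
    which tends to 0.\<close>
  have l: "((\<lambda>x::real. x ^ (n+1) * exp (- x)) \<longlongrightarrow> 0) at_top"
    using tendsto_power_div_exp_0[of "n+1"] by (simp add: exp_minus divide_inverse)
  have "((\<lambda>h::real. (1/h) ^ (n+1) * exp (- (1/h))) \<longlongrightarrow> 0) (at_right 0)"
    using filterlim_compose[OF l filterlim_inverse_at_top_right] by (simp add: inverse_eq_divide)
  then have "((\<lambda>h. flat_exp n h / h) \<longlongrightarrow> 0) (at_right 0)"
    by (rule Lim_transform_eventually)
       (auto simp: eventually_at_right_less flat_exp_def eventually_at_filter field_simps)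
  moreover have "((\<lambda>h. flat_exp n h / h) \<longlongrightarrow> 0) (at_left 0)"
    by (rule Lim_transform_eventually[of "\<lambda>_. 0"])
       (auto simp: flat_exp_def eventually_at_filter)
  ultimately have "((\<lambda>h. flat_exp n h / h) \<longlongrightarrow> 0) (at 0)"
    by (simp add: filterlim_at_split)
  then show ?thesis using equal
    by (simp add: has_field_derivative_iff flat_exp_def)
qed

lemma flat_exp_Ck: "Ck_on k UNIV (flat_exp n)"
proof (induction k arbitrary: n)
  case 0
  show ?case using flat_exp_has_derivative[of n]
    by (auto intro!: continuous_at_imp_continuous_on DERIV_isCont)
next
  case (Suc k)
  have "Ck_on k UNIV (\<lambda>t. flat_exp (n+2) t + (- real n) * flat_exp (n+1) t)"
    by (intro Ck_on_add Ck_on_mult Ck_on_const Suc open_UNIV)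
  then show ?case
    by (intro Ck_on_real_SucI[OF flat_exp_has_derivative]) simp
qed

section \<open>Compactly supported smooth functions on an interval\<close>

definition bump_on :: "real set \<Rightarrow> (real \<Rightarrow> real) \<Rightarrow> bool" where
  "bump_on I \<eta> \<longleftrightarrow> smooth_on UNIV \<eta> \<and> (\<exists>a b. a \<le> b \<and> {a..b} \<subseteq> I \<and> (\<forall>x. x \<notin> {a..b} \<longrightarrow> \<eta> x = 0))"

lemma bump_on_continuous: "bump_on I \<eta> \<Longrightarrow> continuous_on UNIV \<eta>"
  unfolding bump_on_def smooth_on_def by (metis Ck_on.simps(1))

lemma bump_on_has_derivative:
  assumes "bump_on I \<eta>" shows "(\<eta> has_real_derivative deriv \<eta> x) (at x)"
proof -
  have "Ck_on (Suc 0) UNIV \<eta>" using assms by (auto simp: bump_on_def smooth_on_def simp del: Ck_on.simps)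
  then have "\<eta> differentiable (at x)" by auto
  then show ?thesis by (simp add: DERIV_deriv_iff_real_differentiable)
qed

lemma frechet_derivative_real_eq_deriv:
  fixes \<eta> :: "real \<Rightarrow> real"
  assumes "\<eta> differentiable (at x)" shows "frechet_derivative \<eta> (at x) e = deriv \<eta> x * e"
proof -
  have "(\<eta> has_derivative (\<lambda>e. deriv \<eta> x * e)) (at x)"
    using assms by (simp add: DERIV_deriv_iff_real_differentiable[symmetric] has_field_derivative_def)
  then show ?thesis using frechet_derivative_at by metis
qed

lemma bump_on_deriv:
  assumes "bump_on I \<eta>" shows "bump_on I (deriv \<eta>)"
proof -
  obtain a b where ab: "a \<le> b" "{a..b} \<subseteq> I" "\<And>x. x \<notin> {a..b} \<Longrightarrow> \<eta> x = 0" using assms unfolding bump_on_def by blast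
  have "Ck_on k UNIV (deriv \<eta>)" for k
  proof -
    have S: "Ck_on (Suc k) UNIV \<eta>" using assms unfolding bump_on_def smooth_on_def by blast
    then have "Ck_on k UNIV (\<lambda>x. frechet_derivative \<eta> (at x) 1)" by simp
    moreover have "frechet_derivative \<eta> (at x) 1 = deriv \<eta> x" for x
      using S frechet_derivative_real_eq_deriv by auto
    ultimately show ?thesis by simp
  qed
  moreover have "deriv \<eta> x = 0" if "x \<notin> {a..b}" for x
  proof -
    have "((\<lambda>_. 0) has_real_derivative 0) (at x)" by simp
    then have "(\<eta> has_real_derivative 0) (at x)"
      by (rule has_field_derivative_transform_within_open[where S = "- {a..b}"])
         (use that ab(3) in \<open>auto simp: open_Compl\<close>)
    then show ?thesis by (rule DERIV_imp_deriv)
  qed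
  ultimately show ?thesis using ab unfolding bump_on_def smooth_on_def by blast
qed

lemma bump_on_add:
  assumes "is_interval I" "bump_on I f" "bump_on I g" shows "bump_on I (\<lambda>x. f x + g x)"
proof -
  obtain a b where ab: "a \<le> b" "{a..b} \<subseteq> I" "\<And>x. x \<notin> {a..b} \<Longrightarrow> f x = 0" using assms(2) unfolding bump_on_def by blast
  obtain c d where cd: "c \<le> d" "{c..d} \<subseteq> I" "\<And>x. x \<notin> {c..d} \<Longrightarrow> g x = 0" using assms(3) unfolding bump_on_def by blast
  have "min a c \<in> I" "max b d \<in> I" using ab cd by (auto simp: min_def max_def)
  then have "{min a c..max b d} \<subseteq> I"
    using assms(1) by (meson atLeastAtMost_iff mem_is_interval_1_I subsetI)
  moreover have "f x + g x = 0" if "x \<notin> {min a c..max b d}" for x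
    using that ab(3)[of x] cd(3)[of x] by (auto simp: min_le_iff_disj le_max_iff_disj)
  moreover have "Ck_on k UNIV (\<lambda>x. f x + g x)" for k
    using assms(2,3) unfolding bump_on_def smooth_on_def by (intro Ck_on_add) auto
  moreover have "min a c \<le> max b d" using ab cd by linarith
  ultimately show ?thesis unfolding bump_on_def smooth_on_def by blast
qed

lemma bump_on_mult_smooth:
  assumes "bump_on I f" "smooth_on UNIV g" shows "bump_on I (\<lambda>x. g x * f x)"
proof -
  have "Ck_on k UNIV (\<lambda>x. g x * f x)" for k
    using assms unfolding bump_on_def smooth_on_def by (intro Ck_on_mult) auto
  then show ?thesis using assms(1) unfolding bump_on_def smooth_on_def by (metis mult_zero_right)
qed

lemma bump_on_cmult: "bump_on I f \<Longrightarrow> bump_on I (\<lambda>x. c * f x)"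
  by (rule bump_on_mult_smooth) (auto simp: smooth_on_def Ck_on_const)

lemma bump_on_approx_interval:
  fixes a b :: real
  assumes "a < b" "{a..b} \<subseteq> I"
  shows "\<exists>\<eta> :: nat \<Rightarrow> real \<Rightarrow> real. (\<forall>n. bump_on I (\<eta> n)) \<and> (\<forall>n x. 0 \<le> \<eta> n x) \<and> (\<forall>n x. \<eta> n x \<le> 1) \<and>
    (\<forall>n x. x \<notin> {a<..<b} \<longrightarrow> \<eta> n x = 0) \<and> (\<forall>x. (\<lambda>n. \<eta> n x) \<longlonglongrightarrow> indicator {a<..<b} x) \<and>
    (\<forall>n x. x \<in> {a<..<b} \<longrightarrow> 0 < \<eta> (Suc n) x)"
proof -
  \<comment> \<open>For fixed t > 0, \<open>flat_exp 0 (n t)\<close> = exp(-1/(n t)) tends to 1 as n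
    grows, while one of the factors vanishes outside (a, b); scaling the argument thus drives the
    product to the indicator.\<close>
  define \<eta> where "\<eta> n x = flat_exp 0 (real n * (x - a)) * flat_exp 0 (real n * (b - x))" for n x
  have b1: "bump_on I (\<eta> n)" for n
  proof -
    have l: "Ck_on k UNIV (\<lambda>x. real n * (x - a))" "Ck_on k UNIV (\<lambda>x. real n * (b - x))" for k
      using Ck_on_add[OF _ Ck_on_mult[OF _ Ck_on_const Ck_on_bounded_linear[OF _ bounded_linear_ident]] Ck_on_const, of UNIV k "real n" "- real n * a"]
        Ck_on_add[OF _ Ck_on_mult[OF _ Ck_on_const Ck_on_bounded_linear[OF _ bounded_linear_ident]] Ck_on_const, of UNIV k "- real n" "real n * b"]
      by (simp_all add: algebra_simps)
    have "Ck_on k UNIV (\<eta> n)" for k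
      unfolding \<eta>_def
      by (intro Ck_on_mult open_UNIV Ck_on_compose_real[OF open_UNIV open_UNIV subset_UNIV flat_exp_Ck l(1)]
          Ck_on_compose_real[OF open_UNIV open_UNIV subset_UNIV flat_exp_Ck l(2)])
    moreover have "\<eta> n x = 0" if "x \<notin> {a..b}" for x
      using that by (auto simp: \<eta>_def flat_exp_def zero_less_mult_iff not_le)
    ultimately show ?thesis using assms unfolding bump_on_def smooth_on_def by (meson less_imp_le)
  qed
  have f0: "0 \<le> flat_exp 0 t" "flat_exp 0 t \<le> 1" for t by (auto simp: flat_exp_def)
  have b2: "0 \<le> \<eta> n x" "\<eta> n x \<le> 1" for n x
    using f0 by (auto simp: \<eta>_def intro!: mult_le_one)
  have z: "\<eta> n x = 0" if "x \<notin> {a<..<b}" for n x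
    using that by (auto simp: \<eta>_def flat_exp_def zero_less_mult_iff not_le)
  have b3: "(\<lambda>n. \<eta> n x) \<longlonglongrightarrow> indicator {a<..<b} x" for x
  proof (cases "x \<in> {a<..<b}")
    case True
    have t: "(\<lambda>n. flat_exp 0 (real n * t)) \<longlonglongrightarrow> 1" if "t > 0" for t
    proof -
      have "(\<lambda>n. inverse (real n) * inverse t) \<longlonglongrightarrow> 0 * inverse t"
        by (intro tendsto_mult lim_inverse_n tendsto_const)
      then have "(\<lambda>n. exp (- (inverse (real n) * inverse t))) \<longlonglongrightarrow> exp (- (0 * inverse t))"
        by (intro tendsto_exp tendsto_minus)
      then have "(\<lambda>n. exp (- (inverse (real n) * inverse t))) \<longlonglongrightarrow> 1" by simp
      moreover have "\<forall>\<^sub>F n in sequentially. exp (- (inverse (real n) * inverse t)) = flat_exp 0 (real n * t)"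
        using eventually_gt_at_top[of 0]
        by eventually_elim (use that in \<open>simp add: flat_exp_def mult_le_0_iff not_le inverse_eq_divide\<close>)
      ultimately show ?thesis by (rule Lim_transform_eventually)
    qed
    have "(\<lambda>n. \<eta> n x) \<longlonglongrightarrow> 1 * 1"
      unfolding \<eta>_def using True by (intro tendsto_mult t) auto
    then show ?thesis using True by simp
  next
    case False
    then show ?thesis using z by simp
  qed
  have b4: "0 < \<eta> (Suc n) x" if "x \<in> {a<..<b}" for n x
    using that by (auto simp: \<eta>_def flat_exp_def not_le intro!: mult_pos_pos)
  show ?thesis
    by (intro exI[of _ \<eta>] conjI allI impI b1 b2 b3 b4 z)
qed

section \<open>Fubini theorems and the fundamental lemma\<close>

lemma borel_fst_real [measurable]: "fst \<in> borel_measurable (borel :: (real \<times> real) measure)"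
  by (intro borel_measurable_continuous_onI continuous_intros)

lemma borel_snd_real [measurable]: "snd \<in> borel_measurable (borel :: (real \<times> real) measure)"
  by (intro borel_measurable_continuous_onI continuous_intros)

lemma
  fixes f :: "real \<times> real \<Rightarrow> 'b::{banach, second_countable_topology}"
  assumes "integrable lborel f"
  shows fubini_AE_fst: "AE x in lborel. integrable lborel (\<lambda>y. f (x, y))"
    and fubini_integrable_fst: "integrable lborel (\<lambda>x. \<integral>y. f (x, y) \<partial>lborel)"
    and fubini_fst: "(\<integral>q. f q \<partial>lborel) = (\<integral>x. \<integral>y. f (x, y) \<partial>lborel \<partial>lborel)"
    and fubini_AE_snd: "AE y in lborel. integrable lborel (\<lambda>x. f (x, y))"
    and fubini_integrable_snd: "integrable lborel (\<lambda>y. \<integral>x. f (x, y) \<partial>lborel)"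
    and fubini_snd: "(\<integral>q. f q \<partial>lborel) = (\<integral>y. \<integral>x. f (x, y) \<partial>lborel \<partial>lborel)"
proof -
  have i: "integrable (lborel \<Otimes>\<^sub>M lborel) (\<lambda>(x, y). f (x, y))"
    using assms by (simp add: lborel_prod)
  note j = i[unfolded case_prod_unfold prod.collapse]
  show "AE x in lborel. integrable lborel (\<lambda>y. f (x, y))" using lborel_pair.AE_integrable_fst'[OF j] .
  show "integrable lborel (\<lambda>x. \<integral>y. f (x, y) \<partial>lborel)" using lborel_pair.integrable_fst'[OF j] .
  show "(\<integral>q. f q \<partial>lborel) = (\<integral>x. \<integral>y. f (x, y) \<partial>lborel \<partial>lborel)"
    using lborel_pair.integral_fst'[OF j] by (simp add: lborel_prod)
  show "AE y in lborel. integrable lborel (\<lambda>x. f (x, y))" using lborel_pair.AE_integrable_snd[OF i] .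
  show "integrable lborel (\<lambda>y. \<integral>x. f (x, y) \<partial>lborel)" using lborel_pair.integrable_snd[OF i] .
  show "(\<integral>q. f q \<partial>lborel) = (\<integral>y. \<integral>x. f (x, y) \<partial>lborel \<partial>lborel)"
    using lborel_pair.integral_snd[OF i] by (simp add: lborel_prod)
qed

lemma nn_fubini_fst:
  fixes f :: "real \<times> real \<Rightarrow> ennreal"
  assumes [measurable]: "f \<in> borel_measurable borel"
  shows "(\<integral>\<^sup>+q. f q \<partial>lborel) = (\<integral>\<^sup>+x. \<integral>\<^sup>+y. f (x, y) \<partial>lborel \<partial>lborel)"
proof -
  have "f \<in> borel_measurable (lborel \<Otimes>\<^sub>M lborel)" by (simp add: lborel_prod)
  from lborel.nn_integral_fst[OF this] show ?thesis by (simp add: lborel_prod)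
qed

lemma nn_fubini_snd:
  fixes f :: "real \<times> real \<Rightarrow> ennreal"
  assumes [measurable]: "f \<in> borel_measurable borel"
  shows "(\<integral>\<^sup>+q. f q \<partial>lborel) = (\<integral>\<^sup>+y. \<integral>\<^sup>+x. f (x, y) \<partial>lborel \<partial>lborel)"
proof -
  have "(\<lambda>(x, y). f (x, y)) \<in> borel_measurable (lborel \<Otimes>\<^sub>M lborel)" by (simp add: lborel_prod)
  from lborel_pair.nn_integral_snd[OF this] show ?thesis by (simp add: lborel_prod)
qed

lemma AE_lborel_pair_fst:
  assumes "AE q in (lborel :: (real \<times> real) measure). P q"
  shows "AE x in lborel. AE y in lborel. P (x, y)"
proof -
  have "AE q in lborel \<Otimes>\<^sub>M lborel. P q" unfolding lborel_prod by (fact assms)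
  from lborel_pair.AE_pair[OF this] show ?thesis .
qed

text \<open>The exceptional set is enclosed in a Borel null set, whose measure survives the swap
  because both iterated integrals of its indicator agree.\<close>

lemma AE_lborel_pair_swap:
  assumes "AE q in (lborel :: (real \<times> real) measure). P q"
  shows "AE q in (lborel :: (real \<times> real) measure). P (snd q, fst q)"
proof -
  obtain N where N: "N \<in> null_sets (lborel :: (real \<times> real) measure)" "{q. \<not> P q} \<subseteq> N"
    using assms unfolding eventually_ae_filter by auto
  then have [measurable]: "N \<in> sets borel" by auto
  have "emeasure (lborel :: (real \<times> real) measure) {q. (snd q, fst q) \<in> N} = (\<integral>\<^sup>+q. indicator N (snd q, fst q) \<partial>lborel)"
  proof -
    have "{q :: real \<times> real. (snd q, fst q) \<in> N} \<in> sets borel" by measurable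
    then have "emeasure (lborel :: (real \<times> real) measure) {q. (snd q, fst q) \<in> N} = (\<integral>\<^sup>+q. indicator {q. (snd q, fst q) \<in> N} q \<partial>lborel)"
      by simp
    also have "\<dots> = (\<integral>\<^sup>+q. indicator N (snd q, fst q) \<partial>lborel)"
      by (intro nn_integral_cong) (auto simp: indicator_def)
    finally show ?thesis .
  qed
  also have "\<dots> = (\<integral>\<^sup>+x. \<integral>\<^sup>+y. indicator N (y, x) \<partial>lborel \<partial>lborel)"
    by (subst nn_fubini_fst) auto
  also have "\<dots> = (\<integral>\<^sup>+q. indicator N q \<partial>lborel)"
    by (subst nn_fubini_snd) auto
  also have "\<dots> = 0" using N by auto
  finally have "{q :: real \<times> real. (snd q, fst q) \<in> N} \<in> null_sets lborel"
    by (auto intro!: null_setsI)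
  then show ?thesis using N(2) by (auto intro!: AE_I'[of "{q. (snd q, fst q) \<in> N}"])
qed

lemma AE_lborel_pair_snd:
  assumes "AE q in (lborel :: (real \<times> real) measure). P q"
  shows "AE y in lborel. AE x in lborel. P (x, y)"
  using AE_lborel_pair_fst[OF AE_lborel_pair_swap[OF assms]] by simp

lemma AE_lborel_pairI:
  assumes "{q. P q} \<in> sets (borel :: (real \<times> real) measure)" "AE x in lborel. AE y in lborel. P (x, y)"
  shows "AE q in (lborel :: (real \<times> real) measure). P q"
proof -
  have "AE q in lborel \<Otimes>\<^sub>M lborel. P q"
  proof (rule lborel_pair.AE_pair_measure)
    have "sets (lborel \<Otimes>\<^sub>M lborel) = sets (borel :: (real \<times> real) measure)"
      "space (lborel \<Otimes>\<^sub>M lborel) = (UNIV :: (real \<times> real) set)"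
      by (simp_all only: lborel_prod sets_lborel space_lborel space_borel)
    then show "{x \<in> space (lborel \<Otimes>\<^sub>M lborel). P x} \<in> sets (lborel \<Otimes>\<^sub>M lborel)"
      using assms(1) by simp
  qed fact
  then show ?thesis unfolding lborel_prod .
qed

lemma integrable_lborel_swap:
  fixes f :: "real \<times> real \<Rightarrow> 'b::{banach, second_countable_topology}"
  shows "integrable lborel (\<lambda>q. f (snd q, fst q)) \<longleftrightarrow> integrable lborel f"
  using lborel_pair.integrable_product_swap_iff[of f] by (simp add: lborel_prod case_prod_unfold)

lemma integral_lborel_swap:
  fixes f :: "real \<times> real \<Rightarrow> 'b::{banach, second_countable_topology}"
  assumes "f \<in> borel_measurable borel"
  shows "(\<integral>q. f (snd q, fst q) \<partial>lborel) = (\<integral>q. f q \<partial>lborel)"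
  using lborel_pair.integral_product_swap[of f] assms by (simp add: lborel_prod case_prod_unfold)

lemma integrable_lborel_tensor:
  fixes g :: "real \<Rightarrow> real" and h :: "real \<Rightarrow> 'b::{banach, second_countable_topology}"
  assumes g: "integrable lborel g" and h: "integrable lborel h"
  shows "integrable (lborel :: (real \<times> real) measure) (\<lambda>q. g (fst q) *\<^sub>R h (snd q))"
proof -
  have [measurable]: "g \<in> borel_measurable borel" "h \<in> borel_measurable borel"
    using g h by (auto dest: borel_measurable_integrable)
  have "integrable (lborel \<Otimes>\<^sub>M lborel) (\<lambda>q. g (fst q) *\<^sub>R h (snd q))"
  proof (rule lborel_pair.Fubini_integrable)
    show "(\<lambda>q. g (fst q) *\<^sub>R h (snd q)) \<in> borel_measurable (lborel \<Otimes>\<^sub>M lborel)" by measurable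
    show "integrable lborel (\<lambda>x. \<integral>y. norm (g (fst (x, y)) *\<^sub>R h (snd (x, y))) \<partial>lborel)"
      using g by simp
    show "AE x in lborel. integrable lborel (\<lambda>y. g (fst (x, y)) *\<^sub>R h (snd (x, y)))"
      using h by simp
  qed
  then show ?thesis by (simp add: lborel_prod)
qed

section \<open>Local integrability on rectangles and the fundamental lemma with product test
  functions\<close>

lemma Times_interval_measurable [measurable, simp]:
  fixes a b c d :: real
  shows "{a..b} \<times> {c..d} \<in> sets borel" "{a<..<b} \<times> {c<..<d} \<in> sets borel"
  by (auto intro!: borel_Times)

text \<open>Local integrability on I x J, tested on compact boxes only. Borel measurability on the
  whole plane is included so that every Fubini step applies directly to products with indicators and
  bumps.\<close>

definition rect_integrable :: "real set \<Rightarrow> real set \<Rightarrow> (real \<times> real \<Rightarrow> 'b::{banach, second_countable_topology}) \<Rightarrow> bool" where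
  "rect_integrable I J f \<longleftrightarrow> f \<in> borel_measurable borel \<and>
    (\<forall>a b c d. {a..b} \<subseteq> I \<longrightarrow> {c..d} \<subseteq> J \<longrightarrow> integrable lborel (\<lambda>q. indicator ({a..b} \<times> {c..d}) q *\<^sub>R f q))"

lemma rect_integrableD:
  assumes "rect_integrable I J f"
  shows rect_integrable_measurable: "f \<in> borel_measurable borel"
    and rect_integrable_integrable: "{a..b} \<subseteq> I \<Longrightarrow> {c..d} \<subseteq> J \<Longrightarrow> integrable lborel (\<lambda>q. indicator ({a..b} \<times> {c..d}) q *\<^sub>R f q)"
  using assms by (auto simp: rect_integrable_def)

lemma rect_integrable_bounded_mult:
  assumes f: "rect_integrable I J f" and "{a..b} \<subseteq> I" "{c..d} \<subseteq> J"
    and g: "g \<in> borel_measurable borel" "\<And>q. \<bar>g q\<bar> \<le> B * indicator ({a..b} \<times> {c..d}) q"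
  shows "integrable lborel (\<lambda>q. g q *\<^sub>R f q)"
proof -
  have [measurable]: "f \<in> borel_measurable borel" "g \<in> borel_measurable borel"
    using f g by (auto simp: rect_integrable_def)
  show ?thesis
  proof (rule Bochner_Integration.integrable_bound[OF integrable_scaleR_right[OF rect_integrable_integrable[OF assms(1-3)], of B]])
    show "AE q in lborel. norm (g q *\<^sub>R f q) \<le> norm (B *\<^sub>R (indicator ({a..b} \<times> {c..d}) q *\<^sub>R f q))"
    proof (intro AE_I2)
      fix q :: "real \<times> real"
      have "\<bar>g q\<bar> * norm (f q) \<le> (B * indicator ({a..b} \<times> {c..d}) q) * norm (f q)"
        by (intro mult_right_mono g) auto
      also have "\<dots> \<le> norm (B *\<^sub>R (indicator ({a..b} \<times> {c..d}) q *\<^sub>R f q))"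
        by (auto simp: indicator_def intro!: mult_right_mono)
      finally show "norm (g q *\<^sub>R f q) \<le> norm (B *\<^sub>R (indicator ({a..b} \<times> {c..d}) q *\<^sub>R f q))" by simp
    qed
  qed measurable
qed

lemma bump_on_bounded:
  assumes "bump_on I \<eta>"
  obtains a b B where "a \<le> b" "{a..b} \<subseteq> I" "0 \<le> B" "\<And>x. \<bar>\<eta> x\<bar> \<le> B * indicator {a..b} x" "\<And>x. x \<notin> {a..b} \<Longrightarrow> \<eta> x = 0"
proof -
  obtain a b where ab: "a \<le> b" "{a..b} \<subseteq> I" "\<And>x. x \<notin> {a..b} \<Longrightarrow> \<eta> x = 0"
    using assms unfolding bump_on_def by blast
  have "compact (\<eta> ` {a..b})"
    using bump_on_continuous[OF assms] by (intro compact_continuous_image) (auto intro: continuous_on_subset)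
  then obtain B where "\<And>y. y \<in> \<eta> ` {a..b} \<Longrightarrow> norm y \<le> B"
    using compact_imp_bounded bounded_iff by metis
  then have "\<bar>\<eta> x\<bar> \<le> max B 0 * indicator {a..b} x" for x
    using ab(3)[of x] by (cases "x \<in> {a..b}") (auto simp: le_max_iff_disj)
  then show ?thesis using ab that[of a b "max B 0"] by auto
qed

lemma bump_on_measurable: "bump_on I \<eta> \<Longrightarrow> \<eta> \<in> borel_measurable borel"
  using bump_on_continuous by (intro borel_measurable_continuous_onI)

lemma bump_on_integrable: assumes "bump_on I \<eta>" shows "integrable lborel \<eta>"
proof -
  obtain a b B where ab: "\<And>x. \<bar>\<eta> x\<bar> \<le> B * indicator {a..b} x"
    using bump_on_bounded[OF assms] by metis
  have [measurable]: "\<eta> \<in> borel_measurable borel" using bump_on_measurable assms .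
  show ?thesis
    by (rule Bochner_Integration.integrable_bound[of _ "\<lambda>x. B * indicator {a..b} x"])
       (use ab in \<open>auto intro!: AE_I2 order_trans[OF _ abs_ge_self] integrable_real_indicator simp: emeasure_lborel_Icc_eq\<close>)
qed

lemma rect_integrable_bump_mult:
  assumes f: "rect_integrable I J f" and "bump_on I \<eta>" "bump_on J \<xi>"
  shows "integrable lborel (\<lambda>q. (\<eta> (fst q) * \<xi> (snd q)) *\<^sub>R f q)"
proof -
  obtain a b B where 1: "{a..b} \<subseteq> I" "0 \<le> B" "\<And>x. \<bar>\<eta> x\<bar> \<le> B * indicator {a..b} x"
    using bump_on_bounded[OF assms(2)] by metis
  obtain c d C where 2: "{c..d} \<subseteq> J" "0 \<le> C" "\<And>x. \<bar>\<xi> x\<bar> \<le> C * indicator {c..d} x"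
    using bump_on_bounded[OF assms(3)] by metis
  have [measurable]: "\<eta> \<in> borel_measurable borel" "\<xi> \<in> borel_measurable borel"
    using bump_on_measurable assms by auto
  have "\<bar>\<eta> (fst q) * \<xi> (snd q)\<bar> \<le> (B * C) * indicator ({a..b} \<times> {c..d}) q" for q
  proof -
    have "\<bar>\<eta> (fst q) * \<xi> (snd q)\<bar> \<le> (B * indicator {a..b} (fst q)) * (C * indicator {c..d} (snd q))"
      unfolding abs_mult by (intro mult_mono 1 2 mult_nonneg_nonneg) auto
    also have "\<dots> = (B * C) * indicator ({a..b} \<times> {c..d}) q" by (auto simp: indicator_def mem_Times_iff)
    finally show ?thesis .
  qed
  then show ?thesis
    by (intro rect_integrable_bounded_mult[OF f 1(1) 2(1)]) measurable
qed

text \<open>Rational endpoints make the family of boxes countable, so that one null set serves for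
  all of them; the strict inequalities leave room around [c, d].\<close>

lemma open_rational_interval:
  fixes c d :: real
  assumes "open J" "{c..d} \<subseteq> J" "c \<le> d"
  obtains c' d' where "c' \<in> \<rat>" "d' \<in> \<rat>" "c' < c" "d < d'" "{c'..d'} \<subseteq> J"
proof -
  have "c \<in> J" "d \<in> J" using assms by auto
  then obtain e1 e2 where e: "e1 > 0" "ball c e1 \<subseteq> J" "e2 > 0" "ball d e2 \<subseteq> J"
    using assms(1) open_contains_ball by metis
  obtain c' where c': "c' \<in> \<rat>" "c - e1 < c'" "c' < c" using Rats_dense_in_real[of "c - e1" c] e by auto
  obtain d' where d': "d' \<in> \<rat>" "d < d'" "d' < d + e2" using Rats_dense_in_real[of d "d + e2"] e by auto
  have "x \<in> J" if "x \<in> {c'..d'}" for x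
  proof -
    consider "x < c" | "x \<in> {c..d}" | "x > d" by force
    then show ?thesis
    proof cases
      case 1 then have "x \<in> ball c e1" using that c' by (auto simp: dist_real_def)
      then show ?thesis using e by auto
    next
      case 2 then show ?thesis using assms by auto
    next
      case 3 then have "x \<in> ball d e2" using that d' by (auto simp: dist_real_def)
      then show ?thesis using e by auto
    qed
  qed
  then show ?thesis using that c' d' by blast
qed

text \<open>Boxes form an intersection-stable generator of the Borel sets, and the sets over which
  the integral of f vanishes are closed under complements and disjoint unions. Hence f has zero
  integral over every Borel set.\<close>

lemma integral_zero_boxes_AE:
  fixes f :: "real \<times> real \<Rightarrow> 'b::{banach, second_countable_topology}"
  assumes f: "integrable lborel f"
    and 0: "(\<integral>q. f q \<partial>lborel) = 0" "\<And>a b. (\<integral>q. indicator (box a b) q *\<^sub>R f q \<partial>lborel) = 0"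
  shows "AE q in lborel. f q = 0"
proof (rule sigma_finite_measure.density_zero[OF sigma_finite_lborel f])
  fix A :: "(real \<times> real) set" assume A: "A \<in> sets lborel"
  have "Int_stable (range (\<lambda>(a, b). box a b :: (real \<times> real) set))"
    by (auto simp: Int_stable_def box_Int_box)
  moreover have "(range (\<lambda>(a, b). box a b :: (real \<times> real) set)) \<subseteq> Pow UNIV"
    by auto
  moreover have "A \<in> sigma_sets UNIV (range (\<lambda>(a, b). box a b :: (real \<times> real) set))"
    using A by (simp add: borel_eq_box)
  ultimately show "set_lebesgue_integral lborel A f = 0"
  proof (induction rule: sigma_sets_induct_disjoint)
    case (basic A) then show ?case using 0 by (auto simp: set_lebesgue_integral_def)
  next
    case empty then show ?case by (simp add: set_lebesgue_integral_def)
  next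
    case (compl A)
    then have [measurable]: "A \<in> sets borel" by (simp add: borel_eq_box)
    have "(\<integral>q. indicator (UNIV - A) q *\<^sub>R f q \<partial>lborel) = (\<integral>q. f q - indicator A q *\<^sub>R f q \<partial>lborel)"
      by (intro Bochner_Integration.integral_cong) (auto simp: indicator_def)
    also have "\<dots> = (\<integral>q. f q \<partial>lborel) - (\<integral>q. indicator A q *\<^sub>R f q \<partial>lborel)"
      by (intro Bochner_Integration.integral_diff f integrable_mult_indicator) auto
    finally show ?case using 0 compl by (simp add: set_lebesgue_integral_def)
  next
    case (union F)
    then have [measurable]: "\<And>i. F i \<in> sets borel" by (simp add: borel_eq_box subset_eq)
    have "(LINT x:(\<Union>i. F i)|lborel. f x) = (\<Sum>i. (LINT x:(F i)|lborel. f x))"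
      using union f by (intro lebesgue_integral_countable_add)
        (auto simp: disjoint_family_on_def set_integrable_def intro!: integrable_mult_indicator)
    then show ?case using union by simp
  qed
qed

text \<open>Products of bumps converge boundedly to indicators of open boxes, so h integrates to 0
  over every box whose closure lies in I x J. This gives h = 0 almost everywhere on each such box,
  and countably many rational boxes cover the rectangle.\<close>

lemma fundamental_lemma_rect:
  fixes h :: "real \<times> real \<Rightarrow> 'b::{banach, second_countable_topology}"
  assumes "open I" "open J" and h: "rect_integrable I J h"
    and 0: "\<And>\<eta> \<xi>. bump_on I \<eta> \<Longrightarrow> bump_on J \<xi> \<Longrightarrow> (\<integral>q. (\<eta> (fst q) * \<xi> (snd q)) *\<^sub>R h q \<partial>lborel) = 0"
  shows "AE q in lborel. q \<in> I \<times> J \<longrightarrow> h q = 0"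
proof -
  have [measurable]: "h \<in> borel_measurable borel" using h by (simp add: rect_integrable_def)
  have box0: "(\<integral>q. indicator ({a<..<b} \<times> {c<..<d}) q *\<^sub>R h q \<partial>lborel) = 0"
    if "{a..b} \<subseteq> I" "{c..d} \<subseteq> J" for a b c d
  proof (cases "a < b \<and> c < d")
    case True
    note ab = that
    obtain \<eta> where \<eta>: "\<And>n::nat. bump_on I (\<eta> n)" "\<And>n x. 0 \<le> \<eta> n x" "\<And>n x. \<eta> n x \<le> 1"
      "\<And>n x. x \<notin> {a<..<b} \<Longrightarrow> \<eta> n x = 0" "\<And>x. (\<lambda>n. \<eta> n x) \<longlonglongrightarrow> indicator {a<..<b} x"
      using bump_on_approx_interval[of a b I] True ab by blast
    obtain \<xi> where \<xi>: "\<And>n::nat. bump_on J (\<xi> n)" "\<And>n x. 0 \<le> \<xi> n x" "\<And>n x. \<xi> n x \<le> 1"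
      "\<And>n x. x \<notin> {c<..<d} \<Longrightarrow> \<xi> n x = 0" "\<And>x. (\<lambda>n. \<xi> n x) \<longlonglongrightarrow> indicator {c<..<d} x"
      using bump_on_approx_interval[of c d J] True ab by blast
    have [measurable]: "\<eta> n \<in> borel_measurable borel" "\<xi> n \<in> borel_measurable borel" for n
      using bump_on_measurable \<eta> \<xi> by auto
    have "(\<lambda>n. \<integral>q. (\<eta> n (fst q) * \<xi> n (snd q)) *\<^sub>R h q \<partial>lborel) \<longlonglongrightarrow>
       (\<integral>q. (indicator {a<..<b} (fst q) * indicator {c<..<d} (snd q)) *\<^sub>R h q \<partial>lborel)"
    proof (rule integral_dominated_convergence[where w = "\<lambda>q. norm (indicator ({a..b} \<times> {c..d}) q *\<^sub>R h q)"])
      show "integrable lborel (\<lambda>q. norm (indicator ({a..b} \<times> {c..d}) q *\<^sub>R h q))"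
        using rect_integrable_integrable[OF h that] by (rule integrable_norm)
      show "AE q in lborel. (\<lambda>n. (\<eta> n (fst q) * \<xi> n (snd q)) *\<^sub>R h q) \<longlonglongrightarrow> (indicator {a<..<b} (fst q) * indicator {c<..<d} (snd q)) *\<^sub>R h q"
        by (intro AE_I2 tendsto_intros \<eta> \<xi>)
      show "AE q in lborel. norm ((\<eta> n (fst q) * \<xi> n (snd q)) *\<^sub>R h q) \<le> norm (indicator ({a..b} \<times> {c..d}) q *\<^sub>R h q)" for n
      proof (intro AE_I2)
        fix q :: "real \<times> real"
        have "\<eta> n (fst q) * \<xi> n (snd q) \<le> indicator ({a..b} \<times> {c..d}) q"
          using \<eta>(2,3)[of n "fst q"] \<xi>(2,3)[of n "snd q"] \<eta>(4)[of "fst q" n] \<xi>(4)[of "snd q" n]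
          by (cases q) (auto simp: indicator_def intro!: mult_le_one)
        then show "norm ((\<eta> n (fst q) * \<xi> n (snd q)) *\<^sub>R h q) \<le> norm (indicator ({a..b} \<times> {c..d}) q *\<^sub>R h q)"
          using \<eta>(2)[of n "fst q"] \<xi>(2)[of n "snd q"] by (auto intro!: mult_right_mono simp: abs_mult)
      qed
    qed measurable
    moreover have "(\<integral>q. (\<eta> n (fst q) * \<xi> n (snd q)) *\<^sub>R h q \<partial>lborel) = 0" for n
      using 0 \<eta> \<xi> by auto
    ultimately have "(\<integral>q. (indicator {a<..<b} (fst q) * indicator {c<..<d} (snd q)) *\<^sub>R h q \<partial>lborel) = 0"
      by (simp add: LIMSEQ_const_iff)
    then show ?thesis by (simp add: indicator_times)
  next
    case False
    then have e: "{a<..<b} \<times> {c<..<d} = {}" by auto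
    show ?thesis unfolding e by simp
  qed
  have loc: "AE q in lborel. q \<in> {a<..<b} \<times> {c<..<d} \<longrightarrow> h q = 0" if "{a..b} \<subseteq> I" "{c..d} \<subseteq> J" for a b c d
  proof -
    let ?f = "\<lambda>q. indicator ({a<..<b} \<times> {c<..<d}) q *\<^sub>R h q"
    have "AE q in lborel. ?f q = 0"
    proof (rule integral_zero_boxes_AE)
      have "integrable lborel (\<lambda>q. indicator ({a<..<b} \<times> {c<..<d}) q *\<^sub>R (indicator ({a..b} \<times> {c..d}) q *\<^sub>R h q))"
        by (rule integrable_mult_indicator[OF _ rect_integrable_integrable[OF h that]]) (auto intro!: borel_Times)
      also have "(\<lambda>q. indicator ({a<..<b} \<times> {c<..<d}) q *\<^sub>R (indicator ({a..b} \<times> {c..d}) q *\<^sub>R h q)) = ?f"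
        by (auto simp: indicator_def fun_eq_iff)
      finally show "integrable lborel ?f" .
      show "(\<integral>q. ?f q \<partial>lborel) = 0" using box0[OF that] .
      show "(\<integral>q. indicator (box u v) q *\<^sub>R ?f q \<partial>lborel) = 0" for u v
      proof -
        let ?a = "max a (fst u)" and ?b = "min b (fst v)" and ?c = "max c (snd u)" and ?d = "min d (snd v)"
        have "{?a..?b} \<subseteq> I" "{?c..?d} \<subseteq> J" using that by auto
        from box0[OF this] have "(\<integral>q. indicator ({?a<..<?b} \<times> {?c<..<?d}) q *\<^sub>R h q \<partial>lborel) = 0" .
        also have "(\<lambda>q. indicator ({?a<..<?b} \<times> {?c<..<?d}) q *\<^sub>R h q) = (\<lambda>q. indicator (box u v) q *\<^sub>R ?f q)"
          by (auto simp: indicator_def fun_eq_iff box_def Basis_prod_def inner_prod_def)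
        finally show ?thesis .
      qed
    qed
    then show ?thesis by eventually_elim (auto simp: indicator_def split: if_splits)
  qed
  define \<R> where "\<R> = {(a, b, c, d). a \<in> \<rat> \<and> b \<in> \<rat> \<and> c \<in> \<rat> \<and> d \<in> \<rat> \<and> {a..b} \<subseteq> I \<and> {c..d} \<subseteq> (J :: real set)}"
  have "countable (\<rat> \<times> \<rat> \<times> \<rat> \<times> \<rat> :: (real \<times> real \<times> real \<times> real) set)"
    by (intro countable_SIGMA countable_rat)
  then have "countable \<R>" by (rule countable_subset[rotated]) (auto simp: \<R>_def)
  moreover have "\<forall>r\<in>\<R>. AE q in lborel. (case r of (a, b, c, d) \<Rightarrow> q \<in> {a<..<b} \<times> {c<..<d} \<longrightarrow> h q = 0)"
    using loc by (auto simp: \<R>_def)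
  ultimately have "AE q in lborel. \<forall>r\<in>\<R>. (case r of (a, b, c, d) \<Rightarrow> q \<in> {a<..<b} \<times> {c<..<d} \<longrightarrow> h q = 0)"
    by (simp add: AE_ball_countable)
  then show ?thesis
  proof eventually_elim
    case (elim q)
    show ?case
    proof
      assume q: "q \<in> I \<times> J"
      obtain a b where "a \<in> \<rat>" "b \<in> \<rat>" "a < fst q" "fst q < b" "{a..b} \<subseteq> I"
        by (rule open_rational_interval[of I "fst q" "fst q"]) (use assms(1) q in auto)
      moreover obtain c d where "c \<in> \<rat>" "d \<in> \<rat>" "c < snd q" "snd q < d" "{c..d} \<subseteq> J"
        by (rule open_rational_interval[of J "snd q" "snd q"]) (use assms(2) q in auto)
      ultimately have "(a, b, c, d) \<in> \<R>" "q \<in> {a<..<b} \<times> {c<..<d}" by (auto simp: \<R>_def mem_Times_iff)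
      then show "h q = 0" using elim by auto
    qed
  qed
qed

section \<open>Absolute continuity on lines\<close>

text \<open>Signed indicator of the oriented interval from a to b. Integrals against it are additive
  in the endpoints whatever their order, so a primitive based at an interior point needs no case
  distinction.\<close>

definition sgn_ind :: "real \<Rightarrow> real \<Rightarrow> real \<Rightarrow> real" where
  "sgn_ind a b x = indicator {a<..b} x - indicator {b<..a} x"

definition signed_integral :: "real \<Rightarrow> real \<Rightarrow> (real \<Rightarrow> 'b::{banach, second_countable_topology}) \<Rightarrow> 'b" where
  "signed_integral a b f = (\<integral>x. sgn_ind a b x *\<^sub>R f x \<partial>lborel)"

definition interval_integrable :: "real set \<Rightarrow> (real \<Rightarrow> 'b::{banach, second_countable_topology}) \<Rightarrow> bool" where
  "interval_integrable J f \<longleftrightarrow> f \<in> borel_measurable borel \<and>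
     (\<forall>c d. {c..d} \<subseteq> J \<longrightarrow> integrable lborel (\<lambda>x. indicator {c..d} x *\<^sub>R f x))"

lemma sgn_ind_add: "sgn_ind a b x + sgn_ind b c x = sgn_ind a c x"
  by (auto simp: sgn_ind_def indicator_def)

lemma sgn_ind_measurable [measurable]:
  assumes [measurable]: "f \<in> borel_measurable M" "g \<in> borel_measurable M" "h \<in> borel_measurable M"
  shows "(\<lambda>x. sgn_ind (f x) (g x) (h x)) \<in> borel_measurable M"
proof -
  have e: "sgn_ind (f x) (g x) (h x) = (if f x < h x \<and> h x \<le> g x then 1 else 0) - (if g x < h x \<and> h x \<le> f x then 1 else 0)" for x
    by (auto simp: sgn_ind_def indicator_def)
  show ?thesis unfolding e by measurable
qed

lemma sgn_ind_bound:
  assumes "a \<in> {c..d}" "b \<in> {c..d}"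
  shows "\<bar>sgn_ind a b x\<bar> \<le> indicator {c..d} x"
  using assms by (auto simp: sgn_ind_def indicator_def)

lemma sgn_ind_integrable:
  assumes "is_interval J" "a \<in> J" "b \<in> J" "interval_integrable J f"
  shows "integrable lborel (\<lambda>x. sgn_ind a b x *\<^sub>R f x)"
proof -
  have [measurable]: "f \<in> borel_measurable borel" using assms by (auto simp: interval_integrable_def)
  have "min a b \<in> J" "max a b \<in> J" using assms by (auto simp: min_def max_def)
  then have J: "{min a b..max a b} \<subseteq> J"
    using assms(1) by (meson atLeastAtMost_iff mem_is_interval_1_I subsetI)
  then have "integrable lborel (\<lambda>x. indicator {min a b..max a b} x *\<^sub>R f x)"
    using assms(4) unfolding interval_integrable_def by blast
  then show ?thesis
  proof (rule Bochner_Integration.integrable_bound)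
    show "AE x in lborel. norm (sgn_ind a b x *\<^sub>R f x) \<le> norm (indicator {min a b..max a b} x *\<^sub>R f x)"
    proof (intro AE_I2)
      fix x
      have "\<bar>sgn_ind a b x\<bar> \<le> indicator {min a b..max a b} x"
        by (intro sgn_ind_bound) auto
      then show "norm (sgn_ind a b x *\<^sub>R f x) \<le> norm (indicator {min a b..max a b} x *\<^sub>R f x)"
        by (auto intro!: mult_right_mono)
    qed
  qed measurable
qed

lemma signed_integral_add:
  assumes "is_interval J" "a \<in> J" "b \<in> J" "c \<in> J" "interval_integrable J f"
  shows "signed_integral a b f + signed_integral b c f = signed_integral a c f"
  unfolding signed_integral_def
  using sgn_ind_integrable[OF assms(1,2,3,5)] sgn_ind_integrable[OF assms(1,3,4,5)]
  by (subst Bochner_Integration.integral_add[symmetric])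
     (auto intro!: Bochner_Integration.integral_cong simp: scaleR_add_left[symmetric] sgn_ind_add)

lemma signed_integral_measurable:
  fixes A :: "real \<times> real \<Rightarrow> 'b::{banach, second_countable_topology}"
  assumes [measurable]: "A \<in> borel_measurable borel"
  shows "(\<lambda>q. signed_integral j (snd q) (\<lambda>t. A (fst q, t))) \<in> borel_measurable borel"
proof -
  have "(\<lambda>r. sgn_ind j (snd (fst r)) (snd r) *\<^sub>R A (fst (fst r), snd r)) \<in> borel_measurable ((borel :: (real \<times> real) measure) \<Otimes>\<^sub>M lborel)"
    by measurable
  then show ?thesis unfolding signed_integral_def
    by (intro lborel.borel_measurable_lebesgue_integral) (simp add: case_prod_unfold)
qed

lemma signed_integral_measurable_fun:
  fixes f :: "real \<Rightarrow> 'b::{banach, second_countable_topology}"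
  assumes [measurable]: "f \<in> borel_measurable borel"
  shows "(\<lambda>x. signed_integral j x f) \<in> borel_measurable borel"
proof -
  have "(\<lambda>q::real \<times> real. signed_integral j (snd q) (\<lambda>t. f (snd (fst q, t)))) \<in> borel_measurable borel"
    by (rule signed_integral_measurable) measurable
  then have "(\<lambda>x. (\<lambda>q::real \<times> real. signed_integral j (snd q) (\<lambda>t. f (snd (fst q, t)))) (0, x)) \<in> borel_measurable borel"
    by (rule measurable_compose[rotated]) measurable
  then show ?thesis by simp
qed

lemma fubini_tensor_bound:
  fixes F :: "real \<times> real \<Rightarrow> 'b::{banach, second_countable_topology}"
  assumes [measurable]: "F \<in> borel_measurable borel"
    and "integrable lborel g" "integrable lborel (h :: real \<Rightarrow> real)"
    and "\<And>x y. norm (F (x, y)) \<le> g x * h y"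
  shows "integrable lborel F"
  by (rule Bochner_Integration.integrable_bound[OF integrable_lborel_tensor[OF assms(2,3)]])
     (use assms(4) in \<open>auto intro!: AE_I2 order_trans[OF assms(4) abs_ge_self]\<close>)

text \<open>Absolute continuity is encoded as u = k + oriented primitive of f. The formula is Fubini
  on the triangle a < y <= x <= b for \<psi>'(x) f(y): one order produces the primitive of f, the
  other produces \<psi>(b) - \<psi>(y).\<close>

lemma ac_integral_by_parts:
  fixes f :: "real \<Rightarrow> 'b::euclidean_space"
  assumes J: "is_interval J" "j \<in> J" "{a..b} \<subseteq> J" "a \<le> b" and f: "interval_integrable J f"
    and u: "\<And>x. x \<in> {a..b} \<Longrightarrow> u x = k + signed_integral j x f"
    and \<psi>: "\<And>x. x \<in> {a..b} \<Longrightarrow> (\<psi> has_real_derivative \<psi>' x) (at x within {a..b})" "continuous_on {a..b} \<psi>'"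
  shows "(\<integral>x. (indicator {a..b} x * \<psi>' x) *\<^sub>R u x \<partial>lborel)
     = \<psi> b *\<^sub>R u b - \<psi> a *\<^sub>R u a - (\<integral>x. (indicator {a..b} x * \<psi> x) *\<^sub>R f x \<partial>lborel)"
proof -
  let ?D = "\<lambda>x. indicator {a..b} x * \<psi>' x"
  have c\<psi>: "continuous_on {a..b} \<psi>" using \<psi>(1) by (meson DERIV_continuous_on)
  then have m\<psi>: "(\<lambda>x. indicator {a..b} x * \<psi> x) \<in> borel_measurable borel"
    using borel_measurable_continuous_on_indicator[of "{a..b}" \<psi>] by simp
  have [measurable]: "f \<in> borel_measurable borel" using f by (auto simp: interval_integrable_def)
  have FTC: "(\<integral>x. indicator {c..b} x * \<psi>' x \<partial>lborel) = \<psi> b - \<psi> c" if "c \<in> {a..b}" for c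
  proof -
    have "(\<integral>x. indicator {c..b} x *\<^sub>R \<psi>' x \<partial>lborel) = \<psi> b - \<psi> c"
    proof (rule integral_FTC_atLeastAtMost)
      show "continuous_on {c..b} \<psi>'" using \<psi>(2) that by (auto intro: continuous_on_subset)
      show "(\<psi> has_vector_derivative \<psi>' x) (at x within {c..b})" if "c \<le> x" "x \<le> b" for x
      proof -
        have "(\<psi> has_real_derivative \<psi>' x) (at x within {a..b})" using \<psi>(1) that \<open>c \<in> {a..b}\<close> by auto
        then have "(\<psi> has_real_derivative \<psi>' x) (at x within {c..b})"
          by (rule DERIV_subset) (use \<open>c \<in> {a..b}\<close> in auto)
        then show ?thesis by (simp add: has_real_derivative_iff_has_vector_derivative)
      qed
    qed (use that in auto)
    then show ?thesis by simp
  qed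
  have i\<psi>': "integrable lborel (\<lambda>x. indicator {a..b} x * \<psi>' x)"
    using borel_integrable_atLeastAtMost'[OF \<psi>(2)] by (simp add: set_integrable_def)
  then have m\<psi>' [measurable]: "(\<lambda>x. indicator {a..b} x * \<psi>' x) \<in> borel_measurable borel"
    by (auto dest: borel_measurable_integrable)
  have if': "integrable lborel (\<lambda>x. indicator {a..b} x *\<^sub>R f x)"
    using f J(3) by (auto simp: interval_integrable_def)
  have ax: "a \<in> J" "x \<in> {a..b} \<Longrightarrow> x \<in> J" for x using J by auto
  have u2: "u x = u a + signed_integral a x f" if "x \<in> {a..b}" for x
    using u[OF that] u[of a] signed_integral_add[OF J(1) J(2) ax(1) ax(2)[OF that] f] J(4)
    by (simp add: algebra_simps)
  let ?F = "\<lambda>q. ((indicator {a..b} (fst q) * \<psi>' (fst q)) * (indicator {a<..b} (snd q) * indicator {snd q..} (fst q))) *\<^sub>R f (snd q)"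
  have ind_m: "(\<lambda>q::real \<times> real. indicator {snd q..} (fst q) :: real) \<in> borel_measurable borel"
  proof -
    have "(\<lambda>q::real \<times> real. indicator {snd q..} (fst q) :: real) = (\<lambda>q. if snd q \<le> fst q then 1 else 0)"
      by (auto simp: indicator_def)
    then show ?thesis by simp
  qed
  have "integrable lborel ?F"
  proof (rule fubini_tensor_bound[where g = "\<lambda>x. \<bar>indicator {a..b} x * \<psi>' x\<bar>" and h = "\<lambda>y. norm (indicator {a..b} y *\<^sub>R f y)"])
    have "(\<lambda>q::real \<times> real. indicator {a..b} (fst q) * \<psi>' (fst q)) \<in> borel_measurable borel"
      using measurable_compose[OF borel_fst_real m\<psi>'] .
    then show "?F \<in> borel_measurable borel" using ind_m by measurable
    show "integrable lborel (\<lambda>x. \<bar>indicator {a..b} x * \<psi>' x\<bar>)" using i\<psi>' by simp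
    show "integrable lborel (\<lambda>y. norm (indicator {a..b} y *\<^sub>R f y))" using if' by (rule integrable_norm)
    show "norm (?F (x, y)) \<le> \<bar>indicator {a..b} x * \<psi>' x\<bar> * norm (indicator {a..b} y *\<^sub>R f y)" for x y
      by (auto simp: indicator_def)
  qed
  note F = this
  have slice: "(\<integral>y. ?F (x, y) \<partial>lborel) = ?D x *\<^sub>R signed_integral a x f" for x
  proof (cases "x \<in> {a..b}")
    case True
    have "(\<integral>y. ?F (x, y) \<partial>lborel) = (\<integral>y. ?D x *\<^sub>R (sgn_ind a x y *\<^sub>R f y) \<partial>lborel)"
      using True by (intro Bochner_Integration.integral_cong refl) (auto simp: indicator_def sgn_ind_def)
    also have "\<dots> = ?D x *\<^sub>R signed_integral a x f"
      unfolding signed_integral_def by (rule integral_scaleR_right)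
    finally show ?thesis .
  qed simp
  have "(\<integral>x. ?D x *\<^sub>R signed_integral a x f \<partial>lborel) = (\<integral>x. \<integral>y. ?F (x, y) \<partial>lborel \<partial>lborel)"
    by (simp only: slice)
  also have "\<dots> = (\<integral>y. \<integral>x. ?F (x, y) \<partial>lborel \<partial>lborel)"
    using fubini_fst[OF F] fubini_snd[OF F] by simp
  also have "\<dots> = (\<integral>y. (indicator {a<..b} y * (\<psi> b - \<psi> y)) *\<^sub>R f y \<partial>lborel)"
  proof (intro Bochner_Integration.integral_cong refl)
    fix y
    show "(\<integral>x. ?F (x, y) \<partial>lborel) = (indicator {a<..b} y * (\<psi> b - \<psi> y)) *\<^sub>R f y"
    proof (cases "y \<in> {a<..b}")
      case True
      have "(\<integral>x. ?F (x, y) \<partial>lborel) = (\<integral>x. (indicator {y..b} x * \<psi>' x) *\<^sub>R f y \<partial>lborel)"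
        using True by (intro Bochner_Integration.integral_cong refl) (auto simp: indicator_def)
      also have "\<dots> = (\<integral>x. (indicator {y..b} x * \<psi>' x) \<partial>lborel) *\<^sub>R f y"
      proof (rule integral_scaleR_left)
        assume "f y \<noteq> 0"
        have "continuous_on {y..b} \<psi>'" using \<psi>(2) True by (auto intro: continuous_on_subset)
        from borel_integrable_atLeastAtMost'[OF this]
        show "integrable lborel (\<lambda>x. indicator {y..b} x * \<psi>' x)" by (simp add: set_integrable_def)
      qed
      finally show ?thesis using FTC[of y] True by simp
    qed simp
  qed
  also have "\<dots> = (\<integral>y. (\<psi> b *\<^sub>R (indicator {a<..b} y *\<^sub>R f y)) - (indicator {a..b} y * \<psi> y) *\<^sub>R f y \<partial>lborel)"
  proof (intro integral_cong_AE)
    have "(\<lambda>y. (indicator {a<..b} y * (\<psi> b - \<psi> y)) *\<^sub>R f y) = (\<lambda>y. (indicator {a<..b} y * (\<psi> b - indicator {a..b} y * \<psi> y)) *\<^sub>R f y)"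
      by (auto simp: indicator_def)
    then show "(\<lambda>y. (indicator {a<..b} y * (\<psi> b - \<psi> y)) *\<^sub>R f y) \<in> borel_measurable lborel" using m\<psi> by simp
    show "(\<lambda>y. (\<psi> b *\<^sub>R (indicator {a<..b} y *\<^sub>R f y)) - (indicator {a..b} y * \<psi> y) *\<^sub>R f y) \<in> borel_measurable lborel"
      using m\<psi> by measurable
    show "AE y in lborel. (indicator {a<..b} y * (\<psi> b - \<psi> y)) *\<^sub>R f y = (\<psi> b *\<^sub>R (indicator {a<..b} y *\<^sub>R f y)) - (indicator {a..b} y * \<psi> y) *\<^sub>R f y"
      using AE_lborel_singleton[of a] by eventually_elim (auto simp: indicator_def algebra_simps)
  qed
  also have "\<dots> = \<psi> b *\<^sub>R signed_integral a b f - (\<integral>y. (indicator {a..b} y * \<psi> y) *\<^sub>R f y \<partial>lborel)"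
  proof -
    have "bounded (\<psi> ` {a..b})"
      using compact_continuous_image[OF c\<psi>] compact_imp_bounded[of "\<psi> ` {a..b}"] by auto
    then obtain B where "\<forall>y \<in> \<psi> ` {a..b}. norm y \<le> B" unfolding bounded_iff by blast
    then have B: "\<And>x. x \<in> {a..b} \<Longrightarrow> norm (\<psi> x) \<le> B" by blast
    have "integrable lborel (\<lambda>y. (indicator {a..b} y * \<psi> y) *\<^sub>R f y)"
    proof (rule Bochner_Integration.integrable_bound[OF integrable_scaleR_right[OF if', of B]])
      show "AE x in lborel. norm ((indicator {a..b} x * \<psi> x) *\<^sub>R f x) \<le> norm (B *\<^sub>R (indicator {a..b} x *\<^sub>R f x))"
        using B by (intro AE_I2) (force simp: indicator_def intro!: mult_right_mono)
    qed (use m\<psi> in measurable)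
    moreover have "integrable lborel (\<lambda>y. indicator {a<..b} y *\<^sub>R f y)"
      by (rule Bochner_Integration.integrable_bound[OF if']) (auto simp: indicator_def)
    moreover have "(\<integral>y. indicator {a<..b} y *\<^sub>R f y \<partial>lborel) = signed_integral a b f"
      unfolding signed_integral_def using J(4) by (intro Bochner_Integration.integral_cong) (auto simp: sgn_ind_def)
    ultimately show ?thesis
      by (subst Bochner_Integration.integral_diff) (auto simp only: integral_scaleR_right intro!: integrable_scaleR_right)
  qed
  finally have main: "(\<integral>x. ?D x *\<^sub>R signed_integral a x f \<partial>lborel)
    = \<psi> b *\<^sub>R signed_integral a b f - (\<integral>y. (indicator {a..b} y * \<psi> y) *\<^sub>R f y \<partial>lborel)" .
  have "(\<integral>x. ?D x *\<^sub>R u x \<partial>lborel)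
      = (\<integral>x. ?D x *\<^sub>R u a + ?D x *\<^sub>R signed_integral a x f \<partial>lborel)"
  proof (intro Bochner_Integration.integral_cong refl)
    fix x
    show "?D x *\<^sub>R u x = ?D x *\<^sub>R u a + ?D x *\<^sub>R signed_integral a x f"
    proof (cases "x \<in> {a..b}")
      case True
      show ?thesis unfolding u2[OF True] by (simp add: scaleR_add_right)
    qed simp
  qed
  also have "\<dots> = (\<integral>x. ?D x *\<^sub>R u a \<partial>lborel) + (\<integral>x. ?D x *\<^sub>R signed_integral a x f \<partial>lborel)"
  proof (rule Bochner_Integration.integral_add)
    show "integrable lborel (\<lambda>x. ?D x *\<^sub>R u a)" using i\<psi>' by (intro integrable_scaleR_left)
    show "integrable lborel (\<lambda>x. ?D x *\<^sub>R signed_integral a x f)" using fubini_integrable_fst[OF F] by (simp only: slice)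
  qed
  also have "(\<integral>x. ?D x *\<^sub>R u a \<partial>lborel) = (\<psi> b - \<psi> a) *\<^sub>R u a"
    using FTC[of a] J(4) i\<psi>' by (subst integral_scaleR_left) auto
  finally have "(\<integral>x. ?D x *\<^sub>R u x \<partial>lborel) = (\<psi> b - \<psi> a) *\<^sub>R u a + (\<psi> b *\<^sub>R signed_integral a b f - (\<integral>y. (indicator {a..b} y * \<psi> y) *\<^sub>R f y \<partial>lborel))"
    unfolding main .
  moreover have "u b = u a + signed_integral a b f" using u2[of b] J(4) by simp
  ultimately show ?thesis by (simp add: algebra_simps)
qed

text \<open>The exceptional set of x might depend on the compact interval in y. Rational boxes
  reduce this to a countable union, and every [c, d] sits inside a rational interval contained in
  J.\<close>

lemma rect_integrable_slice:
  fixes f :: "real \<times> real \<Rightarrow> 'b::{banach, second_countable_topology}"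
  assumes "open I" "open J" and f: "rect_integrable I J f"
  shows "AE x in lborel. x \<in> I \<longrightarrow> interval_integrable J (\<lambda>y. f (x, y))"
proof -
  have [measurable]: "f \<in> borel_measurable borel" using f by (simp add: rect_integrable_def)
  define \<R> where "\<R> = {(a, b, c, d). a \<in> \<rat> \<and> b \<in> \<rat> \<and> c \<in> \<rat> \<and> d \<in> \<rat> \<and> {a..b} \<subseteq> I \<and> {c..d} \<subseteq> (J :: real set)}"
  have "countable (\<rat> \<times> \<rat> \<times> \<rat> \<times> \<rat> :: (real \<times> real \<times> real \<times> real) set)"
    by (intro countable_SIGMA countable_rat)
  then have "countable \<R>" by (rule countable_subset[rotated]) (auto simp: \<R>_def)
  moreover have "\<forall>r\<in>\<R>. AE x in lborel. (case r of (a, b, c, d) \<Rightarrow> x \<in> {a..b} \<longrightarrow> integrable lborel (\<lambda>y. indicator {c..d} y *\<^sub>R f (x, y)))"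
  proof (clarsimp simp: \<R>_def)
    fix a b c d :: real assume "{a..b} \<subseteq> I" "{c..d} \<subseteq> J"
    then have "integrable lborel (\<lambda>q. indicator ({a..b} \<times> {c..d}) q *\<^sub>R f q)"
      using f by (auto simp: rect_integrable_def)
    from fubini_AE_fst[OF this]
    show "AE x in lborel. a \<le> x \<and> x \<le> b \<longrightarrow> integrable lborel (\<lambda>y. indicator {c..d} y *\<^sub>R f (x, y))"
      by eventually_elim (auto simp: indicator_times indicator_def[of "{a..b}"])
  qed
  ultimately have "AE x in lborel. \<forall>r\<in>\<R>. (case r of (a, b, c, d) \<Rightarrow> x \<in> {a..b} \<longrightarrow> integrable lborel (\<lambda>y. indicator {c..d} y *\<^sub>R f (x, y)))"
    by (simp add: AE_ball_countable)
  then show ?thesis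
  proof eventually_elim
    case (elim x)
    show ?case
    proof
      assume x: "x \<in> I"
      have "integrable lborel (\<lambda>y. indicator {c..d} y *\<^sub>R f (x, y))" if cd: "{c..d} \<subseteq> J" for c d
      proof (cases "c \<le> d")
        case True
        obtain a b where "a \<in> \<rat>" "b \<in> \<rat>" "a < x" "x < b" "{a..b} \<subseteq> I"
          by (rule open_rational_interval[of I x x]) (use assms(1) x in auto)
        moreover obtain c' d' where c': "c' \<in> \<rat>" "d' \<in> \<rat>" "c' < c" "d < d'" "{c'..d'} \<subseteq> J"
          by (rule open_rational_interval[OF assms(2) cd True]) (rule that)
        ultimately have "(a, b, c', d') \<in> \<R>" "x \<in> {a..b}" by (auto simp: \<R>_def)
        then have "integrable lborel (\<lambda>y. indicator {c'..d'} y *\<^sub>R f (x, y))" using elim by auto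
        then show ?thesis
          by (rule Bochner_Integration.integrable_bound) (use c' in \<open>auto simp: indicator_def\<close>)
      qed simp
      then show "interval_integrable J (\<lambda>y. f (x, y))" unfolding interval_integrable_def by auto
    qed
  qed
qed

text \<open>The primitive starts at a - 1, left of the support, and the zero mean makes it vanish
  again to the right of the support; so it is itself a bump.\<close>

lemma bump_primitive:
  assumes "is_interval J" "bump_on J m" "(\<integral>x. m x \<partial>lborel) = 0"
  shows "\<exists>\<xi>. bump_on J \<xi> \<and> (\<forall>x. (\<xi> has_real_derivative m x) (at x))"
proof -
  obtain a b where ab: "a \<le> b" "{a..b} \<subseteq> J" "\<And>x. x \<notin> {a..b} \<Longrightarrow> m x = 0"
    using assms(2) unfolding bump_on_def by blast
  have cm: "continuous_on S m" for S using bump_on_continuous[OF assms(2)] continuous_on_subset by blast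
  define \<xi> where "\<xi> x = integral {a - 1..x} m" for x
  have z1: "\<xi> x = 0" if "x < a" for x
  proof -
    have "integral {a - 1..x} m = integral {a - 1..x} (\<lambda>_. 0)"
      by (rule Henstock_Kurzweil_Integration.integral_cong) (use ab(3) that in auto)
    then show ?thesis by (simp add: \<xi>_def)
  qed
  have z2: "\<xi> x = 0" if "x > b" for x
  proof -
    have "set_integrable lborel {a - 1..x} m" using cm by (rule borel_integrable_atLeastAtMost')
    from set_borel_integral_eq_integral(2)[OF this]
    have "\<xi> x = (LINT y:{a - 1..x}|lborel. m y)" by (simp add: \<xi>_def)
    also have "\<dots> = (\<integral>y. m y \<partial>lborel)" unfolding set_lebesgue_integral_def
    proof (rule Bochner_Integration.integral_cong)
      show "indicat_real {a - 1..x} y *\<^sub>R m y = m y" for y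
        by (cases "y \<in> {a..b}") (use ab(3)[of y] that in auto)
    qed simp
    finally show ?thesis using assms(3) by simp
  qed
  have d: "(\<xi> has_real_derivative m x) (at x)" for x
  proof (cases "x < a")
    case True
    have "((\<lambda>_. 0) has_real_derivative m x) (at x)" using ab(3)[of x] True by simp
    then show ?thesis
      by (rule has_field_derivative_transform_within_open[where S = "{..<a}"]) (use True z1 in auto)
  next
    case False
    have "((\<lambda>u. integral {a - 1..u} m) has_real_derivative m x) (at x within {a - 1..x + 1})"
      by (rule integral_has_real_derivative[OF cm]) (use False in auto)
    moreover have "at x within {a - 1..x + 1} = at x"
      by (rule at_within_interior) (use False in \<open>auto simp: interior_atLeastAtMost_real\<close>)
    ultimately show ?thesis by (simp add: \<xi>_def[abs_def])
  qed
  have "Ck_on (Suc k) UNIV \<xi>" for k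
    using assms(2) by (intro Ck_on_real_SucI[OF d]) (auto simp: bump_on_def smooth_on_def)
  then have "smooth_on UNIV \<xi>" unfolding smooth_on_def using Ck_on_mono_Suc by blast
  moreover have "\<xi> x = 0" if "x \<notin> {a..b}" for x
    using that z1 z2 by (auto simp: not_le)
  ultimately show ?thesis using d ab unfolding bump_on_def by blast
qed

text \<open>The integrals of the approximating bumps converge to b - a > 0, so some member has
  positive integral and can be normalised.\<close>

lemma bump_unit_mass:
  assumes "open J" "j \<in> J"
  shows "\<exists>\<mu>. bump_on J \<mu> \<and> (\<integral>x. \<mu> x \<partial>lborel) = 1"
proof -
  obtain a b where ab: "a < j" "j < b" "{a..b} \<subseteq> J"
    by (rule open_rational_interval[of J j j]) (use assms in auto)
  obtain \<eta> :: "nat \<Rightarrow> real \<Rightarrow> real" where \<eta>: "\<And>n. bump_on J (\<eta> n)" "\<And>n x. 0 \<le> \<eta> n x" "\<And>n x. \<eta> n x \<le> 1"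
      "\<And>n x. x \<notin> {a<..<b} \<Longrightarrow> \<eta> n x = 0" "\<And>x. (\<lambda>n. \<eta> n x) \<longlonglongrightarrow> indicator {a<..<b} x"
    using bump_on_approx_interval[of a b J] ab by auto
  have "(\<lambda>n. \<integral>x. \<eta> n x \<partial>lborel) \<longlonglongrightarrow> (\<integral>x. indicator {a<..<b} x \<partial>lborel)"
  proof (rule integral_dominated_convergence[where w = "indicator {a..b}"])
    show "integrable lborel (indicat_real {a..b})" by (auto intro: integrable_real_indicator simp: emeasure_lborel_Icc_eq)
    show "AE x in lborel. (\<lambda>n. \<eta> n x) \<longlonglongrightarrow> indicat_real {a<..<b} x" using \<eta> by auto
    show "AE x in lborel. norm (\<eta> n x) \<le> indicat_real {a..b} x" for n
    proof (intro AE_I2)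
      fix x show "norm (\<eta> n x) \<le> indicat_real {a..b} x"
        using \<eta>(2,3)[of n x] \<eta>(4)[of x n] by (auto simp: indicator_def)
    qed
    show "\<eta> n \<in> borel_measurable lborel" for n using bump_on_measurable[OF \<eta>(1)[of n]] by simp
  qed simp
  then have "(\<lambda>n. \<integral>x. \<eta> n x \<partial>lborel) \<longlonglongrightarrow> b - a" using ab by simp
  then have "\<forall>\<^sub>F n in sequentially. (\<integral>x. \<eta> n x \<partial>lborel) > 0"
    using ab by (intro order_tendstoD) auto
  then obtain n where n: "(\<integral>x. \<eta> n x \<partial>lborel) > 0" by (auto simp: eventually_sequentially)
  have "bump_on J (\<lambda>x. (1 / (\<integral>x. \<eta> n x \<partial>lborel)) * \<eta> n x)"
    by (rule bump_on_cmult[OF \<eta>(1)])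
  moreover have "(\<integral>x. (1 / (\<integral>x. \<eta> n x \<partial>lborel)) * \<eta> n x \<partial>lborel) = 1" using n by simp
  ultimately show ?thesis by blast
qed

lemma ac_integral_by_parts_compact:
  fixes f :: "real \<Rightarrow> 'b::euclidean_space"
  assumes J: "is_interval J" "j \<in> J" "{a..b} \<subseteq> J" "a \<le> b" and f: "interval_integrable J f"
    and u: "AE x in lborel. x \<in> {a..b} \<longrightarrow> u x = k + signed_integral j x f"
    and [measurable]: "u \<in> borel_measurable borel"
    and \<psi>: "\<And>x. x \<in> {a..b} \<Longrightarrow> (\<psi> has_real_derivative \<psi>' x) (at x within {a..b})" "continuous_on {a..b} \<psi>'" "\<psi> a = 0" "\<psi> b = 0"
  shows "(\<integral>x. (indicator {a..b} x * \<psi>' x) *\<^sub>R u x \<partial>lborel)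
     = - (\<integral>x. (indicator {a..b} x * \<psi> x) *\<^sub>R f x \<partial>lborel)"
proof -
  have [measurable]: "f \<in> borel_measurable borel" using f by (auto simp: interval_integrable_def)
  have m\<psi>' [measurable]: "(\<lambda>x. indicator {a..b} x * \<psi>' x) \<in> borel_measurable borel"
    using borel_measurable_continuous_on_indicator[of "{a..b}" \<psi>'] \<psi>(2) by simp
  have "(\<lambda>q. signed_integral j (snd q) (\<lambda>t. f t)) \<in> borel_measurable (borel :: (real \<times> real) measure)"
    using signed_integral_measurable[of "\<lambda>q. f (snd q)" j] by simp
  then have m: "(\<lambda>x. signed_integral j x f) \<in> borel_measurable borel"
    using measurable_compose[of "\<lambda>x::real. (0::real, x)" borel borel "\<lambda>q. signed_integral j (snd q) f" borel]
    by (simp add: borel_measurable_Pair)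
  have "(\<integral>x. (indicator {a..b} x * \<psi>' x) *\<^sub>R u x \<partial>lborel) = (\<integral>x. (indicator {a..b} x * \<psi>' x) *\<^sub>R (k + signed_integral j x f) \<partial>lborel)"
  proof (rule integral_cong_AE)
    show "AE x in lborel. (indicator {a..b} x * \<psi>' x) *\<^sub>R u x = (indicator {a..b} x * \<psi>' x) *\<^sub>R (k + signed_integral j x f)"
      using u by eventually_elim (auto simp: indicator_def)
  qed (use m in measurable)
  also have "\<dots> = \<psi> b *\<^sub>R (k + signed_integral j b f) - \<psi> a *\<^sub>R (k + signed_integral j a f) - (\<integral>x. (indicator {a..b} x * \<psi> x) *\<^sub>R f x \<partial>lborel)"
    by (rule ac_integral_by_parts[OF J f refl \<psi>(1,2)])
  finally show ?thesis using \<psi> by simp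
qed

section \<open>Primitives in one variable, slicewise integration by parts and the du Bois-Reymond
  lemma\<close>

lemma rect_integrable_add:
  assumes "rect_integrable I J f" "rect_integrable I J g"
  shows "rect_integrable I J (\<lambda>q. f q + g q)" "rect_integrable I J (\<lambda>q. f q - g q)"
  using assms unfolding rect_integrable_def by (auto simp: scaleR_add_right scaleR_diff_right)

lemma rect_integrable_tensor:
  assumes "interval_integrable I k" "\<And>c d. {c..d} \<subseteq> J \<Longrightarrow> integrable lborel (\<lambda>x. indicator {c..d} x *\<^sub>R h x)" "h \<in> borel_measurable borel"
    and [measurable]: "f \<in> borel_measurable borel" and "\<And>x y. x \<in> I \<Longrightarrow> y \<in> J \<Longrightarrow> norm (f (x, y)) \<le> k x * (h y :: real)"
  shows "rect_integrable I J f"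
  unfolding rect_integrable_def
proof (intro conjI allI impI)
  fix a b c d assume I: "{a..b} \<subseteq> I" and J: "{c..d} \<subseteq> J"
  show "integrable lborel (\<lambda>q. indicator ({a..b} \<times> {c..d}) q *\<^sub>R f q)"
  proof (rule fubini_tensor_bound)
    show "integrable lborel (\<lambda>x. indicator {a..b} x *\<^sub>R k x)" using assms(1) I by (auto simp: interval_integrable_def)
    show "integrable lborel (\<lambda>x. indicator {c..d} x *\<^sub>R h x)" using assms(2) J by auto
    show "norm (indicator ({a..b} \<times> {c..d}) (x, y) *\<^sub>R f (x, y)) \<le> (indicator {a..b} x *\<^sub>R k x) * (indicator {c..d} y *\<^sub>R h y)" for x y
      using assms(5)[of x y] I[THEN subsetD, of x] J[THEN subsetD, of y] by (auto simp: indicator_def)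
  qed measurable
qed simp

text \<open>On a box the primitive is dominated by the integral of the norm of A over a vertical
  segment. That is a function of x alone, integrable by Fubini.\<close>

lemma rect_integrable_primitive:
  fixes A :: "real \<times> real \<Rightarrow> 'b::euclidean_space"
  assumes "is_interval J" "j \<in> J" and A: "rect_integrable I J A"
  shows "rect_integrable I J (\<lambda>q. signed_integral j (snd q) (\<lambda>t. A (fst q, t)))"
  unfolding rect_integrable_def
proof (intro conjI allI impI)
  have [measurable]: "A \<in> borel_measurable borel" using A by (simp add: rect_integrable_def)
  have mF: "(\<lambda>q. signed_integral j (snd q) (\<lambda>t. A (fst q, t))) \<in> borel_measurable borel"
    by (rule signed_integral_measurable) measurable
  then show "(\<lambda>q. signed_integral j (snd q) (\<lambda>t. A (fst q, t))) \<in> borel_measurable borel" .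
  fix a b c d assume I: "{a..b} \<subseteq> I" and J: "{c..d} \<subseteq> J"
  show "integrable lborel (\<lambda>q. indicator ({a..b} \<times> {c..d}) q *\<^sub>R signed_integral j (snd q) (\<lambda>t. A (fst q, t)))"
  proof (cases "c \<le> d")
    case False
    then have e: "{a..b} \<times> {c..d} = {}" by auto
    show ?thesis unfolding e by simp
  next
    case True
    \<comment> \<open>The segment must reach the base point j, which may lie outside [c, d].\<close>
    let ?c = "min j c" and ?d = "max j d"
    let ?Q = "{a..b} \<times> {?c..?d}"
    have "?c \<in> J" "?d \<in> J" using J True assms(2) by (auto simp: min_def max_def)
    then have J': "{?c..?d} \<subseteq> J" using assms(1) by (meson atLeastAtMost_iff mem_is_interval_1_I subsetI)
    have A': "integrable lborel (\<lambda>q. indicator ?Q q *\<^sub>R A q)"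
      using A I J' by (auto simp: rect_integrable_def)
    then have A'': "integrable lborel (\<lambda>q. norm (indicator ?Q q *\<^sub>R A q))" by (rule integrable_norm)
    have G: "integrable lborel (\<lambda>x. \<integral>y. norm (indicator ?Q (x, y) *\<^sub>R A (x, y)) \<partial>lborel)"
      using fubini_integrable_fst[OF A''] .
    have ae: "AE x in lborel. integrable lborel (\<lambda>y. indicator ?Q (x, y) *\<^sub>R A (x, y))"
      using fubini_AE_fst[OF A'] .
    have H: "integrable lborel (\<lambda>q. (\<integral>y. norm (indicator ?Q (fst q, y) *\<^sub>R A (fst q, y)) \<partial>lborel) *\<^sub>R indicat_real {c..d} (snd q))"
      by (rule integrable_lborel_tensor[OF G]) (auto intro: integrable_real_indicator simp: emeasure_lborel_Icc_eq)
    show ?thesis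
    proof (rule Bochner_Integration.integrable_bound[OF H])
      show "(\<lambda>q. indicator ({a..b} \<times> {c..d}) q *\<^sub>R signed_integral j (snd q) (\<lambda>t. A (fst q, t))) \<in> borel_measurable lborel"
        using mF by simp
      \<comment> \<open>Integrability of almost every slice is a statement about x; to use it at
        almost every point q, the set of good x has to be Borel.\<close>
      have "AE q in (lborel :: (real \<times> real) measure). integrable lborel (\<lambda>y. indicator ?Q (fst q, y) *\<^sub>R A (fst q, y))" (is "AE q in _. ?P q")
      proof (rule AE_lborel_pairI[where P = ?P])
        have "(\<lambda>r. (indicator {a..b} (fst r) * indicator {?c..?d} (snd r)) *\<^sub>R A (fst r, snd r)) \<in> borel_measurable ((borel :: real measure) \<Otimes>\<^sub>M lborel)"
          by measurable
        then have "Measurable.pred borel (\<lambda>x. integrable lborel (\<lambda>y. indicator ?Q (x, y) *\<^sub>R A (x, y)))"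
          using lborel.borel_measurable_lebesgue_integrable[of "\<lambda>x y. indicator ?Q (x, y) *\<^sub>R A (x, y)" borel]
          by (simp add: case_prod_unfold indicator_times)
        then have "{x. integrable lborel (\<lambda>y. indicator ?Q (x, y) *\<^sub>R A (x, y))} \<in> sets borel"
          by (simp add: pred_def)
        from measurable_sets[OF borel_fst_real this]
        show "{q. ?P q} \<in> sets (borel :: (real \<times> real) measure)" by (simp add: vimage_def)
      next
        show "AE x in lborel. AE y in lborel. ?P (x, y)" using ae by eventually_elim auto
      qed
      then show "AE q in lborel. norm (indicator ({a..b} \<times> {c..d}) q *\<^sub>R signed_integral j (snd q) (\<lambda>t. A (fst q, t)))
        \<le> norm ((\<integral>y. norm (indicator ?Q (fst q, y) *\<^sub>R A (fst q, y)) \<partial>lborel) *\<^sub>R indicat_real {c..d} (snd q))"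
      proof eventually_elim
        case (elim q)
        show ?case
        proof (cases "q \<in> {a..b} \<times> {c..d}")
          case True
          have "norm (signed_integral j (snd q) (\<lambda>t. A (fst q, t))) \<le> (\<integral>t. norm (sgn_ind j (snd q) t *\<^sub>R A (fst q, t)) \<partial>lborel)"
            unfolding signed_integral_def by (rule integral_norm_bound)
          also have "\<dots> \<le> (\<integral>y. norm (indicator ?Q (fst q, y) *\<^sub>R A (fst q, y)) \<partial>lborel)"
          proof (rule integral_mono')
            show "integrable lborel (\<lambda>y. norm (indicator ?Q (fst q, y) *\<^sub>R A (fst q, y)))"
              using elim by (rule integrable_norm)
            show "norm (sgn_ind j (snd q) t *\<^sub>R A (fst q, t)) \<le> norm (indicator ?Q (fst q, t) *\<^sub>R A (fst q, t))" for t
              using True sgn_ind_bound[of j ?c ?d "snd q" t] by (auto simp: indicator_times le_max_iff_disj min_le_iff_disj intro!: mult_right_mono)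
          qed simp
          finally show ?thesis using True by (auto simp: indicator_times)
        qed simp
      qed
    qed
  qed
qed

lemma indicator_mult_bounded:
  fixes P :: "real \<times> real \<Rightarrow> real"
  assumes "compact K" "continuous_on K P"
  obtains B where "\<And>q. \<bar>indicator K q * P q\<bar> \<le> B * indicator K q"
proof -
  have "bounded (P ` K)" using assms by (intro compact_imp_bounded compact_continuous_image)
  then obtain B where B: "\<forall>y \<in> P ` K. norm y \<le> B" unfolding bounded_iff by blast
  have "\<bar>indicator K q * P q\<bar> \<le> B * indicator K q" for q
    using B by (cases "q \<in> K") auto
  then show thesis using that by blast
qed

lemma rect_by_parts_snd:
  fixes U A :: "real \<times> real \<Rightarrow> 'b::euclidean_space"
  assumes I: "open I" and J: "open J" "is_interval J" "j \<in> J"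
    and U: "rect_integrable I J U" and A: "rect_integrable I J A"
    and ac: "AE x in lborel. x \<in> I \<longrightarrow> (\<exists>k. AE y in lborel. y \<in> J \<longrightarrow> U (x, y) = k + signed_integral j y (\<lambda>t. A (x, t)))"
    and ab: "{a..b} \<subseteq> I" and cd: "{c..d} \<subseteq> J" "c \<le> d"
    and P: "\<And>x y. x \<in> {a..b} \<Longrightarrow> y \<in> {c..d} \<Longrightarrow> ((\<lambda>y. P (x, y)) has_real_derivative P' (x, y)) (at y within {c..d})"
    and cP: "continuous_on ({a..b} \<times> {c..d}) P" "continuous_on ({a..b} \<times> {c..d}) P'"
    and [measurable]: "P \<in> borel_measurable borel" "P' \<in> borel_measurable borel"
    and P0: "\<And>x. x \<in> {a..b} \<Longrightarrow> P (x, c) = 0" "\<And>x. x \<in> {a..b} \<Longrightarrow> P (x, d) = 0"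
  shows "(\<integral>q. (indicator ({a..b} \<times> {c..d}) q * P' q) *\<^sub>R U q \<partial>lborel) = - (\<integral>q. (indicator ({a..b} \<times> {c..d}) q * P q) *\<^sub>R A q \<partial>lborel)"
    and "integrable lborel (\<lambda>q. (indicator ({a..b} \<times> {c..d}) q * P' q) *\<^sub>R U q)"
    and "integrable lborel (\<lambda>q. (indicator ({a..b} \<times> {c..d}) q * P q) *\<^sub>R A q)"
proof -
  let ?Q = "{a..b} \<times> {c..d}"
  have cQ: "compact ?Q" by (intro compact_Times compact_Icc)
  have mU [measurable]: "U \<in> borel_measurable borel" using U by (simp add: rect_integrable_def)
  obtain B where B: "\<And>q. \<bar>indicator ?Q q * P' q\<bar> \<le> B * indicator ?Q q" using indicator_mult_bounded[OF cQ cP(2)] by metis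
  obtain C where C: "\<And>q. \<bar>indicator ?Q q * P q\<bar> \<le> C * indicator ?Q q" using indicator_mult_bounded[OF cQ cP(1)] by metis
  show i1: "integrable lborel (\<lambda>q. (indicator ?Q q * P' q) *\<^sub>R U q)"
    by (rule rect_integrable_bounded_mult[OF U ab cd(1) _ B]) measurable
  show i2: "integrable lborel (\<lambda>q. (indicator ?Q q * P q) *\<^sub>R A q)"
    by (rule rect_integrable_bounded_mult[OF A ab cd(1) _ C]) measurable
  show "(\<integral>q. (indicator ?Q q * P' q) *\<^sub>R U q \<partial>lborel) = - (\<integral>q. (indicator ?Q q * P q) *\<^sub>R A q \<partial>lborel)"
  proof -
   have "(\<integral>x. \<integral>y. (indicator ?Q (x, y) * P' (x, y)) *\<^sub>R U (x, y) \<partial>lborel \<partial>lborel) = (\<integral>x. - (\<integral>y. (indicator ?Q (x, y) * P (x, y)) *\<^sub>R A (x, y) \<partial>lborel) \<partial>lborel)"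
   proof (rule integral_cong_AE)
    show "(\<lambda>x. \<integral>y. (indicator ?Q (x, y) * P' (x, y)) *\<^sub>R U (x, y) \<partial>lborel) \<in> borel_measurable lborel"
      using fubini_integrable_fst[OF i1] by (auto dest: borel_measurable_integrable)
    show "(\<lambda>x. - (\<integral>y. (indicator ?Q (x, y) * P (x, y)) *\<^sub>R A (x, y) \<partial>lborel)) \<in> borel_measurable lborel"
      using fubini_integrable_fst[OF i2] by (auto dest: borel_measurable_integrable)
    show "AE x in lborel. (\<integral>y. (indicator ?Q (x, y) * P' (x, y)) *\<^sub>R U (x, y) \<partial>lborel) = - (\<integral>y. (indicator ?Q (x, y) * P (x, y)) *\<^sub>R A (x, y) \<partial>lborel)"
      using ac rect_integrable_slice[OF I J(1) A]
    proof eventually_elim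
      case (elim x)
      show ?case
      proof (cases "x \<in> {a..b}")
        case True
        then have "x \<in> I" using ab by auto
        then obtain k where k: "AE y in lborel. y \<in> J \<longrightarrow> U (x, y) = k + signed_integral j y (\<lambda>t. A (x, t))" using elim by auto
        have f: "interval_integrable J (\<lambda>y. A (x, y))" using elim \<open>x \<in> I\<close> by auto
        have "(\<integral>y. (indicator {c..d} y * P' (x, y)) *\<^sub>R U (x, y) \<partial>lborel) = - (\<integral>y. (indicator {c..d} y * P (x, y)) *\<^sub>R A (x, y) \<partial>lborel)"
        proof (rule ac_integral_by_parts_compact[OF J(2,3) cd f])
          show "AE y in lborel. y \<in> {c..d} \<longrightarrow> U (x, y) = k + signed_integral j y (\<lambda>t. A (x, t))"
            using k by eventually_elim (use cd in auto)
          show "continuous_on {c..d} (\<lambda>y. P' (x, y))"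
            by (rule continuous_on_compose2[OF cP(2)]) (use True in \<open>auto intro!: continuous_intros\<close>)
          show "(\<lambda>y. U (x, y)) \<in> borel_measurable borel"
            using measurable_compose[OF _ mU, of "\<lambda>y. (x, y)" borel] by simp
        qed (use P[OF True] P0[OF True] in auto)
        then show ?thesis using True by (simp add: indicator_times)
      qed (simp add: indicator_times)
    qed
   qed
   then show ?thesis using fubini_fst[OF i1] fubini_fst[OF i2] by simp
  qed
qed

text \<open>Subtracting the primitive F of A leaves V with vanishing weak derivative in the second
  variable. A test function \<mu> of mean m differs from m \<mu>0 by the derivative of a bump, so V
  pairs with \<mu> exactly as the function k does, where k(x) is the \<mu>0-average of V(x, .). The
  fundamental lemma then gives V = k.\<close>

lemma du_Bois_Reymond_snd:
  fixes u A :: "real \<times> real \<Rightarrow> 'b::euclidean_space"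
  assumes I: "open I" and J: "open J" "is_interval J" "j \<in> J"
    and u: "rect_integrable I J u" and A: "rect_integrable I J A"
    and weak: "\<And>\<eta> \<xi>. bump_on I \<eta> \<Longrightarrow> bump_on J \<xi> \<Longrightarrow>
      (\<integral>q. (\<eta> (fst q) * deriv \<xi> (snd q)) *\<^sub>R u q \<partial>lborel) = - (\<integral>q. (\<eta> (fst q) * \<xi> (snd q)) *\<^sub>R A q \<partial>lborel)"
  shows "\<exists>k. k \<in> borel_measurable borel \<and>
    (AE q in lborel. q \<in> I \<times> J \<longrightarrow> u q = k (fst q) + signed_integral j (snd q) (\<lambda>t. A (fst q, t)))"
proof -
  define F where "F = (\<lambda>q. signed_integral j (snd q) (\<lambda>t. A (fst q, t)))"
  have [measurable]: "A \<in> borel_measurable borel" "u \<in> borel_measurable borel"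
    using A u by (simp_all add: rect_integrable_def)
  have rF: "rect_integrable I J F" unfolding F_def by (rule rect_integrable_primitive[OF J(2,3) A])
  then have mF [measurable]: "F \<in> borel_measurable borel" by (simp add: rect_integrable_def)
  define V where "V = (\<lambda>q. u q - F q)"
  have rV: "rect_integrable I J V" unfolding V_def using rect_integrable_add[OF u rF] by simp
  then have mV [measurable]: "V \<in> borel_measurable borel" by (simp add: rect_integrable_def)
  have weakF: "(\<integral>q. (\<eta> (fst q) * deriv \<xi> (snd q)) *\<^sub>R F q \<partial>lborel) = - (\<integral>q. (\<eta> (fst q) * \<xi> (snd q)) *\<^sub>R A q \<partial>lborel)"
    if \<eta>: "bump_on I \<eta>" and \<xi>: "bump_on J \<xi>" for \<eta> \<xi>
  proof -
    obtain c d where cd: "c \<le> d" "{c..d} \<subseteq> J" "\<And>x. x \<notin> {c..d} \<Longrightarrow> \<xi> x = 0"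
      using \<xi> unfolding bump_on_def by blast
    obtain c' d' where c': "c' < c" "d < d'" "{c'..d'} \<subseteq> J"
      by (rule open_rational_interval[OF J(1) cd(2,1)])
    have \<xi>0: "\<xi> x = 0" "deriv \<xi> x = 0" if "x \<notin> {c'..d'}" for x
    proof -
      show "\<xi> x = 0" using that c' by (intro cd(3)) auto
      have "((\<lambda>_. 0) has_real_derivative 0) (at x)" by simp
      then have "(\<xi> has_real_derivative 0) (at x)"
        by (rule has_field_derivative_transform_within_open[where S = "- {c..d}"])
           (use that c' cd(3) in \<open>auto simp: open_Compl\<close>)
      then show "deriv \<xi> x = 0" by (rule DERIV_imp_deriv)
    qed
    obtain a b where ab: "{a..b} \<subseteq> I" "\<And>x. x \<notin> {a..b} \<Longrightarrow> \<eta> x = 0"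
      using \<eta> unfolding bump_on_def by blast
    let ?Q = "{a..b} \<times> {c'..d'}" and ?P = "\<lambda>q. \<eta> (fst q) * \<xi> (snd q)" and ?P' = "\<lambda>q. \<eta> (fst q) * deriv \<xi> (snd q)"
    have c: "continuous_on ?Q (\<lambda>q. \<eta> (fst q) * \<zeta> (snd q))" if "continuous_on UNIV \<zeta>" for \<zeta> :: "real \<Rightarrow> real"
      using bump_on_continuous[OF \<eta>] that
      by (intro continuous_on_mult continuous_on_compose2[of UNIV \<eta> ?Q fst] continuous_on_compose2[of UNIV \<zeta> ?Q snd] continuous_intros) auto
    note [measurable] = bump_on_measurable[OF \<eta>] bump_on_measurable[OF \<xi>] bump_on_measurable[OF bump_on_deriv[OF \<xi>]]
    have "(\<integral>q. (indicator ?Q q * ?P' q) *\<^sub>R F q \<partial>lborel) = - (\<integral>q. (indicator ?Q q * ?P q) *\<^sub>R A q \<partial>lborel)"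
    proof (rule rect_by_parts_snd(1)[OF I J rF A _ ab(1) c'(3)])
      show "AE x in lborel. x \<in> I \<longrightarrow> (\<exists>k. AE y in lborel. y \<in> J \<longrightarrow> F (x, y) = k + signed_integral j y (\<lambda>t. A (x, t)))"
        by (intro AE_I2 impI exI[of _ 0]) (simp add: F_def)
      show "((\<lambda>y. ?P (x, y)) has_real_derivative ?P' (x, y)) (at y within {c'..d'})" for x y
        using DERIV_cmult[OF DERIV_subset[OF bump_on_has_derivative[OF \<xi>, of y] subset_UNIV]] by simp
    qed (use cd c' bump_on_continuous[OF \<xi>] bump_on_continuous[OF bump_on_deriv[OF \<xi>]] c in auto)
    moreover have "indicator ?Q q * ?P' q = ?P' q" "indicator ?Q q * ?P q = ?P q" for q
      using \<xi>0[of "snd q"] ab(2)[of "fst q"] by (auto simp: indicator_def mem_Times_iff)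
    ultimately show ?thesis by (simp only:)
  qed
  have V0: "(\<integral>q. (\<eta> (fst q) * deriv \<xi> (snd q)) *\<^sub>R V q \<partial>lborel) = 0"
    if \<eta>: "bump_on I \<eta>" and \<xi>: "bump_on J \<xi>" for \<eta> \<xi>
  proof -
    have "(\<integral>q. (\<eta> (fst q) * deriv \<xi> (snd q)) *\<^sub>R V q \<partial>lborel)
       = (\<integral>q. (\<eta> (fst q) * deriv \<xi> (snd q)) *\<^sub>R u q \<partial>lborel) - (\<integral>q. (\<eta> (fst q) * deriv \<xi> (snd q)) *\<^sub>R F q \<partial>lborel)"
      unfolding V_def scaleR_diff_right
      by (intro Bochner_Integration.integral_diff rect_integrable_bump_mult[OF rF \<eta> bump_on_deriv[OF \<xi>]]
          rect_integrable_bump_mult[OF u \<eta> bump_on_deriv[OF \<xi>]])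
    then show ?thesis using weakF[OF that] weak[OF that] by simp
  qed
  obtain \<mu>0 where \<mu>0: "bump_on J \<mu>0" "(\<integral>x. \<mu>0 x \<partial>lborel) = 1" using bump_unit_mass[OF J(1,3)] by blast
  define k where "k x = (\<integral>y. \<mu>0 y *\<^sub>R V (x, y) \<partial>lborel)" for x
  have [measurable]: "\<mu>0 \<in> borel_measurable borel" using bump_on_measurable[OF \<mu>0(1)] .
  have mk [measurable]: "k \<in> borel_measurable borel"
  proof -
    have "(\<lambda>r. \<mu>0 (snd r) *\<^sub>R V (fst r, snd r)) \<in> borel_measurable ((borel :: real measure) \<Otimes>\<^sub>M lborel)"
      by measurable
    then show ?thesis unfolding k_def
      by (intro lborel.borel_measurable_lebesgue_integral) (simp add: case_prod_unfold)
  qed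
  obtain c0 d0 B0 where c0: "{c0..d0} \<subseteq> J" "0 \<le> B0" "\<And>x. \<bar>\<mu>0 x\<bar> \<le> B0 * indicator {c0..d0} x"
    using bump_on_bounded[OF \<mu>0(1)] by metis
  have \<mu>V: "integrable lborel (\<lambda>q. (indicator {a..b} (fst q) * \<mu>0 (snd q)) *\<^sub>R V q)" if "{a..b} \<subseteq> I" for a b
  proof (rule rect_integrable_bounded_mult[OF rV that c0(1), where B = B0])
    show "\<bar>indicator {a..b} (fst q) * \<mu>0 (snd q)\<bar> \<le> B0 * indicator ({a..b} \<times> {c0..d0}) q" for q
      using c0(3)[of "snd q"] c0(2) by (cases q) (auto simp: indicator_def abs_mult)
  qed measurable
  have ik: "interval_integrable I k"
    unfolding interval_integrable_def
  proof (intro conjI mk allI impI)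
    fix a b assume "{a..b} \<subseteq> I"
    from fubini_integrable_fst[OF \<mu>V[OF this]]
    have "integrable lborel (\<lambda>x. \<integral>y. indicator {a..b} x *\<^sub>R (\<mu>0 y *\<^sub>R V (x, y)) \<partial>lborel)"
      by (simp only: fst_conv snd_conv scaleR_scaleR)
    then show "integrable lborel (\<lambda>x. indicator {a..b} x *\<^sub>R k x)"
      by (simp only: integral_scaleR_right k_def)
  qed
  have ikn: "interval_integrable I (\<lambda>x. norm (k x))"
    unfolding interval_integrable_def
  proof (intro conjI allI impI)
    fix a b assume "{a..b} \<subseteq> I"
    then have "integrable lborel (\<lambda>x. indicator {a..b} x *\<^sub>R k x)" using ik by (auto simp: interval_integrable_def)
    from integrable_norm[OF this] show "integrable lborel (\<lambda>x. indicator {a..b} x *\<^sub>R norm (k x))" by simp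
  qed measurable
  have rk: "rect_integrable I J (\<lambda>q. k (fst q))"
    by (rule rect_integrable_tensor[OF ikn, where h = "\<lambda>_. 1"])
       (auto intro: integrable_real_indicator simp: emeasure_lborel_Icc_eq)
  have "AE q in lborel. q \<in> I \<times> J \<longrightarrow> V q - k (fst q) = 0"
  proof (rule fundamental_lemma_rect[OF I J(1) rect_integrable_add(2)[OF rV rk]])
    fix \<eta> \<mu> assume \<eta>: "bump_on I \<eta>" and \<mu>: "bump_on J \<mu>"
    let ?m = "\<integral>x. \<mu> x \<partial>lborel"
    have "bump_on J (\<lambda>x. \<mu> x + (- ?m) * \<mu>0 x)" by (intro bump_on_add J \<mu> bump_on_cmult \<mu>0)
    moreover have "(\<integral>x. \<mu> x + (- ?m) * \<mu>0 x \<partial>lborel) = 0"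
      using \<mu>0 bump_on_integrable[OF \<mu>0(1)] bump_on_integrable[OF \<mu>] by simp
    ultimately obtain \<xi> where \<xi>: "bump_on J \<xi>" "\<And>x. (\<xi> has_real_derivative (\<mu> x + (- ?m) * \<mu>0 x)) (at x)"
      using bump_primitive[OF J(2), of "\<lambda>x. \<mu> x + (- ?m) * \<mu>0 x"] by blast
    have d: "deriv \<xi> x = \<mu> x - ?m * \<mu>0 x" for x using DERIV_imp_deriv[OF \<xi>(2)] by simp
    have i1: "integrable lborel (\<lambda>q. (\<eta> (fst q) * \<mu> (snd q)) *\<^sub>R V q)" by (rule rect_integrable_bump_mult[OF rV \<eta> \<mu>])
    have i2: "integrable lborel (\<lambda>q. (\<eta> (fst q) * \<mu>0 (snd q)) *\<^sub>R V q)" by (rule rect_integrable_bump_mult[OF rV \<eta> \<mu>0(1)])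
    have i3: "integrable lborel (\<lambda>q. (\<eta> (fst q) * \<mu> (snd q)) *\<^sub>R k (fst q))" by (rule rect_integrable_bump_mult[OF rk \<eta> \<mu>])
    have "0 = (\<integral>q. (\<eta> (fst q) * \<mu> (snd q)) *\<^sub>R V q - ?m *\<^sub>R ((\<eta> (fst q) * \<mu>0 (snd q)) *\<^sub>R V q) \<partial>lborel)"
      using V0[OF \<eta> \<xi>(1)] by (simp add: d algebra_simps)
    also have "\<dots> = (\<integral>q. (\<eta> (fst q) * \<mu> (snd q)) *\<^sub>R V q \<partial>lborel) - ?m *\<^sub>R (\<integral>q. (\<eta> (fst q) * \<mu>0 (snd q)) *\<^sub>R V q \<partial>lborel)"
      by (subst Bochner_Integration.integral_diff[OF i1 integrable_scaleR_right[OF i2]]) (simp only: integral_scaleR_right)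
    also have "?m *\<^sub>R (\<integral>q. (\<eta> (fst q) * \<mu>0 (snd q)) *\<^sub>R V q \<partial>lborel) = ?m *\<^sub>R (\<integral>x. \<eta> x *\<^sub>R k x \<partial>lborel)"
      unfolding fubini_fst[OF i2] k_def
      by (simp only: integral_scaleR_right[symmetric] scaleR_scaleR fst_conv snd_conv)
    also have "?m *\<^sub>R (\<integral>x. \<eta> x *\<^sub>R k x \<partial>lborel) = (\<integral>q. (\<eta> (fst q) * \<mu> (snd q)) *\<^sub>R k (fst q) \<partial>lborel)"
    proof -
      have "(\<integral>q. (\<eta> (fst q) * \<mu> (snd q)) *\<^sub>R k (fst q) \<partial>lborel) = (\<integral>x. \<integral>y. \<mu> y *\<^sub>R (\<eta> x *\<^sub>R k x) \<partial>lborel \<partial>lborel)"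
        unfolding fubini_fst[OF i3] by (simp add: mult.commute)
      also have "\<dots> = (\<integral>x. ?m *\<^sub>R (\<eta> x *\<^sub>R k x) \<partial>lborel)"
        using bump_on_integrable[OF \<mu>] by (simp only: integral_scaleR_left)
      finally show ?thesis by (simp only: integral_scaleR_right)
    qed
    finally show "(\<integral>q. (\<eta> (fst q) * \<mu> (snd q)) *\<^sub>R (V q - k (fst q)) \<partial>lborel) = 0"
      unfolding scaleR_diff_right by (subst Bochner_Integration.integral_diff[OF i1 i3]) simp
  qed
  then have "AE q in lborel. q \<in> I \<times> J \<longrightarrow> u q = k (fst q) + signed_integral j (snd q) (\<lambda>t. A (fst q, t))"
    by eventually_elim (simp add: V_def F_def algebra_simps)
  then show ?thesis using mk by blast
qed

lemma du_Bois_Reymond_fst: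
  fixes u R :: "real \<times> real \<Rightarrow> 'b::euclidean_space"
  assumes I: "open I" "is_interval I" "i \<in> I" and J: "open J"
    and u: "rect_integrable I J u" and R: "rect_integrable I J R"
    and weak: "\<And>\<eta> \<xi>. bump_on I \<eta> \<Longrightarrow> bump_on J \<xi> \<Longrightarrow>
      (\<integral>q. (deriv \<eta> (fst q) * \<xi> (snd q)) *\<^sub>R u q \<partial>lborel) = - (\<integral>q. (\<eta> (fst q) * \<xi> (snd q)) *\<^sub>R R q \<partial>lborel)"
  shows "\<exists>k. k \<in> borel_measurable borel \<and>
    (AE q in lborel. q \<in> I \<times> J \<longrightarrow> u q = k (snd q) + signed_integral i (fst q) (\<lambda>t. R (t, snd q)))"
proof -
  have [measurable]: "u \<in> borel_measurable borel" "R \<in> borel_measurable borel"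
    using u R by (simp_all add: rect_integrable_def)
  have sw: "rect_integrable J I (\<lambda>q. f (snd q, fst q))" if "rect_integrable I J f" for f :: "real \<times> real \<Rightarrow> 'b"
    unfolding rect_integrable_def
  proof (intro conjI allI impI)
    have [measurable]: "f \<in> borel_measurable borel" using that by (simp add: rect_integrable_def)
    show "(\<lambda>q. f (snd q, fst q)) \<in> borel_measurable borel" by measurable
    fix a b c d assume "{a..b} \<subseteq> J" "{c..d} \<subseteq> I"
    then have "integrable lborel (\<lambda>q. indicator ({c..d} \<times> {a..b}) q *\<^sub>R f q)" using that by (auto simp: rect_integrable_def)
    then have "integrable lborel (\<lambda>q. indicator ({c..d} \<times> {a..b}) (snd q, fst q) *\<^sub>R f (snd q, fst q))"
      by (subst integrable_lborel_swap[of "\<lambda>q. indicator ({c..d} \<times> {a..b}) q *\<^sub>R f q"])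
    then show "integrable lborel (\<lambda>q. indicator ({a..b} \<times> {c..d}) q *\<^sub>R f (snd q, fst q))"
      by (simp add: indicator_times mult.commute)
  qed
  have "\<exists>k. k \<in> borel_measurable borel \<and>
    (AE q in lborel. q \<in> J \<times> I \<longrightarrow> u (snd q, fst q) = k (fst q) + signed_integral i (snd q) (\<lambda>t. R (snd (fst q, t), fst (fst q, t))))"
  proof (rule du_Bois_Reymond_snd[OF J I sw[OF u] sw[OF R]])
    fix \<xi> \<eta> assume b: "bump_on J \<xi>" "bump_on I \<eta>"
    have [measurable]: "\<xi> \<in> borel_measurable borel" "\<eta> \<in> borel_measurable borel" "deriv \<eta> \<in> borel_measurable borel"
      using b bump_on_measurable bump_on_deriv by blast+
    have "(\<integral>q. (\<xi> (fst q) * deriv \<eta> (snd q)) *\<^sub>R u (snd q, fst q) \<partial>lborel) = (\<integral>q. (deriv \<eta> (fst q) * \<xi> (snd q)) *\<^sub>R u q \<partial>lborel)"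
      by (subst integral_lborel_swap[symmetric]) (simp_all add: mult.commute)
    also have "\<dots> = - (\<integral>q. (\<eta> (fst q) * \<xi> (snd q)) *\<^sub>R R q \<partial>lborel)" by (rule weak[OF b(2,1)])
    also have "(\<integral>q. (\<eta> (fst q) * \<xi> (snd q)) *\<^sub>R R q \<partial>lborel) = (\<integral>q. (\<xi> (fst q) * \<eta> (snd q)) *\<^sub>R R (snd q, fst q) \<partial>lborel)"
      by (subst integral_lborel_swap[symmetric]) (simp_all add: mult.commute)
    finally show "(\<integral>q. (\<xi> (fst q) * deriv \<eta> (snd q)) *\<^sub>R u (snd q, fst q) \<partial>lborel) = - (\<integral>q. (\<xi> (fst q) * \<eta> (snd q)) *\<^sub>R R (snd q, fst q) \<partial>lborel)" .
  qed
  then obtain k where k: "k \<in> borel_measurable borel"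
    "AE q in lborel. q \<in> J \<times> I \<longrightarrow> u (snd q, fst q) = k (fst q) + signed_integral i (snd q) (\<lambda>t. R (t, fst q))"
    by auto
  from AE_lborel_pair_swap[OF k(2)] have "AE q in lborel. q \<in> I \<times> J \<longrightarrow> u q = k (snd q) + signed_integral i (fst q) (\<lambda>t. R (t, snd q))"
    by eventually_elim (auto simp: mem_Times_iff)
  then show ?thesis using k(1) by blast
qed

section \<open>Polar-type coordinates on the half plane\<close>

text \<open>The second coordinate c is the cotangent of the polar angle: c -> +\<infinity> is the
  positive and c -> -\<infinity> the negative half of the flat boundary. With this choice the
  coordinates involve only square roots and quotients, no trigonometry.\<close>

definition polar_map :: "real \<times> real \<Rightarrow> real \<times> real" where
  "polar_map q = (snd q * sqrt (fst q / (1 + (snd q)\<^sup>2)), sqrt (fst q / (1 + (snd q)\<^sup>2)))"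

definition polar_inv :: "real \<times> real \<Rightarrow> real \<times> real" where
  "polar_inv p = ((fst p)\<^sup>2 + (snd p)\<^sup>2, fst p / snd p)"

text \<open>The value 0 for \<sigma> <= 0 matters: \<open>sqrt\<close> is odd, so there
  \<open>polar_map\<close> yields points with y <= 0, and the vanishing Jacobian is what restricts
  integrals to the upper half plane.\<close>

definition polar_jac :: "real \<times> real \<Rightarrow> real" where
  "polar_jac q = (if 0 < fst q then 1 / (2 * (1 + (snd q)\<^sup>2)) else 0)"

lemma one_plus_sq_pos [simp]: "0 < 1 + (c::real)\<^sup>2" "1 + (c::real)\<^sup>2 \<noteq> 0" "0 \<le> 1 + (c::real)\<^sup>2"
  using zero_le_power2[of c] by (linarith+)

lemma polar_map_measurable [measurable]: "polar_map \<in> borel_measurable borel"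
  unfolding polar_map_def[abs_def] by measurable

lemma polar_inv_measurable [measurable]: "polar_inv \<in> borel_measurable borel"
  unfolding polar_inv_def[abs_def] by measurable

lemma polar_jac_measurable [measurable]: "polar_jac \<in> borel_measurable borel"
  unfolding polar_jac_def[abs_def] by measurable

lemma polar_jac_nonneg [simp]: "0 \<le> polar_jac q"
  by (simp add: polar_jac_def)

lemma snd_polar_map_pos [simp]: "0 < snd (polar_map q) \<longleftrightarrow> 0 < fst q"
proof -
  have "\<not> 1 + (snd q)\<^sup>2 < 0" by (simp add: not_less)
  then show ?thesis by (simp add: polar_map_def zero_less_divide_iff)
qed

lemma polar_jac_pos [simp]: "0 < polar_jac q \<longleftrightarrow> 0 < fst q"
proof -
  have "0 < 2 * (1 + (snd q)\<^sup>2)" by (intro mult_pos_pos) auto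
  then show ?thesis by (simp add: polar_jac_def)
qed

lemma polar_inv_map: "0 < fst q \<Longrightarrow> polar_inv (polar_map q) = q"
proof -
  assume q: "0 < fst q"
  have "(snd q)\<^sup>2 * (fst q / (1 + (snd q)\<^sup>2)) + fst q / (1 + (snd q)\<^sup>2) = fst q / (1 + (snd q)\<^sup>2) * (1 + (snd q)\<^sup>2)"
    by algebra
  also have "\<dots> = fst q" by simp
  finally show ?thesis using q
    by (cases q) (simp add: polar_inv_def polar_map_def power_mult_distrib)
qed

lemma polar_map_inv: "0 < snd p \<Longrightarrow> polar_map (polar_inv p) = p"
proof -
  assume p: "0 < snd p"
  have "((fst p)\<^sup>2 + (snd p)\<^sup>2) / (1 + (fst p / snd p)\<^sup>2) = (snd p)\<^sup>2"
  proof -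
    have "(snd p)\<^sup>2 * (1 + (fst p / snd p)\<^sup>2) = (fst p)\<^sup>2 + (snd p)\<^sup>2"
      using p by (simp add: power_divide distrib_left)
    then show ?thesis by (simp add: divide_eq_eq)
  qed
  then show ?thesis using p by (cases p) (simp add: polar_inv_def polar_map_def)
qed

lemma fst_polar_inv_pos: "0 < snd p \<Longrightarrow> 0 < fst (polar_inv p)"
  by (simp add: polar_inv_def add_nonneg_pos)

lemma half_ball_iff: "p \<in> half_ball (0, 0) r \<longleftrightarrow> 0 < snd p \<and> (fst p)\<^sup>2 + (snd p)\<^sup>2 < r\<^sup>2 \<and> 0 < r"
proof -
  have "dist (0, 0) p = sqrt ((fst p)\<^sup>2 + (snd p)\<^sup>2)"
    by (cases p) (simp add: dist_Pair_Pair dist_real_def)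
  moreover have "sqrt ((fst p)\<^sup>2 + (snd p)\<^sup>2) < r \<longleftrightarrow> (fst p)\<^sup>2 + (snd p)\<^sup>2 < r\<^sup>2 \<and> 0 < r"
  proof (cases "0 < r")
    case True
    then have "r = sqrt (r\<^sup>2)" by simp
    then show ?thesis using True by (metis real_sqrt_less_iff)
  next
    case False
    have "0 \<le> sqrt ((fst p)\<^sup>2 + (snd p)\<^sup>2)" by simp
    then have "\<not> sqrt ((fst p)\<^sup>2 + (snd p)\<^sup>2) < r" using False by linarith
    then show ?thesis using False by simp
  qed
  ultimately show ?thesis by (auto simp: half_ball_def)
qed

lemma polar_map_half_ball:
  assumes "0 < r" "0 < fst q"
  shows "polar_map q \<in> half_ball (0, 0) r \<longleftrightarrow> fst q < r\<^sup>2"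
proof -
  have "fst (polar_inv (polar_map q)) = fst q" using polar_inv_map[OF assms(2)] by simp
  then have "(fst (polar_map q))\<^sup>2 + (snd (polar_map q))\<^sup>2 = fst q" by (simp add: polar_inv_def)
  then show ?thesis using assms by (simp add: half_ball_iff)
qed

lemma polar_inv_half_ball:
  assumes "p \<in> half_ball (0, 0) r"
  shows "fst (polar_inv p) \<in> {0<..<r\<^sup>2}" "polar_map (polar_inv p) = p"
proof -
  have p: "0 < snd p" "(fst p)\<^sup>2 + (snd p)\<^sup>2 < r\<^sup>2" using assms by (auto simp: half_ball_iff)
  show "polar_map (polar_inv p) = p" using polar_map_inv p by auto
  show "fst (polar_inv p) \<in> {0<..<r\<^sup>2}" using fst_polar_inv_pos[OF p(1)] p by (simp add: polar_inv_def)
qed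

text \<open>The substitution t = y^2 is made on [0, n], followed by monotone convergence in n on
  both sides.\<close>

lemma nn_integral_square_subst:
  fixes h :: "real \<Rightarrow> ennreal"
  assumes [measurable]: "h \<in> borel_measurable borel"
  shows "(\<integral>\<^sup>+y. h y * ennreal y * indicator {0..} y \<partial>lborel) = (\<integral>\<^sup>+t. h (sqrt t) * ennreal (1/2) * indicator {0..} t \<partial>lborel)"
proof -
  have step: "(\<integral>\<^sup>+y. h y * ennreal y * indicator {0..real n} y \<partial>lborel) = (\<integral>\<^sup>+t. h (sqrt t) * ennreal (1/2) * indicator {0..(real n)\<^sup>2} t \<partial>lborel)"
    if "n > 0" for n :: nat
  proof -
    have "(\<integral>\<^sup>+t. (h (sqrt t) * ennreal (1/2)) * indicator {0\<^sup>2..(real n)\<^sup>2} t \<partial>lborel)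
      = (\<integral>\<^sup>+y. (h (sqrt (y\<^sup>2)) * ennreal (1/2)) * ennreal (2 * y) * indicator {0..real n} y \<partial>lborel)"
    proof (rule nn_integral_substitution_aux[where g = "\<lambda>y. y\<^sup>2" and g' = "\<lambda>y. 2 * y"])
      show "((\<lambda>y. y\<^sup>2) has_real_derivative 2 * x) (at x)" for x :: real
        by (auto intro!: derivative_eq_intros)
    qed (use that in \<open>auto intro!: continuous_intros\<close>)
    also have "\<dots> = (\<integral>\<^sup>+y. h y * ennreal y * indicator {0..real n} y \<partial>lborel)"
    proof (rule nn_integral_cong)
      fix y :: real
      show "(h (sqrt (y\<^sup>2)) * ennreal (1/2)) * ennreal (2 * y) * indicator {0..real n} y = h y * ennreal y * indicator {0..real n} y"
      proof (cases "y \<ge> 0")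
        case True
        have "ennreal (1/2) * ennreal (2 * y) = ennreal (1/2 * (2 * y))" using True by (intro ennreal_mult[symmetric]) auto
        also have "\<dots> = ennreal y" by simp
        finally show ?thesis using True by (simp only: mult.assoc real_sqrt_pow2_iff real_sqrt_abs abs_of_nonneg)
      qed (auto simp: indicator_def)
    qed
    finally show ?thesis by simp
  qed
  have L: "(\<lambda>n. \<integral>\<^sup>+y. h y * ennreal y * indicator {0..real n} y \<partial>lborel) \<longlonglongrightarrow> (\<integral>\<^sup>+y. h y * ennreal y * indicator {0..} y \<partial>lborel)"
  proof (rule nn_integral_LIMSEQ)
    show "(\<lambda>n. h y * ennreal y * indicator {0..real n} y) \<longlonglongrightarrow> h y * ennreal y * indicator {0..} y" for y
    proof (rule tendsto_eventually)
      obtain m :: nat where "y \<le> real m" using real_arch_simple by blast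
      then show "\<forall>\<^sub>F n in sequentially. h y * ennreal y * indicator {0..real n} y = h y * ennreal y * indicator {0..} y"
        unfolding eventually_sequentially by (intro exI[of _ m]) (auto simp: indicator_def)
    qed
  qed (auto simp: incseq_def le_fun_def indicator_def)
  have R: "(\<lambda>n. \<integral>\<^sup>+t. h (sqrt t) * ennreal (1/2) * indicator {0..(real n)\<^sup>2} t \<partial>lborel) \<longlonglongrightarrow> (\<integral>\<^sup>+t. h (sqrt t) * ennreal (1/2) * indicator {0..} t \<partial>lborel)"
  proof (rule nn_integral_LIMSEQ)
    show "(\<lambda>n. h (sqrt y) * ennreal (1/2) * indicator {0..(real n)\<^sup>2} y) \<longlonglongrightarrow> h (sqrt y) * ennreal (1/2) * indicator {0..} y" for y
    proof (rule tendsto_eventually)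
      obtain m :: nat where m: "max y 1 \<le> real m" using real_arch_simple by blast
      have "y \<le> (real n)\<^sup>2" if "n \<ge> m" for n
      proof -
        have "y \<le> real n" "1 \<le> real n" using m that by linarith+
        then have "real n * 1 \<le> real n * real n" by (intro mult_left_mono) auto
        then show ?thesis using \<open>y \<le> real n\<close> by (simp add: power2_eq_square)
      qed
      then show "\<forall>\<^sub>F n in sequentially. h (sqrt y) * ennreal (1/2) * indicator {0..(real n)\<^sup>2} y = h (sqrt y) * ennreal (1/2) * indicator {0..} y"
        unfolding eventually_sequentially by (intro exI[of _ m]) (auto simp: indicator_def)
    qed
    show "incseq (\<lambda>n t. h (sqrt t) * ennreal (1/2) * indicator {0..(real n)\<^sup>2} t)"
    proof (intro incseq_SucI le_funI mult_left_mono)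
      show "indicator {0..(real n)\<^sup>2} t \<le> (indicator {0..(real (Suc n))\<^sup>2} t :: ennreal)" for n t
      proof -
        have "(real n)\<^sup>2 \<le> (real (Suc n))\<^sup>2" by (intro power_mono) auto
        then show ?thesis by (auto simp: indicator_def simp del: of_nat_Suc intro: order_trans[of t "(real n)\<^sup>2"])
      qed
    qed simp
  qed auto
  have "\<forall>\<^sub>F n in sequentially. (\<integral>\<^sup>+t. h (sqrt t) * ennreal (1/2) * indicator {0..(real n)\<^sup>2} t \<partial>lborel) = (\<integral>\<^sup>+y. h y * ennreal y * indicator {0..real n} y \<partial>lborel)"
    using eventually_gt_at_top[of 0] by eventually_elim (use step in auto)
  from Lim_transform_eventually[OF R this] L show ?thesis
    using LIMSEQ_unique by blast
qed

text \<open>Three one-dimensional substitutions: x = c y for fixed y > 0, then y = sqrt t for fixed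
  c, then t = \<sigma> / (1 + c^2). The factor y of the first is absorbed by the second, leaving
  1/2; the third contributes 1 / (1 + c^2).\<close>

lemma nn_integral_polar:
  fixes f :: "real \<times> real \<Rightarrow> ennreal"
  assumes [measurable]: "f \<in> borel_measurable borel"
  shows "(\<integral>\<^sup>+p. f p * indicator {p. 0 < snd p} p \<partial>lborel) = (\<integral>\<^sup>+q. f (polar_map q) * ennreal (polar_jac q) \<partial>lborel)"
proof -
  have [measurable]: "{p :: real \<times> real. 0 < snd p} \<in> sets borel" by measurable
  have "(\<integral>\<^sup>+p. f p * indicator {p. 0 < snd p} p \<partial>lborel) = (\<integral>\<^sup>+y. \<integral>\<^sup>+x. f (x, y) * indicator {0<..} y \<partial>lborel \<partial>lborel)"
    by (subst nn_fubini_snd) (auto simp: indicator_def)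
  also have "\<dots> = (\<integral>\<^sup>+y. \<integral>\<^sup>+c. f (c * y, y) * ennreal y * indicator {0..} y \<partial>lborel \<partial>lborel)"
  proof (rule nn_integral_cong)
    fix y :: real
    show "(\<integral>\<^sup>+x. f (x, y) * indicator {0<..} y \<partial>lborel) = (\<integral>\<^sup>+c. f (c * y, y) * ennreal y * indicator {0..} y \<partial>lborel)"
    proof (cases "y > 0")
      case True
      have "(\<integral>\<^sup>+x. f (x, y) \<partial>lborel) = \<bar>y\<bar> * (\<integral>\<^sup>+c. f (0 + y * c, y) \<partial>lborel)"
        by (rule nn_integral_real_affine) (use True in auto)
      also have "\<dots> = (\<integral>\<^sup>+c. f (c * y, y) * ennreal y \<partial>lborel)"
        using True by (subst nn_integral_multc) (auto simp: mult.commute)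
      finally show ?thesis using True by simp
    next
      case False
      then have "ennreal y = 0" by (simp add: ennreal_neg)
      then show ?thesis using False by simp
    qed
  qed
  also have "\<dots> = (\<integral>\<^sup>+c. \<integral>\<^sup>+y. f (c * y, y) * ennreal y * indicator {0..} y \<partial>lborel \<partial>lborel)"
  proof -
    have m: "(\<lambda>q. f (fst q * snd q, snd q) * ennreal (snd q) * indicator {0..} (snd q)) \<in> borel_measurable borel"
      by measurable
    from nn_fubini_fst[OF m] nn_fubini_snd[OF m] show ?thesis by simp
  qed
  also have "\<dots> = (\<integral>\<^sup>+c. \<integral>\<^sup>+t. f (c * sqrt t, sqrt t) * ennreal (1/2) * indicator {0..} t \<partial>lborel \<partial>lborel)"
  proof (rule nn_integral_cong)
    fix c :: real
    show "(\<integral>\<^sup>+y. f (c * y, y) * ennreal y * indicator {0..} y \<partial>lborel) = (\<integral>\<^sup>+t. f (c * sqrt t, sqrt t) * ennreal (1/2) * indicator {0..} t \<partial>lborel)"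
      by (rule nn_integral_square_subst) measurable
  qed
  also have "\<dots> = (\<integral>\<^sup>+c. \<integral>\<^sup>+\<sigma>. f (polar_map (\<sigma>, c)) * ennreal (1 / (2 * (1 + c\<^sup>2))) * indicator {0..} \<sigma> \<partial>lborel \<partial>lborel)"
  proof (rule nn_integral_cong)
    fix c :: real
    let ?k = "1 / (1 + c\<^sup>2)"
    have k: "?k > 0" by simp
    have "(\<integral>\<^sup>+t. f (c * sqrt t, sqrt t) * ennreal (1/2) * indicator {0..} t \<partial>lborel)
      = \<bar>?k\<bar> * (\<integral>\<^sup>+\<sigma>. f (c * sqrt (0 + ?k * \<sigma>), sqrt (0 + ?k * \<sigma>)) * ennreal (1/2) * indicator {0..} (0 + ?k * \<sigma>) \<partial>lborel)"
      by (rule nn_integral_real_affine) (use k in auto)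
    also have "\<dots> = (\<integral>\<^sup>+\<sigma>. ennreal ?k * (f (c * sqrt (0 + ?k * \<sigma>), sqrt (0 + ?k * \<sigma>)) * ennreal (1/2) * indicator {0..} (0 + ?k * \<sigma>)) \<partial>lborel)"
      using k by (subst nn_integral_cmult) auto
    also have "\<dots> = (\<integral>\<^sup>+\<sigma>. f (polar_map (\<sigma>, c)) * ennreal (1 / (2 * (1 + c\<^sup>2))) * indicator {0..} \<sigma> \<partial>lborel)"
    proof (rule nn_integral_cong)
      fix \<sigma> :: real
      have "ennreal ?k * ennreal (1/2) = ennreal (?k * (1/2))" using k by (intro ennreal_mult[symmetric]) auto
      also have "?k * (1/2) = 1 / (2 * (1 + c\<^sup>2))" by simp
      finally have "ennreal ?k * ennreal (1/2) = ennreal (1 / (2 * (1 + c\<^sup>2)))" .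
      note J = this
      have I: "indicator {0..} (0 + ?k * \<sigma>) = (indicator {0..} \<sigma> :: ennreal)"
      proof -
        have "\<not> 1 + c\<^sup>2 \<le> 0" by (simp add: not_le)
        then show ?thesis by (auto simp: indicator_def zero_le_divide_iff)
      qed
      have P: "(c * sqrt (0 + ?k * \<sigma>), sqrt (0 + ?k * \<sigma>)) = polar_map (\<sigma>, c)"
        by (simp add: polar_map_def)
      show "ennreal ?k * (f (c * sqrt (0 + ?k * \<sigma>), sqrt (0 + ?k * \<sigma>)) * ennreal (1/2) * indicator {0..} (0 + ?k * \<sigma>))
        = f (polar_map (\<sigma>, c)) * ennreal (1 / (2 * (1 + c\<^sup>2))) * indicator {0..} \<sigma>"
        unfolding I P J[symmetric] by (simp only: mult_ac)
    qed
    finally show "(\<integral>\<^sup>+t. f (c * sqrt t, sqrt t) * ennreal (1/2) * indicator {0..} t \<partial>lborel)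
      = (\<integral>\<^sup>+\<sigma>. f (polar_map (\<sigma>, c)) * ennreal (1 / (2 * (1 + c\<^sup>2))) * indicator {0..} \<sigma> \<partial>lborel)" .
  qed
  also have "\<dots> = (\<integral>\<^sup>+c. \<integral>\<^sup>+\<sigma>. f (polar_map (\<sigma>, c)) * ennreal (polar_jac (\<sigma>, c)) \<partial>lborel \<partial>lborel)"
  proof (rule nn_integral_cong, rule nn_integral_cong_AE)
    fix c :: real
    show "AE \<sigma> in lborel. f (polar_map (\<sigma>, c)) * ennreal (1 / (2 * (1 + c\<^sup>2))) * indicator {0..} \<sigma> = f (polar_map (\<sigma>, c)) * ennreal (polar_jac (\<sigma>, c))"
      using AE_lborel_singleton[of 0] by eventually_elim (auto simp: polar_jac_def indicator_def)
  qed
  also have "\<dots> = (\<integral>\<^sup>+q. f (polar_map q) * ennreal (polar_jac q) \<partial>lborel)"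
    by (subst nn_fubini_snd) auto
  finally show ?thesis .
qed

text \<open>Stated as an identity of measures, the change of variables yields Bochner integrals,
  integrability and null sets together.\<close>

lemma distr_polar:
  "distr (density lborel (\<lambda>q. ennreal (polar_jac q))) borel polar_map = density lborel (\<lambda>p. ennreal (indicator {p. 0 < snd p} p))"
proof (rule measure_eqI)
  fix A assume "A \<in> sets (distr (density lborel (\<lambda>q. ennreal (polar_jac q))) borel polar_map)"
  then have A [measurable]: "A \<in> sets borel" by simp
  have [measurable]: "{p :: real \<times> real. 0 < snd p} \<in> sets borel" by measurable
  have V [measurable]: "polar_map -` A \<in> sets borel" using measurable_sets[OF polar_map_measurable A] by simp
  have "emeasure (distr (density lborel (\<lambda>q. ennreal (polar_jac q))) borel polar_map) A
    = (\<integral>\<^sup>+q. ennreal (polar_jac q) * indicator (polar_map -` A) q \<partial>lborel)"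
    by (subst emeasure_distr) (auto simp: emeasure_density)
  also have "\<dots> = (\<integral>\<^sup>+q. indicator A (polar_map q) * ennreal (polar_jac q) \<partial>lborel)"
    by (intro nn_integral_cong) (auto simp: indicator_def)
  also have "\<dots> = (\<integral>\<^sup>+p. indicator A p * indicator {p. 0 < snd p} p \<partial>lborel)"
    by (rule nn_integral_polar[symmetric]) measurable
  also have "\<dots> = emeasure (density lborel (\<lambda>p. ennreal (indicator {p. 0 < snd p} p))) A"
    by (subst emeasure_density) (auto intro!: nn_integral_cong simp: indicator_def)
  finally show "emeasure (distr (density lborel (\<lambda>q. ennreal (polar_jac q))) borel polar_map) A
    = emeasure (density lborel (\<lambda>p. ennreal (indicator {p. 0 < snd p} p))) A" .
qed simp

lemma
  fixes F :: "real \<times> real \<Rightarrow> 'b::{banach, second_countable_topology}"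
  assumes [measurable]: "F \<in> borel_measurable borel"
  shows polar_integral: "(\<integral>p. indicator {p. 0 < snd p} p *\<^sub>R F p \<partial>lborel) = (\<integral>q. polar_jac q *\<^sub>R F (polar_map q) \<partial>lborel)"
    and polar_integrable: "integrable lborel (\<lambda>p. indicator {p. 0 < snd p} p *\<^sub>R F p) \<longleftrightarrow> integrable lborel (\<lambda>q. polar_jac q *\<^sub>R F (polar_map q))"
proof -
  have [measurable]: "{p :: real \<times> real. 0 < snd p} \<in> sets borel" by measurable
  show "(\<integral>p. indicator {p. 0 < snd p} p *\<^sub>R F p \<partial>lborel) = (\<integral>q. polar_jac q *\<^sub>R F (polar_map q) \<partial>lborel)"
    by (subst integral_density[symmetric]) (auto simp: distr_polar[symmetric] integral_distr integral_density)
  show "integrable lborel (\<lambda>p. indicator {p. 0 < snd p} p *\<^sub>R F p) \<longleftrightarrow> integrable lborel (\<lambda>q. polar_jac q *\<^sub>R F (polar_map q))"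
    by (subst integrable_density[symmetric]) (auto simp: distr_polar[symmetric] integrable_distr_eq integrable_density)
qed

lemma polar_AE_iff:
  assumes P: "{p. P p} \<in> sets (borel :: (real \<times> real) measure)"
  shows "(AE p in lborel. 0 < snd p \<longrightarrow> P p) \<longleftrightarrow> (AE q in lborel. 0 < fst q \<longrightarrow> P (polar_map q))"
proof -
  have [measurable]: "{p :: real \<times> real. 0 < snd p} \<in> sets borel" by measurable
  have "(AE p in lborel. 0 < snd p \<longrightarrow> P p) \<longleftrightarrow> (AE p in density lborel (\<lambda>p. ennreal (indicator {p. 0 < snd p} p)). P p)"
    by (subst AE_density) (auto simp: indicator_def intro!: AE_cong)
  also have "\<dots> \<longleftrightarrow> (AE q in density lborel (\<lambda>q. ennreal (polar_jac q)). P (polar_map q))"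
    unfolding distr_polar[symmetric] using P by (subst AE_distr_iff) auto
  also have "\<dots> \<longleftrightarrow> (AE q in lborel. 0 < fst q \<longrightarrow> P (polar_map q))"
    by (subst AE_density) auto
  finally show ?thesis .
qed

section \<open>Transport of null sets and Borel representatives of Lebesgue measurable maps\<close>

lemma AE_lborel_borel_set:
  assumes "AE x in (lborel :: 'a::euclidean_space measure). P x"
  obtains N where "N \<in> sets borel" "\<And>x. \<not> P x \<Longrightarrow> x \<in> N" "AE x in (lborel :: 'a measure). x \<notin> N"
proof -
  obtain N where N: "N \<in> null_sets (lborel :: 'a measure)" "{x. \<not> P x} \<subseteq> N"
    using assms unfolding eventually_ae_filter by auto
  then have "N \<in> sets borel" "AE x in (lborel :: 'a measure). x \<notin> N" by (auto dest: AE_not_in)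
  then show ?thesis using N that by blast
qed

text \<open>P is an arbitrary predicate, so its failure set is first enclosed in a Borel null set;
  only then is the preimage under \<open>polar_inv\<close> known to be measurable and the change of
  variables applicable.\<close>

lemma polar_AE_pushforward:
  assumes "AE q in lborel. 0 < fst q \<longrightarrow> P q"
  shows "AE p in lborel. 0 < snd p \<longrightarrow> P (polar_inv p)"
proof -
  obtain N where N: "N \<in> sets borel" "\<And>x. \<not> (0 < fst x \<longrightarrow> P x) \<Longrightarrow> x \<in> N" "AE x in lborel. x \<notin> N"
    using AE_lborel_borel_set[OF assms] by metis
  have "{p. polar_inv p \<notin> N} = - (polar_inv -` N)" by auto
  then have s: "{p. polar_inv p \<notin> N} \<in> sets borel"
    using measurable_sets[OF polar_inv_measurable N(1)] by auto
  have "AE q in lborel. 0 < fst q \<longrightarrow> polar_inv (polar_map q) \<notin> N"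
    using N(3) by eventually_elim (simp add: polar_inv_map)
  then have "AE p in lborel. 0 < snd p \<longrightarrow> polar_inv p \<notin> N" using polar_AE_iff[OF s] by simp
  then show ?thesis by eventually_elim (use N(2) fst_polar_inv_pos in blast)
qed

lemma open_half_ball: "open (half_ball c r)"
  unfolding half_ball_def by (intro open_Int open_ball open_Collect_less continuous_intros)

lemma lebesgue_borel_version:
  fixes f :: "'a::euclidean_space \<Rightarrow> 'b::euclidean_space"
  assumes f: "f \<in> borel_measurable lebesgue"
  shows "\<exists>g \<in> borel_measurable borel. AE x in lborel. f x = g x"
proof -
  have "\<exists>g. g \<in> borel_measurable lborel \<and> (AE x in lborel. f x \<bullet> i = g x)" for i
    using completion_ex_borel_measurable_real[of "\<lambda>x. f x \<bullet> i" lborel] f by auto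
  then obtain g where g: "\<And>i. g i \<in> borel_measurable lborel" "\<And>i. AE x in lborel. f x \<bullet> i = g i x" by metis
  define h where "h x = (\<Sum>i\<in>Basis. g i x *\<^sub>R i)" for x
  have "h \<in> borel_measurable borel" unfolding h_def using g(1) by simp
  moreover have "AE x in lborel. \<forall>i\<in>Basis. f x \<bullet> i = g i x"
    using g(2) by (intro AE_finite_allI) auto
  then have "AE x in lborel. f x = h x"
    by eventually_elim (metis (mono_tags, lifting) euclidean_representation h_def sum.cong)
  ultimately show ?thesis by blast
qed

text \<open>Integrability is given on compact subsets only, so measurability on the whole open set
  comes from an exhaustion by compact sets.\<close>

lemma locally_integrable_measurable:
  fixes f :: "real \<times> real \<Rightarrow> real^'d"
  assumes "open \<Omega>" "locally_integrable_on \<Omega> f"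
  shows "(\<lambda>p. indicator \<Omega> p *\<^sub>R f p) \<in> borel_measurable lebesgue"
proof -
  have "\<exists>C. (\<forall>n::nat. compact (C n)) \<and> (\<forall>n. C n \<subseteq> \<Omega>) \<and> (\<forall>K. compact K \<longrightarrow> K \<subseteq> \<Omega> \<longrightarrow> (\<exists>N. \<forall>n\<ge>N. K \<subseteq> C n))"
    apply (rule open_Union_compact_subsets[OF assms(1)])
    subgoal for C by (intro exI[of _ C] conjI allI impI) simp_all
    done
  then obtain C where C': "(\<forall>n::nat. compact (C n)) \<and> (\<forall>n. C n \<subseteq> \<Omega>) \<and> (\<forall>K. compact K \<longrightarrow> K \<subseteq> \<Omega> \<longrightarrow> (\<exists>N. \<forall>n\<ge>N. K \<subseteq> C n))"
    by blast
  then have C: "\<And>n. compact (C n)" "\<And>n. C n \<subseteq> \<Omega>" "\<And>K. compact K \<Longrightarrow> K \<subseteq> \<Omega> \<Longrightarrow> \<exists>N. \<forall>n\<ge>N. K \<subseteq> C n"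
    by simp_all
  show ?thesis
  proof (rule borel_measurable_LIMSEQ_metric)
    show "(\<lambda>p. indicator (C n) p *\<^sub>R f p) \<in> borel_measurable lebesgue" for n
      using assms(2) C(1,2)[of n] unfolding locally_integrable_on_def set_integrable_def
      by (auto dest: borel_measurable_integrable)
    show "(\<lambda>n. indicator (C n) p *\<^sub>R f p) \<longlonglongrightarrow> indicator \<Omega> p *\<^sub>R f p" for p
    proof (cases "p \<in> \<Omega>")
      case True
      then obtain N where N: "\<forall>n\<ge>N. {p} \<subseteq> C n" using C(3)[of "{p}"] by auto
      show ?thesis
        by (rule tendsto_eventually) (use N True in \<open>auto simp: eventually_sequentially indicator_def intro!: exI[of _ N]\<close>)
    next
      case False
      then have "indicator (C n) p = (0::real)" for n using C(2)[of n] by (auto simp: indicator_def)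
      then show ?thesis using False by simp
    qed
  qed
qed

text \<open>Fubini and the change of variables are carried out for Borel functions. A map in the
  weighted space and its weak gradient are merely Lebesgue measurable on the domain, and are
  replaced by Borel versions at the outset.\<close>

lemma locally_integrable_borel_version:
  fixes f :: "real \<times> real \<Rightarrow> real^'d"
  assumes "open \<Omega>" "locally_integrable_on \<Omega> f"
  shows "\<exists>g \<in> borel_measurable borel. AE p in lborel. p \<in> \<Omega> \<longrightarrow> f p = g p"
proof -
  from lebesgue_borel_version[OF locally_integrable_measurable[OF assms]]
  obtain g where "g \<in> borel_measurable borel" "AE p in lborel. indicator \<Omega> p *\<^sub>R f p = g p" by blast
  then show ?thesis by (intro bexI[of _ g]) (auto elim: eventually_mono)
qed

section \<open>Weak gradients in polar coordinates\<close>

text \<open>The product bump \<eta>(\<sigma>) \<xi>(c) in Cartesian coordinates. The value 0 for y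
  <= 0 is its smooth extension, because the support keeps away from the flat boundary.\<close>

definition sector_bump :: "(real \<Rightarrow> real) \<Rightarrow> (real \<Rightarrow> real) \<Rightarrow> real \<times> real \<Rightarrow> real" where
  "sector_bump \<eta> \<xi> p = (if 0 < snd p then \<eta> ((fst p)\<^sup>2 + (snd p)\<^sup>2) * \<xi> (fst p / snd p) else 0)"

lemma open_upper_half: "open {p :: real \<times> real. 0 < snd p}"
  by (intro open_Collect_less continuous_intros)

lemma Ck_on_fst: "open S \<Longrightarrow> Ck_on k S (fst :: real \<times> real \<Rightarrow> real)"
  and Ck_on_snd: "open S \<Longrightarrow> Ck_on k S (snd :: real \<times> real \<Rightarrow> real)"
  by (auto intro: Ck_on_bounded_linear bounded_linear_fst bounded_linear_snd)

text \<open>The support lies in a sector |x| <= C y between two half circles. As the inner radius is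
  positive and the outer one below r, this is a compact subset of the open half disc. The smooth
  factor m accommodates the components of radial and rotational vector fields.\<close>

lemma sector_bump_test_function:
  assumes "0 < r" and \<eta>: "bump_on {0<..<r\<^sup>2} \<eta>" and \<xi>: "bump_on UNIV \<xi>" and m: "smooth_on UNIV m"
  shows "test_function (half_ball (0, 0) r) (\<lambda>p. m p * sector_bump \<eta> \<xi> p)"
proof -
  obtain a b where ab: "a \<le> b" "{a..b} \<subseteq> {0<..<r\<^sup>2}" "\<And>x. x \<notin> {a..b} \<Longrightarrow> \<eta> x = 0"
    using \<eta> unfolding bump_on_def by blast
  obtain c d where cd: "c \<le> d" "\<And>x. x \<notin> {c..d} \<Longrightarrow> \<xi> x = 0"
    using \<xi> unfolding bump_on_def by blast
  define C where "C = max \<bar>c\<bar> \<bar>d\<bar>"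
  have a0: "0 < a" "b < r\<^sup>2" using ab by auto
  define K where "K = {p :: real \<times> real. 0 \<le> snd p \<and> a \<le> (fst p)\<^sup>2 + (snd p)\<^sup>2 \<and> (fst p)\<^sup>2 + (snd p)\<^sup>2 \<le> b \<and> \<bar>fst p\<bar> \<le> C * snd p}"
  have "closed K" unfolding K_def
    by (intro closed_Collect_conj closed_Collect_le continuous_intros)
  moreover have "K \<subseteq> cball 0 (sqrt b)"
  proof
    fix p assume "p \<in> K"
    then have "(fst p)\<^sup>2 + (snd p)\<^sup>2 \<le> b" by (simp add: K_def)
    then have "sqrt ((fst p)\<^sup>2 + (snd p)\<^sup>2) \<le> sqrt b" by simp
    then show "p \<in> cball 0 (sqrt b)" by (cases p) (simp add: norm_Pair)
  qed
  then have "bounded K" using bounded_cball bounded_subset by blast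
  ultimately have cK: "compact K" by (simp add: compact_eq_bounded_closed)
  have KO: "K \<subseteq> half_ball (0, 0) r"
  proof
    fix p assume p: "p \<in> K"
    have "snd p \<noteq> 0"
    proof
      assume "snd p = 0"
      then have "fst p = 0" using p by (simp add: K_def)
      then show False using p \<open>snd p = 0\<close> a0 by (simp add: K_def)
    qed
    then show "p \<in> half_ball (0, 0) r" using p a0 \<open>0 < r\<close> by (auto simp: K_def half_ball_iff)
  qed
  have z: "sector_bump \<eta> \<xi> p = 0" if "p \<notin> K" for p
  proof (cases "0 < snd p")
    case True
    show ?thesis
    proof (rule ccontr)
      assume "sector_bump \<eta> \<xi> p \<noteq> 0"
      then have "\<eta> ((fst p)\<^sup>2 + (snd p)\<^sup>2) \<noteq> 0" "\<xi> (fst p / snd p) \<noteq> 0" using True by (auto simp: sector_bump_def)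
      then have 1: "(fst p)\<^sup>2 + (snd p)\<^sup>2 \<in> {a..b}" "fst p / snd p \<in> {c..d}" using ab(3) cd(2) by auto
      then have "\<bar>fst p / snd p\<bar> \<le> C" unfolding C_def by (auto simp: abs_le_iff)
      then have "\<bar>fst p\<bar> \<le> C * snd p" using True by (simp add: divide_le_eq abs_divide)
      then show False using that 1 True by (simp add: K_def)
    qed
  qed (simp add: sector_bump_def)
  have "Ck_on k UNIV (\<lambda>p. m p * sector_bump \<eta> \<xi> p)" for k
  proof -
    let ?H = "{p :: real \<times> real. 0 < snd p}"
    have oH: "open ?H" by (rule open_upper_half)
    have k\<eta>: "Ck_on k UNIV \<eta>" "Ck_on k UNIV \<xi>" "Ck_on k ?H m"
      using \<eta> \<xi> m unfolding bump_on_def smooth_on_def by (auto intro: Ck_on_subset)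
    have "Ck_on k ?H (\<lambda>p. inverse (snd p))"
      by (rule Ck_on_compose_real[OF oH _ _ Ck_on_inverse Ck_on_snd[OF oH]]) auto
    then have "Ck_on k ?H (\<lambda>p. fst p * inverse (snd p))"
      by (rule Ck_on_mult[OF oH Ck_on_fst[OF oH]])
    then have 1: "Ck_on k ?H (\<lambda>p. \<xi> (fst p * inverse (snd p)))"
      by (rule Ck_on_compose_real[OF oH open_UNIV subset_UNIV k\<eta>(2)])
    have "Ck_on k ?H (\<lambda>p. fst p * fst p + snd p * snd p)"
      by (rule Ck_on_add[OF oH Ck_on_mult[OF oH Ck_on_fst[OF oH] Ck_on_fst[OF oH]] Ck_on_mult[OF oH Ck_on_snd[OF oH] Ck_on_snd[OF oH]]])
    then have 2: "Ck_on k ?H (\<lambda>p. \<eta> (fst p * fst p + snd p * snd p))"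
      by (rule Ck_on_compose_real[OF oH open_UNIV subset_UNIV k\<eta>(1)])
    have "Ck_on k ?H (\<lambda>p. m p * (\<eta> (fst p * fst p + snd p * snd p) * \<xi> (fst p * inverse (snd p))))"
      by (rule Ck_on_mult[OF oH k\<eta>(3) Ck_on_mult[OF oH 2 1]])
    then have H: "Ck_on k ?H (\<lambda>p. m p * sector_bump \<eta> \<xi> p)"
      by (rule Ck_on_cong[OF oH, rotated]) (simp add: sector_bump_def power2_eq_square divide_inverse)
    have oK: "open (- K)" using cK by (simp add: compact_imp_closed open_Compl)
    have "Ck_on k (- K) (\<lambda>p. m p * sector_bump \<eta> \<xi> p)"
      by (rule Ck_on_cong[OF oK _ Ck_on_const[OF oK, of k 0]]) (simp add: z)
    from Ck_on_Un[OF oH oK H this] have "Ck_on k (?H \<union> - K) (\<lambda>p. m p * sector_bump \<eta> \<xi> p)" .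
    moreover have "?H \<union> - K = UNIV" using KO by (auto simp: half_ball_iff)
    ultimately show ?thesis by simp
  qed
  then have "smooth_on UNIV (\<lambda>p. m p * sector_bump \<eta> \<xi> p)" by (simp add: smooth_on_def)
  moreover have sub: "closure {p. m p * sector_bump \<eta> \<xi> p \<noteq> 0} \<subseteq> K"
    by (rule closure_minimal) (use z cK compact_imp_closed in auto)
  have "bounded {p. m p * sector_bump \<eta> \<xi> p \<noteq> 0}"
    by (rule bounded_subset[OF compact_imp_bounded[OF cK]]) (use z in auto)
  then have "compact (closure {p. m p * sector_bump \<eta> \<xi> p \<noteq> 0})" by (simp add: compact_closure)
  ultimately show ?thesis using KO sub unfolding test_function_def by blast
qed

lemma test_function_smooth:
  assumes "test_function \<Omega> \<phi>"
  shows "\<phi> differentiable (at p)" "continuous_on UNIV \<phi>" "e \<in> Basis \<Longrightarrow> continuous_on UNIV (\<lambda>p. frechet_derivative \<phi> (at p) e)"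
proof -
  have "Ck_on k UNIV \<phi>" for k using assms by (simp add: test_function_def smooth_on_def)
  from this[of 0] this[of "Suc 0"]
  show "\<phi> differentiable (at p)" "continuous_on UNIV \<phi>" "e \<in> Basis \<Longrightarrow> continuous_on UNIV (\<lambda>p. frechet_derivative \<phi> (at p) e)"
    by (simp_all del: split_paired_All)
qed

lemma test_function_measurable:
  assumes "test_function \<Omega> \<phi>"
  shows "\<phi> \<in> borel_measurable borel" "(\<lambda>p. frechet_derivative \<phi> (at p) (1, 0)) \<in> borel_measurable borel"
    "(\<lambda>p. frechet_derivative \<phi> (at p) (0, 1)) \<in> borel_measurable borel"
  using test_function_smooth[OF assms] by (auto intro!: borel_measurable_continuous_onI simp: Basis_prod_def)

lemma sector_bump_has_derivative:
  assumes "bump_on I \<eta>" "bump_on J \<xi>" "0 < snd p"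
  shows "(sector_bump \<eta> \<xi> has_derivative (\<lambda>h. deriv \<eta> ((fst p)\<^sup>2 + (snd p)\<^sup>2) * (2 * fst p * fst h + 2 * snd p * snd h) * \<xi> (fst p / snd p)
     + \<eta> ((fst p)\<^sup>2 + (snd p)\<^sup>2) * (deriv \<xi> (fst p / snd p) * (fst h / snd p - fst p * snd h / (snd p)\<^sup>2)))) (at p)"
proof -
  have 1: "((\<lambda>p. (fst p)\<^sup>2 + (snd p)\<^sup>2) has_derivative (\<lambda>h. 2 * fst p * fst h + 2 * snd p * snd h)) (at p)"
    by (auto intro!: derivative_eq_intros)
  have 2: "((\<lambda>p. fst p / snd p) has_derivative (\<lambda>h. fst h / snd p - fst p * snd h / (snd p)\<^sup>2)) (at p)"
    using assms(3) by (auto intro!: derivative_eq_intros simp: fun_eq_iff field_simps power2_eq_square)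
  have e: "(\<eta> has_derivative (\<lambda>h. deriv \<eta> x * h)) (at x)" "(\<xi> has_derivative (\<lambda>h. deriv \<xi> x * h)) (at x)" for x
    using bump_on_has_derivative[OF assms(1)] bump_on_has_derivative[OF assms(2)] by (auto simp: has_field_derivative_def)
  have "((\<lambda>p. \<eta> ((fst p)\<^sup>2 + (snd p)\<^sup>2) * \<xi> (fst p / snd p)) has_derivative (\<lambda>h. \<eta> ((fst p)\<^sup>2 + (snd p)\<^sup>2) * (deriv \<xi> (fst p / snd p) * (fst h / snd p - fst p * snd h / (snd p)\<^sup>2))
     + deriv \<eta> ((fst p)\<^sup>2 + (snd p)\<^sup>2) * (2 * fst p * fst h + 2 * snd p * snd h) * \<xi> (fst p / snd p))) (at p)"
    by (rule has_derivative_mult[OF has_derivative_compose[OF 1 e(1)] has_derivative_compose[OF 2 e(2)]])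
  then have "((\<lambda>p. \<eta> ((fst p)\<^sup>2 + (snd p)\<^sup>2) * \<xi> (fst p / snd p)) has_derivative (\<lambda>h. deriv \<eta> ((fst p)\<^sup>2 + (snd p)\<^sup>2) * (2 * fst p * fst h + 2 * snd p * snd h) * \<xi> (fst p / snd p)
     + \<eta> ((fst p)\<^sup>2 + (snd p)\<^sup>2) * (deriv \<xi> (fst p / snd p) * (fst h / snd p - fst p * snd h / (snd p)\<^sup>2)))) (at p)"
    by (simp only: add.commute)
  then show ?thesis
    by (rule has_derivative_transform_within_open[OF _ open_upper_half]) (use assms in \<open>auto simp: sector_bump_def\<close>)
qed

lemma half_ball_measurable [measurable]: "half_ball c r \<in> sets borel"
  using open_half_ball by auto

lemma half_ball_integral:
  fixes F :: "real \<times> real \<Rightarrow> 'b::{banach, second_countable_topology}"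
  assumes r: "0 < r" and [measurable]: "F \<in> borel_measurable borel"
  shows "(LINT p:half_ball (0, 0) r|lebesgue. F p) = (\<integral>q. (indicator ({0<..<r\<^sup>2} \<times> UNIV) q * polar_jac q) *\<^sub>R F (polar_map q) \<partial>lborel)"
proof -
  have "(LINT p:half_ball (0, 0) r|lebesgue. F p) = (\<integral>p. indicator (half_ball (0, 0) r) p *\<^sub>R F p \<partial>lborel)"
    unfolding set_lebesgue_integral_def by (rule integral_completion) measurable
  also have "\<dots> = (\<integral>p. indicator {p. 0 < snd p} p *\<^sub>R (indicator (half_ball (0, 0) r) p *\<^sub>R F p) \<partial>lborel)"
    by (intro Bochner_Integration.integral_cong) (auto simp: indicator_def half_ball_iff)
  also have "\<dots> = (\<integral>q. polar_jac q *\<^sub>R (indicator (half_ball (0, 0) r) (polar_map q) *\<^sub>R F (polar_map q)) \<partial>lborel)"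
    by (rule polar_integral) measurable
  also have "\<dots> = (\<integral>q. (indicator ({0<..<r\<^sup>2} \<times> UNIV) q * polar_jac q) *\<^sub>R F (polar_map q) \<partial>lborel)"
  proof (rule Bochner_Integration.integral_cong[OF refl])
    fix q
    show "polar_jac q *\<^sub>R (indicator (half_ball (0, 0) r) (polar_map q) *\<^sub>R F (polar_map q)) = (indicator ({0<..<r\<^sup>2} \<times> UNIV) q * polar_jac q) *\<^sub>R F (polar_map q)"
      using polar_map_half_ball[OF r, of q] by (cases "0 < fst q") (auto simp: indicator_def polar_jac_def mem_Times_iff)
  qed
  finally show ?thesis .
qed

lemma half_ball_integral_eq:
  fixes F :: "real \<times> real \<Rightarrow> 'b::{banach, second_countable_topology}"
  assumes "0 < r" "F \<in> borel_measurable borel"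
    and "\<And>q. fst q \<in> {0<..<r\<^sup>2} \<Longrightarrow> polar_jac q *\<^sub>R F (polar_map q) = H q" "\<And>q. fst q \<notin> {0<..<r\<^sup>2} \<Longrightarrow> H q = 0"
  shows "(LINT p:half_ball (0, 0) r|lebesgue. F p) = (\<integral>q. H q \<partial>lborel)"
  unfolding half_ball_integral[OF assms(1,2)]
  using assms(3,4) by (intro Bochner_Integration.integral_cong refl) (auto simp: indicator_def mem_Times_iff)

section \<open>Transport of local integrability and of weak derivatives to the strip\<close>

lemma rect_integrable_continuous_mult:
  assumes f: "rect_integrable I J f" and m: "continuous_on (I \<times> J) m" and [measurable]: "m \<in> borel_measurable borel"
  shows "rect_integrable I J (\<lambda>q. m q *\<^sub>R f q)"
  unfolding rect_integrable_def
proof (intro conjI allI impI)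
  have [measurable]: "f \<in> borel_measurable borel" using f by (simp add: rect_integrable_def)
  show "(\<lambda>q. m q *\<^sub>R f q) \<in> borel_measurable borel" by measurable
  fix a b c d assume I: "{a..b} \<subseteq> I" and J: "{c..d} \<subseteq> J"
  have "compact (m ` ({a..b} \<times> {c..d}))"
    by (rule compact_continuous_image) (use I J in \<open>auto intro!: continuous_on_subset[OF m] compact_Times\<close>)
  then have "bounded (m ` ({a..b} \<times> {c..d}))" by (rule compact_imp_bounded)
  then obtain B where "\<forall>y \<in> m ` ({a..b} \<times> {c..d}). norm y \<le> B" unfolding bounded_iff by blast
  then have B: "q \<in> {a..b} \<times> {c..d} \<Longrightarrow> \<bar>m q\<bar> \<le> B" for q by (metis image_eqI real_norm_def)
  have "integrable lborel (\<lambda>q. (indicator ({a..b} \<times> {c..d}) q * m q) *\<^sub>R f q)"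
  proof (rule rect_integrable_bounded_mult[OF f I J, where B = B])
    show "\<bar>indicator ({a..b} \<times> {c..d}) q * m q\<bar> \<le> B * indicator ({a..b} \<times> {c..d}) q" for q
      using B[of q] by (cases "q \<in> {a..b} \<times> {c..d}") auto
  qed measurable
  then show "integrable lborel (\<lambda>q. indicator ({a..b} \<times> {c..d}) q *\<^sub>R (m q *\<^sub>R f q))" by simp
qed

lemma polar_map_continuous: "continuous_on ({0<..} \<times> UNIV) polar_map"
  unfolding polar_map_def by (intro continuous_intros) auto

text \<open>On a compact box \<open>polar_jac\<close> is bounded below by 1/B, so integrability with
  the Jacobian implies integrability without it; the box itself is mapped to a compact subset of the
  half disc.\<close>

lemma rect_integrable_polar:
  fixes f :: "real \<times> real \<Rightarrow> real^'d"
  assumes r: "0 < r" and [measurable]: "f \<in> borel_measurable borel" and f: "locally_integrable_on (half_ball (0, 0) r) f"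
  shows "rect_integrable {0<..<r\<^sup>2} UNIV (\<lambda>q. f (polar_map q))"
  unfolding rect_integrable_def
proof (intro conjI allI impI)
  show "(\<lambda>q. f (polar_map q)) \<in> borel_measurable borel" by measurable
  fix a b c d :: real assume I: "{a..b} \<subseteq> {0<..<r\<^sup>2}"
  let ?Q = "{a..b} \<times> {c..d}"
  define K where "K = polar_map ` ?Q"
  have pos: "0 < fst q" "fst q < r\<^sup>2" if "q \<in> ?Q" for q using that I by auto
  have "compact K" unfolding K_def
    by (rule compact_continuous_image) (use pos in \<open>auto intro!: continuous_on_subset[OF polar_map_continuous] compact_Times\<close>)
  moreover have "K \<subseteq> half_ball (0, 0) r"
    unfolding K_def using polar_map_half_ball[OF r pos(1)] pos(2) by auto
  ultimately have "set_integrable lebesgue K f" using f by (auto simp: locally_integrable_on_def)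
  have [measurable]: "K \<in> sets borel" using \<open>compact K\<close> by (rule borel_compact)
  have "integrable lborel (\<lambda>p. indicator K p *\<^sub>R f p)"
    using \<open>set_integrable lebesgue K f\<close> unfolding set_integrable_def by (subst (asm) integrable_completion) auto
  moreover have "(\<lambda>p. indicator K p *\<^sub>R f p) = (\<lambda>p. indicator {p. 0 < snd p} p *\<^sub>R (indicator K p *\<^sub>R f p))"
    using \<open>K \<subseteq> _\<close> by (auto simp: fun_eq_iff indicator_def half_ball_iff)
  ultimately have "integrable lborel (\<lambda>p. indicator {p. 0 < snd p} p *\<^sub>R (indicator K p *\<^sub>R f p))" by simp
  then have i: "integrable lborel (\<lambda>q. polar_jac q *\<^sub>R (indicator K (polar_map q) *\<^sub>R f (polar_map q)))"
    by (subst (asm) polar_integrable) auto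
  define B where "B = 2 * (1 + (max \<bar>c\<bar> \<bar>d\<bar>)\<^sup>2)"
  show "integrable lborel (\<lambda>q. indicator ?Q q *\<^sub>R f (polar_map q))"
  proof (rule Bochner_Integration.integrable_bound[OF integrable_scaleR_right[OF i, of B]])
    show "AE q in lborel. norm (indicator ?Q q *\<^sub>R f (polar_map q)) \<le> norm (B *\<^sub>R (polar_jac q *\<^sub>R (indicator K (polar_map q) *\<^sub>R f (polar_map q))))"
    proof (intro AE_I2)
      fix q
      show "norm (indicator ?Q q *\<^sub>R f (polar_map q)) \<le> norm (B *\<^sub>R (polar_jac q *\<^sub>R (indicator K (polar_map q) *\<^sub>R f (polar_map q))))"
      proof (cases "q \<in> ?Q")
        case True
        have "\<bar>snd q\<bar> \<le> max \<bar>c\<bar> \<bar>d\<bar>" using True by (auto simp: abs_le_iff)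
        then have "(snd q)\<^sup>2 \<le> (max \<bar>c\<bar> \<bar>d\<bar>)\<^sup>2" by (metis abs_ge_zero power2_abs power_mono)
        then have "1 \<le> B / (2 * (1 + (snd q)\<^sup>2))"
          unfolding B_def by (subst le_divide_eq_1_pos) (simp_all add: add_pos_nonneg)
        then have J: "1 \<le> B * polar_jac q" using pos(1)[OF True] by (simp add: polar_jac_def)
        have "polar_map q \<in> K" using True by (auto simp: K_def)
        then have "norm (B *\<^sub>R (polar_jac q *\<^sub>R (indicator K (polar_map q) *\<^sub>R f (polar_map q)))) = \<bar>B * polar_jac q\<bar> * norm (f (polar_map q))"
          by (simp add: abs_mult)
        moreover have "1 * norm (f (polar_map q)) \<le> \<bar>B * polar_jac q\<bar> * norm (f (polar_map q))"
          using J by (intro mult_right_mono) auto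
        moreover have "norm (indicator ?Q q *\<^sub>R f (polar_map q)) = norm (f (polar_map q))" using True by simp
        ultimately show ?thesis by linarith
      qed simp
    qed
  qed measurable
qed

text \<open>Chain rule for the \<sigma>-derivative of a function with gradient (g1, g2): along a ray
  dx/d\<sigma> = x / (2 \<sigma>) and dy/d\<sigma> = y / (2 \<sigma>).\<close>

definition polar_radial :: "(real \<times> real \<Rightarrow> 'b::real_vector) \<Rightarrow> (real \<times> real \<Rightarrow> 'b) \<Rightarrow> real \<times> real \<Rightarrow> 'b" where
  "polar_radial g1 g2 q = (fst (polar_map q) / (2 * fst q)) *\<^sub>R g1 (polar_map q) + (snd (polar_map q) / (2 * fst q)) *\<^sub>R g2 (polar_map q)"

text \<open>Chain rule in c at fixed \<sigma>: dx/dc = y / (1 + c^2) and dy/dc = -x / (1 +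
  c^2).\<close>

definition polar_angular :: "(real \<times> real \<Rightarrow> 'b::real_vector) \<Rightarrow> (real \<times> real \<Rightarrow> 'b) \<Rightarrow> real \<times> real \<Rightarrow> 'b" where
  "polar_angular g1 g2 q = (snd (polar_map q) / (1 + (snd q)\<^sup>2)) *\<^sub>R g1 (polar_map q) + (- fst (polar_map q) / (1 + (snd q)\<^sup>2)) *\<^sub>R g2 (polar_map q)"

lemma bump_on_divide_id:
  assumes "bump_on {0<..<S} M" shows "bump_on {0<..<S} (\<lambda>x. M x / x)"
proof -
  obtain a b where ab: "a \<le> b" "{a..b} \<subseteq> {0<..<S}" "\<And>x. x \<notin> {a..b} \<Longrightarrow> M x = 0"
    using assms unfolding bump_on_def by blast
  have "Ck_on k UNIV (\<lambda>x. M x / x)" for k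
  proof -
    have M: "Ck_on k {0<..} M" using assms unfolding bump_on_def smooth_on_def by (auto intro: Ck_on_subset)
    have "Ck_on k {0<..} (\<lambda>x. M x * inverse x)"
      by (rule Ck_on_mult[OF _ M Ck_on_subset[OF Ck_on_inverse]]) auto
    moreover have o: "open (- {a..b})" by (simp add: open_Compl)
    have "Ck_on k (- {a..b}) (\<lambda>x. M x * inverse x)"
      by (rule Ck_on_cong[OF o _ Ck_on_const[OF o, of k 0]]) (use ab(3) in simp)
    ultimately have "Ck_on k ({0<..} \<union> - {a..b}) (\<lambda>x. M x * inverse x)" using o by (intro Ck_on_Un) auto
    moreover have "{0<..} \<union> - {a..b} = UNIV" using ab by auto
    ultimately show ?thesis by (simp add: divide_inverse)
  qed
  moreover have "\<forall>x. x \<notin> {a..b} \<longrightarrow> M x / x = 0" using ab(3) by auto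
  ultimately show ?thesis using ab(1,2) unfolding bump_on_def smooth_on_def by blast
qed

lemma smooth_one_plus_sq: "smooth_on UNIV (\<lambda>x::real. 1 + x\<^sup>2)"
  unfolding smooth_on_def power2_eq_square
  by (intro allI Ck_on_add Ck_on_const Ck_on_mult Ck_on_bounded_linear open_UNIV bounded_linear_ident)

lemma polar_coords:
  assumes "0 < fst q"
  shows "(fst (polar_map q))\<^sup>2 + (snd (polar_map q))\<^sup>2 = fst q" "fst (polar_map q) / snd (polar_map q) = snd q" "0 < snd (polar_map q)"
    "fst (polar_map q) = snd q * snd (polar_map q)" "(snd (polar_map q))\<^sup>2 = fst q / (1 + (snd q)\<^sup>2)"
proof -
  show "(fst (polar_map q))\<^sup>2 + (snd (polar_map q))\<^sup>2 = fst q" "fst (polar_map q) / snd (polar_map q) = snd q"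
    using polar_inv_map[OF assms] by (auto simp: polar_inv_def prod_eq_iff)
  show "0 < snd (polar_map q)" "fst (polar_map q) = snd q * snd (polar_map q)" "(snd (polar_map q))\<^sup>2 = fst q / (1 + (snd q)\<^sup>2)"
    using assms by (auto simp: polar_map_def)
qed

lemma test_function_support:
  assumes "test_function \<Omega> \<phi>"
  obtains K where "compact K" "K \<subseteq> \<Omega>" "\<And>p. p \<notin> K \<Longrightarrow> \<phi> p = 0" "\<And>p e. p \<notin> K \<Longrightarrow> frechet_derivative \<phi> (at p) e = 0"
proof -
  obtain K where K: "K = closure {p. \<phi> p \<noteq> 0}" by blast
  have cK: "compact K" "K \<subseteq> \<Omega>" using assms by (simp_all add: test_function_def K)
  have "{p. \<phi> p \<noteq> 0} \<subseteq> K" unfolding K by (rule closure_subset)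
  then have z: "\<phi> p = 0" if "p \<notin> K" for p using that by auto
  have d: "frechet_derivative \<phi> (at p) e = 0" if "p \<notin> K" for p e
  proof -
    have "((\<lambda>_ :: real \<times> real. 0 :: real) has_derivative (\<lambda>_. 0)) (at p)" by (rule has_derivative_const)
    then have "(\<phi> has_derivative (\<lambda>_. 0)) (at p)"
      by (rule has_derivative_transform_within_open[OF _ open_Compl[OF compact_imp_closed[OF cK(1)]]]) (simp_all add: that z)
    from frechet_derivative_at[OF this] show ?thesis by metis
  qed
  from that[OF cK z d] show thesis by blast
qed

lemma locally_integrable_continuous_mult:
  fixes f :: "real \<times> real \<Rightarrow> real^'d"
  assumes f: "locally_integrable_on \<Omega> f" and K: "compact K" "K \<subseteq> \<Omega>"
    and h: "continuous_on UNIV h" "\<And>p. p \<notin> K \<Longrightarrow> h p = 0"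
  shows "set_integrable lebesgue \<Omega> (\<lambda>p. h p *\<^sub>R f p)"
proof -
  have i: "integrable lebesgue (\<lambda>p. indicator K p *\<^sub>R f p)"
    using f K by (auto simp: locally_integrable_on_def set_integrable_def)
  have "bounded (h ` K)" using K h by (intro compact_imp_bounded compact_continuous_image) (auto intro: continuous_on_subset)
  then obtain B where "\<forall>y \<in> h ` K. norm y \<le> B" unfolding bounded_iff by blast
  then have B: "\<bar>h p\<bar> \<le> B" if "p \<in> K" for p using that by auto
  have hm: "h \<in> borel_measurable lebesgue" using h(1) by (intro measurable_completion) (auto intro: borel_measurable_continuous_onI)
  have "integrable lebesgue (\<lambda>p. h p *\<^sub>R (indicator K p *\<^sub>R f p))"
  proof (rule Bochner_Integration.integrable_bound[OF integrable_scaleR_right[OF i, of B]])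
    show "(\<lambda>p. h p *\<^sub>R (indicator K p *\<^sub>R f p)) \<in> borel_measurable lebesgue"
      using hm borel_measurable_integrable[OF i] by (rule borel_measurable_scaleR)
    show "AE p in lebesgue. norm (h p *\<^sub>R (indicator K p *\<^sub>R f p)) \<le> norm (B *\<^sub>R (indicator K p *\<^sub>R f p))"
    proof (intro AE_I2)
      fix p
      show "norm (h p *\<^sub>R (indicator K p *\<^sub>R f p)) \<le> norm (B *\<^sub>R (indicator K p *\<^sub>R f p))"
        using order_trans[OF B abs_ge_self, of p] by (cases "p \<in> K") (auto intro!: mult_right_mono)
    qed
  qed
  also have "(\<lambda>p. h p *\<^sub>R (indicator K p *\<^sub>R f p)) = (\<lambda>p. indicator \<Omega> p *\<^sub>R (h p *\<^sub>R f p))"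
    using K(2) h(2) by (auto simp: fun_eq_iff indicator_def)
  finally show ?thesis by (simp add: set_integrable_def)
qed

lemma test_function_integrable:
  fixes f :: "real \<times> real \<Rightarrow> real^'d"
  assumes f: "locally_integrable_on \<Omega> f" and t: "test_function \<Omega> \<phi>"
  shows "set_integrable lebesgue \<Omega> (\<lambda>p. \<phi> p *\<^sub>R f p)"
    and "e \<in> Basis \<Longrightarrow> set_integrable lebesgue \<Omega> (\<lambda>p. frechet_derivative \<phi> (at p) e *\<^sub>R f p)"
proof -
  obtain K where K: "compact K" "K \<subseteq> \<Omega>" "\<And>p. p \<notin> K \<Longrightarrow> \<phi> p = 0" "\<And>p e. p \<notin> K \<Longrightarrow> frechet_derivative \<phi> (at p) e = 0"
    using test_function_support[OF t] by metis
  show "set_integrable lebesgue \<Omega> (\<lambda>p. \<phi> p *\<^sub>R f p)"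
    by (rule locally_integrable_continuous_mult[OF f K(1,2) test_function_smooth(2)[OF t] K(3)])
  show "set_integrable lebesgue \<Omega> (\<lambda>p. frechet_derivative \<phi> (at p) e *\<^sub>R f p)" if "e \<in> Basis"
    by (rule locally_integrable_continuous_mult[OF f K(1,2) test_function_smooth(3)[OF t that] K(4)])
qed

text \<open>Testing with a vector field through its divergence lets the rotational and the radial
  field isolate one coordinate derivative each.\<close>

lemma weak_grad_divergence:
  assumes wg: "is_weak_grad \<Omega> v g1 g2" and t: "test_function \<Omega> \<phi>" "test_function \<Omega> \<psi>"
  shows "(LINT p:\<Omega>|lebesgue. (frechet_derivative \<phi> (at p) (1, 0) + frechet_derivative \<psi> (at p) (0, 1)) *\<^sub>R v p)
    = - (LINT p:\<Omega>|lebesgue. (\<phi> p *\<^sub>R g1 p + \<psi> p *\<^sub>R g2 p))"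
proof -
  have l: "locally_integrable_on \<Omega> v" "locally_integrable_on \<Omega> g1" "locally_integrable_on \<Omega> g2"
    using wg by (auto simp: is_weak_grad_def)
  have B: "(1, 0) \<in> (Basis :: (real \<times> real) set)" "(0, 1) \<in> (Basis :: (real \<times> real) set)" by (auto simp: Basis_prod_def)
  show ?thesis
    unfolding scaleR_add_left
    using wg t
    by (subst set_integral_add[OF test_function_integrable(2)[OF l(1) t(1) B(1)] test_function_integrable(2)[OF l(1) t(2) B(2)]],
        subst set_integral_add[OF test_function_integrable(1)[OF l(2) t(1)] test_function_integrable(1)[OF l(3) t(2)]])
       (simp add: is_weak_grad_def)
qed

lemma smooth_fst_snd: "smooth_on UNIV (fst :: real \<times> real \<Rightarrow> real)" "smooth_on UNIV (snd :: real \<times> real \<Rightarrow> real)"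
  "smooth_on UNIV (\<lambda>p :: real \<times> real. - fst p)" "smooth_on UNIV (\<lambda>p :: real \<times> real. 1 :: real)"
  unfolding smooth_on_def
  by (auto intro: Ck_on_fst Ck_on_snd Ck_on_const Ck_on_bounded_linear bounded_linear_minus bounded_linear_fst)

lemma sector_bump_measurable:
  assumes "bump_on I \<eta>" "bump_on J \<xi>" shows "sector_bump \<eta> \<xi> \<in> borel_measurable borel"
proof -
  have [measurable]: "\<eta> \<in> borel_measurable borel" "\<xi> \<in> borel_measurable borel"
    using assms bump_on_measurable by auto
  show ?thesis unfolding sector_bump_def[abs_def] by measurable
qed

lemma polar_jac_mult:
  assumes "0 < fst q"
  shows "polar_jac q * (X * (1 + (snd q)\<^sup>2)) = X / 2" "polar_jac q * (X * ((1 + (snd q)\<^sup>2) * Y)) = X * Y / 2"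
    "polar_jac q * (X * (Y * ((1 + (snd q)\<^sup>2) * Z))) = X * Y * Z / 2"
proof -
  have J: "polar_jac q * (1 + (snd q)\<^sup>2) = 1 / 2"
    using assms by (simp add: polar_jac_def del: distrib_left_numeral)
  have "polar_jac q * (X * (1 + (snd q)\<^sup>2)) = X * (polar_jac q * (1 + (snd q)\<^sup>2))"
    "polar_jac q * (X * ((1 + (snd q)\<^sup>2) * Y)) = X * Y * (polar_jac q * (1 + (snd q)\<^sup>2))"
    "polar_jac q * (X * (Y * ((1 + (snd q)\<^sup>2) * Z))) = X * Y * Z * (polar_jac q * (1 + (snd q)\<^sup>2))"
    by (simp_all only: mult_ac)
  then show "polar_jac q * (X * (1 + (snd q)\<^sup>2)) = X / 2" "polar_jac q * (X * ((1 + (snd q)\<^sup>2) * Y)) = X * Y / 2"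
    "polar_jac q * (X * (Y * ((1 + (snd q)\<^sup>2) * Z))) = X * Y * Z / 2"
    unfolding J by simp_all
qed

lemma sector_bump_polar: "0 < fst q \<Longrightarrow> sector_bump \<eta> \<xi> (polar_map q) = \<eta> (fst q) * \<xi> (snd q)"
  unfolding sector_bump_def using polar_coords(1-3)[of q] by (simp only: if_True)

context
  fixes r :: real and v g1 g2 :: "real \<times> real \<Rightarrow> real^'d"
  assumes r: "0 < r" and wg: "is_weak_grad (half_ball (0, 0) r) v g1 g2"
    and mv [measurable]: "v \<in> borel_measurable borel"
    and mg1 [measurable]: "g1 \<in> borel_measurable borel" and mg2 [measurable]: "g2 \<in> borel_measurable borel"
begin

lemma polar_rect_integrable:
  shows "rect_integrable {0<..<r\<^sup>2} UNIV (\<lambda>q. v (polar_map q))"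
    and "rect_integrable {0<..<r\<^sup>2} UNIV (polar_radial g1 g2)"
    and "rect_integrable {0<..<r\<^sup>2} UNIV (polar_angular g1 g2)"
proof -
  have c: "continuous_on ({0<..<r\<^sup>2} \<times> UNIV) polar_map"
    by (rule continuous_on_subset[OF polar_map_continuous]) auto
  have l: "locally_integrable_on (half_ball (0, 0) r) v" "locally_integrable_on (half_ball (0, 0) r) g1" "locally_integrable_on (half_ball (0, 0) r) g2"
    using wg by (auto simp: is_weak_grad_def)
  show "rect_integrable {0<..<r\<^sup>2} UNIV (\<lambda>q. v (polar_map q))" by (rule rect_integrable_polar[OF r mv l(1)])
  note g = rect_integrable_polar[OF r mg1 l(2)] rect_integrable_polar[OF r mg2 l(3)]
  show "rect_integrable {0<..<r\<^sup>2} UNIV (polar_radial g1 g2)"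
    unfolding polar_radial_def[abs_def]
  proof (intro rect_integrable_add rect_integrable_continuous_mult g)
    show "continuous_on ({0<..<r\<^sup>2} \<times> UNIV) (\<lambda>q. fst (polar_map q) / (2 * fst q))"
      "continuous_on ({0<..<r\<^sup>2} \<times> UNIV) (\<lambda>q. snd (polar_map q) / (2 * fst q))"
      using c by (auto intro!: continuous_intros)
  qed measurable
  show "rect_integrable {0<..<r\<^sup>2} UNIV (polar_angular g1 g2)"
    unfolding polar_angular_def[abs_def]
  proof (intro rect_integrable_add rect_integrable_continuous_mult g)
    show "continuous_on ({0<..<r\<^sup>2} \<times> UNIV) (\<lambda>q. snd (polar_map q) / (1 + (snd q)\<^sup>2))"
      "continuous_on ({0<..<r\<^sup>2} \<times> UNIV) (\<lambda>q. - fst (polar_map q) / (1 + (snd q)\<^sup>2))"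
      using c by (auto intro!: continuous_intros)
  qed measurable
qed

text \<open>The field is (y, -x) times \<eta>(\<sigma>) \<xi>(c). Rotation is divergence free,
  annihilates \<sigma> and sends c = x/y to 1 + c^2, so the divergence is \<eta> \<xi>' (1 + c^2);
  the last factor cancels against the Jacobian up to the constant 1/2.\<close>

lemma polar_weak_angular:
  assumes \<eta>: "bump_on {0<..<r\<^sup>2} \<eta>" and \<xi>: "bump_on UNIV \<xi>"
  shows "(\<integral>q. (\<eta> (fst q) * deriv \<xi> (snd q)) *\<^sub>R v (polar_map q) \<partial>lborel) = - (\<integral>q. (\<eta> (fst q) * \<xi> (snd q)) *\<^sub>R polar_angular g1 g2 q \<partial>lborel)"
proof -
  let ?f = "sector_bump \<eta> \<xi>"
  let ?\<phi> = "\<lambda>p. snd p * ?f p" and ?\<psi> = "\<lambda>p. (- fst p) * ?f p"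
  have t: "test_function (half_ball (0, 0) r) ?\<phi>" "test_function (half_ball (0, 0) r) ?\<psi>"
    by (rule sector_bump_test_function[OF r \<eta> \<xi> smooth_fst_snd(2)], rule sector_bump_test_function[OF r \<eta> \<xi> smooth_fst_snd(3)])
  have [measurable]: "(\<lambda>p. frechet_derivative ?\<phi> (at p) (1, 0)) \<in> borel_measurable borel"
    "(\<lambda>p. frechet_derivative ?\<psi> (at p) (0, 1)) \<in> borel_measurable borel" "?f \<in> borel_measurable borel"
    using test_function_measurable[OF t(1)] test_function_measurable[OF t(2)] sector_bump_measurable[OF \<eta> \<xi>] by auto
  have D: "frechet_derivative ?\<phi> (at p) (1, 0) + frechet_derivative ?\<psi> (at p) (0, 1)
     = \<eta> ((fst p)\<^sup>2 + (snd p)\<^sup>2) * deriv \<xi> (fst p / snd p) * (1 + (fst p / snd p)\<^sup>2)" if p: "0 < snd p" for p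
  proof -
    note d = sector_bump_has_derivative[OF \<eta> \<xi> p]
    have 1: "(snd has_derivative snd) (at p)" "((\<lambda>p. - fst p) has_derivative (\<lambda>h. - fst h)) (at p)"
      by (auto intro!: derivative_eq_intros)
    show ?thesis using p
      unfolding frechet_derivative_at[OF has_derivative_mult[OF 1(1) d], symmetric] frechet_derivative_at[OF has_derivative_mult[OF 1(2) d], symmetric]
      by (simp add: power2_eq_square field_simps)
  qed
  have z: "\<eta> (fst q) = 0" if "fst q \<notin> {0<..<r\<^sup>2}" for q :: "real \<times> real" using \<eta> that unfolding bump_on_def by blast
  have "(LINT p:half_ball (0, 0) r|lebesgue. (frechet_derivative ?\<phi> (at p) (1, 0) + frechet_derivative ?\<psi> (at p) (0, 1)) *\<^sub>R v p)
    = (\<integral>q. (1/2) *\<^sub>R ((\<eta> (fst q) * deriv \<xi> (snd q)) *\<^sub>R v (polar_map q)) \<partial>lborel)"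
  proof (rule half_ball_integral_eq[OF r])
    fix q :: "real \<times> real" assume "fst q \<in> {0<..<r\<^sup>2}"
    then have q: "0 < fst q" by simp
    show "polar_jac q *\<^sub>R ((frechet_derivative ?\<phi> (at (polar_map q)) (1, 0) + frechet_derivative ?\<psi> (at (polar_map q)) (0, 1)) *\<^sub>R v (polar_map q))
      = (1/2) *\<^sub>R ((\<eta> (fst q) * deriv \<xi> (snd q)) *\<^sub>R v (polar_map q))"
      unfolding D[OF polar_coords(3)[OF q]] polar_coords(1,2)[OF q] by (simp add: polar_jac_mult[OF q])
  qed (measurable, simp add: z)
  then have L: "(LINT p:half_ball (0, 0) r|lebesgue. (frechet_derivative ?\<phi> (at p) (1, 0) + frechet_derivative ?\<psi> (at p) (0, 1)) *\<^sub>R v p)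
    = (1/2) *\<^sub>R (\<integral>q. (\<eta> (fst q) * deriv \<xi> (snd q)) *\<^sub>R v (polar_map q) \<partial>lborel)" by (simp only: integral_scaleR_right)
  have "(LINT p:half_ball (0, 0) r|lebesgue. (?\<phi> p *\<^sub>R g1 p + ?\<psi> p *\<^sub>R g2 p)) = (\<integral>q. (1/2) *\<^sub>R ((\<eta> (fst q) * \<xi> (snd q)) *\<^sub>R polar_angular g1 g2 q) \<partial>lborel)"
  proof (rule half_ball_integral_eq[OF r])
    fix q :: "real \<times> real" assume "fst q \<in> {0<..<r\<^sup>2}"
    then have q: "0 < fst q" by simp
    show "polar_jac q *\<^sub>R (?\<phi> (polar_map q) *\<^sub>R g1 (polar_map q) + ?\<psi> (polar_map q) *\<^sub>R g2 (polar_map q)) = (1/2) *\<^sub>R ((\<eta> (fst q) * \<xi> (snd q)) *\<^sub>R polar_angular g1 g2 q)"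
      unfolding sector_bump_polar[OF q] polar_angular_def using q
      by (simp add: polar_jac_def scaleR_add_right scaleR_diff_right mult_ac)
  qed (measurable, simp add: z)
  then have R: "(LINT p:half_ball (0, 0) r|lebesgue. (?\<phi> p *\<^sub>R g1 p + ?\<psi> p *\<^sub>R g2 p))
    = (1/2) *\<^sub>R (\<integral>q. (\<eta> (fst q) * \<xi> (snd q)) *\<^sub>R polar_angular g1 g2 q \<partial>lborel)" by (simp only: integral_scaleR_right)
  from weak_grad_divergence[OF wg t] show ?thesis unfolding L R
    by (metis (no_types, lifting) divide_eq_0_iff one_neq_zero scaleR_cancel_left scaleR_minus_right zero_neq_numeral)
qed

text \<open>The field is (x, y) times \<eta>(\<sigma>) \<xi>(c). It annihilates c and sends \<sigma>
  to 2 \<sigma>, so its divergence is 2 (\<eta> + \<sigma> \<eta>') \<xi> = 2 (\<sigma> \<eta>)'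
  \<xi>.\<close>

lemma polar_weak_radial:
  assumes M: "bump_on {0<..<r\<^sup>2} M" and \<Xi>: "bump_on UNIV \<Xi>"
  shows "(\<integral>q. (deriv M (fst q) * \<Xi> (snd q)) *\<^sub>R v (polar_map q) \<partial>lborel) = - (\<integral>q. (M (fst q) * \<Xi> (snd q)) *\<^sub>R polar_radial g1 g2 q \<partial>lborel)"
proof -
  \<comment> \<open>Dividing by \<sigma> makes (\<sigma> \<eta>)' equal to M', and the factor 1 +
    c^2 in \<xi> compensates the Jacobian 1 / (2 (1 + c^2)).\<close>
  define \<eta> where "\<eta> x = M x / x" for x
  define \<xi> where "\<xi> x = (1 + x\<^sup>2) * \<Xi> x" for x
  have \<eta>: "bump_on {0<..<r\<^sup>2} \<eta>" unfolding \<eta>_def[abs_def] by (rule bump_on_divide_id[OF M])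
  have \<xi>: "bump_on UNIV \<xi>" unfolding \<xi>_def[abs_def] by (rule bump_on_mult_smooth[OF \<Xi> smooth_one_plus_sq])
  have dM: "deriv M x = \<eta> x + x * deriv \<eta> x" if "0 < x" for x
  proof -
    have "((\<lambda>x. x * \<eta> x) has_real_derivative (x * deriv \<eta> x + 1 * \<eta> x)) (at x)"
      by (rule DERIV_mult'[OF DERIV_ident bump_on_has_derivative[OF \<eta>]])
    then have "(M has_real_derivative (x * deriv \<eta> x + 1 * \<eta> x)) (at x)"
      by (rule has_field_derivative_transform_within_open[where S = "{0<..}"]) (use that in \<open>auto simp: \<eta>_def\<close>)
    then show ?thesis using DERIV_imp_deriv by fastforce
  qed
  let ?f = "sector_bump \<eta> \<xi>"
  let ?\<phi> = "\<lambda>p. fst p * ?f p" and ?\<psi> = "\<lambda>p. snd p * ?f p"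
  have t: "test_function (half_ball (0, 0) r) ?\<phi>" "test_function (half_ball (0, 0) r) ?\<psi>"
    by (rule sector_bump_test_function[OF r \<eta> \<xi> smooth_fst_snd(1)], rule sector_bump_test_function[OF r \<eta> \<xi> smooth_fst_snd(2)])
  have [measurable]: "(\<lambda>p. frechet_derivative ?\<phi> (at p) (1, 0)) \<in> borel_measurable borel"
    "(\<lambda>p. frechet_derivative ?\<psi> (at p) (0, 1)) \<in> borel_measurable borel" "?f \<in> borel_measurable borel"
    using test_function_measurable[OF t(1)] test_function_measurable[OF t(2)] sector_bump_measurable[OF \<eta> \<xi>] by auto
  have D: "frechet_derivative ?\<phi> (at p) (1, 0) + frechet_derivative ?\<psi> (at p) (0, 1)
     = 2 * deriv M ((fst p)\<^sup>2 + (snd p)\<^sup>2) * \<xi> (fst p / snd p)" if p: "0 < snd p" for p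
  proof -
    note d = sector_bump_has_derivative[OF \<eta> \<xi> p]
    have 1: "(snd has_derivative snd) (at p)" "(fst has_derivative fst) (at p)"
      by (auto intro!: derivative_eq_intros)
    have s: "0 < (fst p)\<^sup>2 + (snd p)\<^sup>2" using p by (simp add: add_nonneg_pos)
    have f: "?f p = \<eta> ((fst p)\<^sup>2 + (snd p)\<^sup>2) * \<xi> (fst p / snd p)" using p by (simp add: sector_bump_def)
    show ?thesis using p
      unfolding frechet_derivative_at[OF has_derivative_mult[OF 1(2) d], symmetric] frechet_derivative_at[OF has_derivative_mult[OF 1(1) d], symmetric] dM[OF s]
      by (simp add: f power2_eq_square field_simps)
  qed
  have z: "M (fst q) = 0" "deriv M (fst q) = 0" if "fst q \<notin> {0<..<r\<^sup>2}" for q :: "real \<times> real"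
    using M bump_on_deriv[OF M] that unfolding bump_on_def by blast+
  have L: "(LINT p:half_ball (0, 0) r|lebesgue. (frechet_derivative ?\<phi> (at p) (1, 0) + frechet_derivative ?\<psi> (at p) (0, 1)) *\<^sub>R v p)
    = (\<integral>q. (deriv M (fst q) * \<Xi> (snd q)) *\<^sub>R v (polar_map q) \<partial>lborel)"
  proof (rule half_ball_integral_eq[OF r])
    fix q :: "real \<times> real" assume "fst q \<in> {0<..<r\<^sup>2}"
    then have q: "0 < fst q" by simp
    show "polar_jac q *\<^sub>R ((frechet_derivative ?\<phi> (at (polar_map q)) (1, 0) + frechet_derivative ?\<psi> (at (polar_map q)) (0, 1)) *\<^sub>R v (polar_map q))
      = (deriv M (fst q) * \<Xi> (snd q)) *\<^sub>R v (polar_map q)"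
      unfolding D[OF polar_coords(3)[OF q]] polar_coords(1,2)[OF q] by (simp add: \<xi>_def polar_jac_mult[OF q])
  qed (measurable, simp add: z)
  have R: "(LINT p:half_ball (0, 0) r|lebesgue. (?\<phi> p *\<^sub>R g1 p + ?\<psi> p *\<^sub>R g2 p)) = (\<integral>q. (M (fst q) * \<Xi> (snd q)) *\<^sub>R polar_radial g1 g2 q \<partial>lborel)"
  proof (rule half_ball_integral_eq[OF r])
    fix q :: "real \<times> real" assume "fst q \<in> {0<..<r\<^sup>2}"
    then have q: "0 < fst q" by simp
    have e: "polar_jac q * (z * (M (fst q) / fst q * ((1 + (snd q)\<^sup>2) * \<Xi> (snd q)))) = M (fst q) * \<Xi> (snd q) * (z / (2 * fst q))" for z
      unfolding polar_jac_mult(3)[OF q] by (simp add: mult_ac)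
    show "polar_jac q *\<^sub>R (?\<phi> (polar_map q) *\<^sub>R g1 (polar_map q) + ?\<psi> (polar_map q) *\<^sub>R g2 (polar_map q)) = (M (fst q) * \<Xi> (snd q)) *\<^sub>R polar_radial g1 g2 q"
      unfolding sector_bump_polar[OF q] polar_radial_def \<eta>_def \<xi>_def scaleR_add_right scaleR_scaleR e ..
  qed (measurable, simp add: z)
  from weak_grad_divergence[OF wg t] show ?thesis unfolding L R .
qed

lemma polar_ac_angular:
  "\<exists>k. k \<in> borel_measurable borel \<and> (AE q in lborel. q \<in> {0<..<r\<^sup>2} \<times> UNIV \<longrightarrow>
     v (polar_map q) = k (fst q) + signed_integral 0 (snd q) (\<lambda>t. polar_angular g1 g2 (fst q, t)))"
  by (rule du_Bois_Reymond_snd[OF _ open_UNIV is_interval_univ UNIV_I polar_rect_integrable(1,3) polar_weak_angular]) auto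

lemma polar_ac_radial:
  "j \<in> {0<..<r\<^sup>2} \<Longrightarrow> \<exists>k. k \<in> borel_measurable borel \<and> (AE q in lborel. q \<in> {0<..<r\<^sup>2} \<times> UNIV \<longrightarrow>
     v (polar_map q) = k (snd q) + signed_integral j (fst q) (\<lambda>t. polar_radial g1 g2 (t, snd q)))"
  by (rule du_Bois_Reymond_fst[OF _ _ _ open_UNIV polar_rect_integrable(1,2) polar_weak_radial])
     (auto simp: is_interval_oo)

end

text \<open>The radial and rotational directions are orthogonal: the squared norms of x g1 + y g2
  and y g1 - x g2 add up to \<sigma> (|g1|^2 + |g2|^2). The coefficients come from the
  normalisations in \<open>polar_radial\<close> and \<open>polar_angular\<close>.\<close>

lemma polar_gradient_norm:
  fixes g1 g2 :: "real \<times> real \<Rightarrow> 'b::real_inner"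
  assumes q: "0 < fst q"
  shows "(norm (g1 (polar_map q)))\<^sup>2 + (norm (g2 (polar_map q)))\<^sup>2
    = 4 * fst q * (norm (polar_radial g1 g2 q))\<^sup>2 + (1 + (snd q)\<^sup>2)\<^sup>2 * (norm (polar_angular g1 g2 q))\<^sup>2 / fst q"
proof -
  define x y \<sigma> a b where d: "x = fst (polar_map q)" "y = snd (polar_map q)" "\<sigma> = fst q" "a = g1 (polar_map q)" "b = g2 (polar_map q)"
  have s: "\<sigma> = x\<^sup>2 + y\<^sup>2" "\<sigma> > 0" using polar_coords(1)[OF q] q by (auto simp: d)
  have R: "polar_radial g1 g2 q = (1 / (2 * \<sigma>)) *\<^sub>R (x *\<^sub>R a + y *\<^sub>R b)"
    by (simp add: polar_radial_def d scaleR_add_right)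
  have A: "polar_angular g1 g2 q = (1 / (1 + (snd q)\<^sup>2)) *\<^sub>R (y *\<^sub>R a - x *\<^sub>R b)"
    by (simp add: polar_angular_def d scaleR_diff_right)
  have "4 * \<sigma> * (norm (polar_radial g1 g2 q))\<^sup>2 = (norm (x *\<^sub>R a + y *\<^sub>R b))\<^sup>2 / \<sigma>"
    unfolding R norm_scaleR power_mult_distrib power2_abs using s(2) by (simp add: power2_eq_square)
  moreover have "(1 + (snd q)\<^sup>2)\<^sup>2 * (norm (polar_angular g1 g2 q))\<^sup>2 / \<sigma> = (norm (y *\<^sub>R a - x *\<^sub>R b))\<^sup>2 / \<sigma>"
    unfolding A norm_scaleR power_mult_distrib power2_abs by (simp add: power_divide)
  moreover have "(norm (x *\<^sub>R a + y *\<^sub>R b))\<^sup>2 + (norm (y *\<^sub>R a - x *\<^sub>R b))\<^sup>2 = \<sigma> * ((norm a)\<^sup>2 + (norm b)\<^sup>2)"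
    unfolding s(1) power2_norm_eq_inner
    by (simp add: inner_add_left inner_add_right inner_diff_left inner_diff_right inner_commute power2_eq_square algebra_simps)
  ultimately show ?thesis using s(2) by (simp add: d add_divide_distrib[symmetric])
qed

text \<open>\<open>energy_s\<close> uses a weak gradient selected by choice; this lemma makes the
  energy independent of that selection. It is the fundamental lemma on the strip, carried back by
  \<open>polar_inv\<close>.\<close>

lemma weak_grad_unique:
  fixes v g1 g2 h1 h2 :: "real \<times> real \<Rightarrow> real^'d"
  assumes r: "0 < r" and g: "is_weak_grad (half_ball (0, 0) r) v g1 g2" and h: "is_weak_grad (half_ball (0, 0) r) v h1 h2"
    and [measurable]: "g1 \<in> borel_measurable borel" "g2 \<in> borel_measurable borel" "h1 \<in> borel_measurable borel" "h2 \<in> borel_measurable borel"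
  shows "AE p in lborel. p \<in> half_ball (0, 0) r \<longrightarrow> g1 p = h1 p \<and> g2 p = h2 p"
proof -
  have main: "AE p in lborel. p \<in> half_ball (0, 0) r \<longrightarrow> a p = b p"
    if [measurable]: "a \<in> borel_measurable borel" "b \<in> borel_measurable borel"
      and l: "locally_integrable_on (half_ball (0, 0) r) a" "locally_integrable_on (half_ball (0, 0) r) b"
      and e: "\<And>\<phi>. test_function (half_ball (0, 0) r) \<phi> \<Longrightarrow> (LINT p:half_ball (0, 0) r|lebesgue. \<phi> p *\<^sub>R a p) = (LINT p:half_ball (0, 0) r|lebesgue. \<phi> p *\<^sub>R b p)"
    for a b :: "real \<times> real \<Rightarrow> real^'d"
  proof -
    have "AE q in lborel. q \<in> {0<..<r\<^sup>2} \<times> UNIV \<longrightarrow> a (polar_map q) - b (polar_map q) = 0"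
    proof (rule fundamental_lemma_rect)
      have ra: "rect_integrable {0<..<r\<^sup>2} UNIV (\<lambda>q. a (polar_map q))" "rect_integrable {0<..<r\<^sup>2} UNIV (\<lambda>q. b (polar_map q))"
        by (intro rect_integrable_polar r l, measurable)+
      then show "rect_integrable {0<..<r\<^sup>2} UNIV (\<lambda>q. a (polar_map q) - b (polar_map q))"
        by (rule rect_integrable_add)
      fix \<eta> \<xi> assume \<eta>: "bump_on {0<..<r\<^sup>2} \<eta>" and \<xi>: "bump_on UNIV \<xi>"
      \<comment> \<open>The factor 2 (1 + c^2) cancels \<open>polar_jac\<close>, so that in the
        strip the pairing is with the plain product of \<eta> and \<xi>.\<close>
      define \<xi>' where "\<xi>' x = (1 + x\<^sup>2) * (2 * \<xi> x)" for x
      have \<xi>': "bump_on UNIV \<xi>'" unfolding \<xi>'_def[abs_def] by (intro bump_on_mult_smooth bump_on_cmult \<xi> smooth_one_plus_sq)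
      have t: "test_function (half_ball (0, 0) r) (\<lambda>p. 1 * sector_bump \<eta> \<xi>' p)"
        by (rule sector_bump_test_function[OF r \<eta> \<xi>' smooth_fst_snd(4)])
      have [measurable]: "sector_bump \<eta> \<xi>' \<in> borel_measurable borel" by (rule sector_bump_measurable[OF \<eta> \<xi>'])
      have I: "(LINT p:half_ball (0, 0) r|lebesgue. (1 * sector_bump \<eta> \<xi>' p) *\<^sub>R f p) = (\<integral>q. (\<eta> (fst q) * \<xi> (snd q)) *\<^sub>R f (polar_map q) \<partial>lborel)"
        if [measurable]: "f \<in> borel_measurable borel" for f :: "real \<times> real \<Rightarrow> real^'d"
      proof (rule half_ball_integral_eq[OF r])
        fix q :: "real \<times> real" assume "fst q \<in> {0<..<r\<^sup>2}"
        then have q: "0 < fst q" by simp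
        show "polar_jac q *\<^sub>R ((1 * sector_bump \<eta> \<xi>' (polar_map q)) *\<^sub>R f (polar_map q)) = (\<eta> (fst q) * \<xi> (snd q)) *\<^sub>R f (polar_map q)"
          unfolding sector_bump_polar[OF q] by (simp add: \<xi>'_def polar_jac_mult[OF q])
      next
        fix q :: "real \<times> real" assume "fst q \<notin> {0<..<r\<^sup>2}"
        then have "\<eta> (fst q) = 0" using \<eta> unfolding bump_on_def by blast
        then show "(\<eta> (fst q) * \<xi> (snd q)) *\<^sub>R f (polar_map q) = 0" by simp
      qed measurable
      have "(\<integral>q. (\<eta> (fst q) * \<xi> (snd q)) *\<^sub>R (a (polar_map q) - b (polar_map q)) \<partial>lborel)
        = (\<integral>q. (\<eta> (fst q) * \<xi> (snd q)) *\<^sub>R a (polar_map q) \<partial>lborel) - (\<integral>q. (\<eta> (fst q) * \<xi> (snd q)) *\<^sub>R b (polar_map q) \<partial>lborel)"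
        unfolding scaleR_diff_right
        by (rule Bochner_Integration.integral_diff[OF rect_integrable_bump_mult[OF ra(1) \<eta> \<xi>] rect_integrable_bump_mult[OF ra(2) \<eta> \<xi>]])
      also have "\<dots> = 0" using e[OF t] I[of a] I[of b] by simp
      finally show "(\<integral>q. (\<eta> (fst q) * \<xi> (snd q)) *\<^sub>R (a (polar_map q) - b (polar_map q)) \<partial>lborel) = 0" .
    qed auto
    then have "AE q in lborel. 0 < fst q \<longrightarrow> (fst q < r\<^sup>2 \<longrightarrow> a (polar_map q) = b (polar_map q))"
      by eventually_elim (auto simp: mem_Times_iff)
    from polar_AE_pushforward[OF this] show ?thesis
      by eventually_elim (auto simp: half_ball_iff polar_map_inv polar_inv_def dest: polar_map_inv)
  qed
  have "AE p in lborel. p \<in> half_ball (0, 0) r \<longrightarrow> g1 p = h1 p"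
    by (rule main) (use g h in \<open>auto simp: is_weak_grad_def\<close>)
  moreover have "AE p in lborel. p \<in> half_ball (0, 0) r \<longrightarrow> g2 p = h2 p"
    by (rule main) (use g h in \<open>auto simp: is_weak_grad_def\<close>)
  ultimately show ?thesis by eventually_elim auto
qed

text \<open>\<open>energy_s\<close> on a smaller half disc selects its own weak gradient there, so
  the restriction has to be recognised as one. Test functions of the subset are test functions of
  the whole set, and all integrals live on their supports.\<close>

lemma is_weak_grad_subset:
  assumes "is_weak_grad \<Omega> v g1 g2" "\<Omega>' \<subseteq> \<Omega>"
  shows "is_weak_grad \<Omega>' v g1 g2"
  unfolding is_weak_grad_def
proof (intro conjI allI impI)
  show "locally_integrable_on \<Omega>' v" "locally_integrable_on \<Omega>' g1" "locally_integrable_on \<Omega>' g2"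
    using assms unfolding is_weak_grad_def locally_integrable_on_def by (meson subset_trans)+
  fix \<phi> assume t: "test_function \<Omega>' \<phi>"
  then have t': "test_function \<Omega> \<phi>" using assms(2) by (auto simp: test_function_def)
  obtain K where K: "compact K" "K \<subseteq> \<Omega>'" "\<And>p. p \<notin> K \<Longrightarrow> \<phi> p = 0" "\<And>p e. p \<notin> K \<Longrightarrow> frechet_derivative \<phi> (at p) e = 0"
    using test_function_support[OF t] by metis
  have e: "(LINT p:\<Omega>'|lebesgue. (h p *\<^sub>R f p)) = (LINT p:\<Omega>|lebesgue. (h p *\<^sub>R f p))" if "\<And>p. p \<notin> K \<Longrightarrow> h p = 0" for h f
    unfolding set_lebesgue_integral_def
    using that K(2) assms(2) by (intro Bochner_Integration.integral_cong refl) (force simp: indicator_def)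
  show "(LINT p:\<Omega>'|lebesgue. (frechet_derivative \<phi> (at p) (1, 0) *\<^sub>R v p)) = - (LINT p:\<Omega>'|lebesgue. (\<phi> p *\<^sub>R g1 p))"
    "(LINT p:\<Omega>'|lebesgue. (frechet_derivative \<phi> (at p) (0, 1) *\<^sub>R v p)) = - (LINT p:\<Omega>'|lebesgue. (\<phi> p *\<^sub>R g2 p))"
    using assms(1) t' by (simp_all add: e K is_weak_grad_def)
qed

section \<open>From absolute continuity on lines to weak gradients\<close>

lemma rect_integrable_swap:
  fixes f :: "real \<times> real \<Rightarrow> 'b::{banach, second_countable_topology}"
  assumes "rect_integrable I J f"
  shows "rect_integrable J I (\<lambda>q. f (snd q, fst q))"
  unfolding rect_integrable_def
proof (intro conjI allI impI)
  have [measurable]: "f \<in> borel_measurable borel" using assms by (simp add: rect_integrable_def)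
  show "(\<lambda>q. f (snd q, fst q)) \<in> borel_measurable borel" by measurable
  fix a b c d assume "{a..b} \<subseteq> J" "{c..d} \<subseteq> I"
  then have "integrable lborel (\<lambda>q. indicator ({c..d} \<times> {a..b}) q *\<^sub>R f q)" using assms by (auto simp: rect_integrable_def)
  then have "integrable lborel (\<lambda>q. indicator ({c..d} \<times> {a..b}) (snd q, fst q) *\<^sub>R f (snd q, fst q))"
    by (subst integrable_lborel_swap[of "\<lambda>q. indicator ({c..d} \<times> {a..b}) q *\<^sub>R f q"])
  then show "integrable lborel (\<lambda>q. indicator ({a..b} \<times> {c..d}) q *\<^sub>R f (snd q, fst q))"
    by (simp add: indicator_times mult.commute)
qed

lemma rect_by_parts_fst:
  fixes U R :: "real \<times> real \<Rightarrow> 'b::euclidean_space"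
  assumes I: "open I" "is_interval I" "i \<in> I" and J: "open J"
    and U: "rect_integrable I J U" and R: "rect_integrable I J R"
    and ac: "AE y in lborel. y \<in> J \<longrightarrow> (\<exists>k. AE x in lborel. x \<in> I \<longrightarrow> U (x, y) = k + signed_integral i x (\<lambda>t. R (t, y)))"
    and ab: "{a..b} \<subseteq> I" "a \<le> b" and cd: "{c..d} \<subseteq> J"
    and P: "\<And>x y. x \<in> {a..b} \<Longrightarrow> y \<in> {c..d} \<Longrightarrow> ((\<lambda>x. P (x, y)) has_real_derivative P' (x, y)) (at x within {a..b})"
    and cP: "continuous_on ({a..b} \<times> {c..d}) P" "continuous_on ({a..b} \<times> {c..d}) P'"
    and [measurable]: "P \<in> borel_measurable borel" "P' \<in> borel_measurable borel"
    and P0: "\<And>y. y \<in> {c..d} \<Longrightarrow> P (a, y) = 0" "\<And>y. y \<in> {c..d} \<Longrightarrow> P (b, y) = 0"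
  shows "(\<integral>q. (indicator ({a..b} \<times> {c..d}) q * P' q) *\<^sub>R U q \<partial>lborel) = - (\<integral>q. (indicator ({a..b} \<times> {c..d}) q * P q) *\<^sub>R R q \<partial>lborel)"
    and "integrable lborel (\<lambda>q. (indicator ({a..b} \<times> {c..d}) q * P' q) *\<^sub>R U q)"
    and "integrable lborel (\<lambda>q. (indicator ({a..b} \<times> {c..d}) q * P q) *\<^sub>R R q)"
proof -
  let ?Q = "{a..b} \<times> {c..d}" and ?Q' = "{c..d} \<times> {a..b}"
  have [measurable]: "U \<in> borel_measurable borel" "R \<in> borel_measurable borel"
    using U R by (simp_all add: rect_integrable_def)
  let ?s = "\<lambda>f q. f (snd q, fst q)"
  have c: "continuous_on ?Q' (?s f)" if "continuous_on ?Q f" for f :: "real \<times> real \<Rightarrow> real"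
    by (rule continuous_on_compose2[OF that]) (auto intro!: continuous_intros)
  have ac': "AE y in lborel. y \<in> J \<longrightarrow> (\<exists>k. AE x in lborel. x \<in> I \<longrightarrow> ?s U (y, x) = k + signed_integral i x (\<lambda>t. ?s R (y, t)))"
    using ac by simp
  have mP: "?s P \<in> borel_measurable borel" "?s P' \<in> borel_measurable borel" by measurable
  have dP: "((\<lambda>x. ?s P (y, x)) has_real_derivative ?s P' (y, x)) (at x within {a..b})" if "y \<in> {c..d}" "x \<in> {a..b}" for x y
    using P[OF that(2,1)] by simp
  have zP: "?s P (y, a) = 0" "?s P (y, b) = 0" if "y \<in> {c..d}" for y using P0[OF that] by simp_all
  note raw = rect_by_parts_snd[where P = "?s P" and P' = "?s P'", OF J I rect_integrable_swap[OF U] rect_integrable_swap[OF R] ac' cd ab dP c[OF cP(1)] c[OF cP(2)] mP zP]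
  have main1: "(\<integral>q. (indicator ?Q' q * ?s P' q) *\<^sub>R ?s U q \<partial>lborel) = - (\<integral>q. (indicator ?Q' q * ?s P q) *\<^sub>R ?s R q \<partial>lborel)"
    by (rule raw(1))
  have main2: "integrable lborel (\<lambda>q. (indicator ?Q' q * ?s P' q) *\<^sub>R ?s U q)"
    by (rule raw(2))
  have main3: "integrable lborel (\<lambda>q. (indicator ?Q' q * ?s P q) *\<^sub>R ?s R q)"
    by (rule raw(3))
  have ind: "indicator ?Q' q = (indicator ?Q (snd q, fst q) :: real)" for q
    by (cases q) (auto simp: indicator_def)
  have s1: "(\<integral>q. (indicator ?Q' q * ?s P' q) *\<^sub>R ?s U q \<partial>lborel) = (\<integral>q. (indicator ?Q q * P' q) *\<^sub>R U q \<partial>lborel)"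
    unfolding ind by (rule integral_lborel_swap[of "\<lambda>q. (indicator ?Q q * P' q) *\<^sub>R U q"]) measurable
  have s2: "(\<integral>q. (indicator ?Q' q * ?s P q) *\<^sub>R ?s R q \<partial>lborel) = (\<integral>q. (indicator ?Q q * P q) *\<^sub>R R q \<partial>lborel)"
    unfolding ind by (rule integral_lborel_swap[of "\<lambda>q. (indicator ?Q q * P q) *\<^sub>R R q"]) measurable
  show "(\<integral>q. (indicator ?Q q * P' q) *\<^sub>R U q \<partial>lborel) = - (\<integral>q. (indicator ?Q q * P q) *\<^sub>R R q \<partial>lborel)"
    using main1 unfolding s1 s2 by simp
  show "integrable lborel (\<lambda>q. (indicator ?Q q * P' q) *\<^sub>R U q)"
    using main2 unfolding ind by (simp only: integrable_lborel_swap[of "\<lambda>q. (indicator ?Q q * P' q) *\<^sub>R U q"])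
  show "integrable lborel (\<lambda>q. (indicator ?Q q * P q) *\<^sub>R R q)"
    using main3 unfolding ind by (simp only: integrable_lborel_swap[of "\<lambda>q. (indicator ?Q q * P q) *\<^sub>R R q"])
qed

text \<open>\<open>polar_inv\<close> is continuous on the open half plane, so K has compact image.
  The rectangle is slightly larger than this image, so that a pulled-back test function supported in
  K vanishes on its sides and leaves no boundary terms.\<close>

lemma compact_polar_rectangle:
  assumes r: "0 < r" and K: "compact K" "K \<subseteq> half_ball (0, 0) r"
  obtains a b c d where "{a..b} \<subseteq> {0<..<r\<^sup>2}" "a < b" "c < d"
    "\<And>q. 0 < fst q \<Longrightarrow> polar_map q \<in> K \<Longrightarrow> fst q \<in> {a<..<b} \<and> snd q \<in> {c<..<d}"
proof (cases "K = {}")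
  case True
  obtain S where S: "S = r\<^sup>2" "0 < S" using zero_less_power[OF r, of 2] by blast
  show ?thesis
    by (rule that[of "S / 3" "S / 2" 0 1]) (use True S(2) in \<open>auto simp: S(1)[symmetric]\<close>)
next
  case False
  have cont: "continuous_on K polar_inv"
    unfolding polar_inv_def using K(2) by (intro continuous_intros) (auto simp: half_ball_iff)
  have c1: "compact ((\<lambda>p. fst (polar_inv p)) ` K)" "compact ((\<lambda>p. snd (polar_inv p)) ` K)"
    by (intro compact_continuous_image continuous_intros cont K(1))+
  obtain a0 where a0: "a0 \<in> (\<lambda>p. fst (polar_inv p)) ` K" "\<forall>t \<in> (\<lambda>p. fst (polar_inv p)) ` K. a0 \<le> t"
    using compact_attains_inf[OF c1(1)] False by blast
  obtain b0 where b0: "b0 \<in> (\<lambda>p. fst (polar_inv p)) ` K" "\<forall>t \<in> (\<lambda>p. fst (polar_inv p)) ` K. t \<le> b0"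
    using compact_attains_sup[OF c1(1)] False by blast
  have "{a0..b0} \<subseteq> {0<..<r\<^sup>2}" "a0 \<le> b0"
    using a0 b0 K(2) polar_inv_half_ball(1) by fastforce+
  note ab0 = this
  obtain a b where ab: "a < a0" "b0 < b" "{a..b} \<subseteq> {0<..<r\<^sup>2}"
    by (rule open_rational_interval[of "{0<..<r\<^sup>2}" a0 b0]) (use ab0 in auto)
  obtain C where C: "\<forall>t \<in> (\<lambda>p. snd (polar_inv p)) ` K. norm t \<le> C"
    using compact_imp_bounded[OF c1(2)] unfolding bounded_iff by blast
  then have "0 \<le> C" using False by (force intro: order_trans[OF norm_ge_zero])
  show ?thesis
  proof (rule that[of a b "- (C + 1)" "C + 1"])
    fix q :: "real \<times> real" assume q: "0 < fst q" "polar_map q \<in> K"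
    then have "fst q \<in> (\<lambda>p. fst (polar_inv p)) ` K" "snd q \<in> (\<lambda>p. snd (polar_inv p)) ` K"
      using polar_inv_map[OF q(1)] by (auto intro!: image_eqI[where x = "polar_map q"])
    then have "a0 \<le> fst q" "fst q \<le> b0" "norm (snd q) \<le> C" using a0 b0 C by auto
    then show "fst q \<in> {a<..<b} \<and> snd q \<in> {- (C + 1)<..<C + 1}" using ab by auto
  qed (use ab \<open>a0 \<le> b0\<close> \<open>0 \<le> C\<close> in auto)
qed

text \<open>The converse transport uses only that \<open>polar_jac\<close> is at most 1 and that a
  compact set is covered by one box of the strip.\<close>

lemma locally_integrable_polar_inv:
  fixes f :: "real \<times> real \<Rightarrow> real^'d"
  assumes r: "0 < r" and f: "rect_integrable {0<..<r\<^sup>2} UNIV f"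
    and g: "\<And>q. 0 < fst q \<Longrightarrow> g (polar_map q) = f q" and [measurable]: "g \<in> borel_measurable borel"
  shows "locally_integrable_on (half_ball (0, 0) r) g"
  unfolding locally_integrable_on_def set_integrable_def
proof (intro allI impI)
  have mf [measurable]: "f \<in> borel_measurable borel" using f by (simp add: rect_integrable_def)
  fix K assume "compact K \<and> K \<subseteq> half_ball (0, 0) r"
  then have K: "compact K" "K \<subseteq> half_ball (0, 0) r" by auto
  have [measurable]: "K \<in> sets borel" using K(1) by (rule borel_compact)
  obtain a b c d where ab: "{a..b} \<subseteq> {0<..<r\<^sup>2}" "a < b" "c < d"
    "\<And>q. 0 < fst q \<Longrightarrow> polar_map q \<in> K \<Longrightarrow> fst q \<in> {a<..<b} \<and> snd q \<in> {c<..<d}"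
    using compact_polar_rectangle[OF r K] by metis
  have "integrable lborel (\<lambda>q. (polar_jac q * indicator K (polar_map q)) *\<^sub>R f q)"
  proof (rule rect_integrable_bounded_mult[OF f ab(1), of c d])
    show "\<bar>polar_jac q * indicator K (polar_map q)\<bar> \<le> 1 * indicator ({a..b} \<times> {c..d}) q" for q
    proof (cases "0 < fst q \<and> polar_map q \<in> K")
      case True
      then have "q \<in> {a..b} \<times> {c..d}" using ab(4)[of q] by (auto simp: mem_Times_iff)
      moreover have "polar_jac q \<le> 1" by (simp add: polar_jac_def divide_le_eq)
      ultimately show ?thesis using True by simp
    qed (auto simp: polar_jac_def)
  qed auto
  also have "(\<lambda>q. (polar_jac q * indicator K (polar_map q)) *\<^sub>R f q) = (\<lambda>q. polar_jac q *\<^sub>R (indicator K (polar_map q) *\<^sub>R g (polar_map q)))"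
  proof
    fix q show "(polar_jac q * indicator K (polar_map q)) *\<^sub>R f q = polar_jac q *\<^sub>R (indicator K (polar_map q) *\<^sub>R g (polar_map q))"
      using g[of q] by (cases "0 < fst q") (auto simp: polar_jac_def)
  qed
  finally have "integrable lborel (\<lambda>p. indicator {p. 0 < snd p} p *\<^sub>R (indicator K p *\<^sub>R g p))"
    by (subst polar_integrable) auto
  moreover have "(\<lambda>p. indicator {p. 0 < snd p} p *\<^sub>R (indicator K p *\<^sub>R g p)) = (\<lambda>p. indicator K p *\<^sub>R g p)"
    using K(2) by (auto simp: fun_eq_iff indicator_def half_ball_iff)
  ultimately show "integrable lebesgue (\<lambda>p. indicator K p *\<^sub>R g p)"
    by (subst integrable_completion) auto
qed

section \<open>Derivatives of test functions along the coordinate lines\<close>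

lemma polar_height_derivs:
  assumes "0 < \<sigma>"
  shows "((\<lambda>\<sigma>. snd (polar_map (\<sigma>, c))) has_real_derivative snd (polar_map (\<sigma>, c)) / (2 * \<sigma>)) (at \<sigma>)"
    and "((\<lambda>c. snd (polar_map (\<sigma>, c))) has_real_derivative (- c * snd (polar_map (\<sigma>, c)) / (1 + c\<^sup>2))) (at c)"
proof -
  define k where "k = 1 + c\<^sup>2"
  have k: "k > 0" by (simp add: k_def)
  define s where "s = sqrt (\<sigma> / k)"
  have s: "s > 0" "s * s = \<sigma> / k" using assms k by (auto simp: s_def)
  have i: "inverse s = s * k / \<sigma>" using s assms k by (simp add: field_simps)
  have "((\<lambda>\<sigma>. sqrt (\<sigma> / k)) has_real_derivative (inverse s / 2 * (1 / k))) (at \<sigma>)"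
    unfolding s_def using assms k by (auto intro!: derivative_eq_intros simp: field_simps)
  moreover have "inverse s / 2 * (1 / k) = s / (2 * \<sigma>)" unfolding i using k by simp
  ultimately show "((\<lambda>\<sigma>. snd (polar_map (\<sigma>, c))) has_real_derivative snd (polar_map (\<sigma>, c)) / (2 * \<sigma>)) (at \<sigma>)"
    by (simp add: polar_map_def k_def s_def)
  have "((\<lambda>c. \<sigma> / (1 + c\<^sup>2)) has_real_derivative (- (\<sigma> * (2 * c)) / (k * k))) (at c)"
    unfolding k_def by (auto intro!: derivative_eq_intros)
  then have "((\<lambda>c. sqrt (\<sigma> / (1 + c\<^sup>2))) has_real_derivative (inverse (sqrt (\<sigma> / (1 + c\<^sup>2))) / 2 * (- (\<sigma> * (2 * c)) / (k * k)))) (at c)"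
    by (intro DERIV_chain2[OF DERIV_real_sqrt]) (use assms in auto)
  moreover have "inverse (sqrt (\<sigma> / (1 + c\<^sup>2))) / 2 * (- (\<sigma> * (2 * c)) / (k * k)) = - c * s / k"
    unfolding k_def[symmetric] s_def[symmetric] i using assms k by (simp add: field_simps)
  ultimately show "((\<lambda>c. snd (polar_map (\<sigma>, c))) has_real_derivative (- c * snd (polar_map (\<sigma>, c)) / (1 + c\<^sup>2))) (at c)"
    by (simp add: polar_map_def k_def s_def)
qed

lemma test_function_polar_derivs:
  fixes \<sigma> c :: real
  assumes t: "test_function \<Omega> \<phi>" and "0 < \<sigma>"
  defines "D1 \<equiv> \<lambda>q. frechet_derivative \<phi> (at (polar_map q)) (1, 0)" and "D2 \<equiv> \<lambda>q. frechet_derivative \<phi> (at (polar_map q)) (0, 1)"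
    and "s \<equiv> snd (polar_map (\<sigma>, c))"
  shows "((\<lambda>\<sigma>. \<phi> (polar_map (\<sigma>, c))) has_real_derivative (D1 (\<sigma>, c) * (c * (s / (2 * \<sigma>))) + D2 (\<sigma>, c) * (s / (2 * \<sigma>)))) (at \<sigma>)"
    and "((\<lambda>c. \<phi> (polar_map (\<sigma>, c))) has_real_derivative (D1 (\<sigma>, c) * (s / (1 + c\<^sup>2)) + D2 (\<sigma>, c) * (- c * s / (1 + c\<^sup>2)))) (at c)"
proof -
  let ?p = "polar_map (\<sigma>, c)"
  have d: "(\<phi> has_derivative frechet_derivative \<phi> (at ?p)) (at ?p)"
    using test_function_smooth(1)[OF t] by (simp add: frechet_derivative_works)
  then have l: "linear (frechet_derivative \<phi> (at ?p))" by (rule has_derivative_linear)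
  have e: "frechet_derivative \<phi> (at ?p) (x, y) = D1 (\<sigma>, c) * x + D2 (\<sigma>, c) * y" for x y
  proof -
    have "(x, y) = x *\<^sub>R (1, 0) + y *\<^sub>R (0 :: real, 1 :: real)" by simp
    then have "frechet_derivative \<phi> (at ?p) (x, y) = x *\<^sub>R frechet_derivative \<phi> (at ?p) (1, 0) + y *\<^sub>R frechet_derivative \<phi> (at ?p) (0, 1)"
      by (simp only: linear_add[OF l] linear_scale[OF l])
    then show ?thesis by (simp add: D1_def D2_def mult.commute)
  qed
  have pm: "polar_map q = (snd q * snd (polar_map q), snd (polar_map q))" for q by (simp add: polar_map_def)
  note h = polar_height_derivs[OF assms(2), of c]
  have x1: "((\<lambda>\<sigma>. c * snd (polar_map (\<sigma>, c))) has_real_derivative c * (s / (2 * \<sigma>))) (at \<sigma>)"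
    unfolding s_def by (rule DERIV_cmult[OF h(1)])
  have "((\<lambda>\<sigma>. polar_map (\<sigma>, c)) has_derivative (\<lambda>t. (t * (c * (s / (2 * \<sigma>))), t * (s / (2 * \<sigma>))))) (at \<sigma>)"
    apply (subst pm)
    using has_derivative_Pair[OF x1[unfolded has_field_derivative_def] h(1)[unfolded has_field_derivative_def]]
    by (simp add: s_def mult.commute)
  from has_derivative_compose[OF this d]
  show "((\<lambda>\<sigma>. \<phi> (polar_map (\<sigma>, c))) has_real_derivative (D1 (\<sigma>, c) * (c * (s / (2 * \<sigma>))) + D2 (\<sigma>, c) * (s / (2 * \<sigma>)))) (at \<sigma>)"
    unfolding e has_field_derivative_def by (rule has_derivative_eq_rhs) (simp add: fun_eq_iff algebra_simps)
  have "((\<lambda>c. c * snd (polar_map (\<sigma>, c))) has_real_derivative (c * (- c * s / (1 + c\<^sup>2)) + 1 * s)) (at c)"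
    unfolding s_def by (rule DERIV_mult'[OF DERIV_ident h(2)])
  moreover have "c * (- c * s / (1 + c\<^sup>2)) + 1 * s = s / (1 + c\<^sup>2)"
  proof -
    have "s * (1 + c\<^sup>2) = s + c * (c * s)" by (simp add: algebra_simps power2_eq_square)
    then have "s = s / (1 + c\<^sup>2) + c * (c * s) / (1 + c\<^sup>2)"
      by (simp add: add_divide_distrib[symmetric] eq_divide_eq)
    then show ?thesis by simp
  qed
  ultimately have x2: "((\<lambda>c. c * snd (polar_map (\<sigma>, c))) has_real_derivative s / (1 + c\<^sup>2)) (at c)" by simp
  have "((\<lambda>c. polar_map (\<sigma>, c)) has_derivative (\<lambda>t. (t * (s / (1 + c\<^sup>2)), t * (- c * s / (1 + c\<^sup>2))))) (at c)"
    apply (subst pm)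
    using has_derivative_Pair[OF x2[unfolded has_field_derivative_def] h(2)[unfolded has_field_derivative_def]]
    by (simp add: s_def mult.commute)
  from has_derivative_compose[OF this d]
  show "((\<lambda>c. \<phi> (polar_map (\<sigma>, c))) has_real_derivative (D1 (\<sigma>, c) * (s / (1 + c\<^sup>2)) + D2 (\<sigma>, c) * (- c * s / (1 + c\<^sup>2)))) (at c)"
    unfolding e has_field_derivative_def by (rule has_derivative_eq_rhs) (simp add: fun_eq_iff algebra_simps)
qed

text \<open>U is a function of (\<sigma>, c) with coordinate derivatives R and A, absolutely
  continuous on almost all lines, and w is the same function of the point p. In the application U is
  a glued map, and this is how the competitor acquires a weak gradient.\<close>

context
  fixes r j :: real and U R A :: "real \<times> real \<Rightarrow> real^'d" and w :: "real \<times> real \<Rightarrow> real^'d"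
  assumes r: "0 < r" and j: "j \<in> {0<..<r\<^sup>2}"
    and U: "rect_integrable {0<..<r\<^sup>2} UNIV U" and R: "rect_integrable {0<..<r\<^sup>2} UNIV R" and A: "rect_integrable {0<..<r\<^sup>2} UNIV A"
    and acR: "AE c in lborel. \<exists>k. AE \<sigma> in lborel. \<sigma> \<in> {0<..<r\<^sup>2} \<longrightarrow> U (\<sigma>, c) = k + signed_integral j \<sigma> (\<lambda>t. R (t, c))"
    and acA: "AE \<sigma> in lborel. \<sigma> \<in> {0<..<r\<^sup>2} \<longrightarrow> (\<exists>k. AE c in lborel. U (\<sigma>, c) = k + signed_integral 0 c (\<lambda>t. A (\<sigma>, t)))"
    and w: "\<And>q. 0 < fst q \<Longrightarrow> w (polar_map q) = U q" and mw [measurable]: "w \<in> borel_measurable borel"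
begin

text \<open>\<open>(\<alpha>, \<beta>)\<close> is the Piola transform of the constant field \<open>e\<close>, hence divergence free; this is why the
  same \<open>\<gamma>\<close> appears with opposite signs.\<close>

lemma polar_green:
  fixes G :: "real \<times> real \<Rightarrow> real^'d"
  assumes t: "test_function (half_ball (0, 0) r) \<phi>" and e: "e \<in> {(1, 0), (0, 1)}"
    and [measurable]: "G \<in> borel_measurable borel" "\<alpha> \<in> borel_measurable borel" "\<beta> \<in> borel_measurable borel" "\<gamma> \<in> borel_measurable borel"
    and cont: "continuous_on ({0<..} \<times> UNIV) \<alpha>" "continuous_on ({0<..} \<times> UNIV) \<beta>" "continuous_on ({0<..} \<times> UNIV) \<gamma>"
    and d\<alpha>: "\<And>\<sigma> c. 0 < \<sigma> \<Longrightarrow> ((\<lambda>\<sigma>. \<alpha> (\<sigma>, c)) has_real_derivative \<gamma> (\<sigma>, c)) (at \<sigma>)"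
    and d\<beta>: "\<And>\<sigma> c. 0 < \<sigma> \<Longrightarrow> ((\<lambda>c. \<beta> (\<sigma>, c)) has_real_derivative - \<gamma> (\<sigma>, c)) (at c)"
    and piola: "\<And>\<sigma> c x y. 0 < \<sigma> \<Longrightarrow> (x * (c * (snd (polar_map (\<sigma>, c)) / (2 * \<sigma>))) + y * (snd (polar_map (\<sigma>, c)) / (2 * \<sigma>))) * \<alpha> (\<sigma>, c)
        + (x * (snd (polar_map (\<sigma>, c)) / (1 + c\<^sup>2)) + y * (- c * snd (polar_map (\<sigma>, c)) / (1 + c\<^sup>2))) * \<beta> (\<sigma>, c)
        = polar_jac (\<sigma>, c) * (fst e * x + snd e * y)"
    and G: "\<And>q. 0 < fst q \<Longrightarrow> \<alpha> q *\<^sub>R R q + \<beta> q *\<^sub>R A q = polar_jac q *\<^sub>R G (polar_map q)"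
  shows "(LINT p:half_ball (0, 0) r|lebesgue. (frechet_derivative \<phi> (at p) e *\<^sub>R w p)) = - (LINT p:half_ball (0, 0) r|lebesgue. (\<phi> p *\<^sub>R G p))"
proof -
  obtain K where K: "compact K" "K \<subseteq> half_ball (0, 0) r" "\<And>p. p \<notin> K \<Longrightarrow> \<phi> p = 0" "\<And>p e. p \<notin> K \<Longrightarrow> frechet_derivative \<phi> (at p) e = 0"
    using test_function_support[OF t] by metis
  obtain a b c d where ab: "{a..b} \<subseteq> {0<..<r\<^sup>2}" "a < b" "c < d"
    and rect: "\<And>q. 0 < fst q \<Longrightarrow> polar_map q \<in> K \<Longrightarrow> fst q \<in> {a<..<b} \<and> snd q \<in> {c<..<d}"
    using compact_polar_rectangle[OF r K(1,2)] by metis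
  have a0: "0 < a" "b < r\<^sup>2" using subsetD[OF ab(1), of a] subsetD[OF ab(1), of b] ab(2) by auto
  let ?Q = "{a..b} \<times> {c..d}"
  define \<Phi> where "\<Phi> q = \<phi> (polar_map q)" for q
  define D1 where "D1 q = frechet_derivative \<phi> (at (polar_map q)) (1, 0)" for q
  define D2 where "D2 q = frechet_derivative \<phi> (at (polar_map q)) (0, 1)" for q
  define s where "s q = snd (polar_map q)" for q
  note mt = test_function_measurable[OF t]
  have [measurable]: "\<Phi> \<in> borel_measurable borel" "D1 \<in> borel_measurable borel" "D2 \<in> borel_measurable borel" "s \<in> borel_measurable borel"
    using measurable_compose[OF polar_map_measurable mt(1)] measurable_compose[OF polar_map_measurable mt(2)]
      measurable_compose[OF polar_map_measurable mt(3)]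
    by (simp_all add: \<Phi>_def[abs_def] D1_def[abs_def] D2_def[abs_def] s_def[abs_def])
  have Q0: "?Q \<subseteq> {0<..} \<times> UNIV" using a0 by auto
  have pc: "continuous_on ?Q polar_map" by (rule continuous_on_subset[OF polar_map_continuous Q0])
  have cs: "continuous_on ?Q \<Phi>" "continuous_on ?Q D1" "continuous_on ?Q D2" "continuous_on ?Q s"
    unfolding \<Phi>_def D1_def D2_def s_def
    using continuous_on_compose2[OF test_function_smooth(2)[OF t] pc] continuous_on_compose2[OF test_function_smooth(3)[OF t] pc]
    by (auto simp: Basis_prod_def intro!: continuous_intros pc)
  have cc: "continuous_on ?Q \<alpha>" "continuous_on ?Q \<beta>" "continuous_on ?Q \<gamma>"
    using cont Q0 continuous_on_subset by blast+
  \<comment> \<open>\<open>P'\<close> and \<open>N'\<close> are the \<sigma>-derivative of \<Phi>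
    \<alpha> and the c-derivative of \<Phi> \<beta>. In their sum the \<gamma> terms cancel, and
    what remains is \<open>polar_jac\<close> times the derivative of \<phi> in direction e.\<close>
  define P where "P q = \<Phi> q * \<alpha> q" for q
  define P' where "P' q = (D1 q * (snd q * (s q / (2 * fst q))) + D2 q * (s q / (2 * fst q))) * \<alpha> q + \<gamma> q * \<Phi> q" for q
  define N where "N q = \<Phi> q * \<beta> q" for q
  define N' where "N' q = (D1 q * (s q / (1 + (snd q)\<^sup>2)) + D2 q * (- snd q * s q / (1 + (snd q)\<^sup>2))) * \<beta> q + (- \<gamma> q) * \<Phi> q" for q
  have zero: "\<Phi> q = 0" "D1 q = 0" "D2 q = 0" if "0 < fst q" "\<not> (fst q \<in> {a<..<b} \<and> snd q \<in> {c<..<d})" for q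
    using rect[OF that(1)] that(2) K(3,4)[of "polar_map q"] by (auto simp: \<Phi>_def D1_def D2_def)
  have acR': "AE y in lborel. y \<in> UNIV \<longrightarrow> (\<exists>k. AE x in lborel. x \<in> {0<..<r\<^sup>2} \<longrightarrow> U (x, y) = k + signed_integral j x (\<lambda>t. R (t, y)))"
    using acR by simp
  have acA': "AE x in lborel. x \<in> {0<..<r\<^sup>2} \<longrightarrow> (\<exists>k. AE y in lborel. y \<in> UNIV \<longrightarrow> U (x, y) = k + signed_integral 0 y (\<lambda>t. A (x, t)))"
    using acA by simp
  have mP: "P \<in> borel_measurable borel" "P' \<in> borel_measurable borel" "N \<in> borel_measurable borel" "N' \<in> borel_measurable borel"
    unfolding P_def[abs_def] P'_def[abs_def] N_def[abs_def] N'_def[abs_def] by measurable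
  have cP: "continuous_on ?Q P" "continuous_on ?Q P'" "continuous_on ?Q N" "continuous_on ?Q N'"
    unfolding P_def[abs_def] P'_def[abs_def] N_def[abs_def] N'_def[abs_def]
    using cs cc a0 by (auto intro!: continuous_intros)
  have dP: "((\<lambda>x. P (x, y)) has_real_derivative P' (x, y)) (at x within {a..b})" if "x \<in> {a..b}" for x y
  proof -
    have x: "0 < x" using that a0 by auto
    show ?thesis
      unfolding P_def P'_def \<Phi>_def D1_def D2_def s_def fst_conv snd_conv
      by (rule has_field_derivative_at_within[OF DERIV_mult[OF test_function_polar_derivs(1)[OF t x] d\<alpha>[OF x]]])
  qed
  have dN: "((\<lambda>y. N (x, y)) has_real_derivative N' (x, y)) (at y within {c..d})" if "x \<in> {a..b}" for x y
  proof -
    have x: "0 < x" using that a0 by auto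
    show ?thesis
      unfolding N_def N'_def \<Phi>_def D1_def D2_def s_def fst_conv snd_conv
      by (rule has_field_derivative_at_within[OF DERIV_mult[OF test_function_polar_derivs(2)[OF t x] d\<beta>[OF x]]])
  qed
  have zP: "P (a, y) = 0" "P (b, y) = 0" for y using zero(1)[of "(a, y)"] zero(1)[of "(b, y)"] a0 ab by (auto simp: P_def)
  have zN: "N (x, c) = 0" "N (x, d) = 0" if "x \<in> {a..b}" for x
    using zero(1)[of "(x, c)"] zero(1)[of "(x, d)"] a0 that by (auto simp: N_def)
  note r1 = rect_by_parts_fst[OF open_greaterThanLessThan is_interval_oo j open_UNIV U R acR' ab(1) less_imp_le[OF ab(2)] subset_UNIV dP cP(1,2) mP(1,2) zP]
  note r2 = rect_by_parts_snd[OF open_greaterThanLessThan open_UNIV is_interval_univ UNIV_I U A acA' ab(1) subset_UNIV less_imp_le[OF ab(3)] dN cP(3,4) mP(3,4) zN]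
  have b1: "(\<integral>q. (indicator ?Q q * P' q) *\<^sub>R U q \<partial>lborel) = - (\<integral>q. (indicator ?Q q * P q) *\<^sub>R R q \<partial>lborel)"
    by (rule r1(1))
  have b1': "integrable lborel (\<lambda>q. (indicator ?Q q * P' q) *\<^sub>R U q)" by (rule r1(2))
  have b1'': "integrable lborel (\<lambda>q. (indicator ?Q q * P q) *\<^sub>R R q)" by (rule r1(3))
  have b2: "(\<integral>q. (indicator ?Q q * N' q) *\<^sub>R U q \<partial>lborel) = - (\<integral>q. (indicator ?Q q * N q) *\<^sub>R A q \<partial>lborel)"
    by (rule r2(1))
  have b2': "integrable lborel (\<lambda>q. (indicator ?Q q * N' q) *\<^sub>R U q)" by (rule r2(2))
  have b2'': "integrable lborel (\<lambda>q. (indicator ?Q q * N q) *\<^sub>R A q)" by (rule r2(3))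
  have De: "frechet_derivative \<phi> (at (polar_map q)) e = fst e * D1 q + snd e * D2 q" for q
    using e by (auto simp: D1_def D2_def)
  have me [measurable]: "(\<lambda>p. frechet_derivative \<phi> (at p) e) \<in> borel_measurable borel" using e mt by auto
  have [measurable]: "\<phi> \<in> borel_measurable borel" by (rule mt)
  have outside: "q \<notin> ?Q" if "fst q \<notin> {0<..<r\<^sup>2}" for q using that ab(1) by (auto simp: mem_Times_iff)
  have "(LINT p:half_ball (0, 0) r|lebesgue. (frechet_derivative \<phi> (at p) e *\<^sub>R w p)) = (\<integral>q. (indicator ?Q q * P' q) *\<^sub>R U q + (indicator ?Q q * N' q) *\<^sub>R U q \<partial>lborel)"
  proof (rule half_ball_integral_eq[OF r])
    fix q :: "real \<times> real" assume "fst q \<in> {0<..<r\<^sup>2}"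
    then have q: "0 < fst q" by simp
    have "P' q + N' q = polar_jac q * (fst e * D1 q + snd e * D2 q)"
      using piola[OF q, of "D1 q" "snd q" "D2 q"] by (simp add: P'_def N'_def s_def)
    then have *: "polar_jac q *\<^sub>R (frechet_derivative \<phi> (at (polar_map q)) e *\<^sub>R w (polar_map q)) = P' q *\<^sub>R U q + N' q *\<^sub>R U q"
      by (simp add: De w[OF q] scaleR_add_left[symmetric])
    show "polar_jac q *\<^sub>R (frechet_derivative \<phi> (at (polar_map q)) e *\<^sub>R w (polar_map q)) = (indicator ?Q q * P' q) *\<^sub>R U q + (indicator ?Q q * N' q) *\<^sub>R U q"
    proof (cases "q \<in> ?Q")
      case False
      then have "frechet_derivative \<phi> (at (polar_map q)) e = 0" using zero(2,3)[OF q] De by (auto simp: mem_Times_iff)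
      then show ?thesis using False by simp
    qed (use * in simp)
  qed (measurable, simp add: outside)
  also have "\<dots> = - (\<integral>q. (indicator ?Q q * P q) *\<^sub>R R q \<partial>lborel) - (\<integral>q. (indicator ?Q q * N q) *\<^sub>R A q \<partial>lborel)"
    by (subst Bochner_Integration.integral_add[OF b1' b2']) (simp only: b1 b2 diff_conv_add_uminus)
  also have "\<dots> = - (\<integral>q. (indicator ?Q q * P q) *\<^sub>R R q + (indicator ?Q q * N q) *\<^sub>R A q \<partial>lborel)"
    by (subst Bochner_Integration.integral_add[OF b1'' b2'']) simp
  also have "(\<integral>q. (indicator ?Q q * P q) *\<^sub>R R q + (indicator ?Q q * N q) *\<^sub>R A q \<partial>lborel) = (LINT p:half_ball (0, 0) r|lebesgue. (\<phi> p *\<^sub>R G p))"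
  proof (rule half_ball_integral_eq[OF r, symmetric])
    fix q :: "real \<times> real" assume "fst q \<in> {0<..<r\<^sup>2}"
    then have q: "0 < fst q" by simp
    have "P q *\<^sub>R R q + N q *\<^sub>R A q = \<Phi> q *\<^sub>R (\<alpha> q *\<^sub>R R q + \<beta> q *\<^sub>R A q)" by (simp add: P_def N_def scaleR_add_right)
    then have *: "P q *\<^sub>R R q + N q *\<^sub>R A q = polar_jac q *\<^sub>R (\<phi> (polar_map q) *\<^sub>R G (polar_map q))"
      unfolding G[OF q] by (simp add: \<Phi>_def mult.commute)
    show "polar_jac q *\<^sub>R (\<phi> (polar_map q) *\<^sub>R G (polar_map q)) = (indicator ?Q q * P q) *\<^sub>R R q + (indicator ?Q q * N q) *\<^sub>R A q"
    proof (cases "q \<in> ?Q")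
      case False
      then have "\<phi> (polar_map q) = 0" using zero(1)[OF q] by (auto simp: mem_Times_iff \<Phi>_def)
      then show ?thesis using False by simp
    qed (use * in simp)
  qed (measurable, simp add: outside)
  finally show ?thesis .
qed

text \<open>Chain rule for the inverse coordinates: the x-derivatives of \<sigma> and c are 2x and
  1/y, the y-derivatives 2y and -x/y^2.\<close>

definition grad_x :: "real \<times> real \<Rightarrow> real^'d" where
  "grad_x p = (2 * fst p) *\<^sub>R R (polar_inv p) + (1 / snd p) *\<^sub>R A (polar_inv p)"

definition grad_y :: "real \<times> real \<Rightarrow> real^'d" where
  "grad_y p = (2 * snd p) *\<^sub>R R (polar_inv p) + (- fst p / (snd p)\<^sup>2) *\<^sub>R A (polar_inv p)"

lemma grad_measurable: "grad_x \<in> borel_measurable borel" "grad_y \<in> borel_measurable borel"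
proof -
  have [measurable]: "R \<in> borel_measurable borel" "A \<in> borel_measurable borel"
    using R A by (simp_all add: rect_integrable_def)
  show "grad_x \<in> borel_measurable borel" "grad_y \<in> borel_measurable borel"
    unfolding grad_x_def[abs_def] grad_y_def[abs_def] by measurable
qed

lemma polar_weak_grad: "is_weak_grad (half_ball (0, 0) r) w grad_x grad_y"
  unfolding is_weak_grad_def
proof (intro conjI allI impI)
  have gx: "grad_x (polar_map q) = (2 * fst (polar_map q)) *\<^sub>R R q + (1 / snd (polar_map q)) *\<^sub>R A q"
    and gy: "grad_y (polar_map q) = (2 * snd (polar_map q)) *\<^sub>R R q + (- fst (polar_map q) / (snd (polar_map q))\<^sup>2) *\<^sub>R A q" if "0 < fst q" for q
    by (simp_all add: grad_x_def grad_y_def polar_inv_map[OF that])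
  have c: "continuous_on ({0<..<r\<^sup>2} \<times> UNIV) polar_map"
    by (rule continuous_on_subset[OF polar_map_continuous]) auto
  have nz: "snd (polar_map q) \<noteq> 0" if "q \<in> {0<..} \<times> UNIV" for q
    using that snd_polar_map_pos[of q] by (auto simp del: snd_polar_map_pos)
  have nz': "snd (polar_map q) \<noteq> 0" if "q \<in> {0<..<r\<^sup>2} \<times> UNIV" for q
    using nz[of q] that by (auto simp: mem_Times_iff)
  show "locally_integrable_on (half_ball (0, 0) r) w"
    by (rule locally_integrable_polar_inv[OF r U w mw])
  show "locally_integrable_on (half_ball (0, 0) r) grad_x"
  proof (rule locally_integrable_polar_inv[OF r _ gx grad_measurable(1)])
    show "rect_integrable {0<..<r\<^sup>2} UNIV (\<lambda>q. (2 * fst (polar_map q)) *\<^sub>R R q + (1 / snd (polar_map q)) *\<^sub>R A q)"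
    proof (intro rect_integrable_add rect_integrable_continuous_mult R A)
      show "continuous_on ({0<..<r\<^sup>2} \<times> UNIV) (\<lambda>q. 2 * fst (polar_map q))"
        "continuous_on ({0<..<r\<^sup>2} \<times> UNIV) (\<lambda>q. 1 / snd (polar_map q))"
        using c nz' by (auto intro!: continuous_intros)
    qed measurable
  qed
  show "locally_integrable_on (half_ball (0, 0) r) grad_y"
  proof (rule locally_integrable_polar_inv[OF r _ gy grad_measurable(2)])
    show "rect_integrable {0<..<r\<^sup>2} UNIV (\<lambda>q. (2 * snd (polar_map q)) *\<^sub>R R q + (- fst (polar_map q) / (snd (polar_map q))\<^sup>2) *\<^sub>R A q)"
    proof (intro rect_integrable_add rect_integrable_continuous_mult R A)
      show "continuous_on ({0<..<r\<^sup>2} \<times> UNIV) (\<lambda>q. 2 * snd (polar_map q))"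
        "continuous_on ({0<..<r\<^sup>2} \<times> UNIV) (\<lambda>q. - fst (polar_map q) / (snd (polar_map q))\<^sup>2)"
        using c nz' by (auto intro!: continuous_intros)
    qed measurable
  qed
  fix \<phi> assume t: "test_function (half_ball (0, 0) r) \<phi>"
  have pc: "continuous_on ({0<..} \<times> UNIV) (\<lambda>q. snd (polar_map q))"
    by (intro continuous_intros polar_map_continuous)
  have s2: "(snd (polar_map (\<sigma>, c)))\<^sup>2 = \<sigma> / (1 + c\<^sup>2)" "0 < snd (polar_map (\<sigma>, c))" if "0 < \<sigma>" for \<sigma> c
    using polar_coords(5)[of "(\<sigma>, c)"] that by simp_all
  show "(LINT p:half_ball (0, 0) r|lebesgue. (frechet_derivative \<phi> (at p) (1, 0) *\<^sub>R w p)) = - (LINT p:half_ball (0, 0) r|lebesgue. (\<phi> p *\<^sub>R grad_x p))"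
  \<comment> \<open>Here \<alpha> and \<beta> are \<open>polar_jac\<close> times the x-derivatives
    2x and 1/y of \<sigma> and c, rewritten with x = c y; \<gamma> is the \<sigma>-derivative of
    \<alpha>.\<close>
  proof (rule polar_green[OF t, where \<alpha> = "\<lambda>q. snd q * snd (polar_map q) / (1 + (snd q)\<^sup>2)" and \<beta> = "\<lambda>q. 1 / (2 * (snd (polar_map q) * (1 + (snd q)\<^sup>2)))"
        and \<gamma> = "\<lambda>q. snd q * (snd (polar_map q) / (2 * fst q)) / (1 + (snd q)\<^sup>2)"])
    show "continuous_on ({0<..} \<times> UNIV) (\<lambda>q. snd q * snd (polar_map q) / (1 + (snd q)\<^sup>2))"
      "continuous_on ({0<..} \<times> UNIV) (\<lambda>q. 1 / (2 * (snd (polar_map q) * (1 + (snd q)\<^sup>2))))"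
      "continuous_on ({0<..} \<times> UNIV) (\<lambda>q. snd q * (snd (polar_map q) / (2 * fst q)) / (1 + (snd q)\<^sup>2))"
      using pc nz by (auto intro!: continuous_intros)
    fix \<sigma> c :: real assume \<sigma>: "0 < \<sigma>"
    define k where "k = 1 + c\<^sup>2"
    define s where "s = snd (polar_map (\<sigma>, c))"
    have k: "k > 0" "c * c = k - 1" unfolding k_def by (simp, simp add: power2_eq_square)
    have s: "s * s = \<sigma> / k" "s > 0" using s2[OF \<sigma>, of c] by (simp_all add: s_def k_def power2_eq_square)
    note h = polar_height_derivs[OF \<sigma>, of c]
    show "((\<lambda>\<sigma>. snd (\<sigma>, c) * snd (polar_map (\<sigma>, c)) / (1 + (snd (\<sigma>, c))\<^sup>2)) has_real_derivative snd (\<sigma>, c) * (snd (polar_map (\<sigma>, c)) / (2 * fst (\<sigma>, c))) / (1 + (snd (\<sigma>, c))\<^sup>2)) (at \<sigma>)"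
      unfolding fst_conv snd_conv by (rule DERIV_cdivide[OF DERIV_cmult[OF h(1)]])
    have dk: "((\<lambda>c. 1 + c\<^sup>2) has_real_derivative 2 * c) (at c)" by (auto intro!: derivative_eq_intros)
    have d1: "((\<lambda>c. snd (polar_map (\<sigma>, c)) * (1 + c\<^sup>2)) has_real_derivative c * s) (at c)"
      by (rule DERIV_cong[OF DERIV_mult[OF h(2) dk]]) (use k in \<open>simp add: s_def[symmetric] k_def[symmetric]\<close>)
    have "((\<lambda>c. inverse 2 * inverse (snd (polar_map (\<sigma>, c)) * (1 + c\<^sup>2))) has_real_derivative inverse 2 * (- (inverse (s * k) * (c * s) * inverse (s * k)))) (at c)"
      using DERIV_cmult[OF DERIV_inverse'[OF d1], of "inverse 2"] s k by (simp add: s_def[symmetric] k_def[symmetric])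
    moreover have "inverse 2 * (- (inverse (s * k) * (c * s) * inverse (s * k))) = - (c * (s / (2 * \<sigma>)) / k)"
    proof -
      have "\<sigma> = s * s * k" using s k by simp
      then show ?thesis using s(2) k(1) by (simp add: field_simps)
    qed
    ultimately show "((\<lambda>c. 1 / (2 * (snd (polar_map (\<sigma>, c)) * (1 + (snd (\<sigma>, c))\<^sup>2)))) has_real_derivative - (snd (\<sigma>, c) * (snd (polar_map (\<sigma>, c)) / (2 * fst (\<sigma>, c))) / (1 + (snd (\<sigma>, c))\<^sup>2))) (at c)"
      by (simp add: s_def k_def inverse_eq_divide mult_ac)
    fix x y :: real
    have sk: "\<sigma> = s * s * k" using s k by simp
    show "(x * (c * (snd (polar_map (\<sigma>, c)) / (2 * \<sigma>))) + y * (snd (polar_map (\<sigma>, c)) / (2 * \<sigma>))) * (snd (\<sigma>, c) * snd (polar_map (\<sigma>, c)) / (1 + (snd (\<sigma>, c))\<^sup>2))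
        + (x * (snd (polar_map (\<sigma>, c)) / (1 + c\<^sup>2)) + y * (- c * snd (polar_map (\<sigma>, c)) / (1 + c\<^sup>2))) * (1 / (2 * (snd (polar_map (\<sigma>, c)) * (1 + (snd (\<sigma>, c))\<^sup>2))))
        = polar_jac (\<sigma>, c) * (fst (1, 0) * x + snd (1, 0) * y)"
    proof -
      have "(x * (c * (s / (2 * (s * s * k)))) + y * (s / (2 * (s * s * k)))) * (c * s / k) + (x * (s / k) + y * (- c * s / k)) * (1 / (2 * (s * k)))
        = x * (c * c + 1) / (2 * k * k)"
        using s(2) k(1) by (simp add: field_simps)
      also have "\<dots> = x / (2 * k)" using k by simp
      finally show ?thesis using \<sigma> unfolding fst_conv snd_conv polar_jac_def s_def[symmetric] k_def[symmetric] sk[symmetric] by simp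
    qed
  next
    fix q :: "real \<times> real" assume q: "0 < fst q"
    define s c where "s = snd (polar_map q)" and "c = snd q"
    define k where "k = 1 + c\<^sup>2"
    have k: "k > 0" and s: "s > 0" using q by (simp_all add: k_def s_def)
    show "(snd q * snd (polar_map q) / (1 + (snd q)\<^sup>2)) *\<^sub>R R q + (1 / (2 * (snd (polar_map q) * (1 + (snd q)\<^sup>2)))) *\<^sub>R A q = polar_jac q *\<^sub>R grad_x (polar_map q)"
    proof -
      have J: "polar_jac q = 1 / (2 * k)" using q by (simp add: polar_jac_def k_def c_def)
      have e1: "c * s / k = 1 / (2 * k) * (2 * (c * s))" by simp
      have e2: "1 / (2 * (s * k)) = 1 / (2 * k) * (1 / s)" by simp
      show ?thesis unfolding gx[OF q] J scaleR_add_right scaleR_scaleR polar_coords(4)[OF q] s_def[symmetric] k_def[symmetric] c_def[symmetric] e1 e2 ..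
    qed
  qed (use grad_measurable in measurable)
  show "(LINT p:half_ball (0, 0) r|lebesgue. (frechet_derivative \<phi> (at p) (0, 1) *\<^sub>R w p)) = - (LINT p:half_ball (0, 0) r|lebesgue. (\<phi> p *\<^sub>R grad_y p))"
  \<comment> \<open>Likewise \<open>polar_jac\<close> times the y-derivatives 2y and -x/y^2 =
    -c/y.\<close>
  proof (rule polar_green[OF t, where \<alpha> = "\<lambda>q. snd (polar_map q) / (1 + (snd q)\<^sup>2)" and \<beta> = "\<lambda>q. - snd q / (2 * (snd (polar_map q) * (1 + (snd q)\<^sup>2)))"
        and \<gamma> = "\<lambda>q. (snd (polar_map q) / (2 * fst q)) / (1 + (snd q)\<^sup>2)"])
    show "continuous_on ({0<..} \<times> UNIV) (\<lambda>q. snd (polar_map q) / (1 + (snd q)\<^sup>2))"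
      "continuous_on ({0<..} \<times> UNIV) (\<lambda>q. - snd q / (2 * (snd (polar_map q) * (1 + (snd q)\<^sup>2))))"
      "continuous_on ({0<..} \<times> UNIV) (\<lambda>q. (snd (polar_map q) / (2 * fst q)) / (1 + (snd q)\<^sup>2))"
      using pc nz by (auto intro!: continuous_intros)
    fix \<sigma> c :: real assume \<sigma>: "0 < \<sigma>"
    define k where "k = 1 + c\<^sup>2"
    define s where "s = snd (polar_map (\<sigma>, c))"
    have k: "k > 0" "c * c = k - 1" unfolding k_def by (simp, simp add: power2_eq_square)
    have s: "s * s = \<sigma> / k" "s > 0" using s2[OF \<sigma>, of c] by (simp_all add: s_def k_def power2_eq_square)
    have sk: "\<sigma> = s * s * k" using s k by simp
    note h = polar_height_derivs[OF \<sigma>, of c]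
    show "((\<lambda>\<sigma>. snd (polar_map (\<sigma>, c)) / (1 + (snd (\<sigma>, c))\<^sup>2)) has_real_derivative (snd (polar_map (\<sigma>, c)) / (2 * fst (\<sigma>, c))) / (1 + (snd (\<sigma>, c))\<^sup>2)) (at \<sigma>)"
      unfolding fst_conv snd_conv by (rule DERIV_cdivide[OF h(1)])
    have dk: "((\<lambda>c. 1 + c\<^sup>2) has_real_derivative 2 * c) (at c)" by (auto intro!: derivative_eq_intros)
    have d1: "((\<lambda>c. snd (polar_map (\<sigma>, c)) * (1 + c\<^sup>2)) has_real_derivative c * s) (at c)"
      by (rule DERIV_cong[OF DERIV_mult[OF h(2) dk]]) (use k in \<open>simp add: s_def[symmetric] k_def[symmetric]\<close>)
    have d2: "((\<lambda>c. inverse (snd (polar_map (\<sigma>, c)) * (1 + c\<^sup>2))) has_real_derivative - (inverse (s * k) * (c * s) * inverse (s * k))) (at c)"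
      using DERIV_inverse'[OF d1] s k by (simp add: s_def[symmetric] k_def[symmetric])
    have "((\<lambda>c. (- (1/2)) * (c * inverse (snd (polar_map (\<sigma>, c)) * (1 + c\<^sup>2)))) has_real_derivative
        (- (1/2)) * (c * (- (inverse (s * k) * (c * s) * inverse (s * k))) + 1 * inverse (s * k))) (at c)"
      using DERIV_cmult[OF DERIV_mult'[OF DERIV_ident d2], of "- (1/2)"] by (simp add: s_def[symmetric] k_def[symmetric])
    moreover have "(- (1/2)) * (c * (- (inverse (s * k) * (c * s) * inverse (s * k))) + 1 * inverse (s * k)) = - (s / (2 * \<sigma>) / k)"
    proof -
      have "(- (1/2)) * (c * (- (inverse (s * k) * (c * s) * inverse (s * k))) + 1 * inverse (s * k)) = (c * c - k) / (2 * s * k * k)"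
        using s(2) k(1) by (simp add: field_simps)
      also have "\<dots> = - (s / (2 * (s * s * k)) / k)" unfolding k(2) using s(2) k(1) by (simp add: field_simps)
      finally show ?thesis unfolding sk[symmetric] .
    qed
    ultimately have "((\<lambda>c. (- (1/2)) * (c * inverse (snd (polar_map (\<sigma>, c)) * (1 + c\<^sup>2)))) has_real_derivative - (s / (2 * \<sigma>) / k)) (at c)"
      by (simp only:)
    moreover have "(\<lambda>c. (- (1/2)) * (c * inverse (snd (polar_map (\<sigma>, c)) * (1 + c\<^sup>2)))) = (\<lambda>c. - c / (2 * (snd (polar_map (\<sigma>, c)) * (1 + c\<^sup>2))))"
      by (simp add: fun_eq_iff inverse_eq_divide)
    ultimately show "((\<lambda>c. - snd (\<sigma>, c) / (2 * (snd (polar_map (\<sigma>, c)) * (1 + (snd (\<sigma>, c))\<^sup>2)))) has_real_derivative - ((snd (polar_map (\<sigma>, c)) / (2 * fst (\<sigma>, c))) / (1 + (snd (\<sigma>, c))\<^sup>2))) (at c)"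
      by (simp only: fst_conv snd_conv s_def k_def)
    fix x y :: real
    show "(x * (c * (snd (polar_map (\<sigma>, c)) / (2 * \<sigma>))) + y * (snd (polar_map (\<sigma>, c)) / (2 * \<sigma>))) * (snd (polar_map (\<sigma>, c)) / (1 + (snd (\<sigma>, c))\<^sup>2))
        + (x * (snd (polar_map (\<sigma>, c)) / (1 + c\<^sup>2)) + y * (- c * snd (polar_map (\<sigma>, c)) / (1 + c\<^sup>2))) * (- snd (\<sigma>, c) / (2 * (snd (polar_map (\<sigma>, c)) * (1 + (snd (\<sigma>, c))\<^sup>2))))
        = polar_jac (\<sigma>, c) * (fst (0, 1) * x + snd (0, 1) * y)"
    proof -
      have "(x * (c * (s / (2 * (s * s * k)))) + y * (s / (2 * (s * s * k)))) * (s / k) + (x * (s / k) + y * (- c * s / k)) * (- c / (2 * (s * k)))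
        = y * (c * c + 1) / (2 * k * k)"
        using s(2) k(1) by (simp add: field_simps)
      also have "\<dots> = y / (2 * k)" using k by simp
      finally show ?thesis using \<sigma> unfolding fst_conv snd_conv polar_jac_def s_def[symmetric] k_def[symmetric] sk[symmetric] by simp
    qed
  next
    fix q :: "real \<times> real" assume q: "0 < fst q"
    define s c where "s = snd (polar_map q)" and "c = snd q"
    define k where "k = 1 + c\<^sup>2"
    have k: "k > 0" and s: "s > 0" using q by (simp_all add: k_def s_def)
    show "(snd (polar_map q) / (1 + (snd q)\<^sup>2)) *\<^sub>R R q + (- snd q / (2 * (snd (polar_map q) * (1 + (snd q)\<^sup>2)))) *\<^sub>R A q = polar_jac q *\<^sub>R grad_y (polar_map q)"
    proof -
      have J: "polar_jac q = 1 / (2 * k)" using q by (simp add: polar_jac_def k_def c_def)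
      have e1: "s / k = 1 / (2 * k) * (2 * s)" by simp
      have e2: "- c / (2 * (s * k)) = 1 / (2 * k) * (- (c * s) / s\<^sup>2)" using s by (simp add: power2_eq_square)
      show ?thesis unfolding gy[OF q] J scaleR_add_right scaleR_scaleR polar_coords(4)[OF q] s_def[symmetric] k_def[symmetric] c_def[symmetric] e1 e2 ..
    qed
  qed (use grad_measurable in measurable)
qed

text \<open>Pointwise, the Cartesian gradient just built converts back to R and A, so the energy of
  a glued map can be read off piece by piece in the strip.\<close>

lemma polar_radial_grad:
  assumes q: "0 < fst q"
  shows "polar_radial grad_x grad_y q = R q" "polar_angular grad_x grad_y q = A q"
proof -
  define x y \<sigma> k where d: "x = fst (polar_map q)" "y = snd (polar_map q)" "\<sigma> = fst q" "k = 1 + (snd q)\<^sup>2"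
  have p: "y > 0" "\<sigma> > 0" "k > 0" "x * x + y * y = \<sigma>" "y * y * k = \<sigma>"
    using polar_coords[OF q] q by (simp_all add: d power2_eq_square[symmetric])
  have "polar_radial grad_x grad_y q = ((x / (2 * \<sigma>)) * (2 * x) + (y / (2 * \<sigma>)) * (2 * y)) *\<^sub>R R q + ((x / (2 * \<sigma>)) * (1 / y) + (y / (2 * \<sigma>)) * (- x / y\<^sup>2)) *\<^sub>R A q"
    unfolding polar_radial_def grad_x_def grad_y_def polar_inv_map[OF q] d[symmetric] scaleR_add_right scaleR_add_left scaleR_scaleR by (simp only: add_ac)
  moreover have "(x / (2 * \<sigma>)) * (2 * x) + (y / (2 * \<sigma>)) * (2 * y) = (x * x + y * y) / \<sigma>" by (simp add: add_divide_distrib)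
  moreover have "(x / (2 * \<sigma>)) * (1 / y) + (y / (2 * \<sigma>)) * (- x / y\<^sup>2) = 0" using p(1,2) by (simp add: power2_eq_square field_simps)
  ultimately show "polar_radial grad_x grad_y q = R q" using p by simp
  have "polar_angular grad_x grad_y q = ((y / k) * (2 * x) + (- x / k) * (2 * y)) *\<^sub>R R q + ((y / k) * (1 / y) + (- x / k) * (- x / y\<^sup>2)) *\<^sub>R A q"
    unfolding polar_angular_def grad_x_def grad_y_def polar_inv_map[OF q] d[symmetric] scaleR_add_right scaleR_add_left scaleR_scaleR by (simp only: add_ac)
  moreover have "(y / k) * (2 * x) + (- x / k) * (2 * y) = 0" by simp
  moreover have "(y / k) * (1 / y) + (- x / k) * (- x / y\<^sup>2) = (x * x + y * y) / (y * y * k)" using p(1,3) by (simp add: power2_eq_square field_simps)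
  ultimately show "polar_angular grad_x grad_y q = A q" using p by simp
qed

end

section \<open>Short curves in a submanifold\<close>

text \<open>Smoothness is expressed through partial derivatives, so continuity of operator norms is
  obtained from the images of the basis vectors.\<close>

lemma linear_norm_bound_Basis:
  fixes D :: "'a::euclidean_space \<Rightarrow> 'b::real_normed_vector"
  assumes "linear D"
  shows "norm (D h) \<le> (\<Sum>b\<in>Basis. norm (D b)) * norm h"
proof -
  have "D h = D (\<Sum>b\<in>Basis. (h \<bullet> b) *\<^sub>R b)" by (simp add: euclidean_representation)
  also have "\<dots> = (\<Sum>b\<in>Basis. (h \<bullet> b) *\<^sub>R D b)" by (simp add: linear_sum[OF assms] linear_scale[OF assms])
  finally have "norm (D h) \<le> (\<Sum>b\<in>Basis. norm ((h \<bullet> b) *\<^sub>R D b))"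
    using norm_sum[of "\<lambda>b. (h \<bullet> b) *\<^sub>R D b" Basis] by simp
  also have "\<dots> \<le> (\<Sum>b\<in>Basis. norm (D b) * norm h)"
  proof (rule sum_mono)
    fix b :: 'a assume "b \<in> Basis"
    then have "\<bar>h \<bullet> b\<bar> * norm (D b) \<le> norm h * norm (D b)" by (intro mult_right_mono Basis_le_norm) auto
    then show "norm ((h \<bullet> b) *\<^sub>R D b) \<le> norm (D b) * norm h" by (simp add: mult.commute)
  qed
  finally show ?thesis by (simp add: sum_distrib_right)
qed

lemma smooth_on_partials:
  assumes "smooth_on S f"
  shows "x \<in> S \<Longrightarrow> (f has_derivative frechet_derivative f (at x)) (at x)"
    and "b \<in> Basis \<Longrightarrow> continuous_on S (\<lambda>x. frechet_derivative f (at x) b)"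
proof -
  have "Ck_on (Suc 0) S f" using assms unfolding smooth_on_def by blast
  then show "x \<in> S \<Longrightarrow> (f has_derivative frechet_derivative f (at x)) (at x)"
    "b \<in> Basis \<Longrightarrow> continuous_on S (\<lambda>x. frechet_derivative f (at x) b)"
    by (auto simp: frechet_derivative_works)
qed

text \<open>The bound by \<tau> is relative to the length of the chord, which is the form in which
  the bending of N enters the energy estimate. Continuity on the whole line serves measurability of
  compositions; membership in N and the derivative concern [0, 1] only.\<close>

definition short_curve :: "(real^'d) set \<Rightarrow> real \<Rightarrow> real^'d \<Rightarrow> real^'d \<Rightarrow> (real \<Rightarrow> real^'d) \<Rightarrow> (real \<Rightarrow> real^'d) \<Rightarrow> bool" where
  "short_curve N \<tau> p q G G' \<longleftrightarrow> G 0 = p \<and> G 1 = q \<and> continuous_on UNIV G \<and> continuous_on UNIV G' \<and>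
    (\<forall>t\<in>{0..1}. G t \<in> N \<and> (G has_vector_derivative G' t) (at t within {0..1}) \<and> norm (G' t - (q - p)) \<le> \<tau> * norm (q - p))"

text \<open>The curve and its velocity are composed with the projection of the line onto [0, 1], so
  both continue constantly.\<close>

lemma short_curve_clamp:
  assumes "\<gamma> 0 = p" "\<gamma> 1 = q" and c: "continuous_on {0..1} \<gamma>'"
    and \<gamma>: "\<And>t. t \<in> {0..1} \<Longrightarrow> \<gamma> t \<in> N" "\<And>t. t \<in> {0..1} \<Longrightarrow> (\<gamma> has_vector_derivative \<gamma>' t) (at t within {0..1})"
      "\<And>t. t \<in> {0..1} \<Longrightarrow> norm (\<gamma>' t - (q - p)) \<le> \<tau> * norm (q - p)"
  shows "\<exists>G G'. short_curve N \<tau> p q G G'"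
proof -
  define cl :: "real \<Rightarrow> real" where "cl t = max 0 (min 1 t)" for t
  have cl: "cl t \<in> {0..1}" for t by (simp add: cl_def)
  have cl_id: "t \<in> {0..1} \<Longrightarrow> cl t = t" for t by (simp add: cl_def)
  have ccl: "continuous_on UNIV cl" unfolding cl_def[abs_def] by (intro continuous_intros)
  have cg: "continuous_on {0..1} \<gamma>"
    using \<gamma>(2) by (intro continuous_on_vector_derivative[of "{0..1}" \<gamma> \<gamma>']) auto
  have "short_curve N \<tau> p q (\<lambda>t. \<gamma> (cl t)) (\<lambda>t. \<gamma>' (cl t))"
    unfolding short_curve_def
  proof (intro conjI ballI)
    show "continuous_on UNIV (\<lambda>t. \<gamma> (cl t))" by (rule continuous_on_compose2[OF cg ccl]) (use cl in auto)
    show "continuous_on UNIV (\<lambda>t. \<gamma>' (cl t))" by (rule continuous_on_compose2[OF c ccl]) (use cl in auto)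
    fix t :: real assume t: "t \<in> {0..1}"
    show "((\<lambda>t. \<gamma> (cl t)) has_vector_derivative \<gamma>' (cl t)) (at t within {0..1})"
      unfolding cl_id[OF t] by (rule has_vector_derivative_transform[OF t, of _ \<gamma>]) (use \<gamma>(2) t cl_id in auto)
  qed (use assms cl cl_id in auto)
  then show ?thesis by blast
qed

text \<open>The curve is the preimage of a segment in a flattening chart, traversed at constant
  speed there. Near \<open>p0\<close> the derivative of \<psi> is almost constant, so the velocity
  is almost constant, and q - p is its mean.\<close>

lemma submanifold_short_curves_local:
  fixes N :: "(real^'d) set"
  assumes N: "smooth_submanifold N" and p0: "p0 \<in> N" and \<tau>: "0 < \<tau>"
  shows "\<exists>\<rho>>0. \<forall>p\<in>N \<inter> ball p0 \<rho>. \<forall>q\<in>N \<inter> ball p0 \<rho>. \<exists>G G'. short_curve N \<tau> p q G G'"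
proof -
  from bspec[OF N[unfolded smooth_submanifold_def] p0]
  obtain U V and \<phi> \<psi> :: "real^'d \<Rightarrow> real^'d" and L where UV0: "open U \<and> p0 \<in> U \<and> open V \<and> smooth_on U \<phi> \<and> smooth_on V \<psi> \<and>
      \<phi> ` U = V \<and> (\<forall>x\<in>U. \<psi> (\<phi> x) = x) \<and> (\<forall>z\<in>V. \<phi> (\<psi> z) = z) \<and> \<phi> ` (N \<inter> U) = {z\<in>V. \<forall>i. i \<notin> L \<longrightarrow> z $ i = 0}"
    by (elim exE) (rule that)
  then have UV: "open U" "p0 \<in> U" "open V" "smooth_on U \<phi>" "smooth_on V \<psi>" "\<phi> ` U = V" "\<forall>x\<in>U. \<psi> (\<phi> x) = x"
      "\<phi> ` (N \<inter> U) = {z\<in>V. \<forall>i. i \<notin> L \<longrightarrow> z $ i = 0}"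
    by - (elim conjE, assumption)+
  note d\<phi> = smooth_on_partials[OF UV(4)] and d\<psi> = smooth_on_partials[OF UV(5)]
  define z0 where "z0 = \<phi> p0"
  have z0: "z0 \<in> V" using UV z0_def by auto
  define S where "S x = (\<Sum>b\<in>Basis. norm (frechet_derivative \<phi> (at x) b))" for x
  define \<Lambda> where "\<Lambda> = S p0 + 1"
  have \<Lambda>: "0 < \<Lambda>" unfolding \<Lambda>_def S_def by (intro add_nonneg_pos sum_nonneg) auto
  have cS: "continuous_on U S" unfolding S_def by (intro continuous_intros d\<phi>(2))
  then have "isCont S p0" using UV continuous_on_eq_continuous_at by blast
  then obtain e1 where e1: "0 < e1" "\<And>x. dist x p0 < e1 \<Longrightarrow> dist (S x) (S p0) < 1"
    unfolding continuous_at_eps_delta by (meson zero_less_one)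
  obtain e2 where e2: "0 < e2" "ball p0 e2 \<subseteq> U" using UV open_contains_ball by metis
  define \<rho>1 where "\<rho>1 = min e1 e2"
  have \<rho>1: "0 < \<rho>1" "ball p0 \<rho>1 \<subseteq> U" using e1 e2 by (auto simp: \<rho>1_def)
  have lip: "norm (\<phi> x - \<phi> y) \<le> \<Lambda> * norm (x - y)" if "x \<in> ball p0 \<rho>1" "y \<in> ball p0 \<rho>1" for x y
  proof (rule differentiable_bound[where S = "ball p0 \<rho>1" and f' = "\<lambda>x. frechet_derivative \<phi> (at x)"])
    fix x assume x: "x \<in> ball p0 \<rho>1"
    then have xU: "x \<in> U" using \<rho>1 by auto
    show "(\<phi> has_derivative frechet_derivative \<phi> (at x)) (at x within ball p0 \<rho>1)"
      using d\<phi>(1)[OF xU] has_derivative_at_withinI by blast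
    have "dist x p0 < e1" using x by (simp add: \<rho>1_def dist_commute)
    then have S: "S x \<le> \<Lambda>" using e1(2)[of x] by (simp add: \<Lambda>_def dist_real_def)
    show "onorm (frechet_derivative \<phi> (at x)) \<le> \<Lambda>"
    proof (rule onorm_le)
      fix h
      have "norm (frechet_derivative \<phi> (at x) h) \<le> S x * norm h"
        unfolding S_def by (rule linear_norm_bound_Basis[OF has_derivative_linear[OF d\<phi>(1)[OF xU]]])
      also have "\<dots> \<le> \<Lambda> * norm h" using S by (intro mult_right_mono) auto
      finally show "norm (frechet_derivative \<phi> (at x) h) \<le> \<Lambda> * norm h" .
    qed
  qed (use that in auto)
  \<comment> \<open>Chosen so that 2 \<kappa> \<Lambda> = \<tau>: one \<kappa> for the velocity and
    one for q - p, each compared with the same vector D\<psi>(z0) \<Delta>, and \<Lambda> to return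
    from the chart increment \<Delta> to q - p.\<close>
  define \<kappa> where "\<kappa> = \<tau> / (2 * \<Lambda>)"
  have \<kappa>: "0 < \<kappa>" using \<tau> \<Lambda> by (simp add: \<kappa>_def)
  define M where "M z = (\<Sum>b\<in>Basis. norm (frechet_derivative \<psi> (at z) b - frechet_derivative \<psi> (at z0) b))" for z
  have "continuous_on V M" unfolding M_def by (intro continuous_intros d\<psi>(2))
  then have "isCont M z0" using UV z0 continuous_on_eq_continuous_at by blast
  moreover have "M z0 = 0" by (simp add: M_def)
  ultimately obtain e3 where e3: "0 < e3" "\<And>z. dist z z0 < e3 \<Longrightarrow> dist (M z) 0 < \<kappa>"
    unfolding continuous_at_eps_delta using \<kappa> by metis
  obtain e4 where e4: "0 < e4" "ball z0 e4 \<subseteq> V" using UV z0 open_contains_ball by metis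
  define \<delta> where "\<delta> = min e3 e4"
  have \<delta>: "0 < \<delta>" "ball z0 \<delta> \<subseteq> V" using e3 e4 by (auto simp: \<delta>_def)
  have M: "M z \<le> \<kappa>" if "z \<in> ball z0 \<delta>" for z
    using e3(2)[of z] that by (simp add: \<delta>_def dist_commute dist_real_def)
  define \<rho> where "\<rho> = min \<rho>1 (\<delta> / \<Lambda>)"
  have \<rho>: "0 < \<rho>" using \<rho>1 \<delta> \<Lambda> by (simp add: \<rho>_def)
  have inb: "\<phi> p \<in> ball z0 \<delta>" if "p \<in> ball p0 \<rho>" for p
  proof -
    have "norm (\<phi> p - \<phi> p0) \<le> \<Lambda> * norm (p - p0)" using that \<rho> by (intro lip) (auto simp: \<rho>_def)
    also have "\<dots> < \<Lambda> * (\<delta> / \<Lambda>)" using that \<Lambda> by (intro mult_strict_left_mono) (auto simp: \<rho>_def dist_norm norm_minus_commute)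
    also have "\<dots> = \<delta>" using \<Lambda> by simp
    finally show ?thesis by (simp add: z0_def dist_norm norm_minus_commute)
  qed
  show ?thesis
  proof (intro exI[of _ \<rho>] conjI \<rho> ballI)
    fix p q assume p: "p \<in> N \<inter> ball p0 \<rho>" and q: "q \<in> N \<inter> ball p0 \<rho>"
    define \<Delta> where "\<Delta> = \<phi> q - \<phi> p"
    define z where "z t = \<phi> p + t *\<^sub>R \<Delta>" for t :: real
    define \<gamma> where "\<gamma> t = \<psi> (z t)" for t
    define \<gamma>' where "\<gamma>' t = frechet_derivative \<psi> (at (z t)) \<Delta>" for t
    have U: "p \<in> U" "q \<in> U" using p q \<rho>1 by (auto simp: \<rho>_def)
    have zb: "z t \<in> ball z0 \<delta>" if "t \<in> {0..1}" for t
    proof -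
      have "z t = (1 - t) *\<^sub>R \<phi> p + t *\<^sub>R \<phi> q" by (simp add: z_def \<Delta>_def algebra_simps)
      then show ?thesis using convexD[OF convex_ball inb inb, of p q "1 - t" t] p q that by auto
    qed
    then have zV: "z t \<in> V" if "t \<in> {0..1}" for t using \<delta> that by blast
    have zd: "(z has_vector_derivative \<Delta>) (at t within {0..1})" for t
      unfolding z_def by (auto intro!: derivative_eq_intros)
    have \<gamma>d: "(\<gamma> has_vector_derivative \<gamma>' t) (at t within {0..1})" if t: "t \<in> {0..1}" for t
    proof -
      have "(\<psi> has_derivative frechet_derivative \<psi> (at (z t))) (at (z t))" using d\<psi>(1)[OF zV[OF t]] .
      from has_derivative_compose[OF zd[unfolded has_vector_derivative_def] this]
      show ?thesis
        unfolding \<gamma>_def \<gamma>'_def has_vector_derivative_def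
        by (rule has_derivative_eq_rhs) (simp add: fun_eq_iff linear_scale[OF has_derivative_linear[OF d\<psi>(1)[OF zV[OF t]]]])
    qed
    let ?d = "frechet_derivative \<psi> (at z0) \<Delta>"
    have close: "norm (\<gamma>' t - ?d) \<le> \<kappa> * norm \<Delta>" if t: "t \<in> {0..1}" for t
    proof -
      have "linear (\<lambda>h. frechet_derivative \<psi> (at (z t)) h - frechet_derivative \<psi> (at z0) h)"
        by (intro linear_compose_sub has_derivative_linear[OF d\<psi>(1)[OF zV[OF t]]] has_derivative_linear[OF d\<psi>(1)[OF z0]])
      from linear_norm_bound_Basis[OF this, of \<Delta>]
      have "norm (\<gamma>' t - ?d) \<le> M (z t) * norm \<Delta>" by (simp add: \<gamma>'_def M_def)
      also have "\<dots> \<le> \<kappa> * norm \<Delta>" using M[OF zb[OF t]] by (intro mult_right_mono) auto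
      finally show ?thesis .
    qed
    have ends: "\<gamma> 0 = p" "\<gamma> 1 = q" using UV U by (auto simp: \<gamma>_def z_def \<Delta>_def)
    \<comment> \<open>Mean value inequality for \<gamma>(t) - t D\<psi>(z0) \<Delta>, whose
      increment over [0, 1] is the vector to be estimated.\<close>
    have mv: "norm ((q - p) - ?d) \<le> \<kappa> * norm \<Delta>"
    proof -
      define f where "f t = \<gamma> t - t *\<^sub>R ?d" for t
      have "norm (f 1 - f 0) \<le> \<kappa> * norm \<Delta> * norm (1 - 0 :: real)"
      proof (rule differentiable_bound[where S = "{0..1}" and f' = "\<lambda>t h. h *\<^sub>R (\<gamma>' t - ?d)"])
        fix t :: real assume t: "t \<in> {0..1}"
        show "(f has_derivative (\<lambda>h. h *\<^sub>R (\<gamma>' t - ?d))) (at t within {0..1})"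
          unfolding f_def using \<gamma>d[OF t] unfolding has_vector_derivative_def
          by (auto intro!: derivative_eq_intros simp: algebra_simps)
        show "onorm (\<lambda>h. h *\<^sub>R (\<gamma>' t - ?d)) \<le> \<kappa> * norm \<Delta>"
          by (rule onorm_le) (use close[OF t] in \<open>auto simp: mult.commute intro!: mult_left_mono\<close>)
      qed auto
      then show ?thesis using ends by (simp add: f_def algebra_simps)
    qed
    have \<Delta>b: "norm \<Delta> \<le> \<Lambda> * norm (q - p)"
      unfolding \<Delta>_def using p q by (intro lip) (auto simp: \<rho>_def)
    have bound: "norm (\<gamma>' t - (q - p)) \<le> \<tau> * norm (q - p)" if t: "t \<in> {0..1}" for t
    proof -
      have "norm (\<gamma>' t - (q - p)) \<le> norm (\<gamma>' t - ?d) + norm ((q - p) - ?d)"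
        using norm_triangle_ineq4[of "\<gamma>' t - ?d" "(q - p) - ?d"] by (simp add: algebra_simps)
      also have "\<dots> \<le> 2 * \<kappa> * norm \<Delta>" using close[OF t] mv by simp
      also have "\<dots> \<le> 2 * \<kappa> * (\<Lambda> * norm (q - p))" using \<Delta>b \<kappa> by (intro mult_left_mono) auto
      also have "\<dots> = \<tau> * norm (q - p)" using \<Lambda> by (simp add: \<kappa>_def)
      finally show ?thesis .
    qed
    \<comment> \<open>The flattened N is the part of a coordinate subspace inside V. The segment
      stays in the subspace by linearity, and in V because it stays in a ball, which is
      convex.\<close>
    have inN: "\<gamma> t \<in> N" if t: "t \<in> {0..1}" for t
    proof -
      have "\<phi> p \<in> \<phi> ` (N \<inter> U)" "\<phi> q \<in> \<phi> ` (N \<inter> U)" using p q U by auto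
      then have "\<forall>i. i \<notin> L \<longrightarrow> z t $ i = 0" unfolding UV(8) by (simp add: z_def \<Delta>_def)
      then have "z t \<in> \<phi> ` (N \<inter> U)" unfolding UV(8) using zV[OF t] by simp
      then obtain x where "x \<in> N \<inter> U" "z t = \<phi> x" by auto
      then show ?thesis using UV(7) by (simp add: \<gamma>_def)
    qed
    have c\<gamma>': "continuous_on {0..1} \<gamma>'"
    proof -
      have cz: "continuous_on {0..1} z" unfolding z_def by (intro continuous_intros)
      have "continuous_on {0..1} (\<lambda>t. \<Sum>b\<in>Basis. (\<Delta> \<bullet> b) *\<^sub>R frechet_derivative \<psi> (at (z t)) b)"
        by (intro continuous_intros continuous_on_compose2[OF d\<psi>(2) cz]) (use zV in auto)
      moreover have "(\<Sum>b\<in>Basis. (\<Delta> \<bullet> b) *\<^sub>R frechet_derivative \<psi> (at (z t)) b) = \<gamma>' t" if "t \<in> {0..1}" for t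
      proof -
        have l: "linear (frechet_derivative \<psi> (at (z t)))" by (rule has_derivative_linear[OF d\<psi>(1)[OF zV[OF that]]])
        have "\<gamma>' t = frechet_derivative \<psi> (at (z t)) (\<Sum>b\<in>Basis. (\<Delta> \<bullet> b) *\<^sub>R b)" by (simp add: \<gamma>'_def euclidean_representation)
        then show ?thesis by (simp add: linear_sum[OF l] linear_scale[OF l])
      qed
      ultimately show ?thesis by (rule continuous_on_eq)
    qed
    show "\<exists>G G'. short_curve N \<tau> p q G G'"
      by (rule short_curve_clamp[OF ends c\<gamma>' inN \<gamma>d bound])
  qed
qed

text \<open>A Lebesgue number of the cover of N by the local balls: two points of N closer than this
  lie in a common ball.\<close>

lemma submanifold_short_curves:
  fixes N :: "(real^'d) set"
  assumes "compact N" "smooth_submanifold N" "0 < \<tau>"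
  shows "\<exists>\<rho>>0. \<forall>p\<in>N. \<forall>q\<in>N. norm (q - p) < \<rho> \<longrightarrow> (\<exists>G G'. short_curve N \<tau> p q G G')"
proof -
  define good where "good p q \<longleftrightarrow> (\<exists>G G'. short_curve N \<tau> p q G G')" for p q
  have "\<forall>p0\<in>N. \<exists>\<rho>>0. \<forall>p\<in>N \<inter> ball p0 \<rho>. \<forall>q\<in>N \<inter> ball p0 \<rho>. good p q"
    using submanifold_short_curves_local[OF assms(2) _ assms(3)] unfolding good_def by blast
  then obtain \<rho> where \<rho>: "\<And>p0. p0 \<in> N \<Longrightarrow> 0 < \<rho> p0" "\<And>p0 p q. p0 \<in> N \<Longrightarrow> p \<in> N \<inter> ball p0 (\<rho> p0) \<Longrightarrow> q \<in> N \<inter> ball p0 (\<rho> p0) \<Longrightarrow> good p q"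
    by metis
  obtain e where e: "0 < e" "\<And>x. x \<in> N \<Longrightarrow> \<exists>G \<in> (\<lambda>p. ball p (\<rho> p)) ` N. ball x e \<subseteq> G"
  proof (rule Heine_Borel_lemma[OF assms(1), of "(\<lambda>p. ball p (\<rho> p)) ` N"])
    show "N \<subseteq> \<Union> ((\<lambda>p. ball p (\<rho> p)) ` N)" using \<rho>(1) by auto
  qed auto
  have "good p q" if pq: "p \<in> N" "q \<in> N" "norm (q - p) < e" for p q
  proof -
    obtain p0 where p0: "p0 \<in> N" "ball p e \<subseteq> ball p0 (\<rho> p0)" using e(2)[OF pq(1)] by auto
    have "p \<in> ball p e" "q \<in> ball p e" using pq e(1) by (auto simp: dist_norm norm_minus_commute)
    then show ?thesis using \<rho>(2)[OF p0(1)] p0(2) pq by blast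
  qed
  then show ?thesis using e(1) unfolding good_def by blast
qed

section \<open>Slices and their ends\<close>

text \<open>For |c| >= 1 the integrand is at most |c|^(-2b), integrable at infinity since 2b > 1. It
  is applied with b = 1 - a/2, where the condition reads a < 1.\<close>

lemma nn_integral_powr_one_plus_sq_finite:
  fixes b :: real
  assumes "1/2 < b"
  shows "(\<integral>\<^sup>+c. ennreal ((1 + c\<^sup>2) powr (- b)) \<partial>lborel) < \<infinity>"
proof -
  have tail: "(\<integral>\<^sup>+c. ennreal (c powr (- 2 * b)) * indicator {1..} c \<partial>lborel) = ennreal (1 / (2 * b - 1))"
  proof -
    have "(\<integral>\<^sup>+c. ennreal (c powr (- 2 * b)) * indicator {1..} c \<partial>lborel) = ennreal (0 - (- (1 powr (1 - 2 * b)) / (2 * b - 1)))"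
    proof (rule nn_integral_FTC_atLeast[where F = "\<lambda>c. - (c powr (1 - 2 * b)) / (2 * b - 1)"])
      show "((\<lambda>c. - (c powr (1 - 2 * b)) / (2 * b - 1)) has_real_derivative x powr (- 2 * b)) (at x)" if "1 \<le> x" for x
      proof -
        have "((\<lambda>c. c powr (1 - 2 * b)) has_real_derivative (1 - 2 * b) * x powr (1 - 2 * b - 1)) (at x)"
          using that by (intro has_real_derivative_powr) simp
        from DERIV_cdivide[OF DERIV_minus[OF this], of "2 * b - 1"] show ?thesis
          by (rule DERIV_cong) (use assms in \<open>simp add: divide_eq_eq algebra_simps\<close>)
      qed
      have "((\<lambda>c::real. c powr (1 - 2 * b)) \<longlongrightarrow> 0) at_top"
        by (rule tendsto_neg_powr) (use assms filterlim_ident in auto)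
      from tendsto_divide[OF tendsto_minus[OF this] tendsto_const, of "2 * b - 1"]
      show "((\<lambda>c. - (c powr (1 - 2 * b)) / (2 * b - 1)) \<longlongrightarrow> 0) at_top" using assms by simp
    qed auto
    then show ?thesis by simp
  qed
  have tail': "(\<integral>\<^sup>+c. ennreal ((- c) powr (- 2 * b)) * indicator {1..} (- c) \<partial>lborel) = ennreal (1 / (2 * b - 1))"
  proof -
    have "(\<integral>\<^sup>+c. ennreal (c powr (- 2 * b)) * indicator {1..} c \<partial>lborel) = \<bar>-1::real\<bar> * (\<integral>\<^sup>+c. ennreal ((0 + (-1) * c) powr (- 2 * b)) * indicator {1..} (0 + (-1) * c) \<partial>lborel)"
      by (rule nn_integral_real_affine) auto
    then show ?thesis using tail by simp
  qed
  have split: "(\<integral>\<^sup>+c. ennreal (c powr (- 2 * b)) * indicator {1..} c + ennreal ((- c) powr (- 2 * b)) * indicator {1..} (- c) \<partial>lborel)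
      = (\<integral>\<^sup>+c. ennreal (c powr (- 2 * b)) * indicator {1..} c \<partial>lborel) + (\<integral>\<^sup>+c. ennreal ((- c) powr (- 2 * b)) * indicator {1..} (- c) \<partial>lborel)"
    by (subst nn_integral_add) auto
  have "(\<integral>\<^sup>+c. ennreal ((1 + c\<^sup>2) powr (- b)) \<partial>lborel)
      \<le> (\<integral>\<^sup>+c. indicator {-1..1} c + (ennreal (c powr (- 2 * b)) * indicator {1..} c + ennreal ((- c) powr (- 2 * b)) * indicator {1..} (- c)) \<partial>lborel)"
  proof (rule nn_integral_mono)
    fix c :: real
    have big: "(1 + c\<^sup>2) powr (- b) \<le> \<bar>c\<bar> powr (- 2 * b)" if "1 \<le> \<bar>c\<bar>"
    proof -
      have "(1 + c\<^sup>2) powr (- b) \<le> (c\<^sup>2) powr (- b)" using assms that by (intro powr_mono2') auto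
      also have "(c\<^sup>2) powr (- b) = \<bar>c\<bar> powr (- 2 * b)"
      proof -
        have "c\<^sup>2 = \<bar>c\<bar> powr 2" using that by (simp add: powr_numeral)
        then have "(c\<^sup>2) powr (- b) = \<bar>c\<bar> powr (2 * (- b))" by (simp only: powr_powr)
        then show ?thesis by simp
      qed
      finally show ?thesis .
    qed
    have small: "(1 + c\<^sup>2) powr (- b) \<le> 1"
      using assms powr_mono2'[of "- b" 1 "1 + c\<^sup>2"] by simp
    consider "\<bar>c\<bar> \<le> 1" | "1 < c" | "c < -1" by linarith
    then show "ennreal ((1 + c\<^sup>2) powr (- b)) \<le> indicator {-1..1} c + (ennreal (c powr (- 2 * b)) * indicator {1..} c + ennreal ((- c) powr (- 2 * b)) * indicator {1..} (- c))"
    proof cases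
      case 1
      then have "ennreal ((1 + c\<^sup>2) powr (- b)) \<le> indicator {-1..1} c" using small by (auto simp: indicator_def)
      then show ?thesis by (rule order_trans) simp
    next
      case 2
      then have "ennreal ((1 + c\<^sup>2) powr (- b)) \<le> ennreal (c powr (- 2 * b))" using big by (intro ennreal_leI) auto
      then show ?thesis using 2 by simp
    next
      case 3
      then have "ennreal ((1 + c\<^sup>2) powr (- b)) \<le> ennreal ((- c) powr (- 2 * b))" using big by (intro ennreal_leI) auto
      then show ?thesis using 3 by simp
    qed
  qed
  also have "\<dots> = (\<integral>\<^sup>+c. indicator {-1..1::real} c \<partial>lborel) + (\<integral>\<^sup>+c. ennreal (c powr (- 2 * b)) * indicator {1..} c + ennreal ((- c) powr (- 2 * b)) * indicator {1..} (- c) \<partial>lborel)"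
    by (subst nn_integral_add) auto
  also have "\<dots> < \<infinity>" unfolding split tail tail' by (simp add: emeasure_lborel_Icc_eq)
  finally show ?thesis .
qed

text \<open>Cauchy-Schwarz with the weights (1 + c^2)^(b/2) and (1 + c^2)^(-b/2). For b = 1 - a/2
  the number e is the angular energy of a slice, so a slice of finite energy has finite length and
  therefore limits at both ends.\<close>

lemma weighted_slice_L1:
  fixes f :: "real \<Rightarrow> 'b::{banach, second_countable_topology}" and b e C0 :: real
  assumes [measurable]: "f \<in> borel_measurable borel" and C0: "(\<integral>\<^sup>+c. ennreal ((1 + c\<^sup>2) powr (- b)) \<partial>lborel) = ennreal C0" "0 \<le> C0"
    and e: "(\<integral>\<^sup>+c. ennreal ((1 + c\<^sup>2) powr b * (norm (f c))\<^sup>2) \<partial>lborel) = ennreal e" "0 \<le> e"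
  shows "integrable lborel f" "(\<integral>c. norm (f c) \<partial>lborel)\<^sup>2 \<le> C0 * e"
proof -
  let ?g = "\<lambda>c. ennreal ((1 + c\<^sup>2) powr (b / 2) * norm (f c))" and ?h = "\<lambda>c :: real. ennreal ((1 + c\<^sup>2) powr (- b / 2))"
  have g: "?g c * ?h c = ennreal (norm (f c))" for c
    by (simp add: ennreal_mult[symmetric] powr_add[symmetric])
  have g2: "(?g c)\<^sup>2 = ennreal ((1 + c\<^sup>2) powr b * (norm (f c))\<^sup>2)" for c
    by (simp add: ennreal_power power_mult_distrib) (simp add: power2_eq_square powr_add[symmetric])
  have h2: "(?h c)\<^sup>2 = ennreal ((1 + c\<^sup>2) powr (- b))" for c
    by (simp add: ennreal_power) (simp add: power2_eq_square powr_add[symmetric])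
  have CS: "(\<integral>\<^sup>+c. ennreal (norm (f c)) \<partial>lborel)\<^sup>2 \<le> ennreal (C0 * e)"
    using Cauchy_Schwarz_nn_integral[of ?g lborel ?h] unfolding g g2 h2 C0(1) e(1)
    using C0(2) e(2) by (simp add: ennreal_mult[symmetric] mult.commute)
  then have "(\<integral>\<^sup>+c. ennreal (norm (f c)) \<partial>lborel)\<^sup>2 < \<infinity>" using order_le_less_trans by fastforce
  then have "(\<integral>\<^sup>+c. ennreal (norm (f c)) \<partial>lborel) < \<infinity>"
    by (auto simp: power2_eq_square less_top[symmetric] ennreal_mult_eq_top_iff)
  then show i: "integrable lborel f" by (intro integrableI_bounded) auto
  have "(\<integral>\<^sup>+c. ennreal (norm (f c)) \<partial>lborel) = ennreal (\<integral>c. norm (f c) \<partial>lborel)"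
    by (rule nn_integral_eq_integral[OF integrable_norm[OF i]]) auto
  with CS have "ennreal ((\<integral>c. norm (f c) \<partial>lborel)\<^sup>2) \<le> ennreal (C0 * e)" by (simp add: ennreal_power)
  then show "(\<integral>c. norm (f c) \<partial>lborel)\<^sup>2 \<le> C0 * e" using C0 e by (simp add: ennreal_le_iff)
qed

lemma integrable_imp_interval_integrable: "integrable lborel f \<Longrightarrow> interval_integrable J f"
  unfolding interval_integrable_def by (auto intro: integrable_mult_indicator dest: borel_measurable_integrable)

lemma signed_integral_right_tail:
  fixes f :: "real \<Rightarrow> 'b::{banach, second_countable_topology}"
  assumes f: "integrable lborel f"
  shows "(\<integral>x. indicator {0<..} x *\<^sub>R f x \<partial>lborel) - signed_integral 0 c f = (\<integral>x. indicator {c<..} x *\<^sub>R f x \<partial>lborel)"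
    and "signed_integral 0 c f + (\<integral>x. indicator {..0} x *\<^sub>R f x \<partial>lborel) = (\<integral>x. indicator {..c} x *\<^sub>R f x \<partial>lborel)"
proof -
  have s: "integrable lborel (\<lambda>x. sgn_ind 0 c x *\<^sub>R f x)"
    by (rule sgn_ind_integrable[OF is_interval_univ UNIV_I UNIV_I integrable_imp_interval_integrable[OF f]])
  have i: "integrable lborel (\<lambda>x. indicator B x *\<^sub>R f x)" if "B \<in> sets borel" for B
    using f that by (intro integrable_mult_indicator) auto
  show "(\<integral>x. indicator {0<..} x *\<^sub>R f x \<partial>lborel) - signed_integral 0 c f = (\<integral>x. indicator {c<..} x *\<^sub>R f x \<partial>lborel)"
    unfolding signed_integral_def
    by (subst Bochner_Integration.integral_diff[OF i s, symmetric])
       (auto intro!: Bochner_Integration.integral_cong simp: sgn_ind_def indicator_def)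
  show "signed_integral 0 c f + (\<integral>x. indicator {..0} x *\<^sub>R f x \<partial>lborel) = (\<integral>x. indicator {..c} x *\<^sub>R f x \<partial>lborel)"
    unfolding signed_integral_def
    by (subst Bochner_Integration.integral_add[OF s i, symmetric])
       (auto intro!: Bochner_Integration.integral_cong simp: sgn_ind_def indicator_def)
qed

text \<open>Here k is the value of a slice at c = 0 and f its derivative in c; the end is its limit
  at c -> +\<infinity>, the right endpoint of the half circle.\<close>

definition right_end :: "'b \<Rightarrow> (real \<Rightarrow> 'b::{banach, second_countable_topology}) \<Rightarrow> 'b" where
  "right_end k f = k + (\<integral>x. indicator {0<..} x *\<^sub>R f x \<partial>lborel)"

definition left_end :: "'b \<Rightarrow> (real \<Rightarrow> 'b::{banach, second_countable_topology}) \<Rightarrow> 'b" where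
  "left_end k f = k - (\<integral>x. indicator {..0} x *\<^sub>R f x \<partial>lborel)"

lemma norm_integral_indicator_le:
  fixes f :: "real \<Rightarrow> 'b::{banach, second_countable_topology}"
  assumes f: "integrable lborel f" and "B \<in> sets borel"
  shows "norm (\<integral>x. indicator B x *\<^sub>R f x \<partial>lborel) \<le> (\<integral>x. norm (f x) \<partial>lborel)"
proof -
  have "norm (\<integral>x. indicator B x *\<^sub>R f x \<partial>lborel) \<le> (\<integral>x. norm (indicator B x *\<^sub>R f x) \<partial>lborel)" by (rule integral_norm_bound)
  also have "\<dots> \<le> (\<integral>x. norm (f x) \<partial>lborel)"
    by (rule integral_mono'[OF integrable_norm[OF f]]) (auto simp: indicator_def)
  finally show ?thesis .
qed

text \<open>The difference between the slice and its end is a tail integral of f, bounded by the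
  full length and tending to 0 by dominated convergence.\<close>

lemma slice_end_bounds:
  fixes f :: "real \<Rightarrow> 'b::{banach, second_countable_topology}"
  assumes f: "integrable lborel f"
  shows "norm (k + signed_integral 0 c f - right_end k f) \<le> (\<integral>x. norm (f x) \<partial>lborel)"
    and "norm (left_end k f - right_end k f) \<le> (\<integral>x. norm (f x) \<partial>lborel)"
    and "((\<lambda>c. k + signed_integral 0 c f) \<longlongrightarrow> right_end k f) at_top"
    and "((\<lambda>c. k + signed_integral 0 c f) \<longlongrightarrow> left_end k f) at_bot"
proof -
  have r: "k + signed_integral 0 c f = right_end k f - (\<integral>x. indicator {c<..} x *\<^sub>R f x \<partial>lborel)" for c
    using signed_integral_right_tail(1)[OF f, of c] by (simp add: right_end_def algebra_simps)
  have l: "k + signed_integral 0 c f = left_end k f + (\<integral>x. indicator {..c} x *\<^sub>R f x \<partial>lborel)" for c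
    using signed_integral_right_tail(2)[OF f, of c] by (simp add: left_end_def algebra_simps)
  show "norm (k + signed_integral 0 c f - right_end k f) \<le> (\<integral>x. norm (f x) \<partial>lborel)"
    unfolding r using norm_integral_indicator_le[OF f, of "{c<..}"] by simp
  have "left_end k f - right_end k f = - (\<integral>x. f x \<partial>lborel)"
  proof -
    have "(\<integral>x. f x \<partial>lborel) = (\<integral>x. indicator {0<..} x *\<^sub>R f x + indicator {..0} x *\<^sub>R f x \<partial>lborel)"
      by (intro Bochner_Integration.integral_cong) (auto simp: indicator_def)
    also have "\<dots> = (\<integral>x. indicator {0<..} x *\<^sub>R f x \<partial>lborel) + (\<integral>x. indicator {..0} x *\<^sub>R f x \<partial>lborel)"
      by (intro Bochner_Integration.integral_add integrable_mult_indicator f) auto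
    finally show ?thesis by (simp add: left_end_def right_end_def)
  qed
  then show "norm (left_end k f - right_end k f) \<le> (\<integral>x. norm (f x) \<partial>lborel)" by (simp add: integral_norm_bound)
  have [measurable]: "f \<in> borel_measurable borel" using f by (auto dest: borel_measurable_integrable)
  have T: "((\<lambda>c. \<integral>x. indicator {c<..} x *\<^sub>R f x \<partial>lborel) \<longlongrightarrow> (\<integral>x. 0 \<partial>(lborel :: real measure))) at_top"
  proof (rule integral_dominated_convergence_at_top[where w = "\<lambda>x. norm (f x)"])
    show "\<forall>\<^sub>F c in at_top. AE x in lborel. norm (indicator {c<..} x *\<^sub>R f x) \<le> norm (f x)"
      by (intro always_eventually allI AE_I2) (auto simp: indicator_def)
    show "AE x in lborel. ((\<lambda>c. indicator {c<..} x *\<^sub>R f x) \<longlongrightarrow> 0) at_top"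
    proof (intro AE_I2 tendsto_eventually)
      fix x show "\<forall>\<^sub>F c in at_top. indicator {c<..} x *\<^sub>R f x = 0"
        using eventually_ge_at_top[of x] by eventually_elim auto
    qed
  qed (use f in auto)
  have B: "((\<lambda>c. \<integral>x. indicator {..- c} x *\<^sub>R f x \<partial>lborel) \<longlongrightarrow> (\<integral>x. 0 \<partial>(lborel :: real measure))) at_top"
  proof (rule integral_dominated_convergence_at_top[where w = "\<lambda>x. norm (f x)"])
    show "\<forall>\<^sub>F c in at_top. AE x in lborel. norm (indicator {..- c} x *\<^sub>R f x) \<le> norm (f x)"
      by (intro always_eventually allI AE_I2) (auto simp: indicator_def)
    show "AE x in lborel. ((\<lambda>c. indicator {..- c} x *\<^sub>R f x) \<longlongrightarrow> 0) at_top"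
    proof (intro AE_I2 tendsto_eventually)
      fix x show "\<forall>\<^sub>F c in at_top. indicator {..- c} x *\<^sub>R f x = 0"
        using eventually_gt_at_top[of "- x"] by eventually_elim auto
    qed
  qed (use f in auto)
  show "((\<lambda>c. k + signed_integral 0 c f) \<longlongrightarrow> right_end k f) at_top"
    unfolding r using tendsto_diff[OF tendsto_const T, of "right_end k f"] by simp
  have "((\<lambda>c. k + signed_integral 0 (- c) f) \<longlongrightarrow> left_end k f) at_top"
    unfolding l using tendsto_add[OF tendsto_const B, of "left_end k f"] by simp
  then show "((\<lambda>c. k + signed_integral 0 c f) \<longlongrightarrow> left_end k f) at_bot"
    by (simp add: filterlim_at_bot_mirror)
qed

text \<open>For |c| >= 1 the density 1 / (2 (1 + c^2)) is at least 1 / (4 c^2), whose integral from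
  n on is 1 / (4 n). The factor n is the normalisation 1/h of a strip average of height h =
  1/n.\<close>

lemma nn_integral_inverse_one_plus_sq_tail:
  fixes n :: nat
  assumes "1 \<le> n" and \<epsilon>: "\<epsilon> = 1 \<or> \<epsilon> = (-1::real)"
  shows "ennreal (1/4) \<le> ennreal (real n) * (\<integral>\<^sup>+c. ennreal (1 / (2 * (1 + c\<^sup>2))) * indicator {c. real n < \<epsilon> * c} c \<partial>lborel)"
proof -
  have n: "1 \<le> real n" using assms by simp
  have "(\<integral>\<^sup>+c. ennreal (1 / (4 * c\<^sup>2)) * indicator {real n..} c \<partial>lborel) = ennreal (0 - (- 1 / (4 * real n)))"
  proof (rule nn_integral_FTC_atLeast)
    show "((\<lambda>c. - 1 / (4 * c)) has_real_derivative 1 / (4 * x\<^sup>2)) (at x)" if "real n \<le> x" for x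
      using that n by (auto intro!: derivative_eq_intros simp: power2_eq_square field_simps)
    have "((\<lambda>c::real. (- 1/4) * inverse c) \<longlongrightarrow> (- 1/4) * 0) at_top"
      by (intro tendsto_mult tendsto_const tendsto_inverse_0_at_top filterlim_ident)
    then show "((\<lambda>c::real. - 1 / (4 * c)) \<longlongrightarrow> 0) at_top" by (simp add: field_simps)
  qed auto
  then have 1: "(\<integral>\<^sup>+c. ennreal (1 / (4 * c\<^sup>2)) * indicator {real n..} c \<partial>lborel) = ennreal (1 / (4 * real n))" by simp
  have "(\<integral>\<^sup>+c. ennreal (1 / (4 * c\<^sup>2)) * indicator {real n..} c \<partial>lborel) = \<bar>\<epsilon>\<bar> * (\<integral>\<^sup>+c. ennreal (1 / (4 * (0 + \<epsilon> * c)\<^sup>2)) * indicator {real n..} (0 + \<epsilon> * c) \<partial>lborel)"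
    by (rule nn_integral_real_affine) (use \<epsilon> in auto)
  also have "\<dots> = (\<integral>\<^sup>+c. ennreal (1 / (4 * (0 + \<epsilon> * c)\<^sup>2)) * indicator {real n..} (0 + \<epsilon> * c) \<partial>lborel)" using \<epsilon> by auto
  also have "\<dots> \<le> (\<integral>\<^sup>+c. ennreal (1 / (2 * (1 + c\<^sup>2))) * indicator {c. real n < \<epsilon> * c} c \<partial>lborel)"
  proof (rule nn_integral_mono_AE)
    show "AE c in lborel. ennreal (1 / (4 * (0 + \<epsilon> * c)\<^sup>2)) * indicator {real n..} (0 + \<epsilon> * c) \<le> ennreal (1 / (2 * (1 + c\<^sup>2))) * indicator {c. real n < \<epsilon> * c} c"
      using AE_lborel_singleton[of "\<epsilon> * real n"]
    proof eventually_elim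
      case (elim c)
      show ?case
      proof (cases "real n \<le> \<epsilon> * c")
        case True
        then have lt: "real n < \<epsilon> * c" using elim \<epsilon> by auto
        have "(\<epsilon> * c)\<^sup>2 = c\<^sup>2" using \<epsilon> by auto
        moreover have "1 \<le> (\<epsilon> * c)\<^sup>2" using True n by (simp add: one_le_power)
        ultimately have c: "1 \<le> c\<^sup>2" "(0 + \<epsilon> * c)\<^sup>2 = c\<^sup>2" by simp_all
        then have "1 / (4 * c\<^sup>2) \<le> 1 / (2 * (1 + c\<^sup>2))" by (intro divide_left_mono) (auto intro!: mult_pos_pos)
        then show ?thesis using lt True c by (auto intro: ennreal_leI)
      qed simp
    qed
  qed
  finally have "ennreal (1 / (4 * real n)) \<le> (\<integral>\<^sup>+c. ennreal (1 / (2 * (1 + c\<^sup>2))) * indicator {c. real n < \<epsilon> * c} c \<partial>lborel)"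
    unfolding 1 .
  then have "ennreal (real n) * ennreal (1 / (4 * real n)) \<le> ennreal (real n) * (\<integral>\<^sup>+c. ennreal (1 / (2 * (1 + c\<^sup>2))) * indicator {c. real n < \<epsilon> * c} c \<partial>lborel)"
    by (intro mult_left_mono) auto
  moreover have "ennreal (real n) * ennreal (1 / (4 * real n)) = ennreal (1/4)" using n by (simp add: ennreal_mult[symmetric])
  ultimately show ?thesis by simp
qed

section \<open>Boundary values of the slices\<close>

lemma AE_lborel_fst:
  assumes "AE x in (lborel :: real measure). P x"
  shows "AE p in (lborel :: (real \<times> real) measure). P (fst p)"
proof -
  obtain N where N: "N \<in> sets borel" "\<And>x. \<not> P x \<Longrightarrow> x \<in> N" "AE x in lborel. x \<notin> N"
    using AE_lborel_borel_set[OF assms] by metis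
  have "AE p in (lborel :: (real \<times> real) measure). fst p \<notin> N"
  proof (rule AE_lborel_pairI)
    have "{p :: real \<times> real. fst p \<notin> N} = - (fst -` N)" by auto
    then show "{p :: real \<times> real. fst p \<notin> N} \<in> sets borel"
      using measurable_sets[OF borel_fst_real N(1)] by auto
    show "AE x in lborel. AE y in lborel. fst (x, y :: real) \<notin> N" using N(3) by eventually_elim auto
  qed
  then show ?thesis by eventually_elim (use N(2) in blast)
qed

text \<open>By the change of variables, \<open>n\<close> times the integral of \<open>dist(v, N)\<close> over the sector \<open>\<epsilon> c > n\<close> is dominated
  by a strip average of \<open>|v - g|\<close>; by Fatou the end of almost every slice lies in \<open>N\<close>.\<close>

lemma trace_slice_end:
  fixes v0 v :: "real \<times> real \<Rightarrow> real^'d" and E :: "real \<Rightarrow> real^'d" and \<epsilon> b :: real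
  assumes N: "closed N" and tr: "trace_in N v0 0 1" and mv [measurable]: "v \<in> borel_measurable borel"
    and v0: "AE p in lborel. p \<in> half_ball (0, 0) 1 \<longrightarrow> v0 p = v p"
    and rep: "AE \<sigma> in lborel. \<sigma> \<in> {0<..<1} \<longrightarrow> (AE c in lborel. v (polar_map (\<sigma>, c)) = \<phi> \<sigma> c)"
    and lim: "AE \<sigma> in lborel. \<sigma> \<in> {0<..<1} \<longrightarrow> ((\<lambda>t. \<phi> \<sigma> (\<epsilon> * t)) \<longlongrightarrow> E \<sigma>) at_top"
    and \<epsilon>: "\<epsilon> = 1 \<or> \<epsilon> = -1" and b: "0 < b" "b < 1"
  shows "AE \<sigma> in lborel. \<sigma> \<in> {0<..<b} \<longrightarrow> E \<sigma> \<in> N"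
proof -
  let ?C = "\<lambda>n. {c. real n < \<epsilon> * c}"
  obtain g where g: "AE x in lebesgue. x \<in> {0 - 1<..<0 + 1} \<longrightarrow> g x \<in> N"
    "\<And>\<rho>. 0 < \<rho> \<Longrightarrow> \<rho> < 1 \<Longrightarrow> ((\<lambda>h. ennreal (1 / h) *
               (\<integral>\<^sup>+ p\<in>{0 - \<rho><..<0 + \<rho>} \<times> {0<..<h}. ennreal (norm (v0 p - g (fst p))) \<partial>lebesgue)) \<longlongrightarrow> 0) (at_right 0)"
    using tr unfolding trace_in_def by blast
  have gN: "AE x in lborel. x \<in> {-1<..<1} \<longrightarrow> g x \<in> N" using g(1) by (simp add: AE_completion_iff)
  \<comment> \<open>\<open>infdist\<close> to the empty set is 0 by convention, so distance 0
    characterises membership only for nonempty N; the trace takes values in N on an interval of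
    positive length.\<close>
  have Nne: "N \<noteq> {}"
  proof
    assume "N = {}"
    then have "AE x in lborel. x \<notin> {-1<..<1::real}" using gN unfolding \<open>N = {}\<close> by (simp only: empty_iff simp_thms)
    then have "{-1<..<1::real} \<in> null_sets lborel" by (subst AE_iff_null_sets) auto
    then show False by (simp add: null_sets_def)
  qed
  \<comment> \<open>Half circles with \<sigma> < b lie over |x| < sqrt b, which fixes the width of
    the strip; b < 1 makes this width admissible in the definition of the trace.\<close>
  define \<rho> where "\<rho> = sqrt b"
  have \<rho>: "0 < \<rho>" "\<rho> < 1" "\<rho>\<^sup>2 = b" using b by (auto simp: \<rho>_def real_sqrt_lt_1_iff)
  define F where "F p = ennreal (infdist (v p) N)" for p
  have [measurable]: "(\<lambda>p. infdist (v p) N) \<in> borel_measurable borel"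
    by (rule measurable_compose[OF mv borel_measurable_continuous_onI]) (intro continuous_on_infdist continuous_on_id)
  have [measurable]: "F \<in> borel_measurable borel" unfolding F_def[abs_def] by measurable
  have mC [measurable]: "?C n \<in> sets borel" for n by measurable
  define X where "X n \<sigma> = ennreal (real n) * (\<integral>\<^sup>+c. F (polar_map (\<sigma>, c)) * ennreal (1 / (2 * (1 + c\<^sup>2))) * indicator (?C n) c \<partial>lborel) * indicator {0<..<b} \<sigma>" for n \<sigma>
  have mI: "(\<lambda>q. F (polar_map q) * ennreal (1 / (2 * (1 + (snd q)\<^sup>2))) * indicator (?C n) (snd q)) \<in> borel_measurable borel" for n
    by measurable
  have mX [measurable]: "X n \<in> borel_measurable borel" for n
  proof -
    have "(\<lambda>r. F (polar_map (fst r, snd r)) * ennreal (1 / (2 * (1 + (snd r)\<^sup>2))) * indicator (?C n) (snd r)) \<in> borel_measurable ((borel :: real measure) \<Otimes>\<^sub>M lborel)"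
      by measurable
    then have "(\<lambda>\<sigma>. \<integral>\<^sup>+c. F (polar_map (\<sigma>, c)) * ennreal (1 / (2 * (1 + c\<^sup>2))) * indicator (?C n) c \<partial>lborel) \<in> borel_measurable borel"
      by (intro lborel.borel_measurable_nn_integral) (simp add: case_prod_unfold)
    then show ?thesis unfolding X_def[abs_def] by measurable
  qed
  define strip where "strip h = {0 - \<rho><..<0 + \<rho>} \<times> {0<..<h}" for h :: real
  have [measurable]: "strip h \<in> sets borel" for h unfolding strip_def by simp
  \<comment> \<open>The sector \<epsilon> c > n over \<sigma> < b is mapped into the strip of height
    1/n, since y^2 = \<sigma> / (1 + c^2) < 1/n^2. The condition on n places that strip inside the
    unit half disc, where v0 and v agree almost everywhere.\<close>
  have X_le: "(\<integral>\<^sup>+\<sigma>. X n \<sigma> \<partial>lborel) \<le> ennreal (real n) * (\<integral>\<^sup>+p. ennreal (norm (v0 p - g (fst p))) * indicator (strip (1 / real n)) p \<partial>lebesgue)"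
    if n: "1 \<le> n" "b + (1 / real n)\<^sup>2 \<le> 1" for n
  proof -
    have n0: "0 < real n" using n by simp
    have "(\<integral>\<^sup>+\<sigma>. X n \<sigma> \<partial>lborel) = (\<integral>\<^sup>+\<sigma>. ennreal (real n) * (\<integral>\<^sup>+c. F (polar_map (\<sigma>, c)) * ennreal (1 / (2 * (1 + c\<^sup>2))) * indicator (?C n) c * indicator {0<..<b} \<sigma> \<partial>lborel) \<partial>lborel)"
      unfolding X_def by (intro nn_integral_cong) (auto simp: indicator_def)
    also have "\<dots> = ennreal (real n) * (\<integral>\<^sup>+\<sigma>. \<integral>\<^sup>+c. F (polar_map (\<sigma>, c)) * ennreal (1 / (2 * (1 + c\<^sup>2))) * indicator (?C n) c * indicator {0<..<b} \<sigma> \<partial>lborel \<partial>lborel)"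
    proof (rule nn_integral_cmult)
      have "(\<lambda>r. F (polar_map (fst r, snd r)) * ennreal (1 / (2 * (1 + (snd r)\<^sup>2))) * indicator (?C n) (snd r) * indicator {0<..<b} (fst r)) \<in> borel_measurable ((lborel :: real measure) \<Otimes>\<^sub>M lborel)"
        by measurable
      then show "(\<lambda>\<sigma>. \<integral>\<^sup>+c. F (polar_map (\<sigma>, c)) * ennreal (1 / (2 * (1 + c\<^sup>2))) * indicator (?C n) c * indicator {0<..<b} \<sigma> \<partial>lborel) \<in> borel_measurable lborel"
        by (intro lborel.borel_measurable_nn_integral) (simp add: case_prod_unfold)
    qed
    also have "(\<integral>\<^sup>+\<sigma>. \<integral>\<^sup>+c. F (polar_map (\<sigma>, c)) * ennreal (1 / (2 * (1 + c\<^sup>2))) * indicator (?C n) c * indicator {0<..<b} \<sigma> \<partial>lborel \<partial>lborel)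
      = (\<integral>\<^sup>+q. F (polar_map q) * ennreal (1 / (2 * (1 + (snd q)\<^sup>2))) * indicator (?C n) (snd q) * indicator {0<..<b} (fst q) \<partial>lborel)"
      by (subst nn_fubini_fst) auto
    also have "\<dots> \<le> (\<integral>\<^sup>+q. (F (polar_map q) * indicator (strip (1 / real n)) (polar_map q)) * ennreal (polar_jac q) \<partial>lborel)"
    proof (rule nn_integral_mono)
      fix q :: "real \<times> real"
      show "F (polar_map q) * ennreal (1 / (2 * (1 + (snd q)\<^sup>2))) * indicator (?C n) (snd q) * indicator {0<..<b} (fst q)
        \<le> (F (polar_map q) * indicator (strip (1 / real n)) (polar_map q)) * ennreal (polar_jac q)"
      proof (cases "real n < \<epsilon> * snd q \<and> fst q \<in> {0<..<b}")
        case True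
        then have q: "0 < fst q" "fst q < b" by auto
        have "(real n)\<^sup>2 < (\<epsilon> * snd q)\<^sup>2" using True n0 by (intro power_strict_mono) auto
        also have "(\<epsilon> * snd q)\<^sup>2 = (snd q)\<^sup>2" using \<epsilon> by auto
        finally have c: "(real n)\<^sup>2 < 1 + (snd q)\<^sup>2" by simp
        have "(snd (polar_map q))\<^sup>2 = fst q / (1 + (snd q)\<^sup>2)" by (rule polar_coords(5)[OF q(1)])
        also have "\<dots> < 1 / (real n)\<^sup>2"
          using c q b n0 by (intro frac_less2) auto
        also have "\<dots> = (1 / real n)\<^sup>2" by (simp add: power_divide)
        finally have y: "snd (polar_map q) < 1 / real n"
          using n0 by (intro power_less_imp_less_base[of "snd (polar_map q)" 2]) auto
        have "(fst (polar_map q))\<^sup>2 < \<rho>\<^sup>2"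
          using polar_coords(1)[OF q(1)] polar_coords(3)[OF q(1)] q(2) \<rho>(3) zero_less_power[of "snd (polar_map q)" 2] by linarith
        then have "\<bar>fst (polar_map q)\<bar> < \<rho>" using \<rho>(1) by (metis abs_less_iff abs_of_pos power2_less_imp_less power2_abs less_imp_le)
        then have "polar_map q \<in> strip (1 / real n)"
          using y polar_coords(3)[OF q(1)] by (auto simp: strip_def mem_Times_iff)
        then show ?thesis using True by (simp add: polar_jac_def)
      qed (auto simp: indicator_def)
    qed
    also have "\<dots> = (\<integral>\<^sup>+p. (F p * indicator (strip (1 / real n)) p) * indicator {p. 0 < snd p} p \<partial>lborel)"
      by (rule nn_integral_polar[symmetric]) measurable
    also have "\<dots> \<le> (\<integral>\<^sup>+p. ennreal (norm (v0 p - g (fst p))) * indicator (strip (1 / real n)) p \<partial>lborel)"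
    proof (rule nn_integral_mono_AE)
      show "AE p in lborel. (F p * indicator (strip (1 / real n)) p) * indicator {p. 0 < snd p} p \<le> ennreal (norm (v0 p - g (fst p))) * indicator (strip (1 / real n)) p"
        using v0 AE_lborel_fst[OF gN]
      proof eventually_elim
        case (elim p)
        show ?case
        proof (cases "p \<in> strip (1 / real n)")
          case True
          then have p: "\<bar>fst p\<bar> < \<rho>" "0 < snd p" "snd p < 1 / real n" by (auto simp: strip_def mem_Times_iff)
          have "(fst p)\<^sup>2 < b" using p(1) \<rho> by (metis abs_ge_zero power2_abs power_strict_mono zero_less_numeral)
          moreover have "(snd p)\<^sup>2 \<le> (1 / real n)\<^sup>2" using p by (intro power_mono) auto
          ultimately have "(fst p)\<^sup>2 + (snd p)\<^sup>2 < 1" using n(2) by linarith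
          then have "p \<in> half_ball (0, 0) 1" using p by (simp add: half_ball_iff)
          then have "v0 p = v p" using elim by auto
          moreover have "g (fst p) \<in> N" using elim p \<rho> by auto
          ultimately have "infdist (v p) N \<le> norm (v0 p - g (fst p))" by (simp add: infdist_le dist_norm[symmetric])
          then show ?thesis using True by (auto simp: F_def indicator_def intro: ennreal_leI)
        qed simp
      qed
    qed
    finally show ?thesis by (simp add: nn_integral_completion mult_left_mono)
  qed
  have "(\<lambda>n. \<integral>\<^sup>+\<sigma>. X (Suc n) \<sigma> \<partial>lborel) \<longlonglongrightarrow> 0"
  proof (rule tendsto_sandwich[OF _ _ tendsto_const])
    have fl: "filterlim (\<lambda>n. 1 / real (Suc n)) (at_right 0) sequentially"
      unfolding filterlim_at using LIMSEQ_inverse_real_of_nat by (auto simp: inverse_eq_divide)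
    show "(\<lambda>n. ennreal (1 / (1 / real (Suc n))) * (\<integral>\<^sup>+ p\<in>{0 - \<rho><..<0 + \<rho>} \<times> {0<..<1 / real (Suc n)}. ennreal (norm (v0 p - g (fst p))) \<partial>lebesgue)) \<longlonglongrightarrow> 0"
      using filterlim_compose[OF g(2)[OF \<rho>(1,2)] fl] .
    have "(\<lambda>n. b + (1 / real (Suc n))\<^sup>2) \<longlonglongrightarrow> b + 0\<^sup>2"
      using LIMSEQ_inverse_real_of_nat by (intro tendsto_intros) (simp add: inverse_eq_divide)
    then have "(\<lambda>n. b + (1 / real (Suc n))\<^sup>2) \<longlonglongrightarrow> b" by simp
    from order_tendstoD(2)[OF this b(2)]
    show "\<forall>\<^sub>F n in sequentially. (\<integral>\<^sup>+\<sigma>. X (Suc n) \<sigma> \<partial>lborel) \<le> ennreal (1 / (1 / real (Suc n))) * (\<integral>\<^sup>+ p\<in>{0 - \<rho><..<0 + \<rho>} \<times> {0<..<1 / real (Suc n)}. ennreal (norm (v0 p - g (fst p))) \<partial>lebesgue)"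
    proof eventually_elim
      case (elim n)
      have "1 / (1 / real (Suc n)) = real (Suc n)" by simp
      then show ?case using X_le[of "Suc n"] elim unfolding strip_def by simp
    qed
  qed simp
  then have "liminf (\<lambda>n. \<integral>\<^sup>+\<sigma>. X (Suc n) \<sigma> \<partial>lborel) = 0" by (intro lim_imp_Liminf) auto
  moreover have "(\<integral>\<^sup>+\<sigma>. liminf (\<lambda>n. X (Suc n) \<sigma>) \<partial>lborel) \<le> liminf (\<lambda>n. \<integral>\<^sup>+\<sigma>. X (Suc n) \<sigma> \<partial>lborel)"
    by (rule nn_integral_liminf) simp
  ultimately have "(\<integral>\<^sup>+\<sigma>. liminf (\<lambda>n. X (Suc n) \<sigma>) \<partial>lborel) = 0" by simp
  then have "AE \<sigma> in lborel. liminf (\<lambda>n. X (Suc n) \<sigma>) = 0" by (subst (asm) nn_integral_0_iff_AE) auto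
  then show ?thesis using rep lim
  proof eventually_elim
    case (elim \<sigma>)
    show ?case
    proof
      assume \<sigma>: "\<sigma> \<in> {0<..<b}"
      then have rep': "AE c in lborel. v (polar_map (\<sigma>, c)) = \<phi> \<sigma> c" and lim': "((\<lambda>t. \<phi> \<sigma> (\<epsilon> * t)) \<longlongrightarrow> E \<sigma>) at_top"
        using elim b by auto
      define d where "d = infdist (E \<sigma>) N"
      have "d = 0"
      proof (rule ccontr)
        assume "d \<noteq> 0"
        then have d: "0 < d" using infdist_nonneg[of "E \<sigma>" N] by (simp add: d_def)
        have "((\<lambda>t. infdist (\<phi> \<sigma> (\<epsilon> * t)) N) \<longlongrightarrow> d) at_top" unfolding d_def by (rule tendsto_infdist[OF lim'])
        from order_tendstoD(1)[OF this, of "d / 2"] d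
        obtain T where T: "\<And>t. T \<le> t \<Longrightarrow> d / 2 < infdist (\<phi> \<sigma> (\<epsilon> * t)) N" unfolding eventually_at_top_linorder by auto
        \<comment> \<open>If the end had distance d > 0 from N, the slice would stay at distance d/2
          on the whole sector once n is large. The sector has mass at least 1 / (4 n), hence the
          lower bound d/2 times 1/4, uniform in n.\<close>
        have "ennreal (d / 8) \<le> X n \<sigma>" if n: "1 \<le> n" "T \<le> real n" for n
        proof -
          have "ennreal (d / 8) = ennreal (d / 2) * ennreal (1/4)" using d by (simp add: ennreal_mult[symmetric])
          also have "\<dots> \<le> ennreal (d / 2) * (ennreal (real n) * (\<integral>\<^sup>+c. ennreal (1 / (2 * (1 + c\<^sup>2))) * indicator (?C n) c \<partial>lborel))"
            by (intro mult_left_mono nn_integral_inverse_one_plus_sq_tail n \<epsilon>) auto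
          also have "\<dots> = ennreal (real n) * (\<integral>\<^sup>+c. ennreal (d / 2) * (ennreal (1 / (2 * (1 + c\<^sup>2))) * indicator (?C n) c) \<partial>lborel)"
            by (subst nn_integral_cmult) (auto simp: mult_ac)
          also have "\<dots> \<le> ennreal (real n) * (\<integral>\<^sup>+c. F (polar_map (\<sigma>, c)) * ennreal (1 / (2 * (1 + c\<^sup>2))) * indicator (?C n) c \<partial>lborel)"
          proof (intro mult_left_mono nn_integral_mono_AE)
            show "AE c in lborel. ennreal (d / 2) * (ennreal (1 / (2 * (1 + c\<^sup>2))) * indicator (?C n) c)
              \<le> F (polar_map (\<sigma>, c)) * ennreal (1 / (2 * (1 + c\<^sup>2))) * indicator (?C n) c"
              using rep'
            proof eventually_elim
              case (elim c)
              show ?case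
              proof (cases "real n < \<epsilon> * c")
                case True
                have e: "\<epsilon> * (\<epsilon> * c) = c" using \<epsilon> by auto
                have "T \<le> \<epsilon> * c" using True n by linarith
                from T[OF this] have "d / 2 < infdist (\<phi> \<sigma> c) N" unfolding e .
                then have "ennreal (d / 2) \<le> F (polar_map (\<sigma>, c))" using elim by (simp add: F_def ennreal_leI)
                then show ?thesis using True by (simp add: mult_right_mono)
              qed simp
            qed
          qed simp
          finally show ?thesis using \<sigma> by (simp add: X_def)
        qed
        moreover obtain m :: nat where m: "T \<le> real m" using real_arch_simple by blast
        ultimately have "\<forall>\<^sub>F n in sequentially. ennreal (d / 8) \<le> X (Suc n) \<sigma>"
          unfolding eventually_sequentially by (intro exI[of _ m]) auto
        then have "ennreal (d / 8) \<le> liminf (\<lambda>n. X (Suc n) \<sigma>)" by (rule Liminf_bounded)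
        then show False using elim d by simp
      qed
      then show "E \<sigma> \<in> N" using in_closed_iff_infdist_zero[OF N Nne] by (simp add: d_def)
    qed
  qed
qed

section \<open>Gluing and the energy in polar coordinates\<close>

lemma signed_integral_FTC:
  fixes F :: "real \<Rightarrow> 'b::euclidean_space"
  assumes F: "\<And>x. x \<in> {min a b..max a b} \<Longrightarrow> (F has_vector_derivative f x) (at x within {min a b..max a b})"
    and f: "continuous_on {min a b..max a b} f"
  shows "signed_integral a b f = F b - F a"
proof -
  have b: "(\<integral>x. indicator {min a b..max a b} x *\<^sub>R f x \<partial>lborel) = F (max a b) - F (min a b)"
    using has_bochner_integral_FTC_Icc[OF _ F f] by (simp add: has_bochner_integral_iff)
  have e: "signed_integral a b f = (\<integral>x. (if a \<le> b then 1 else - 1) *\<^sub>R (indicator {min a b..max a b} x *\<^sub>R f x) \<partial>lborel)"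
    unfolding signed_integral_def
  proof (rule Bochner_Integration.integral_cong_AE)
    have [measurable]: "(\<lambda>x. indicator {min a b..max a b} x *\<^sub>R f x) \<in> borel_measurable borel"
      using f by (intro borel_measurable_continuous_on_indicator) auto
    have "(\<lambda>x. sgn_ind a b x *\<^sub>R f x) = (\<lambda>x. sgn_ind a b x *\<^sub>R (indicator {min a b..max a b} x *\<^sub>R f x))"
      by (auto simp: sgn_ind_def indicator_def fun_eq_iff)
    also have "\<dots> \<in> borel_measurable lborel" by measurable
    finally show "(\<lambda>x. sgn_ind a b x *\<^sub>R f x) \<in> borel_measurable lborel" .
    show "(\<lambda>x. (if a \<le> b then 1 else - 1) *\<^sub>R (indicator {min a b..max a b} x *\<^sub>R f x)) \<in> borel_measurable lborel" by measurable
    show "AE x in lborel. sgn_ind a b x *\<^sub>R f x = (if a \<le> b then 1 else - 1) *\<^sub>R (indicator {min a b..max a b} x *\<^sub>R f x)"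
      using AE_lborel_singleton[of a] AE_lborel_singleton[of b]
      by eventually_elim (auto simp: sgn_ind_def indicator_def)
  qed
  show ?thesis unfolding e Bochner_Integration.integral_scaleR_right b by simp
qed

lemma signed_integral_cong:
  assumes "\<And>t. t \<in> {a<..b} \<union> {b<..a} \<Longrightarrow> f t = g t"
  shows "signed_integral a b f = signed_integral a b g"
  unfolding signed_integral_def
  using assms by (intro Bochner_Integration.integral_cong refl) (auto simp: sgn_ind_def indicator_def)

lemma rect_integrable_if:
  fixes f g :: "real \<times> real \<Rightarrow> 'b::{banach, second_countable_topology}"
  assumes g: "rect_integrable I J g" and f: "rect_integrable I J (\<lambda>q. if fst q \<le> S then f q else 0)"
  shows "rect_integrable I J (\<lambda>q. if fst q \<le> S then f q else g q)"
proof -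
  have [measurable]: "g \<in> borel_measurable borel" by (rule rect_integrable_measurable[OF g])
  have "rect_integrable I J (\<lambda>q. if fst q \<le> S then 0 else g q)"
    unfolding rect_integrable_def
  proof (intro conjI allI impI)
    show "(\<lambda>q. if fst q \<le> S then 0 else g q) \<in> borel_measurable borel" by measurable
    fix a b c d :: real assume "{a..b} \<subseteq> I" "{c..d} \<subseteq> J"
    from rect_integrable_integrable[OF g this]
    show "integrable lborel (\<lambda>q. indicator ({a..b} \<times> {c..d}) q *\<^sub>R (if fst q \<le> S then 0 else g q))"
      by (rule Bochner_Integration.integrable_bound) (auto simp: indicator_def)
  qed
  from rect_integrable_add(1)[OF f this] show ?thesis
    by (rule back_subst[of "rect_integrable I J"]) auto
qed

text \<open>Both pieces are written with base point S and the same initial value \<phi>(c), so one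
  constant serves on either side of the interface and no jump arises. In the c-direction nothing has
  to match, since each slice belongs to a single piece.\<close>

lemma glue_absolutely_continuous:
  fixes U R A W WR WA :: "real \<times> real \<Rightarrow> real^'d"
  assumes R: "AE c in lborel. AE \<sigma> in lborel. \<sigma> \<in> {0<..<\<rho>} \<longrightarrow> U (\<sigma>, c) = \<phi> c + signed_integral S \<sigma> (\<lambda>t. R (t, c))"
    and A: "AE \<sigma> in lborel. \<sigma> \<in> {0<..<\<rho>} \<longrightarrow> (\<exists>k. AE c in lborel. U (\<sigma>, c) = k + signed_integral 0 c (\<lambda>t. A (\<sigma>, t)))"
    and WR: "\<And>\<sigma> c. \<sigma> \<in> {0<..S} \<Longrightarrow> W (\<sigma>, c) = \<phi> c + signed_integral S \<sigma> (\<lambda>t. WR (t, c))"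
    and WA: "\<And>\<sigma>. \<sigma> \<in> {0<..S} \<Longrightarrow> \<exists>k. AE c in lborel. W (\<sigma>, c) = k + signed_integral 0 c (\<lambda>t. WA (\<sigma>, t))"
  defines "glue f g \<equiv> \<lambda>q. if fst q \<le> S then f q else g q :: real^'d"
  shows "AE c in lborel. \<exists>k. AE \<sigma> in lborel. \<sigma> \<in> {0<..<\<rho>} \<longrightarrow> glue W U (\<sigma>, c) = k + signed_integral S \<sigma> (\<lambda>t. glue WR R (t, c))"
    and "AE \<sigma> in lborel. \<sigma> \<in> {0<..<\<rho>} \<longrightarrow> (\<exists>k. AE c in lborel. glue W U (\<sigma>, c) = k + signed_integral 0 c (\<lambda>t. glue WA A (\<sigma>, t)))"
proof -
  show "AE c in lborel. \<exists>k. AE \<sigma> in lborel. \<sigma> \<in> {0<..<\<rho>} \<longrightarrow> glue W U (\<sigma>, c) = k + signed_integral S \<sigma> (\<lambda>t. glue WR R (t, c))"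
    using R
  proof eventually_elim
    case (elim c)
    have "AE \<sigma> in lborel. \<sigma> \<in> {0<..<\<rho>} \<longrightarrow> glue W U (\<sigma>, c) = \<phi> c + signed_integral S \<sigma> (\<lambda>t. glue WR R (t, c))"
      using elim
    proof eventually_elim
      case (elim \<sigma>)
      show ?case
      proof
        assume \<sigma>: "\<sigma> \<in> {0<..<\<rho>}"
        show "glue W U (\<sigma>, c) = \<phi> c + signed_integral S \<sigma> (\<lambda>t. glue WR R (t, c))"
        proof (cases "\<sigma> \<le> S")
          case True
          have "signed_integral S \<sigma> (\<lambda>t. glue WR R (t, c)) = signed_integral S \<sigma> (\<lambda>t. WR (t, c))"
            using True by (intro signed_integral_cong) (auto simp: glue_def)
          then show ?thesis using WR[of \<sigma> c] True \<sigma> by (simp add: glue_def)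
        next
          case False
          have "signed_integral S \<sigma> (\<lambda>t. glue WR R (t, c)) = signed_integral S \<sigma> (\<lambda>t. R (t, c))"
            using False by (intro signed_integral_cong) (auto simp: glue_def)
          then show ?thesis using elim False \<sigma> by (simp add: glue_def)
        qed
      qed
    qed
    then show ?case by blast
  qed
  show "AE \<sigma> in lborel. \<sigma> \<in> {0<..<\<rho>} \<longrightarrow> (\<exists>k. AE c in lborel. glue W U (\<sigma>, c) = k + signed_integral 0 c (\<lambda>t. glue WA A (\<sigma>, t)))"
    using A
  proof eventually_elim
    case (elim \<sigma>)
    then show ?case using WA[of \<sigma>] by (cases "\<sigma> \<le> S") (auto simp: glue_def)
  qed
qed

lemma is_weak_grad_cong:
  fixes v v' g1 g1' g2 g2' :: "real \<times> real \<Rightarrow> real^'d"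
  assumes \<Omega>: "open \<Omega>" and wg: "is_weak_grad \<Omega> v g1 g2"
    and ae: "AE p in lborel. p \<in> \<Omega> \<longrightarrow> v' p = v p \<and> g1' p = g1 p \<and> g2' p = g2 p"
    and m: "(\<lambda>p. indicator \<Omega> p *\<^sub>R v' p) \<in> borel_measurable lebesgue" "(\<lambda>p. indicator \<Omega> p *\<^sub>R g1' p) \<in> borel_measurable lebesgue"
      "(\<lambda>p. indicator \<Omega> p *\<^sub>R g2' p) \<in> borel_measurable lebesgue"
  shows "is_weak_grad \<Omega> v' g1' g2'"
proof -
  have loc: "locally_integrable_on \<Omega> f'"
    if f: "locally_integrable_on \<Omega> f" and e: "AE p in lborel. p \<in> \<Omega> \<longrightarrow> f' p = f p" and mf: "(\<lambda>p. indicator \<Omega> p *\<^sub>R f' p) \<in> borel_measurable lebesgue" for f f' :: "real \<times> real \<Rightarrow> real^'d"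
    unfolding locally_integrable_on_def
  proof (intro allI impI)
    fix K assume K: "compact K \<and> K \<subseteq> \<Omega>"
    then have [measurable]: "K \<in> sets lebesgue" by (simp add: compact_imp_closed borel_closed)
    have "set_integrable lebesgue K f" using f K by (auto simp: locally_integrable_on_def)
    then show "set_integrable lebesgue K f'"
      unfolding set_integrable_def
    proof (rule Bochner_Integration.integrable_cong_AE_imp)
      have "(\<lambda>p. indicator K p *\<^sub>R f' p) = (\<lambda>p. indicator K p *\<^sub>R (indicator \<Omega> p *\<^sub>R f' p))"
        using K by (auto simp: indicator_def fun_eq_iff)
      also have "\<dots> \<in> borel_measurable lebesgue" using mf by measurable
      finally show "(\<lambda>p. indicator K p *\<^sub>R f' p) \<in> borel_measurable lebesgue" .
      show "AE p in lebesgue. indicator K p *\<^sub>R f p = indicator K p *\<^sub>R f' p"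
        using AE_completion[OF e] by eventually_elim (use K in \<open>auto simp: indicator_def\<close>)
    qed
  qed
  have int: "(LINT p:\<Omega>|lebesgue. h p *\<^sub>R f' p) = (LINT p:\<Omega>|lebesgue. h p *\<^sub>R f p)"
    if f: "locally_integrable_on \<Omega> f" and e: "AE p in lborel. p \<in> \<Omega> \<longrightarrow> f' p = f p" and mf: "(\<lambda>p. indicator \<Omega> p *\<^sub>R f' p) \<in> borel_measurable lebesgue"
      and mh: "h \<in> borel_measurable borel" for f f' :: "real \<times> real \<Rightarrow> real^'d" and h :: "real \<times> real \<Rightarrow> real"
    unfolding set_lebesgue_integral_def
  proof (rule Bochner_Integration.integral_cong_AE)
    have [measurable]: "h \<in> borel_measurable lebesgue" using mh by (simp add: measurable_completion)
    note [measurable] = mf locally_integrable_measurable[OF \<Omega> f]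
    have "(\<lambda>p. h p *\<^sub>R (indicator \<Omega> p *\<^sub>R f' p)) \<in> borel_measurable lebesgue" "(\<lambda>p. h p *\<^sub>R (indicator \<Omega> p *\<^sub>R f p)) \<in> borel_measurable lebesgue"
      by measurable
    then show "(\<lambda>p. indicator \<Omega> p *\<^sub>R h p *\<^sub>R f' p) \<in> borel_measurable lebesgue" "(\<lambda>p. indicator \<Omega> p *\<^sub>R h p *\<^sub>R f p) \<in> borel_measurable lebesgue"
      by (simp_all add: mult.commute)
    show "AE p in lebesgue. indicator \<Omega> p *\<^sub>R h p *\<^sub>R f' p = indicator \<Omega> p *\<^sub>R h p *\<^sub>R f p"
      using AE_completion[OF e] by eventually_elim (auto simp: indicator_def)
  qed
  have e: "AE p in lborel. p \<in> \<Omega> \<longrightarrow> v' p = v p" "AE p in lborel. p \<in> \<Omega> \<longrightarrow> g1' p = g1 p" "AE p in lborel. p \<in> \<Omega> \<longrightarrow> g2' p = g2 p"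
    using ae by (eventually_elim, simp)+
  show ?thesis
    unfolding is_weak_grad_def
  proof (intro conjI allI impI)
    show "locally_integrable_on \<Omega> v'" "locally_integrable_on \<Omega> g1'" "locally_integrable_on \<Omega> g2'"
      using wg unfolding is_weak_grad_def by (auto intro: loc[OF _ e(1) m(1)] loc[OF _ e(2) m(2)] loc[OF _ e(3) m(3)])
    fix \<phi> assume t: "test_function \<Omega> \<phi>"
    note mt = test_function_measurable[OF t]
    have l: "locally_integrable_on \<Omega> v" "locally_integrable_on \<Omega> g1" "locally_integrable_on \<Omega> g2"
      using wg by (auto simp: is_weak_grad_def)
    show "(LINT p:\<Omega>|lebesgue. (frechet_derivative \<phi> (at p) (1, 0) *\<^sub>R v' p)) = - (LINT p:\<Omega>|lebesgue. (\<phi> p *\<^sub>R g1' p))"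
      unfolding int[OF l(1) e(1) m(1) mt(2)] int[OF l(2) e(2) m(2) mt(1)] using wg t by (simp add: is_weak_grad_def)
    show "(LINT p:\<Omega>|lebesgue. (frechet_derivative \<phi> (at p) (0, 1) *\<^sub>R v' p)) = - (LINT p:\<Omega>|lebesgue. (\<phi> p *\<^sub>R g2' p))"
      unfolding int[OF l(1) e(1) m(1) mt(3)] int[OF l(3) e(3) m(3) mt(1)] using wg t by (simp add: is_weak_grad_def)
  qed
qed

text \<open>The integrand y^a |grad v|^2 times the Jacobian: y^2 = \<sigma> / (1 + c^2) gives the
  first two factors, and \<open>polar_gradient_norm\<close> gives the bracket. Values in
  \<open>ennreal\<close> keep Fubini free of integrability conditions.\<close>

definition polar_density :: "real \<Rightarrow> (real \<times> real \<Rightarrow> 'b::real_normed_vector) \<Rightarrow> (real \<times> real \<Rightarrow> 'b) \<Rightarrow> real \<times> real \<Rightarrow> ennreal" where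
  "polar_density a R A q = ennreal (fst q powr (a / 2) * (1 + (snd q)\<^sup>2) powr (- a / 2)
     * (4 * fst q * (norm (R q))\<^sup>2 + (1 + (snd q)\<^sup>2)\<^sup>2 * (norm (A q))\<^sup>2 / fst q) * polar_jac q)"

text \<open>The density of \<open>disc_energy\<close> in its last argument. Both are twice the
  energy of the problem; the factor 1/2 enters only in \<open>energy_s_polar\<close>.\<close>

definition shell_energy :: "real \<Rightarrow> (real \<times> real \<Rightarrow> 'b::real_normed_vector) \<Rightarrow> (real \<times> real \<Rightarrow> 'b) \<Rightarrow> real \<Rightarrow> ennreal" where
  "shell_energy a R A \<sigma> = (\<integral>\<^sup>+c. polar_density a R A (\<sigma>, c) \<partial>lborel)"

definition disc_energy :: "real \<Rightarrow> (real \<times> real \<Rightarrow> 'b::real_normed_vector) \<Rightarrow> (real \<times> real \<Rightarrow> 'b) \<Rightarrow> real \<Rightarrow> ennreal" where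
  "disc_energy a R A S = (\<integral>\<^sup>+\<sigma>. indicator {0<..<S} \<sigma> * shell_energy a R A \<sigma> \<partial>lborel)"

lemma polar_density_measurable [measurable]:
  fixes R A :: "real \<times> real \<Rightarrow> 'b::{banach, second_countable_topology}"
  assumes [measurable]: "R \<in> borel_measurable borel" "A \<in> borel_measurable borel"
  shows "polar_density a R A \<in> borel_measurable borel"
  unfolding polar_density_def by measurable

lemma shell_energy_measurable [measurable]:
  fixes R A :: "real \<times> real \<Rightarrow> 'b::{banach, second_countable_topology}"
  assumes [measurable]: "R \<in> borel_measurable borel" "A \<in> borel_measurable borel"
  shows "shell_energy a R A \<in> borel_measurable borel"
proof -
  have [measurable]: "(\<lambda>(\<sigma>, c). polar_density a R A (\<sigma>, c)) \<in> borel_measurable (lborel \<Otimes>\<^sub>M lborel)"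
    using polar_density_measurable[OF assms, of a] by (simp add: lborel_prod)
  show ?thesis unfolding shell_energy_def by measurable
qed

lemma half_ball_energy_polar:
  fixes g1 g2 :: "real \<times> real \<Rightarrow> real^'d"
  assumes r: "0 < r" and [measurable]: "g1 \<in> borel_measurable borel" "g2 \<in> borel_measurable borel"
  shows "(\<integral>\<^sup>+p\<in>half_ball (0, 0) r. ennreal (snd p powr a * ((norm (g1 p))\<^sup>2 + (norm (g2 p))\<^sup>2)) \<partial>lebesgue)
    = disc_energy a (polar_radial g1 g2) (polar_angular g1 g2) (r\<^sup>2)"
proof -
  have [measurable]: "polar_radial g1 g2 \<in> borel_measurable borel" "polar_angular g1 g2 \<in> borel_measurable borel"
    unfolding polar_radial_def polar_angular_def by measurable
  let ?F = "\<lambda>p. ennreal (snd p powr a * ((norm (g1 p))\<^sup>2 + (norm (g2 p))\<^sup>2)) * indicator (half_ball (0, 0) r) p"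
  have "(\<integral>\<^sup>+p. ?F p \<partial>lebesgue) = (\<integral>\<^sup>+p. ?F p * indicator {p. 0 < snd p} p \<partial>lborel)"
    unfolding nn_integral_completion by (intro nn_integral_cong) (auto simp: indicator_def half_ball_iff)
  also have "\<dots> = (\<integral>\<^sup>+q. ?F (polar_map q) * ennreal (polar_jac q) \<partial>lborel)"
    by (rule nn_integral_polar) measurable
  also have "\<dots> = (\<integral>\<^sup>+q. indicator {0<..<r\<^sup>2} (fst q) * polar_density a (polar_radial g1 g2) (polar_angular g1 g2) q \<partial>lborel)"
  proof (rule nn_integral_cong)
    fix q :: "real \<times> real"
    show "?F (polar_map q) * ennreal (polar_jac q) = indicator {0<..<r\<^sup>2} (fst q) * polar_density a (polar_radial g1 g2) (polar_angular g1 g2) q"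
    proof (cases "0 < fst q")
      case True
      have "snd (polar_map q) powr a = (fst q / (1 + (snd q)\<^sup>2)) powr (a / 2)"
      proof -
        have "snd (polar_map q) = (fst q / (1 + (snd q)\<^sup>2)) powr (1 / 2)"
          using True by (simp add: polar_map_def powr_half_sqrt)
        then show ?thesis by (simp add: powr_powr)
      qed
      also have "\<dots> = fst q powr (a / 2) * (1 + (snd q)\<^sup>2) powr (- a / 2)"
        using True by (simp add: powr_divide powr_minus_divide)
      finally have y: "snd (polar_map q) powr a = fst q powr (a / 2) * (1 + (snd q)\<^sup>2) powr (- a / 2)" .
      show ?thesis
        using True polar_map_half_ball[OF r True]
        by (simp add: polar_gradient_norm[OF True] y polar_density_def indicator_def ennreal_mult[symmetric])
    next
      case False
      then have "polar_map q \<notin> half_ball (0, 0) r" by (simp add: half_ball_iff)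
      then show ?thesis using False by (simp add: indicator_def)
    qed
  qed
  also have "\<dots> = disc_energy a (polar_radial g1 g2) (polar_angular g1 g2) (r\<^sup>2)"
    unfolding disc_energy_def shell_energy_def
    by (subst nn_fubini_fst) (auto simp: nn_integral_cmult)
  finally show ?thesis .
qed

text \<open>The gradient selected in \<open>energy_s\<close> agrees almost everywhere with g1, g2 by
  uniqueness. \<open>enn2real\<close> sends an infinite value to 0, in accordance with the Lebesgue
  integral of a nonintegrable function.\<close>

lemma energy_s_polar:
  fixes v g1 g2 :: "real \<times> real \<Rightarrow> real^'d"
  assumes r: "0 < r" and wg: "is_weak_grad (half_ball (0, 0) r) v g1 g2"
    and [measurable]: "g1 \<in> borel_measurable borel" "g2 \<in> borel_measurable borel"
  shows "energy_s s v (half_ball (0, 0) r) = 1/2 * enn2real (disc_energy (1 - 2 * s) (polar_radial g1 g2) (polar_angular g1 g2) (r\<^sup>2))"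
proof -
  let ?\<Omega> = "half_ball (0, 0) r"
  obtain h1 h2 where h: "weak_grad ?\<Omega> v = (h1, h2)" by fastforce
  have wh: "is_weak_grad ?\<Omega> v h1 h2"
    using someI[of "\<lambda>g. is_weak_grad ?\<Omega> v (fst g) (snd g)" "(g1, g2)"] wg h by (simp add: weak_grad_def)
  then have l: "locally_integrable_on ?\<Omega> v" "locally_integrable_on ?\<Omega> h1" "locally_integrable_on ?\<Omega> h2" by (auto simp: is_weak_grad_def)
  note [measurable] = locally_integrable_measurable[OF open_half_ball l(1)] locally_integrable_measurable[OF open_half_ball l(2)] locally_integrable_measurable[OF open_half_ball l(3)]
  \<comment> \<open>The selected gradient is merely locally integrable while uniqueness is available
    for Borel functions; k1 and k2 mediate between the two.\<close>
  obtain k1 where k1 [measurable]: "k1 \<in> borel_measurable borel" and e1: "AE p in lborel. p \<in> ?\<Omega> \<longrightarrow> h1 p = k1 p"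
    using locally_integrable_borel_version[OF open_half_ball l(2)] by blast
  obtain k2 where k2 [measurable]: "k2 \<in> borel_measurable borel" and e2: "AE p in lborel. p \<in> ?\<Omega> \<longrightarrow> h2 p = k2 p"
    using locally_integrable_borel_version[OF open_half_ball l(3)] by blast
  have [measurable]: "?\<Omega> \<in> sets lebesgue" by simp
  have bl: "f \<in> borel_measurable lebesgue" if "f \<in> borel_measurable borel" for f :: "real \<times> real \<Rightarrow> 'z::topological_space" using that by (simp add: measurable_completion)
  have wk: "is_weak_grad ?\<Omega> v k1 k2"
  proof (rule is_weak_grad_cong[OF open_half_ball wh])
    show "AE p in lborel. p \<in> ?\<Omega> \<longrightarrow> v p = v p \<and> k1 p = h1 p \<and> k2 p = h2 p" using e1 e2 by eventually_elim auto
    have "(\<lambda>p. indicator ?\<Omega> p *\<^sub>R k1 p) \<in> borel_measurable borel" "(\<lambda>p. indicator ?\<Omega> p *\<^sub>R k2 p) \<in> borel_measurable borel" by measurable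
    then show "(\<lambda>p. indicator ?\<Omega> p *\<^sub>R k1 p) \<in> borel_measurable lebesgue" "(\<lambda>p. indicator ?\<Omega> p *\<^sub>R k2 p) \<in> borel_measurable lebesgue" by (simp_all add: bl)
  qed measurable
  have "AE p in lborel. p \<in> ?\<Omega> \<longrightarrow> g1 p = k1 p \<and> g2 p = k2 p"
    by (rule weak_grad_unique[OF r wg wk]) measurable
  then have u: "AE p in lborel. p \<in> ?\<Omega> \<longrightarrow> g1 p = h1 p \<and> g2 p = h2 p"
    using e1 e2 by eventually_elim auto
  let ?F = "\<lambda>h1 h2 p. indicator ?\<Omega> p *\<^sub>R (snd p powr (1 - 2 * s) * ((norm (h1 p :: real^'d))\<^sup>2 + (norm (h2 p :: real^'d))\<^sup>2))"
  have mF: "?F h1 h2 \<in> borel_measurable lebesgue"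
  proof -
    have [measurable]: "(\<lambda>p. snd p powr (1 - 2 * s)) \<in> borel_measurable (lebesgue :: (real \<times> real) measure)"
      by (rule bl) measurable
    have "?F h1 h2 = (\<lambda>p. snd p powr (1 - 2 * s) * ((norm (indicator ?\<Omega> p *\<^sub>R h1 p))\<^sup>2 + (norm (indicator ?\<Omega> p *\<^sub>R h2 p))\<^sup>2))"
      by (auto simp: indicator_def fun_eq_iff)
    also have "\<dots> \<in> borel_measurable lebesgue" by measurable
    finally show ?thesis .
  qed
  have "(LINT p|lebesgue. ?F h1 h2 p) = enn2real (\<integral>\<^sup>+p. ennreal (?F h1 h2 p) \<partial>lebesgue)"
    by (rule integral_eq_nn_integral[OF mF]) simp
  also have "(\<integral>\<^sup>+p. ennreal (?F h1 h2 p) \<partial>lebesgue) = (\<integral>\<^sup>+p\<in>?\<Omega>. ennreal (snd p powr (1 - 2 * s) * ((norm (g1 p))\<^sup>2 + (norm (g2 p))\<^sup>2)) \<partial>lebesgue)"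
  proof (rule nn_integral_cong_AE)
    show "AE p in lebesgue. ennreal (?F h1 h2 p) = ennreal (snd p powr (1 - 2 * s) * ((norm (g1 p))\<^sup>2 + (norm (g2 p))\<^sup>2)) * indicator ?\<Omega> p"
      using AE_completion[OF u] by eventually_elim (auto simp: indicator_def)
  qed
  also have "\<dots> = disc_energy (1 - 2 * s) (polar_radial g1 g2) (polar_angular g1 g2) (r\<^sup>2)"
    by (rule half_ball_energy_polar[OF r]) measurable
  finally show ?thesis by (simp add: energy_s_def h set_lebesgue_integral_def)
qed

section \<open>The competitor\<close>

lemma nn_integral_powr_interval:
  fixes b S :: real
  assumes "0 < b" "0 < S"
  shows "(\<integral>\<^sup>+\<sigma>. indicator {0<..<S} \<sigma> * ennreal (\<sigma> powr (b - 1)) \<partial>lborel) = ennreal (S powr b / b)"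
proof -
  have "((\<lambda>\<sigma>. \<sigma> powr (b - 1)) has_integral S powr (b - 1 + 1) / (b - 1 + 1)) {0..S}"
    using assms by (intro has_integral_powr_from_0) auto
  then have "(\<integral>\<^sup>+\<sigma>. ennreal (\<sigma> powr (b - 1)) * indicator {0..S} \<sigma> \<partial>lborel) = ennreal (S powr b / b)"
    by (intro nn_integral_has_integral_lebesgue') auto
  moreover have "(\<integral>\<^sup>+\<sigma>. ennreal (\<sigma> powr (b - 1)) * indicator {0..S} \<sigma> \<partial>lborel) = (\<integral>\<^sup>+\<sigma>. indicator {0<..<S} \<sigma> * ennreal (\<sigma> powr (b - 1)) \<partial>lborel)"
  proof (rule nn_integral_cong_AE)
    show "AE \<sigma> in lborel. ennreal (\<sigma> powr (b - 1)) * indicator {0..S} \<sigma> = indicator {0<..<S} \<sigma> * ennreal (\<sigma> powr (b - 1))"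
      using AE_lborel_singleton[of 0] AE_lborel_singleton[of S] by eventually_elim (auto simp: indicator_def)
  qed
  ultimately show ?thesis by simp
qed

text \<open>Since c is the cotangent of the polar angle, this is that angle divided by pi. It is the
  cut-off \<zeta> of the overview, and its derivative is of order 1 / (1 + c^2), small enough for
  the angular weight.\<close>

definition cut :: "real \<Rightarrow> real" where "cut c = 1/2 - arctan c / pi"

lemma cut_bounds: "0 \<le> cut c" "cut c \<le> 1"
  using arctan_bounded[of c] by (auto simp: cut_def divide_simps)

lemma cut_has_derivative: "(cut has_real_derivative - 1 / (pi * (1 + c\<^sup>2))) (at c within s)"
  unfolding cut_def[abs_def] by (auto intro!: derivative_eq_intros simp: divide_simps) (simp add: algebra_simps)?

lemma cut_tendsto: "(cut \<longlongrightarrow> 0) at_top" "(cut \<longlongrightarrow> 1) at_bot"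
proof -
  have "((\<lambda>c. 1/2 - arctan c / pi) \<longlongrightarrow> 1/2 - (pi / 2) / pi) at_top" by (intro tendsto_intros tendsto_arctan_at_top) simp
  then show "(cut \<longlongrightarrow> 0) at_top" by (simp add: cut_def[abs_def])
  have "((\<lambda>c. 1/2 - arctan c / pi) \<longlongrightarrow> 1/2 - (- (pi / 2)) / pi) at_bot" by (intro tendsto_intros tendsto_arctan_at_bot) simp
  then show "(cut \<longlongrightarrow> 1) at_bot" by (simp add: cut_def[abs_def])
qed

lemma cut_measurable [measurable]: "cut \<in> borel_measurable borel"
  unfolding cut_def[abs_def] by measurable

text \<open>The data of one good slice at \<sigma> = S: value k0 at c = 0, derivative f, ends p0
  (right) and q0 (left), and a curve G from p0 to q0 with velocity within relative error \<tau> of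
  the chord.\<close>

locale competitor =
  fixes S \<beta> \<tau> :: real and k0 p0 q0 :: "real^'d" and f \<phi> G G' :: "real \<Rightarrow> real^'d"
  assumes S: "0 < S" and \<beta>: "0 < \<beta>" and \<tau>: "0 \<le> \<tau>" "\<tau> \<le> 1"
    and fi: "integrable lborel f" and fm [measurable]: "f \<in> borel_measurable borel"
    and \<phi>: "\<And>c. \<phi> c = k0 + signed_integral 0 c f" and p0: "p0 = right_end k0 f" and q0: "q0 = left_end k0 f"
    and G01: "G 0 = p0" "G 1 = q0" and cG: "continuous_on UNIV G" "continuous_on UNIV G'"
    and dG: "\<And>t. t \<in> {0..1} \<Longrightarrow> (G has_vector_derivative G' t) (at t within {0..1})"
    and bG: "\<And>t. t \<in> {0..1} \<Longrightarrow> norm (G' t - (q0 - p0)) \<le> \<tau> * norm (q0 - p0)"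
begin

definition pw where "pw \<sigma> = (\<sigma> / S) powr \<beta>"
text \<open>Deviation of the curve from its chord: zero at both ends and of order \<tau> in
  between.\<close>

definition dev where "dev t = G t - p0 - t *\<^sub>R (q0 - p0)"
text \<open>At T = 1 this is the slice itself, as \<open>dev\<close> vanishes there. For c ->
  +\<infinity> it tends to p0 and for c -> -\<infinity> to p0 + T (q0 - p0) + dev(T) = G(T): the
  correction acts in full exactly where the chord would appear as a boundary value.\<close>

definition comp where "comp q = p0 + pw (fst q) *\<^sub>R (\<phi> (snd q) - p0) + cut (snd q) *\<^sub>R dev (pw (fst q))"
definition comp_radial where
  "comp_radial q = (\<beta> * pw (fst q) / fst q) *\<^sub>R ((\<phi> (snd q) - p0) + cut (snd q) *\<^sub>R (G' (pw (fst q)) - (q0 - p0)))"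
definition comp_angular where
  "comp_angular q = pw (fst q) *\<^sub>R f (snd q) + (- 1 / (pi * (1 + (snd q)\<^sup>2))) *\<^sub>R dev (pw (fst q))"

lemma phi_measurable [measurable]: "\<phi> \<in> borel_measurable borel"
proof -
  have "(\<lambda>c. signed_integral 0 c f) \<in> borel_measurable borel" by (rule signed_integral_measurable_fun) measurable
  then show ?thesis unfolding \<phi>[abs_def] by simp
qed

lemma comp_measurable [measurable]:
  "comp \<in> borel_measurable borel" "comp_radial \<in> borel_measurable borel" "comp_angular \<in> borel_measurable borel"
proof -
  note [measurable] = borel_measurable_continuous_onI[OF cG(1)] borel_measurable_continuous_onI[OF cG(2)]
  show "comp \<in> borel_measurable borel" "comp_radial \<in> borel_measurable borel" "comp_angular \<in> borel_measurable borel"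
    unfolding comp_def[abs_def] comp_radial_def[abs_def] comp_angular_def[abs_def] dev_def pw_def by measurable
qed

lemma pw_unit: "\<sigma> \<in> {0<..S} \<Longrightarrow> pw \<sigma> \<in> {0..1}" "\<sigma> \<in> {0<..S} \<Longrightarrow> 0 < pw \<sigma>" "pw S = 1"
  using S \<beta> by (auto simp: pw_def intro: powr_le1)

lemma pw_has_derivative: "0 < \<sigma> \<Longrightarrow> (pw has_real_derivative \<beta> * pw \<sigma> / \<sigma>) (at \<sigma> within s)"
  unfolding pw_def[abs_def] using S
  by (auto intro!: derivative_eq_intros simp: powr_diff field_simps)

lemma comp_radial_ftc:
  assumes "\<sigma> \<in> {0<..S}"
  shows "comp (\<sigma>, c) = \<phi> c + signed_integral S \<sigma> (\<lambda>t. comp_radial (t, c))"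
proof -
  have I: "{min S \<sigma>..max S \<sigma>} = {\<sigma>..S}" using assms by auto
  have "signed_integral S \<sigma> (\<lambda>t. comp_radial (t, c)) = comp (\<sigma>, c) - comp (S, c)"
  proof (rule signed_integral_FTC[where F = "\<lambda>t. comp (t, c)"], unfold I)
    fix x assume x: "x \<in> {\<sigma>..S}"
    then have x0: "0 < x" "x \<in> {0<..S}" using assms by auto
    have im: "pw ` {\<sigma>..S} \<subseteq> {0..1}" using assms pw_unit(1) by force
    have P: "(pw has_vector_derivative \<beta> * pw x / x) (at x within {\<sigma>..S})"
      using pw_has_derivative[OF x0(1)] by (simp add: has_real_derivative_iff_has_vector_derivative)
    have "(G \<circ> pw has_vector_derivative (\<beta> * pw x / x) *\<^sub>R G' (pw x)) (at x within {\<sigma>..S})"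
      by (rule vector_diff_chain_within[OF P has_vector_derivative_within_subset[OF dG[OF pw_unit(1)[OF x0(2)]] im]])
    then have GP: "((\<lambda>t. G (pw t)) has_vector_derivative (\<beta> * pw x / x) *\<^sub>R G' (pw x)) (at x within {\<sigma>..S})"
      by (simp add: o_def)
    show "((\<lambda>t. comp (t, c)) has_vector_derivative comp_radial (x, c)) (at x within {\<sigma>..S})"
    proof -
      have M: "((\<lambda>t. pw t *\<^sub>R v) has_vector_derivative (\<beta> * pw x / x) *\<^sub>R v) (at x within {\<sigma>..S})" for v :: "real^'d"
        using has_vector_derivative_scaleR[OF pw_has_derivative[OF x0(1)] has_vector_derivative_const[of v]] by simp
      have D: "((\<lambda>t. G (pw t) - p0 - pw t *\<^sub>R (q0 - p0)) has_vector_derivative (\<beta> * pw x / x) *\<^sub>R G' (pw x) - 0 - (\<beta> * pw x / x) *\<^sub>R (q0 - p0)) (at x within {\<sigma>..S})"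
        by (intro has_vector_derivative_diff has_vector_derivative_const M GP)
      have "((\<lambda>t. p0 + pw t *\<^sub>R (\<phi> c - p0) + cut c *\<^sub>R (G (pw t) - p0 - pw t *\<^sub>R (q0 - p0))) has_vector_derivative
        (0 + (\<beta> * pw x / x) *\<^sub>R (\<phi> c - p0)) + cut c *\<^sub>R ((\<beta> * pw x / x) *\<^sub>R G' (pw x) - 0 - (\<beta> * pw x / x) *\<^sub>R (q0 - p0))) (at x within {\<sigma>..S})"
        by (intro has_vector_derivative_add has_vector_derivative_const M bounded_linear.has_vector_derivative[OF bounded_linear_scaleR_right] D)
      then show ?thesis
        unfolding comp_def comp_radial_def dev_def fst_conv snd_conv
        by (rule has_vector_derivative_eq_rhs) (simp add: scaleR_add_right scaleR_diff_right mult.commute)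
    qed
  next
    have "continuous_on {\<sigma>..S} pw"
      using assms by (intro DERIV_continuous_on[OF pw_has_derivative]) auto
    moreover have "continuous_on {\<sigma>..S} (\<lambda>t. G' (pw t))"
      by (rule continuous_on_compose2[OF cG(2) \<open>continuous_on {\<sigma>..S} pw\<close>]) simp
    ultimately show "continuous_on {\<sigma>..S} (\<lambda>t. comp_radial (t, c))"
      unfolding comp_radial_def fst_conv snd_conv using assms by (intro continuous_intros) auto
  qed
  moreover have "comp (S, c) = \<phi> c" by (simp add: comp_def pw_unit dev_def G01)
  ultimately show ?thesis by simp
qed

lemma comp_angular_ftc: "comp (\<sigma>, c) = comp (\<sigma>, 0) + signed_integral 0 c (\<lambda>t. comp_angular (\<sigma>, t))"
proof -
  have cc: "continuous_on X (\<lambda>t::real. - 1 / (pi * (1 + t\<^sup>2)))" for X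
    by (intro continuous_intros) (metis add_pos_nonneg mult_eq_0_iff pi_neq_zero less_irrefl zero_le_power2 zero_less_one)
  have z: "signed_integral 0 c (\<lambda>t. (- 1 / (pi * (1 + t\<^sup>2))) *\<^sub>R dev (pw \<sigma>)) = cut c *\<^sub>R dev (pw \<sigma>) - cut 0 *\<^sub>R dev (pw \<sigma>)"
  proof (rule signed_integral_FTC[where F = "\<lambda>t. cut t *\<^sub>R dev (pw \<sigma>)"])
    show "((\<lambda>t. cut t *\<^sub>R dev (pw \<sigma>)) has_vector_derivative (- 1 / (pi * (1 + x\<^sup>2))) *\<^sub>R dev (pw \<sigma>)) (at x within {min 0 c..max 0 c})" for x
      using has_vector_derivative_scaleR[OF cut_has_derivative[of x] has_vector_derivative_const[of "dev (pw \<sigma>)"]] by simp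
  qed (intro continuous_on_scaleR cc continuous_intros)
  have i1: "integrable lborel (\<lambda>t. sgn_ind 0 c t *\<^sub>R f t)"
    by (rule sgn_ind_integrable[OF is_interval_univ _ _ integrable_imp_interval_integrable[OF fi]]) auto
  have "interval_integrable UNIV (\<lambda>t::real. (- 1 / (pi * (1 + t\<^sup>2))) *\<^sub>R dev (pw \<sigma>))"
    unfolding interval_integrable_def
  proof (intro conjI allI impI)
    show "integrable lborel (\<lambda>x. indicator {a..b} x *\<^sub>R (- 1 / (pi * (1 + x\<^sup>2))) *\<^sub>R dev (pw \<sigma>))" for a b :: real
      by (rule borel_integrable_compact) (auto intro!: continuous_on_scaleR cc continuous_intros)
  qed measurable
  then have i2: "integrable lborel (\<lambda>t. sgn_ind 0 c t *\<^sub>R ((- 1 / (pi * (1 + t\<^sup>2))) *\<^sub>R dev (pw \<sigma>)))"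
    by (rule sgn_ind_integrable[OF is_interval_univ, rotated 2]) auto
  have "signed_integral 0 c (\<lambda>t. comp_angular (\<sigma>, t)) = (\<integral>t. pw \<sigma> *\<^sub>R (sgn_ind 0 c t *\<^sub>R f t) + sgn_ind 0 c t *\<^sub>R ((- 1 / (pi * (1 + t\<^sup>2))) *\<^sub>R dev (pw \<sigma>)) \<partial>lborel)"
    unfolding signed_integral_def comp_angular_def fst_conv snd_conv
    by (intro Bochner_Integration.integral_cong refl) (simp add: scaleR_add_right scaleR_diff_right mult.commute)
  also have "\<dots> = pw \<sigma> *\<^sub>R signed_integral 0 c f + (cut c *\<^sub>R dev (pw \<sigma>) - cut 0 *\<^sub>R dev (pw \<sigma>))"
    unfolding Bochner_Integration.integral_add[OF integrable_scaleR_right[OF i1] i2] Bochner_Integration.integral_scaleR_right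
    by (simp only: z[unfolded signed_integral_def] signed_integral_def)
  finally show ?thesis by (simp add: comp_def \<phi> signed_integral_def sgn_ind_def algebra_simps)
qed

abbreviation mass where "mass \<equiv> (\<integral>x. norm (f x) \<partial>lborel)"

lemma mass_bounds: "0 \<le> mass" "norm (\<phi> c - p0) \<le> mass" "norm (q0 - p0) \<le> mass"
  using slice_end_bounds(1,2)[OF fi, of k0] by (simp_all add: \<phi> p0 q0)

text \<open>Mean value inequality. The factor t is kept because it makes the correction decay
  towards the centre at the same rate T as the main part.\<close>

lemma dev_bound:
  assumes t: "t \<in> {0..1}"
  shows "norm (dev t) \<le> t * (\<tau> * mass)"
proof -
  have "norm (dev t - dev 0) \<le> (\<tau> * mass) * norm (t - 0)"
  proof (rule differentiable_bound[where S = "{0..1}" and f' = "\<lambda>x h. h *\<^sub>R (G' x - (q0 - p0))"])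
    fix x :: real assume x: "x \<in> {0..1}"
    have "(dev has_vector_derivative (G' x - (q0 - p0))) (at x within {0..1})"
    proof -
      have "((\<lambda>t. t *\<^sub>R (q0 - p0)) has_vector_derivative (q0 - p0)) (at x within {0..1})"
        using has_vector_derivative_scaleR[OF DERIV_ident has_vector_derivative_const[of "q0 - p0"]] by simp
      from has_vector_derivative_diff[OF has_vector_derivative_diff[OF dG[OF x] has_vector_derivative_const[of p0]] this]
      show ?thesis unfolding dev_def[abs_def] by simp
    qed
    then show "(dev has_derivative (\<lambda>h. h *\<^sub>R (G' x - (q0 - p0)))) (at x within {0..1})"
      by (simp add: has_vector_derivative_def)
    show "onorm (\<lambda>h. h *\<^sub>R (G' x - (q0 - p0))) \<le> \<tau> * mass"
    proof (rule onorm_le)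
      fix h :: real
      have "norm (G' x - (q0 - p0)) \<le> \<tau> * mass"
        using bG[OF x] mult_left_mono[OF mass_bounds(3) \<tau>(1)] by linarith
      from mult_left_mono[OF this abs_ge_zero, of h]
      show "norm (h *\<^sub>R (G' x - (q0 - p0))) \<le> \<tau> * mass * norm h" by (simp add: mult.commute)
    qed
  qed (use t in auto)
  then show ?thesis using t by (simp add: dev_def[of 0] G01 mult.commute)
qed

text \<open>The length \<open>mass\<close> of the slice dominates both |\<phi> - p0| and |q0 - p0|.
  In the first two estimates \<tau> <= 1 absorbs the correction into a factor 2; in the third \<tau>
  is kept, since there it competes with the gain.\<close>

lemma comp_bounds:
  assumes "\<sigma> \<in> {0<..S}"
  shows "norm (comp (\<sigma>, c)) \<le> norm p0 + 2 * mass"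
    and "norm (comp_radial (\<sigma>, c)) \<le> 2 * \<beta> * pw \<sigma> * mass / \<sigma>"
    and "norm (comp_angular (\<sigma>, c)) \<le> pw \<sigma> * (norm (f c) + \<tau> * mass / (1 + c\<^sup>2))"
proof -
  have P: "0 \<le> pw \<sigma>" "pw \<sigma> \<le> 1" "0 < pw \<sigma>" "0 < \<sigma>" using pw_unit(1,2)[OF assms] assms by auto
  have D: "norm (dev (pw \<sigma>)) \<le> pw \<sigma> * (\<tau> * mass)" using assms pw_unit(1) dev_bound by blast
  have tm: "\<tau> * mass \<le> mass" using \<tau> mass_bounds(1) by (simp add: mult_left_le_one_le)
  have "norm (comp (\<sigma>, c)) \<le> norm p0 + pw \<sigma> * norm (\<phi> c - p0) + cut c * norm (dev (pw \<sigma>))"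
    unfolding comp_def fst_conv snd_conv using P(1) cut_bounds[of c]
    by (intro norm_triangle_le add_mono order_refl) auto
  also have "\<dots> \<le> norm p0 + 1 * mass + 1 * mass"
  proof (intro add_mono mult_mono order_refl)
    show "norm (dev (pw \<sigma>)) \<le> mass"
      using D mult_mono[OF P(2) tm] P(1) mass_bounds(1) \<tau> by auto
  qed (use P cut_bounds mass_bounds in auto)
  finally show "norm (comp (\<sigma>, c)) \<le> norm p0 + 2 * mass" by simp
  have "norm ((\<phi> c - p0) + cut c *\<^sub>R (G' (pw \<sigma>) - (q0 - p0))) \<le> norm (\<phi> c - p0) + cut c * norm (G' (pw \<sigma>) - (q0 - p0))"
    using cut_bounds[of c] by (intro norm_triangle_le add_mono order_refl) auto
  also have "\<dots> \<le> mass + 1 * mass"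
  proof (intro add_mono mult_mono)
    show "norm (G' (pw \<sigma>) - (q0 - p0)) \<le> mass"
      using bG[OF pw_unit(1)[OF assms]] mult_left_mono[OF mass_bounds(3) \<tau>(1)] tm by linarith
  qed (use cut_bounds mass_bounds in auto)
  finally have "norm ((\<phi> c - p0) + cut c *\<^sub>R (G' (pw \<sigma>) - (q0 - p0))) \<le> 2 * mass" by simp
  from mult_left_mono[OF this, of "\<beta> * pw \<sigma> / \<sigma>"]
  show "norm (comp_radial (\<sigma>, c)) \<le> 2 * \<beta> * pw \<sigma> * mass / \<sigma>"
    using P \<beta> by (simp add: comp_radial_def mult_ac)
  have "norm (comp_angular (\<sigma>, c)) \<le> pw \<sigma> * norm (f c) + (1 / (pi * (1 + c\<^sup>2))) * norm (dev (pw \<sigma>))"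
    unfolding comp_angular_def fst_conv snd_conv using P(1)
    by (intro norm_triangle_le add_mono order_refl) (auto simp: abs_mult)
  also have "\<dots> \<le> pw \<sigma> * norm (f c) + (1 / (1 + c\<^sup>2)) * (pw \<sigma> * (\<tau> * mass))"
  proof (intro add_mono mult_mono order_refl D)
    have "1 * (1 + c\<^sup>2) \<le> pi * (1 + c\<^sup>2)" using pi_gt3 by (intro mult_right_mono) auto
    then show "1 / (pi * (1 + c\<^sup>2)) \<le> 1 / (1 + c\<^sup>2)"
      by (intro divide_left_mono) (auto intro!: mult_pos_pos add_pos_nonneg)
  qed (use P in auto)
  finally show "norm (comp_angular (\<sigma>, c)) \<le> pw \<sigma> * (norm (f c) + \<tau> * mass / (1 + c\<^sup>2))"
    by (simp add: algebra_simps)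
qed

lemma comp_rect_integrable:
  shows "rect_integrable {0<..<\<rho>} UNIV (\<lambda>q. if fst q \<le> S then comp q else 0)"
    and "rect_integrable {0<..<\<rho>} UNIV (\<lambda>q. if fst q \<le> S then comp_radial q else 0)"
    and "rect_integrable {0<..<\<rho>} UNIV (\<lambda>q. if fst q \<le> S then comp_angular q else 0)"
proof -
  have ii: "interval_integrable {0<..<\<rho>} k" if "continuous_on {0<..} k" "k \<in> borel_measurable borel" for k :: "real \<Rightarrow> real"
    unfolding interval_integrable_def
  proof (intro conjI allI impI that)
    fix c d :: real assume "{c..d} \<subseteq> {0<..<\<rho>}"
    then show "integrable lborel (\<lambda>x. indicator {c..d} x *\<^sub>R k x)"
      by (intro borel_integrable_compact continuous_on_subset[OF that(1)]) auto
  qed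
  have one: "integrable lborel (\<lambda>x. indicator {c..d} x *\<^sub>R (1::real))" for c d :: real
    by (rule borel_integrable_compact) auto
  then have one': "integrable lborel (indicat_real {c..d})" for c d :: real using one[of c d] by simp
  show "rect_integrable {0<..<\<rho>} UNIV (\<lambda>q. if fst q \<le> S then comp q else 0)"
    using comp_bounds(1) mass_bounds(1)
    by (intro rect_integrable_tensor[where k = "\<lambda>_. norm p0 + 2 * mass" and h = "\<lambda>_. 1"] ii one) (auto simp: intro: order_trans)
  show "rect_integrable {0<..<\<rho>} UNIV (\<lambda>q. if fst q \<le> S then comp_radial q else 0)"
  proof (rule rect_integrable_tensor[where k = "\<lambda>\<sigma>. 2 * \<beta> * mass / \<sigma>" and h = "\<lambda>_. 1"])
    fix \<sigma> c :: real assume "\<sigma> \<in> {0<..<\<rho>}"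
    then have s0: "0 < \<sigma>" by simp
    have n: "0 \<le> 2 * \<beta> * mass / \<sigma>" using s0 \<beta> mass_bounds(1) by simp
    show "norm (if fst (\<sigma>, c) \<le> S then comp_radial (\<sigma>, c) else 0) \<le> 2 * \<beta> * mass / \<sigma> * 1"
    proof (cases "\<sigma> \<le> S")
      case True
      with s0 have s: "\<sigma> \<in> {0<..S}" by simp
      have "2 * \<beta> * pw \<sigma> * mass / \<sigma> = pw \<sigma> * (2 * \<beta> * mass / \<sigma>)" by simp
      also have "\<dots> \<le> 1 * (2 * \<beta> * mass / \<sigma>)" using pw_unit(1)[OF s] n by (intro mult_right_mono) auto
      finally show ?thesis using comp_bounds(2)[OF s, of c] True by simp
    qed (use n in simp)
  qed (auto intro!: ii one' continuous_intros)
  show "rect_integrable {0<..<\<rho>} UNIV (\<lambda>q. if fst q \<le> S then comp_angular q else 0)"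
  proof (rule rect_integrable_tensor[where k = "\<lambda>\<sigma>. 1" and h = "\<lambda>c. norm (f c) + \<tau> * mass"])
    fix \<sigma> c :: real assume "\<sigma> \<in> {0<..<\<rho>}"
    then have s0: "0 < \<sigma>" by simp
    have tm: "0 \<le> \<tau> * mass" using \<tau> mass_bounds(1) by simp
    show "norm (if fst (\<sigma>, c) \<le> S then comp_angular (\<sigma>, c) else 0) \<le> 1 * (norm (f c) + \<tau> * mass)"
    proof (cases "\<sigma> \<le> S")
      case True
      with s0 have s: "\<sigma> \<in> {0<..S}" by simp
      have "\<tau> * mass * 1 \<le> \<tau> * mass * (1 + c\<^sup>2)" by (intro mult_left_mono tm) auto
      then have d: "\<tau> * mass / (1 + c\<^sup>2) \<le> \<tau> * mass" by (subst pos_divide_le_eq) (auto intro: add_pos_nonneg)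
      have d0: "0 \<le> \<tau> * mass / (1 + c\<^sup>2)" using tm by simp
      have "pw \<sigma> * (norm (f c) + \<tau> * mass / (1 + c\<^sup>2)) \<le> 1 * (norm (f c) + \<tau> * mass)"
        using pw_unit(1)[OF s] d d0 by (intro mult_mono) auto
      then show ?thesis using comp_bounds(3)[OF s, of c] True by simp
    qed (use tm in simp)
  next
    fix c d :: real
    have "integrable lborel (\<lambda>x. indicator {c..d} x *\<^sub>R norm (f x))"
      using integrable_norm[OF fi] by (rule integrable_mult_indicator[rotated]) simp
    then have "integrable lborel (\<lambda>x. indicator {c..d} x *\<^sub>R norm (f x) + (\<tau> * mass) *\<^sub>R (indicator {c..d} x *\<^sub>R (1::real)))"
      by (intro Bochner_Integration.integrable_add integrable_scaleR_right one)
    then show "integrable lborel (\<lambda>x. indicator {c..d} x *\<^sub>R (norm (f x) + \<tau> * mass))"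
      by (simp add: algebra_simps)
  qed (auto intro!: ii)
qed

text \<open>The slice's own term |f|^2 must keep a coefficient close to 1, here 1 + \<tau>. All
  remaining terms carry \<beta>^2 or \<tau> and may be estimated generously by the squared length of
  the slice.\<close>

lemma comp_density_bound:
  fixes a c \<sigma> :: real
  assumes a: "0 < a" and s: "\<sigma> \<in> {0<..S}"
  shows "polar_density a comp_radial comp_angular (\<sigma>, c)
    \<le> ennreal (1/2 * \<sigma> powr (a / 2 - 1) * (pw \<sigma>)\<^sup>2 *
        ((16 * \<beta>\<^sup>2 + 2 * \<tau>) * mass\<^sup>2 * (1 + c\<^sup>2) powr (- (1 - a / 2)) + (1 + \<tau>) * ((1 + c\<^sup>2) powr (1 - a / 2) * (norm (f c))\<^sup>2)))"
proof -
  define w where "w = 1 + c\<^sup>2"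
  define P where "P = \<sigma> powr (a / 2 - 1)"
  define Q where "Q = w powr (- a / 2 - 1)"
  define V where "V = w powr (- (1 - a / 2))"
  define r z t where "r = norm (comp_radial (\<sigma>, c))" and "z = norm (comp_angular (\<sigma>, c))" and "t = pw \<sigma>"
  define F where "F = norm (f c)"
  have s0: "0 < \<sigma>" using s by simp
  have w: "1 \<le> w" by (simp add: w_def)
  have P: "0 \<le> P" "\<sigma> powr (a / 2) = P * \<sigma>" using s0 by (auto simp: P_def powr_diff)
  have Q: "0 \<le> Q" "w powr (- a / 2) = Q * w" using w by (auto simp: Q_def powr_diff)
  have wt: "w powr (1 - a / 2) = Q * w\<^sup>2"
  proof -
    have "w powr (1 - a / 2) = w powr (- a / 2 - 1 + 2)" by simp
    also have "\<dots> = Q * w powr 2" unfolding Q_def by (rule powr_add)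
    finally show ?thesis using w by (simp add: powr_numeral)
  qed
  \<comment> \<open>Enlarging w^(-a/2 - 1) to w^(a/2 - 1) lets all error terms be integrated in c
    with the single constant C0.\<close>
  have QV: "Q \<le> V" unfolding Q_def V_def using a w by (intro powr_mono) auto
  have t: "0 \<le> t" using pw_unit(1)[OF s] by (simp add: t_def)
  have m: "0 \<le> mass" by (rule mass_bounds)
  have J: "polar_jac (\<sigma>, c) = 1 / (2 * w)" using s0 by (simp add: polar_jac_def w_def)
  have "\<sigma> * r \<le> 2 * \<beta> * t * mass"
    using comp_bounds(2)[OF s, of c] s0 by (simp add: r_def t_def pos_le_divide_eq mult_ac)
  then have "(\<sigma> * r)\<^sup>2 \<le> (2 * \<beta> * t * mass)\<^sup>2" using s0 by (intro power_mono) (auto simp: r_def)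
  then have "4 * Q * (\<sigma> * r)\<^sup>2 \<le> 4 * V * (2 * \<beta> * t * mass)\<^sup>2" using QV Q(1) by (intro mult_mono) auto
  then have R: "4 * Q * (\<sigma> * r)\<^sup>2 \<le> t\<^sup>2 * (16 * \<beta>\<^sup>2 * mass\<^sup>2 * V)" by (simp add: power_mult_distrib mult_ac)
  define y where "y = mass / w"
  have y: "0 \<le> y" using m w by (simp add: y_def)
  have "z \<le> t * (F + \<tau> * y)" using comp_bounds(3)[OF s, of c] by (simp add: z_def t_def F_def w_def y_def)
  then have "z\<^sup>2 \<le> (t * (F + \<tau> * y))\<^sup>2" by (intro power_mono) (auto simp: z_def)
  also have "\<dots> \<le> t\<^sup>2 * ((1 + \<tau>) * F\<^sup>2 + 2 * \<tau> * y\<^sup>2)"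
    unfolding power_mult_distrib
  proof (intro mult_left_mono)
    \<comment> \<open>The cross term is split by 2 F y <= F^2 + y^2, and \<tau>^2 <= \<tau> handles
      the square, so the errors stay linear in \<tau> and F^2 gains only the factor 1 +
      \<tau>.\<close>
    have "\<tau> * (2 * F * y) \<le> \<tau> * (F\<^sup>2 + y\<^sup>2)" using sum_squares_bound[of F y] \<tau> by (intro mult_left_mono) auto
    moreover have "\<tau> * \<tau> * y\<^sup>2 \<le> \<tau> * y\<^sup>2" using \<tau> by (intro mult_right_mono) (auto simp: mult_left_le)
    ultimately show "(F + \<tau> * y)\<^sup>2 \<le> (1 + \<tau>) * F\<^sup>2 + 2 * \<tau> * y\<^sup>2" by (simp add: power2_eq_square algebra_simps)
  qed simp
  finally have "Q * w\<^sup>2 * z\<^sup>2 \<le> Q * w\<^sup>2 * (t\<^sup>2 * ((1 + \<tau>) * F\<^sup>2 + 2 * \<tau> * y\<^sup>2))" using Q(1) by (intro mult_left_mono) auto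
  also have "\<dots> = t\<^sup>2 * ((1 + \<tau>) * (Q * w\<^sup>2 * F\<^sup>2) + 2 * \<tau> * mass\<^sup>2 * Q)"
    using w by (simp add: y_def power_divide algebra_simps)
  also have "\<dots> \<le> t\<^sup>2 * ((1 + \<tau>) * (Q * w\<^sup>2 * F\<^sup>2) + 2 * \<tau> * mass\<^sup>2 * V)"
    using QV \<tau> by (intro mult_left_mono add_left_mono) auto
  finally have A: "Q * w\<^sup>2 * z\<^sup>2 \<le> t\<^sup>2 * ((1 + \<tau>) * (Q * w\<^sup>2 * F\<^sup>2) + 2 * \<tau> * mass\<^sup>2 * V)" .
  have "P * \<sigma> * (Q * w) * (4 * \<sigma> * r\<^sup>2 + w\<^sup>2 * z\<^sup>2 / \<sigma>) * (1 / (2 * w)) = 1/2 * P * (4 * Q * (\<sigma> * r)\<^sup>2 + Q * w\<^sup>2 * z\<^sup>2)"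
    using s0 w by (simp add: field_simps power2_eq_square)
  also have "\<dots> \<le> 1/2 * P * (t\<^sup>2 * (16 * \<beta>\<^sup>2 * mass\<^sup>2 * V) + t\<^sup>2 * ((1 + \<tau>) * (Q * w\<^sup>2 * F\<^sup>2) + 2 * \<tau> * mass\<^sup>2 * V))"
    using P(1) by (intro mult_left_mono add_mono R A) auto
  also have "\<dots> = 1/2 * P * t\<^sup>2 * ((16 * \<beta>\<^sup>2 + 2 * \<tau>) * mass\<^sup>2 * V + (1 + \<tau>) * (Q * w\<^sup>2 * F\<^sup>2))"
    by (simp add: algebra_simps)
  finally show ?thesis
    unfolding polar_density_def fst_conv snd_conv w_def[symmetric] J P(2) Q(2) wt r_def[symmetric] z_def[symmetric] t_def[symmetric] F_def[symmetric] P_def[symmetric] V_def[symmetric]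
    by (rule ennreal_leI)
qed

text \<open>Integration in c turns squared lengths into multiples of e by mass^2 <= C0 e. The factor
  T^2 raises the power of \<sigma> from a/2 - 1 to a/2 + 2 \<beta> - 1, and its integral produces
  the denominator on which the decay rests.\<close>

lemma comp_disc_energy:
  fixes a C0 e :: real
  assumes a: "0 < a" and C0: "(\<integral>\<^sup>+c. ennreal ((1 + c\<^sup>2) powr (- (1 - a / 2))) \<partial>lborel) = ennreal C0" "0 \<le> C0"
    and e: "(\<integral>\<^sup>+c. ennreal ((1 + c\<^sup>2) powr (1 - a / 2) * (norm (f c))\<^sup>2) \<partial>lborel) = ennreal e" "0 \<le> e"
  shows "disc_energy a comp_radial comp_angular S
    \<le> ennreal (1/2 * e * (1 + \<tau> * (1 + 2 * C0\<^sup>2) + 16 * \<beta>\<^sup>2 * C0\<^sup>2) * (S powr (a / 2) / (a / 2 + 2 * \<beta>)))"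
proof -
  let ?K = "1 + \<tau> * (1 + 2 * C0\<^sup>2) + 16 * \<beta>\<^sup>2 * C0\<^sup>2"
  have m2: "mass\<^sup>2 \<le> C0 * e" by (rule weighted_slice_L1(2)[OF fm C0 e])
  have shell: "shell_energy a comp_radial comp_angular \<sigma> \<le> ennreal (1/2 * \<sigma> powr (a / 2 - 1) * (pw \<sigma>)\<^sup>2 * (e * ?K))" if s: "\<sigma> \<in> {0<..S}" for \<sigma>
  proof -
    let ?X = "1/2 * \<sigma> powr (a / 2 - 1) * (pw \<sigma>)\<^sup>2" and ?\<alpha> = "(16 * \<beta>\<^sup>2 + 2 * \<tau>) * mass\<^sup>2"
    have X: "0 \<le> ?X" "0 \<le> ?\<alpha>" using \<tau> by auto
    have "shell_energy a comp_radial comp_angular \<sigma>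
      \<le> (\<integral>\<^sup>+c. ennreal ?X * (ennreal ?\<alpha> * ennreal ((1 + c\<^sup>2) powr (- (1 - a / 2))) + ennreal (1 + \<tau>) * ennreal ((1 + c\<^sup>2) powr (1 - a / 2) * (norm (f c))\<^sup>2)) \<partial>lborel)"
      unfolding shell_energy_def
    proof (rule nn_integral_mono)
      fix c
      have "ennreal ?X * (ennreal ?\<alpha> * ennreal ((1 + c\<^sup>2) powr (- (1 - a / 2))) + ennreal (1 + \<tau>) * ennreal ((1 + c\<^sup>2) powr (1 - a / 2) * (norm (f c))\<^sup>2))
        = ennreal (?X * (?\<alpha> * (1 + c\<^sup>2) powr (- (1 - a / 2)) + (1 + \<tau>) * ((1 + c\<^sup>2) powr (1 - a / 2) * (norm (f c))\<^sup>2)))"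
        using X \<tau> by (simp only: ennreal_mult ennreal_plus add_nonneg_nonneg mult_nonneg_nonneg powr_ge_zero zero_le_power2 zero_le_one)
      with comp_density_bound[OF a s, of c]
      show "polar_density a comp_radial comp_angular (\<sigma>, c) \<le> ennreal ?X * (ennreal ?\<alpha> * ennreal ((1 + c\<^sup>2) powr (- (1 - a / 2))) + ennreal (1 + \<tau>) * ennreal ((1 + c\<^sup>2) powr (1 - a / 2) * (norm (f c))\<^sup>2))"
        by (simp only:)
    qed
    also have "\<dots> = ennreal ?X * (ennreal ?\<alpha> * ennreal C0 + ennreal (1 + \<tau>) * ennreal e)"
    proof -
      let ?V = "\<lambda>c::real. ennreal ((1 + c\<^sup>2) powr (- (1 - a / 2)))" and ?E = "\<lambda>c. ennreal ((1 + c\<^sup>2) powr (1 - a / 2) * (norm (f c))\<^sup>2)"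
      have [measurable]: "?V \<in> borel_measurable lborel" "?E \<in> borel_measurable lborel" by measurable
      have "(\<integral>\<^sup>+c. ennreal ?X * (ennreal ?\<alpha> * ?V c + ennreal (1 + \<tau>) * ?E c) \<partial>lborel) = ennreal ?X * (\<integral>\<^sup>+c. ennreal ?\<alpha> * ?V c + ennreal (1 + \<tau>) * ?E c \<partial>lborel)"
        by (rule nn_integral_cmult) measurable
      also have "(\<integral>\<^sup>+c. ennreal ?\<alpha> * ?V c + ennreal (1 + \<tau>) * ?E c \<partial>lborel) = (\<integral>\<^sup>+c. ennreal ?\<alpha> * ?V c \<partial>lborel) + (\<integral>\<^sup>+c. ennreal (1 + \<tau>) * ?E c \<partial>lborel)"
        by (rule nn_integral_add) measurable
      also have "(\<integral>\<^sup>+c. ennreal ?\<alpha> * ?V c \<partial>lborel) = ennreal ?\<alpha> * ennreal C0" unfolding C0(1)[symmetric] by (rule nn_integral_cmult) measurable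
      also have "(\<integral>\<^sup>+c. ennreal (1 + \<tau>) * ?E c \<partial>lborel) = ennreal (1 + \<tau>) * ennreal e" unfolding e(1)[symmetric] by (rule nn_integral_cmult) measurable
      finally show ?thesis .
    qed
    also have "\<dots> = ennreal (?X * (?\<alpha> * C0 + (1 + \<tau>) * e))"
      using X \<tau> C0(2) e(2) by (simp only: ennreal_mult ennreal_plus add_nonneg_nonneg mult_nonneg_nonneg zero_le_one)
    also have "\<dots> \<le> ennreal (?X * (e * ?K))"
    proof (intro ennreal_leI mult_left_mono X(1))
      have "mass\<^sup>2 * C0 \<le> C0 * e * C0" using m2 C0(2) by (rule mult_right_mono)
      then have "(16 * \<beta>\<^sup>2 + 2 * \<tau>) * (mass\<^sup>2 * C0) \<le> (16 * \<beta>\<^sup>2 + 2 * \<tau>) * (C0 * e * C0)"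
        using \<tau> by (intro mult_left_mono) auto
      then show "?\<alpha> * C0 + (1 + \<tau>) * e \<le> e * ?K" by (simp add: algebra_simps power2_eq_square)
    qed
    finally show ?thesis .
  qed
  have b: "0 < a / 2 + 2 * \<beta>" using a \<beta> by simp
  have "disc_energy a comp_radial comp_angular S
    \<le> (\<integral>\<^sup>+\<sigma>. ennreal (1/2 * e * ?K * S powr (- 2 * \<beta>)) * (indicator {0<..<S} \<sigma> * ennreal (\<sigma> powr (a / 2 + 2 * \<beta> - 1))) \<partial>lborel)"
    unfolding disc_energy_def
  proof (rule nn_integral_mono)
    fix \<sigma> :: real
    show "indicator {0<..<S} \<sigma> * shell_energy a comp_radial comp_angular \<sigma> \<le> ennreal (1/2 * e * ?K * S powr (- 2 * \<beta>)) * (indicator {0<..<S} \<sigma> * ennreal (\<sigma> powr (a / 2 + 2 * \<beta> - 1)))"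
    proof (cases "\<sigma> \<in> {0<..<S}")
      case True
      then have s0: "0 < \<sigma>" by simp
      have "(pw \<sigma>)\<^sup>2 = \<sigma> powr (2 * \<beta>) * S powr (- 2 * \<beta>)"
      proof -
        have "(pw \<sigma>)\<^sup>2 = (\<sigma> / S) powr (2 * \<beta>)" by (simp add: pw_def power2_eq_square powr_add[symmetric])
        also have "\<dots> = \<sigma> powr (2 * \<beta>) / S powr (2 * \<beta>)" by (rule powr_divide)
        also have "\<dots> = \<sigma> powr (2 * \<beta>) * S powr (- 2 * \<beta>)" using powr_minus[of S "2 * \<beta>"] by (simp add: divide_inverse)
        finally show ?thesis .
      qed
      then have "1/2 * \<sigma> powr (a / 2 - 1) * (pw \<sigma>)\<^sup>2 * (e * ?K) = (1/2 * e * ?K * S powr (- 2 * \<beta>)) * (\<sigma> powr (a / 2 - 1) * \<sigma> powr (2 * \<beta>))"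
        by simp
      also have "\<sigma> powr (a / 2 - 1) * \<sigma> powr (2 * \<beta>) = \<sigma> powr (a / 2 + 2 * \<beta> - 1)" by (simp add: powr_add[symmetric] algebra_simps)
      finally have eq: "1/2 * \<sigma> powr (a / 2 - 1) * (pw \<sigma>)\<^sup>2 * (e * ?K) = (1/2 * e * ?K * S powr (- 2 * \<beta>)) * \<sigma> powr (a / 2 + 2 * \<beta> - 1)" .
      have "0 \<le> 1/2 * e * ?K * S powr (- 2 * \<beta>)" using e(2) \<tau> by simp
      then have "ennreal (1/2 * \<sigma> powr (a / 2 - 1) * (pw \<sigma>)\<^sup>2 * (e * ?K)) = ennreal (1/2 * e * ?K * S powr (- 2 * \<beta>)) * ennreal (\<sigma> powr (a / 2 + 2 * \<beta> - 1))"
        unfolding eq by (rule ennreal_mult) simp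
      then show ?thesis using shell[of \<sigma>] True by simp
    qed simp
  qed
  also have "\<dots> = ennreal (1/2 * e * ?K * S powr (- 2 * \<beta>)) * ennreal (S powr (a / 2 + 2 * \<beta>) / (a / 2 + 2 * \<beta>))"
    by (subst nn_integral_cmult) (auto simp: nn_integral_powr_interval[OF b S])
  also have "\<dots> = ennreal (1/2 * e * ?K * S powr (- 2 * \<beta>) * (S powr (a / 2 + 2 * \<beta>) / (a / 2 + 2 * \<beta>)))"
    using b e(2) \<tau> by (intro ennreal_mult[symmetric]) auto
  also have "1/2 * e * ?K * S powr (- 2 * \<beta>) * (S powr (a / 2 + 2 * \<beta>) / (a / 2 + 2 * \<beta>))
      = 1/2 * e * ?K * ((S powr (- 2 * \<beta>) * S powr (a / 2 + 2 * \<beta>)) / (a / 2 + 2 * \<beta>))" by simp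
  also have "S powr (- 2 * \<beta>) * S powr (a / 2 + 2 * \<beta>) = S powr (a / 2)" by (simp add: powr_add[symmetric])
  finally show ?thesis .
qed

end

section \<open>The trace of the competitor\<close>

text \<open>Rescaling y = h t turns the average over a strip of height h into an integral over a
  fixed bounded rectangle, where bounded pointwise convergence suffices.\<close>

lemma strip_average_tendsto_0:
  fixes H :: "real \<times> real \<Rightarrow> real"
  assumes [measurable]: "H \<in> borel_measurable borel" and bd: "\<And>p. 0 \<le> H p" "\<And>p. H p \<le> M"
    and lim: "AE x in lborel. ((\<lambda>y. H (x, y)) \<longlongrightarrow> 0) (at_right 0)"
  shows "((\<lambda>h. ennreal (1 / h) * (\<integral>\<^sup>+p\<in>{a<..<b} \<times> {0<..<h}. ennreal (H p) \<partial>lebesgue)) \<longlongrightarrow> 0) (at_right 0)"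
proof (rule tendsto_at_right_sequentially[of 0 1])
  fix h :: "nat \<Rightarrow> real" assume h: "\<And>n. 0 < h n" "h \<longlonglongrightarrow> 0"
  have eq: "ennreal (1 / h n) * (\<integral>\<^sup>+p\<in>{a<..<b} \<times> {0<..<h n}. ennreal (H p) \<partial>lebesgue)
      = (\<integral>\<^sup>+q. ennreal (H (fst q, h n * snd q)) * indicator ({a<..<b} \<times> {0<..<1}) q \<partial>lborel)" for n
  proof -
    have "(\<integral>\<^sup>+p\<in>{a<..<b} \<times> {0<..<h n}. ennreal (H p) \<partial>lebesgue)
      = (\<integral>\<^sup>+x. \<integral>\<^sup>+y. ennreal (H (x, y)) * indicator ({a<..<b} \<times> {0<..<h n}) (x, y) \<partial>lborel \<partial>lborel)"
      unfolding nn_integral_completion by (rule nn_fubini_fst) measurable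
    also have "\<dots> = (\<integral>\<^sup>+x. ennreal (h n) * (\<integral>\<^sup>+t. ennreal (H (x, h n * t)) * indicator ({a<..<b} \<times> {0<..<1}) (x, t) \<partial>lborel) \<partial>lborel)"
    proof (rule nn_integral_cong)
      fix x
      have "(\<integral>\<^sup>+y. ennreal (H (x, y)) * indicator ({a<..<b} \<times> {0<..<h n}) (x, y) \<partial>lborel)
        = ennreal \<bar>h n\<bar> * (\<integral>\<^sup>+t. ennreal (H (x, 0 + h n * t)) * indicator ({a<..<b} \<times> {0<..<h n}) (x, 0 + h n * t) \<partial>lborel)"
        using h(1)[of n] by (intro nn_integral_real_affine) auto
      also have "\<bar>h n\<bar> = h n" using h(1)[of n] by simp
      also have "(\<integral>\<^sup>+t. ennreal (H (x, 0 + h n * t)) * indicator ({a<..<b} \<times> {0<..<h n}) (x, 0 + h n * t) \<partial>lborel)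
         = (\<integral>\<^sup>+t. ennreal (H (x, h n * t)) * indicator ({a<..<b} \<times> {0<..<1}) (x, t) \<partial>lborel)"
        using h(1)[of n] by (intro nn_integral_cong) (auto simp: indicator_def zero_less_mult_iff)
      finally show "(\<integral>\<^sup>+y. ennreal (H (x, y)) * indicator ({a<..<b} \<times> {0<..<h n}) (x, y) \<partial>lborel)
        = ennreal (h n) * (\<integral>\<^sup>+t. ennreal (H (x, h n * t)) * indicator ({a<..<b} \<times> {0<..<1}) (x, t) \<partial>lborel)" .
    qed
    also have "\<dots> = ennreal (h n) * (\<integral>\<^sup>+x. \<integral>\<^sup>+t. ennreal (H (x, h n * t)) * indicator ({a<..<b} \<times> {0<..<1}) (x, t) \<partial>lborel \<partial>lborel)"
    proof (rule nn_integral_cmult)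
      have "(\<lambda>r. ennreal (H (fst r, h n * snd r)) * indicator ({a<..<b} \<times> {0<..<1}) (fst r, snd r)) \<in> borel_measurable ((lborel :: real measure) \<Otimes>\<^sub>M lborel)"
        unfolding lborel_prod by measurable
      then show "(\<lambda>x. \<integral>\<^sup>+t. ennreal (H (x, h n * t)) * indicator ({a<..<b} \<times> {0<..<1}) (x, t) \<partial>lborel) \<in> borel_measurable lborel"
        by (intro lborel.borel_measurable_nn_integral) (simp add: case_prod_unfold)
    qed
    also have "(\<integral>\<^sup>+x. \<integral>\<^sup>+t. ennreal (H (x, h n * t)) * indicator ({a<..<b} \<times> {0<..<1}) (x, t) \<partial>lborel \<partial>lborel)
      = (\<integral>\<^sup>+q. ennreal (H (fst q, h n * snd q)) * indicator ({a<..<b} \<times> {0<..<1}) q \<partial>lborel)"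
      by (subst nn_fubini_fst) auto
    finally show ?thesis using h(1)[of n] by (simp add: mult.assoc[symmetric] ennreal_mult[symmetric])
  qed
  have "(\<lambda>n. \<integral>\<^sup>+q. ennreal (H (fst q, h n * snd q)) * indicator ({a<..<b} \<times> {0<..<1}) q \<partial>lborel) \<longlonglongrightarrow> (\<integral>\<^sup>+q. 0 \<partial>(lborel :: (real \<times> real) measure))"
  proof (rule nn_integral_dominated_convergence[where w = "\<lambda>q. ennreal M * indicator ({a<..<b} \<times> {0<..<1}) q"])
    show "(\<integral>\<^sup>+q. ennreal M * indicator ({a<..<b} \<times> {0<..<1::real}) q \<partial>lborel) < \<infinity>"
    proof -
      have "emeasure lborel ({a<..<b} \<times> {0<..<1::real}) \<le> emeasure lborel (cbox (a, 0) (b, 1::real))"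

        by (rule emeasure_mono) (auto simp: cbox_Pair_eq)
      also have "\<dots> < \<infinity>" by (rule emeasure_lborel_cbox_finite)
      finally show ?thesis by (subst nn_integral_cmult_indicator) (auto simp: ennreal_mult_less_top)
    qed
    show "AE q in lborel. ennreal (H (fst q, h n * snd q)) * indicator ({a<..<b} \<times> {0<..<1}) q \<le> ennreal M * indicator ({a<..<b} \<times> {0<..<1}) q" for n
      using bd by (intro AE_I2 mult_right_mono ennreal_leI) auto
    show "AE q in lborel. (\<lambda>n. ennreal (H (fst q, h n * snd q)) * indicator ({a<..<b} \<times> {0<..<1}) q) \<longlonglongrightarrow> 0"
      using AE_lborel_fst[OF lim]
    proof eventually_elim
      case (elim q)
      show ?case
      proof (cases "q \<in> {a<..<b} \<times> {0<..<1}")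
        case True
        then have t: "0 < snd q" by (auto simp: mem_Times_iff)
        have "(\<lambda>n. h n * snd q) \<longlonglongrightarrow> 0 * snd q" by (intro tendsto_intros h)
        then have "filterlim (\<lambda>n. h n * snd q) (at_right 0) sequentially"
          using h(1) t by (intro tendsto_imp_filterlim_at_right) auto
        from filterlim_compose[OF elim this] have "(\<lambda>n. ennreal (H (fst q, h n * snd q))) \<longlonglongrightarrow> ennreal 0" by (intro tendsto_ennrealI)
        then show ?thesis using True by simp
      qed simp
    qed
  qed measurable
  then show "(\<lambda>n. ennreal (1 / h n) * (\<integral>\<^sup>+p\<in>{a<..<b} \<times> {0<..<h n}. ennreal (H p) \<partial>lebesgue)) \<longlonglongrightarrow> 0"
    unfolding eq by simp
qed simp

context competitor begin

text \<open>Approaching a point x > 0 of the boundary means c -> +\<infinity>, approaching x < 0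
  means c -> -\<infinity>, in both cases with \<sigma> -> x^2. At x = 0 the formula gives G 0 = p0,
  still a point of the curve.\<close>

definition comp_trace where "comp_trace x = (if 0 < x then p0 else G (pw (x\<^sup>2)))"

lemma comp_boundary_limit:
  assumes x: "x \<noteq> 0"
  shows "((\<lambda>y. comp (x\<^sup>2 + y\<^sup>2, x / y)) \<longlongrightarrow> comp_trace x) (at_right 0)"
proof -
  have x2: "0 < x\<^sup>2" using x by simp
  have "((\<lambda>y. x\<^sup>2 + y\<^sup>2) \<longlongrightarrow> x\<^sup>2 + 0\<^sup>2) (at_right (0::real))" by (intro tendsto_intros)
  then have s: "((\<lambda>y. x\<^sup>2 + y\<^sup>2) \<longlongrightarrow> x\<^sup>2) (at_right (0::real))" by simp
  have "isCont pw (x\<^sup>2)" using pw_has_derivative[OF x2, of UNIV] by (intro DERIV_isCont) simp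
  from isCont_tendsto_compose[OF this s] have T: "((\<lambda>y. pw (x\<^sup>2 + y\<^sup>2)) \<longlongrightarrow> pw (x\<^sup>2)) (at_right 0)" .
  have "isCont G (pw (x\<^sup>2))" using cG(1) by (simp add: continuous_on_eq_continuous_at)
  from isCont_tendsto_compose[OF this T] have GT: "((\<lambda>y. G (pw (x\<^sup>2 + y\<^sup>2))) \<longlongrightarrow> G (pw (x\<^sup>2))) (at_right 0)" .
  have D: "((\<lambda>y. dev (pw (x\<^sup>2 + y\<^sup>2))) \<longlongrightarrow> dev (pw (x\<^sup>2))) (at_right 0)"
    unfolding dev_def by (intro tendsto_intros GT T)
  have L: "((\<lambda>y. comp (x\<^sup>2 + y\<^sup>2, x / y)) \<longlongrightarrow> p0 + pw (x\<^sup>2) *\<^sub>R (e - p0) + z *\<^sub>R dev (pw (x\<^sup>2))) (at_right 0)"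
    if "((\<lambda>y. \<phi> (x / y)) \<longlongrightarrow> e) (at_right 0)" "((\<lambda>y. cut (x / y)) \<longlongrightarrow> z) (at_right 0)" for e z
    unfolding comp_def fst_conv snd_conv by (intro tendsto_intros that T D)
  have lim: "(\<phi> \<longlongrightarrow> p0) at_top" "(\<phi> \<longlongrightarrow> q0) at_bot"
    unfolding \<phi>[abs_def] p0 q0 by (rule slice_end_bounds(3,4)[OF fi])+
  show ?thesis
  proof (cases "0 < x")
    case True
    have "filterlim (\<lambda>y. x * inverse y) at_top (at_right 0)"
      by (rule filterlim_tendsto_pos_mult_at_top[OF tendsto_const True filterlim_inverse_at_top_right])
    then have f: "filterlim (\<lambda>y. x / y) at_top (at_right 0)" by (simp add: divide_inverse)
    from L[OF filterlim_compose[OF lim(1) f] filterlim_compose[OF cut_tendsto(1) f]]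
    show ?thesis using True by (simp add: comp_trace_def)
  next
    case False
    with x have xn: "x < 0" by simp
    have "filterlim (\<lambda>y. x * inverse y) at_bot (at_right 0)"
      by (rule filterlim_tendsto_neg_mult_at_bot[OF tendsto_const xn filterlim_inverse_at_top_right])
    then have f: "filterlim (\<lambda>y. x / y) at_bot (at_right 0)" by (simp add: divide_inverse)
    from L[OF filterlim_compose[OF lim(2) f] filterlim_compose[OF cut_tendsto(2) f]]
    show ?thesis using False by (simp add: comp_trace_def dev_def)
  qed
qed

text \<open>For fixed x with x^2 < S, points (x, y) with small y lie in the inner half disc, where
  the competitor has a pointwise limit; for x^2 >= S the old trace is inherited. The strip averages
  of the new error are majorised by those of the old error plus those of a bounded function H
  tending to 0.\<close>

lemma trace_in_glue:
  fixes v0 v :: "real \<times> real \<Rightarrow> real^'d"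
  assumes S1: "S < 1" and N: "bounded N" and GN: "\<And>t. t \<in> {0..1} \<Longrightarrow> G t \<in> N"
    and tr: "trace_in N v0 0 1" and mv [measurable]: "v \<in> borel_measurable borel"
    and v0: "AE p in lborel. p \<in> half_ball (0, 0) 1 \<longrightarrow> v0 p = v p"
  shows "trace_in N (\<lambda>p. if 0 < snd p \<and> fst (polar_inv p) \<le> S then comp (polar_inv p) else v p) 0 1"
proof -
  let ?w = "\<lambda>p. if 0 < snd p \<and> fst (polar_inv p) \<le> S then comp (polar_inv p) else v p"
  obtain g where gm: "g \<in> borel_measurable lebesgue" and g: "AE x in lebesgue. x \<in> {0 - 1<..<0 + 1} \<longrightarrow> g x \<in> N"
    "\<And>\<rho>. 0 < \<rho> \<Longrightarrow> \<rho> < 1 \<Longrightarrow> ((\<lambda>h. ennreal (1 / h) *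
               (\<integral>\<^sup>+ p\<in>{0 - \<rho><..<0 + \<rho>} \<times> {0<..<h}. ennreal (norm (v0 p - g (fst p))) \<partial>lebesgue)) \<longlongrightarrow> 0) (at_right 0)"
    using tr unfolding trace_in_def by blast
  obtain g' where g' [measurable]: "g' \<in> borel_measurable borel" and gg': "AE x in lborel. g x = g' x"
    using lebesgue_borel_version[OF gm] by blast
  have gN: "AE x in lborel. x \<in> {-1<..<1} \<longrightarrow> g' x \<in> N"
  proof -
    have "AE x in lborel. x \<in> {-1<..<1} \<longrightarrow> g x \<in> N" using g(1) by (simp add: AE_completion_iff)
    with gg' show ?thesis by eventually_elim auto
  qed
  obtain B where B: "\<And>z. z \<in> N \<Longrightarrow> norm z \<le> B" using N by (auto simp: bounded_iff)
  have B0: "0 \<le> B" by (rule order_trans[OF norm_ge_zero[of "G 0"] B[OF GN]]) simp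
  have [measurable]: "G \<in> borel_measurable borel" by (rule borel_measurable_continuous_onI[OF cG(1)])
  have tm [measurable]: "comp_trace \<in> borel_measurable borel" unfolding comp_trace_def[abs_def] pw_def by measurable
  have pwx: "pw (x\<^sup>2) \<in> {0..1}" if "x\<^sup>2 \<le> S" for x
    using that S \<beta> by (auto simp: pw_def intro: powr_le1)
  have ctN: "comp_trace x \<in> N" if "x\<^sup>2 \<le> S" for x
    using GN[OF pwx[OF that]] GN[of 0] by (auto simp: comp_trace_def G01)
  define G' where "G' x = (if x\<^sup>2 < S then comp_trace x else g' x)" for x
  have [measurable]: "G' \<in> borel_measurable borel" unfolding G'_def[abs_def] by measurable
  \<comment> \<open>Excess of the new trace error over the old one. Inside the half disc it is the
    error of \<open>comp\<close>. Above x^2 < S but outside the half disc the map is still v while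
    the trace has been replaced, and 2 B bounds the distance of two points of N.\<close>
  define H where "H p = (if (fst p)\<^sup>2 < S \<and> 0 < snd p then
      (if (fst p)\<^sup>2 + (snd p)\<^sup>2 \<le> S then norm (comp ((fst p)\<^sup>2 + (snd p)\<^sup>2, fst p / snd p) - comp_trace (fst p)) else 2 * B) else 0)" for p
  define M where "M = norm p0 + 2 * (\<integral>x. norm (f x) \<partial>lborel) + 2 * B"
  have M0: "0 \<le> M" using mass_bounds(1) B0 by (simp add: M_def)
  have mH [measurable]: "H \<in> borel_measurable borel" unfolding H_def[abs_def] by measurable
  have H0: "0 \<le> H p" for p using B0 by (simp add: H_def)
  have HM: "H p \<le> M" for p
  proof (cases "(fst p)\<^sup>2 < S \<and> 0 < snd p \<and> (fst p)\<^sup>2 + (snd p)\<^sup>2 \<le> S")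
    case True
    then have s: "(fst p)\<^sup>2 + (snd p)\<^sup>2 \<in> {0<..S}" by (auto intro: add_nonneg_pos)
    have "H p \<le> norm (comp ((fst p)\<^sup>2 + (snd p)\<^sup>2, fst p / snd p)) + norm (comp_trace (fst p))"
      using True by (simp add: H_def norm_triangle_ineq4)
    also have "\<dots> \<le> (norm p0 + 2 * (\<integral>x. norm (f x) \<partial>lborel)) + B"
      using True by (intro add_mono comp_bounds(1)[OF s] B ctN) auto
    finally show ?thesis using B0 by (simp add: M_def)
  next
    case False
    then have "H p = 2 * B \<or> H p = 0" by (auto simp: H_def)
    then show ?thesis using M0 mass_bounds(1) B0 by (auto simp: M_def)
  qed
  have Hlim: "AE x in lborel. ((\<lambda>y. H (x, y)) \<longlongrightarrow> 0) (at_right 0)"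
    using AE_lborel_singleton[of 0]
  proof eventually_elim
    case (elim x)
    show ?case
    proof (cases "x\<^sup>2 < S")
      case True
      have "((\<lambda>y. x\<^sup>2 + y\<^sup>2) \<longlongrightarrow> x\<^sup>2 + 0\<^sup>2) (at_right (0::real))" by (intro tendsto_intros)
      then have "\<forall>\<^sub>F y in at_right 0. x\<^sup>2 + y\<^sup>2 < S" using True by (intro order_tendstoD(2)[where y = "x\<^sup>2"]) auto
      then have ev: "\<forall>\<^sub>F y in at_right 0. norm (comp (x\<^sup>2 + y\<^sup>2, x / y) - comp_trace x) = H (x, y)"
        using eventually_at_right_less[of 0] by eventually_elim (use True in \<open>auto simp: H_def\<close>)
      have "((\<lambda>y. norm (comp (x\<^sup>2 + y\<^sup>2, x / y) - comp_trace x)) \<longlongrightarrow> 0) (at_right 0)"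
        using comp_boundary_limit[of x] elim by (intro tendsto_norm_zero LIM_zero) auto
      with ev show ?thesis by (rule Lim_transform_eventually[rotated])
    qed (simp add: H_def)
  qed
  show ?thesis unfolding trace_in_def
  proof (intro exI[of _ G'] conjI allI impI)
    show "G' \<in> borel_measurable lebesgue" by (simp add: measurable_completion)
    have "AE x in lborel. x \<in> {0 - 1<..<0 + 1} \<longrightarrow> G' x \<in> N"
      using gN by eventually_elim (auto simp: G'_def intro: ctN)
    then show "AE x in lebesgue. x \<in> {0 - 1<..<0 + 1} \<longrightarrow> G' x \<in> N" by (rule AE_completion)
    fix \<rho> :: real assume \<rho>: "0 < \<rho> \<and> \<rho> < 1"
    let ?st = "\<lambda>h. {0 - \<rho><..<0 + \<rho>} \<times> {0<..<h}"
    let ?I = "\<lambda>F h. ennreal (1 / h) * (\<integral>\<^sup>+ p\<in>?st h. ennreal (F p) \<partial>lebesgue)"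
    have "((\<lambda>h. ?I (\<lambda>p. norm (v0 p - g (fst p))) h + ?I H h) \<longlongrightarrow> 0 + 0) (at_right 0)"
      by (intro tendsto_add g(2) strip_average_tendsto_0[OF mH H0 HM Hlim]) (use \<rho> in auto)
    then have lim: "((\<lambda>h. ?I (\<lambda>p. norm (v0 p - g (fst p))) h + ?I H h) \<longlongrightarrow> 0) (at_right 0)" by simp
    have "((\<lambda>h. \<rho>\<^sup>2 + h\<^sup>2) \<longlongrightarrow> \<rho>\<^sup>2 + 0\<^sup>2) (at_right (0::real))" by (intro tendsto_intros)
    moreover have "\<rho>\<^sup>2 < 1" using \<rho> by (simp add: power_less_one_iff abs_square_less_1)
    ultimately have "\<forall>\<^sub>F h in at_right (0::real). \<rho>\<^sup>2 + h\<^sup>2 < 1" by (intro order_tendstoD(2)[where y = "\<rho>\<^sup>2"]) auto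
    then have "\<forall>\<^sub>F h in at_right 0. ?I (\<lambda>p. norm (?w p - G' (fst p))) h \<le> ?I (\<lambda>p. norm (v0 p - g (fst p))) h + ?I H h"
    proof eventually_elim
      case (elim h)
      have [measurable]: "?st h \<in> sets borel" by simp
      have hb: "p \<in> half_ball (0, 0) 1" "\<bar>fst p\<bar> < 1" "0 < snd p" if "p \<in> ?st h" for p
      proof -
        have p: "\<bar>fst p\<bar> < \<rho>" "0 < snd p" "snd p < h" using that by (auto simp: mem_Times_iff)
        have "(fst p)\<^sup>2 \<le> \<rho>\<^sup>2" using p(1) by (intro power2_le_iff_abs_le[THEN iffD2]) (use \<rho> in auto)
        moreover have "(snd p)\<^sup>2 \<le> h\<^sup>2" using p by (intro power_mono) auto
        ultimately have "(fst p)\<^sup>2 + (snd p)\<^sup>2 < 1" using elim by linarith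
        then show "p \<in> half_ball (0, 0) 1" using p by (simp add: half_ball_iff)
        show "\<bar>fst p\<bar> < 1" "0 < snd p" using p \<rho> by auto
      qed
      have "(\<integral>\<^sup>+ p\<in>?st h. ennreal (norm (?w p - G' (fst p))) \<partial>lebesgue) \<le> (\<integral>\<^sup>+ p. ennreal (norm (v p - g' (fst p))) * indicator (?st h) p + ennreal (H p) * indicator (?st h) p \<partial>lborel)"
        unfolding nn_integral_completion
      proof (rule nn_integral_mono_AE)
        show "AE p in lborel. ennreal (norm (?w p - G' (fst p))) * indicator (?st h) p \<le> ennreal (norm (v p - g' (fst p))) * indicator (?st h) p + ennreal (H p) * indicator (?st h) p"
          using AE_lborel_fst[OF gN]
        proof eventually_elim
          case (elim p)
          show ?case
          proof (cases "p \<in> ?st h")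
            case True
            note p = hb[OF True]
            have gb: "norm (g' (fst p)) \<le> B" using elim p(2) by (intro B) auto
            have "norm (?w p - G' (fst p)) \<le> norm (v p - g' (fst p)) + H p"
            proof (cases "(fst p)\<^sup>2 + (snd p)\<^sup>2 \<le> S")
              case i: True
              then have x: "(fst p)\<^sup>2 < S" using p(3) zero_less_power[of "snd p" 2] by linarith
              have "norm (?w p - G' (fst p)) = H p" using i x p(3) by (simp add: polar_inv_def G'_def H_def)
              then show ?thesis by simp
            next
              case o: False
              then have wv: "?w p = v p" by (simp add: polar_inv_def)
              show ?thesis
              proof (cases "(fst p)\<^sup>2 < S")
                case True
                have "norm (v p - comp_trace (fst p)) \<le> norm (v p - g' (fst p)) + norm (g' (fst p) - comp_trace (fst p))"
                  using norm_triangle_ineq[of "v p - g' (fst p)" "g' (fst p) - comp_trace (fst p)"] by simp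
                moreover have "norm (g' (fst p) - comp_trace (fst p)) \<le> norm (g' (fst p)) + norm (comp_trace (fst p))" by (rule norm_triangle_ineq4)
                moreover have "norm (comp_trace (fst p)) \<le> B" using True by (intro B ctN) auto
                ultimately show ?thesis unfolding wv using True o p(3) gb by (simp add: G'_def H_def)
              qed (use H0[of p] in \<open>simp add: wv G'_def\<close>)
            qed
            then show ?thesis using True H0[of p] by (simp add: ennreal_plus[symmetric] ennreal_leI del: ennreal_plus)
          qed simp
        qed
      qed
      also have "\<dots> = (\<integral>\<^sup>+ p. ennreal (norm (v p - g' (fst p))) * indicator (?st h) p \<partial>lborel) + (\<integral>\<^sup>+ p. ennreal (H p) * indicator (?st h) p \<partial>lborel)"
        by (rule nn_integral_add) measurable
      also have "(\<integral>\<^sup>+ p. ennreal (norm (v p - g' (fst p))) * indicator (?st h) p \<partial>lborel) = (\<integral>\<^sup>+ p. ennreal (norm (v0 p - g (fst p))) * indicator (?st h) p \<partial>lborel)"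
      proof (rule nn_integral_cong_AE)
        show "AE p in lborel. ennreal (norm (v p - g' (fst p))) * indicator (?st h) p = ennreal (norm (v0 p - g (fst p))) * indicator (?st h) p"
          using v0 AE_lborel_fst[OF gg']
        proof eventually_elim
          case (elim p)
          then show ?case using hb(1)[of p] by (cases "p \<in> ?st h") auto
        qed
      qed
      finally show ?case unfolding nn_integral_completion distrib_left[symmetric] by (intro mult_left_mono) auto
    qed
    then show "(?I (\<lambda>p. norm (?w p - G' (fst p))) \<longlongrightarrow> 0) (at_right 0)"
      by (rule tendsto_sandwich[OF _ _ tendsto_const lim, rotated]) simp
  qed
qed

end

section \<open>Comparison of energies\<close>

lemma disc_energy_cong:
  assumes "\<And>q. 0 < fst q \<Longrightarrow> fst q < T \<Longrightarrow> R q = R' q" "\<And>q. 0 < fst q \<Longrightarrow> fst q < T \<Longrightarrow> A q = A' q"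
  shows "disc_energy a R A T = disc_energy a R' A' T"
  unfolding disc_energy_def shell_energy_def
proof (rule nn_integral_cong)
  fix \<sigma> :: real
  show "indicator {0<..<T} \<sigma> * (\<integral>\<^sup>+c. polar_density a R A (\<sigma>, c) \<partial>lborel) = indicator {0<..<T} \<sigma> * (\<integral>\<^sup>+c. polar_density a R' A' (\<sigma>, c) \<partial>lborel)"
  proof (cases "\<sigma> \<in> {0<..<T}")
    case True
    then have "polar_density a R A (\<sigma>, c) = polar_density a R' A' (\<sigma>, c)" for c
      using assms[of "(\<sigma>, c)"] by (simp add: polar_density_def)
    then show ?thesis by simp
  qed simp
qed

lemma disc_energy_split:
  fixes R A :: "real \<times> real \<Rightarrow> 'b::{banach, second_countable_topology}"
  assumes [measurable]: "R \<in> borel_measurable borel" "A \<in> borel_measurable borel" and "0 < S" "S < T"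
  shows "disc_energy a R A T = disc_energy a R A S + (\<integral>\<^sup>+\<sigma>. indicator {S<..<T} \<sigma> * shell_energy a R A \<sigma> \<partial>lborel)"
proof -
  have "disc_energy a R A T = (\<integral>\<^sup>+\<sigma>. indicator {0<..<S} \<sigma> * shell_energy a R A \<sigma> + indicator {S<..<T} \<sigma> * shell_energy a R A \<sigma> \<partial>lborel)"
    unfolding disc_energy_def
  proof (rule nn_integral_cong_AE)
    show "AE \<sigma> in lborel. indicator {0<..<T} \<sigma> * shell_energy a R A \<sigma> = indicator {0<..<S} \<sigma> * shell_energy a R A \<sigma> + indicator {S<..<T} \<sigma> * shell_energy a R A \<sigma>"
      using AE_lborel_singleton[of S] by eventually_elim (use assms(3,4) in \<open>auto simp: indicator_def\<close>)
  qed
  also have "\<dots> = disc_energy a R A S + (\<integral>\<^sup>+\<sigma>. indicator {S<..<T} \<sigma> * shell_energy a R A \<sigma> \<partial>lborel)"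
    unfolding disc_energy_def by (rule nn_integral_add) measurable
  finally show ?thesis .
qed

text \<open>Dropping the radial term leaves the weighted angular energy of the slice, the same
  number e that controls the competitor; this closes the comparison.\<close>

lemma shell_energy_ge_angular:
  fixes R A :: "real \<times> real \<Rightarrow> 'b::{banach, second_countable_topology}"
  assumes [measurable]: "A \<in> borel_measurable borel" and s0: "0 < \<sigma>"
  shows "ennreal (1/2 * \<sigma> powr (a / 2 - 1)) * (\<integral>\<^sup>+c. ennreal ((1 + c\<^sup>2) powr (1 - a / 2) * (norm (A (\<sigma>, c)))\<^sup>2) \<partial>lborel) \<le> shell_energy a R A \<sigma>"
proof -
  have [measurable]: "(\<lambda>c. A (\<sigma>, c)) \<in> borel_measurable borel" by (rule measurable_compose[OF _ assms(1)]) measurable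
  have "ennreal (1/2 * \<sigma> powr (a / 2 - 1)) * (\<integral>\<^sup>+c. ennreal ((1 + c\<^sup>2) powr (1 - a / 2) * (norm (A (\<sigma>, c)))\<^sup>2) \<partial>lborel)
    = (\<integral>\<^sup>+c. ennreal (1/2 * \<sigma> powr (a / 2 - 1)) * ennreal ((1 + c\<^sup>2) powr (1 - a / 2) * (norm (A (\<sigma>, c)))\<^sup>2) \<partial>lborel)"
    by (rule nn_integral_cmult[symmetric]) measurable
  also have "\<dots> \<le> shell_energy a R A \<sigma>"
    unfolding shell_energy_def
  proof (rule nn_integral_mono)
    fix c :: real
    define w P z r where "w = 1 + c\<^sup>2" and "P = \<sigma> powr (a / 2 - 1)" and "z = norm (A (\<sigma>, c))" and "r = norm (R (\<sigma>, c))"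
    have w: "1 \<le> w" by (simp add: w_def)
    have P: "\<sigma> powr (a / 2) = P * \<sigma>" using s0 by (auto simp: P_def powr_diff)
    have wt: "w powr (1 - a / 2) = w powr (- a / 2) * w" using w powr_add[of w "- a / 2" 1] by simp
    have "1/2 * P * (w powr (1 - a / 2) * z\<^sup>2) = P * \<sigma> * w powr (- a / 2) * (0 + w\<^sup>2 * z\<^sup>2 / \<sigma>) * (1 / (2 * w))"
      using s0 w unfolding wt by (simp add: field_simps power2_eq_square)
    also have "\<dots> \<le> P * \<sigma> * w powr (- a / 2) * (4 * \<sigma> * r\<^sup>2 + w\<^sup>2 * z\<^sup>2 / \<sigma>) * (1 / (2 * w))"
      using s0 w by (intro mult_right_mono mult_left_mono add_right_mono) (auto simp: P_def)
    finally have "ennreal (1/2 * P * (w powr (1 - a / 2) * z\<^sup>2)) \<le> polar_density a R A (\<sigma>, c)"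
      using s0 by (simp add: polar_density_def polar_jac_def P w_def[symmetric] z_def[symmetric] r_def[symmetric] ennreal_leI)
    moreover have "ennreal (1/2 * P) * ennreal (w powr (1 - a / 2) * z\<^sup>2) = ennreal (1/2 * P * (w powr (1 - a / 2) * z\<^sup>2))"
      by (rule ennreal_mult[symmetric]) (simp_all add: P_def)
    ultimately show "ennreal (1/2 * \<sigma> powr (a / 2 - 1)) * ennreal ((1 + c\<^sup>2) powr (1 - a / 2) * (norm (A (\<sigma>, c)))\<^sup>2) \<le> polar_density a R A (\<sigma>, c)"
      by (simp only: P_def w_def z_def)
  qed
  finally show ?thesis .
qed

text \<open>The competitor is bounded on the inner half disc and equals v outside it. Since y^a <= 1
  on the unit half disc, a bounded map has finite weighted L2 norm there.\<close>

lemma weighted_H1_glue: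
  fixes v w h1 h2 :: "real \<times> real \<Rightarrow> real^'d"
  assumes a: "0 < a" and H1: "weighted_H1 a (half_ball (0, 0) 1) v0"
    and v0: "AE p in lborel. p \<in> half_ball (0, 0) 1 \<longrightarrow> v0 p = v p"
    and w: "\<And>p. p \<in> half_ball (0, 0) 1 \<Longrightarrow> norm (w p) \<le> M \<or> w p = v p"
    and [measurable]: "v \<in> borel_measurable borel" "h1 \<in> borel_measurable borel" "h2 \<in> borel_measurable borel"
    and wg: "is_weak_grad (half_ball (0, 0) 1) w h1 h2"
    and fin: "(\<integral>\<^sup>+p\<in>half_ball (0, 0) 1. ennreal (snd p powr a * ((norm (h1 p))\<^sup>2 + (norm (h2 p))\<^sup>2)) \<partial>lebesgue) < \<infinity>"
  shows "weighted_H1 a (half_ball (0, 0) 1) w"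
  unfolding weighted_H1_def
proof (intro exI conjI)
  show "is_weak_grad (half_ball (0, 0) 1) w h1 h2" by (rule wg)
  let ?\<Omega> = "half_ball (0, 0) 1 :: (real \<times> real) set"
  have vfin: "(\<integral>\<^sup>+p\<in>?\<Omega>. ennreal (snd p powr a * (norm (v p))\<^sup>2) \<partial>lebesgue) < \<infinity>"
  proof -
    obtain g1 g2 :: "real \<times> real \<Rightarrow> real^'d" where g: "(\<integral>\<^sup>+p\<in>?\<Omega>. ennreal (snd p powr a * ((norm (v0 p))\<^sup>2 + (norm (g1 p))\<^sup>2 + (norm (g2 p))\<^sup>2)) \<partial>lebesgue) < \<infinity>"
      using H1 unfolding weighted_H1_def by blast
    have "(\<integral>\<^sup>+p\<in>?\<Omega>. ennreal (snd p powr a * (norm (v p))\<^sup>2) \<partial>lebesgue) \<le> (\<integral>\<^sup>+p\<in>?\<Omega>. ennreal (snd p powr a * ((norm (v0 p))\<^sup>2 + (norm (g1 p))\<^sup>2 + (norm (g2 p))\<^sup>2)) \<partial>lebesgue)"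
      unfolding nn_integral_completion
    proof (rule nn_integral_mono_AE)
      show "AE p in lborel. ennreal (snd p powr a * (norm (v p))\<^sup>2) * indicator ?\<Omega> p \<le> ennreal (snd p powr a * ((norm (v0 p))\<^sup>2 + (norm (g1 p))\<^sup>2 + (norm (g2 p))\<^sup>2)) * indicator ?\<Omega> p"
        using v0 by eventually_elim (auto simp: indicator_def intro!: ennreal_leI mult_left_mono)
    qed
    with g show ?thesis by (rule order_le_less_trans[rotated])
  qed
  have bfin: "(\<integral>\<^sup>+p\<in>?\<Omega>. ennreal (M\<^sup>2) \<partial>lborel) < \<infinity>"
  proof -
    have "emeasure lborel ?\<Omega> \<le> emeasure lborel (ball (0, 0) 1 :: (real \<times> real) set)"
      by (rule emeasure_mono) (auto simp: half_ball_def)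
    also have "\<dots> < \<infinity>" by (rule emeasure_lborel_ball_finite)
    finally show ?thesis by (subst nn_integral_cmult_indicator) (auto simp: ennreal_mult_less_top)
  qed
  have "(\<integral>\<^sup>+p\<in>?\<Omega>. ennreal (snd p powr a * ((norm (w p))\<^sup>2 + (norm (h1 p))\<^sup>2 + (norm (h2 p))\<^sup>2)) \<partial>lebesgue)
    \<le> (\<integral>\<^sup>+p. (ennreal (snd p powr a * (norm (v p))\<^sup>2) * indicator ?\<Omega> p + ennreal (M\<^sup>2) * indicator ?\<Omega> p) + ennreal (snd p powr a * ((norm (h1 p))\<^sup>2 + (norm (h2 p))\<^sup>2)) * indicator ?\<Omega> p \<partial>lborel)"
    unfolding nn_integral_completion
  proof (rule nn_integral_mono)
    fix p :: "real \<times> real"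
    show "ennreal (snd p powr a * ((norm (w p))\<^sup>2 + (norm (h1 p))\<^sup>2 + (norm (h2 p))\<^sup>2)) * indicator ?\<Omega> p
      \<le> (ennreal (snd p powr a * (norm (v p))\<^sup>2) * indicator ?\<Omega> p + ennreal (M\<^sup>2) * indicator ?\<Omega> p) + ennreal (snd p powr a * ((norm (h1 p))\<^sup>2 + (norm (h2 p))\<^sup>2)) * indicator ?\<Omega> p"
    proof (cases "p \<in> ?\<Omega>")
      case True
      have y: "0 < snd p" "snd p \<le> 1"
      proof -
        show "0 < snd p" using True by (simp add: half_ball_iff)
        have "(snd p)\<^sup>2 \<le> 1" using True sum_power2_ge_zero[of "fst p" 0] by (simp add: half_ball_iff) (smt (verit) zero_le_power2)
        then show "snd p \<le> 1" using abs_square_le_1[of "snd p"] by simp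
      qed
      have ya: "snd p powr a \<le> 1" using y a by (intro powr_le1) auto
      have "snd p powr a * (norm (w p))\<^sup>2 \<le> snd p powr a * (norm (v p))\<^sup>2 + M\<^sup>2"
        using w[OF True]
      proof
        assume "norm (w p) \<le> M"
        then have "(norm (w p))\<^sup>2 \<le> M\<^sup>2" by (intro power_mono) auto
        then have "snd p powr a * (norm (w p))\<^sup>2 \<le> 1 * M\<^sup>2" using ya by (intro mult_mono) auto
        moreover have "0 \<le> snd p powr a * (norm (v p))\<^sup>2" by simp
        ultimately show ?thesis by linarith
      qed simp
      then have "snd p powr a * ((norm (w p))\<^sup>2 + (norm (h1 p))\<^sup>2 + (norm (h2 p))\<^sup>2) \<le> snd p powr a * (norm (v p))\<^sup>2 + M\<^sup>2 + snd p powr a * ((norm (h1 p))\<^sup>2 + (norm (h2 p))\<^sup>2)"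
        by (simp add: distrib_left)
      from ennreal_leI[OF this] show ?thesis using True by (simp add: ennreal_plus[symmetric] del: ennreal_plus)
    qed simp
  qed
  also have "\<dots> = (\<integral>\<^sup>+p. ennreal (snd p powr a * (norm (v p))\<^sup>2) * indicator ?\<Omega> p + ennreal (M\<^sup>2) * indicator ?\<Omega> p \<partial>lborel) + (\<integral>\<^sup>+p. ennreal (snd p powr a * ((norm (h1 p))\<^sup>2 + (norm (h2 p))\<^sup>2)) * indicator ?\<Omega> p \<partial>lborel)"
    by (rule nn_integral_add) measurable
  also have "(\<integral>\<^sup>+p. ennreal (snd p powr a * (norm (v p))\<^sup>2) * indicator ?\<Omega> p + ennreal (M\<^sup>2) * indicator ?\<Omega> p \<partial>lborel)
    = (\<integral>\<^sup>+p. ennreal (snd p powr a * (norm (v p))\<^sup>2) * indicator ?\<Omega> p \<partial>lborel) + (\<integral>\<^sup>+p. ennreal (M\<^sup>2) * indicator ?\<Omega> p \<partial>lborel)"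
    by (rule nn_integral_add) measurable
  also have "\<dots> + (\<integral>\<^sup>+p. ennreal (snd p powr a * ((norm (h1 p))\<^sup>2 + (norm (h2 p))\<^sup>2)) * indicator ?\<Omega> p \<partial>lborel) < \<infinity>"
    using vfin bfin fin unfolding nn_integral_completion by simp
  finally show "(\<integral>\<^sup>+p\<in>?\<Omega>. ennreal (snd p powr a * ((norm (w p))\<^sup>2 + (norm (h1 p))\<^sup>2 + (norm (h2 p))\<^sup>2)) \<partial>lebesgue) < \<infinity>" .
qed

lemma compact_half_disc: "compact {p :: real \<times> real. 0 \<le> snd p \<and> (fst p)\<^sup>2 + (snd p)\<^sup>2 \<le> S}"
proof -
  have c: "continuous_on UNIV (\<lambda>p::real \<times> real. (fst p)\<^sup>2 + (snd p)\<^sup>2)" by (intro continuous_intros)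
  have "closed ({p :: real \<times> real. 0 \<le> snd p} \<inter> {p. (fst p)\<^sup>2 + (snd p)\<^sup>2 \<le> S})"
    by (intro closed_Int closed_Collect_le continuous_intros c)
  moreover have "{p :: real \<times> real. 0 \<le> snd p} \<inter> {p. (fst p)\<^sup>2 + (snd p)\<^sup>2 \<le> S} \<subseteq> cball 0 (sqrt S)"
    by (auto simp: norm_Pair)
  ultimately show ?thesis unfolding Collect_conj_eq
    by (meson bounded_cball bounded_subset compact_eq_bounded_closed)
qed

context competitor begin

text \<open>The competitor equals v for \<sigma> > S, so the energies of the outer shells coincide
  and, being finite, cancel. Minimality on the unit half disc thus becomes a comparison on the inner
  one.\<close>

lemma disc_energy_le_comp:
  fixes v0 v g1 g2 :: "real \<times> real \<Rightarrow> real^'d" and s :: real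
  defines "a \<equiv> 1 - 2 * s" and "R \<equiv> polar_radial g1 g2" and "A \<equiv> polar_angular g1 g2"
  assumes s: "s < 1/2" and S1: "S < 1" and N: "bounded N" and GN: "\<And>t. t \<in> {0..1} \<Longrightarrow> G t \<in> N"
    and min: "minimizing_whm_free_boundary s N v0"
    and mv [measurable]: "v \<in> borel_measurable borel" and mg [measurable]: "g1 \<in> borel_measurable borel" "g2 \<in> borel_measurable borel"
    and v0: "AE p in lborel. p \<in> half_ball (0, 0) 1 \<longrightarrow> v0 p = v p"
    and wg0: "is_weak_grad (half_ball (0, 0) 1) v0 g1 g2" and wg: "is_weak_grad (half_ball (0, 0) 1) v g1 g2"
    and fin: "disc_energy a R A 1 < \<infinity>"
    and compfin: "disc_energy a comp_radial comp_angular S < \<infinity>"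
    and acR: "AE c in lborel. AE \<sigma> in lborel. \<sigma> \<in> {0<..<1} \<longrightarrow> v (polar_map (\<sigma>, c)) = \<phi> c + signed_integral S \<sigma> (\<lambda>t. R (t, c))"
    and acA: "AE \<sigma> in lborel. \<sigma> \<in> {0<..<1} \<longrightarrow> (\<exists>k. AE c in lborel. v (polar_map (\<sigma>, c)) = k + signed_integral 0 c (\<lambda>t. A (\<sigma>, t)))"
  shows "disc_energy a R A S \<le> disc_energy a comp_radial comp_angular S"
proof -
  have a: "0 < a" using s by (simp add: a_def)
  have mR [measurable]: "R \<in> borel_measurable borel" "A \<in> borel_measurable borel"
    unfolding R_def A_def polar_radial_def polar_angular_def by measurable
  define w where "w = (\<lambda>p. if 0 < snd p \<and> fst (polar_inv p) \<le> S then comp (polar_inv p) else v p)"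
  have mw [measurable]: "w \<in> borel_measurable borel" unfolding w_def by measurable
  define U' where "U' q = (if fst q \<le> S then comp q else v (polar_map q))" for q
  define R' where "R' q = (if fst q \<le> S then comp_radial q else R q)" for q
  define A' where "A' q = (if fst q \<le> S then comp_angular q else A q)" for q
  have mR' [measurable]: "R' \<in> borel_measurable borel" "A' \<in> borel_measurable borel" unfolding R'_def[abs_def] A'_def[abs_def] by measurable
  have j: "S \<in> {0<..<1\<^sup>2}" using S S1 by simp
  have rU: "rect_integrable {0<..<1\<^sup>2} UNIV U'" unfolding U'_def[abs_def]
    by (rule rect_integrable_if[OF polar_rect_integrable(1)[OF zero_less_one wg mv mg] comp_rect_integrable(1)])
  have rR: "rect_integrable {0<..<1\<^sup>2} UNIV R'" unfolding R'_def[abs_def] R_def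
    by (rule rect_integrable_if[OF polar_rect_integrable(2)[OF zero_less_one wg mv mg] comp_rect_integrable(2)])
  have rA: "rect_integrable {0<..<1\<^sup>2} UNIV A'" unfolding A'_def[abs_def] A_def
    by (rule rect_integrable_if[OF polar_rect_integrable(3)[OF zero_less_one wg mv mg] comp_rect_integrable(3)])
  have ftcA: "\<exists>k. AE c in lborel. comp (\<sigma>, c) = k + signed_integral 0 c (\<lambda>t. comp_angular (\<sigma>, t))" for \<sigma>
    using comp_angular_ftc[of \<sigma>] by (intro exI[of _ "comp (\<sigma>, 0)"] AE_I2) blast
  note glue = glue_absolutely_continuous[OF acR acA comp_radial_ftc ftcA, folded U'_def R'_def A'_def]
  have gR: "AE c in lborel. \<exists>k. AE \<sigma> in lborel. \<sigma> \<in> {0<..<1\<^sup>2} \<longrightarrow> U' (\<sigma>, c) = k + signed_integral S \<sigma> (\<lambda>t. R' (t, c))"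
    using glue(1) by simp
  have gA: "AE \<sigma> in lborel. \<sigma> \<in> {0<..<1\<^sup>2} \<longrightarrow> (\<exists>k. AE c in lborel. U' (\<sigma>, c) = k + signed_integral 0 c (\<lambda>t. A' (\<sigma>, t)))"
    using glue(2) by simp
  have wU: "w (polar_map q) = U' q" if "0 < fst q" for q
    using that by (simp add: w_def U'_def polar_inv_map)
  define h1 h2 where h: "h1 = grad_x R' A'" "h2 = grad_y R' A'"
  note gc = zero_less_one j rU rR rA gR gA wU mw
  have wgw: "is_weak_grad (half_ball (0, 0) 1) w h1 h2" unfolding h by (rule polar_weak_grad[OF gc])
  have mh [measurable]: "h1 \<in> borel_measurable borel" "h2 \<in> borel_measurable borel" unfolding h using grad_measurable[OF gc] by simp_all
  define rest where "rest = (\<integral>\<^sup>+\<sigma>. indicator {S<..<1} \<sigma> * shell_energy a R A \<sigma> \<partial>lborel)"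
  have dv: "disc_energy a R A 1 = disc_energy a R A S + rest"
    unfolding rest_def by (rule disc_energy_split[OF mR S S1])
  have dw: "disc_energy a (polar_radial h1 h2) (polar_angular h1 h2) 1 = disc_energy a comp_radial comp_angular S + rest"
  proof -
    have "disc_energy a (polar_radial h1 h2) (polar_angular h1 h2) 1 = disc_energy a R' A' 1"
      unfolding h by (intro disc_energy_cong polar_radial_grad[OF gc])
    also have "\<dots> = disc_energy a R' A' S + (\<integral>\<^sup>+\<sigma>. indicator {S<..<1} \<sigma> * shell_energy a R' A' \<sigma> \<partial>lborel)"
      by (rule disc_energy_split[OF mR' S S1])
    also have "disc_energy a R' A' S = disc_energy a comp_radial comp_angular S"
      by (rule disc_energy_cong) (auto simp: R'_def A'_def)
    also have "(\<integral>\<^sup>+\<sigma>. indicator {S<..<1} \<sigma> * shell_energy a R' A' \<sigma> \<partial>lborel) = rest"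
      unfolding rest_def by (intro nn_integral_cong) (auto simp: indicator_def shell_energy_def polar_density_def R'_def A'_def)
    finally show ?thesis .
  qed
  have rfin: "rest < \<infinity>" using fin unfolding dv by simp
  have "energy_s s v0 (half_ball (0, 0) 1) \<le> energy_s s w (half_ball (0, 0) 1)"
  proof -
    have m: "weighted_H1 a (half_ball (0, 0) 1) v0" "trace_in N v0 0 1"
      using min by (auto simp: minimizing_whm_free_boundary_def a_def)
    have H: "weighted_H1 a (half_ball (0, 0) 1) w"
    proof (rule weighted_H1_glue[OF a m(1) v0 _ mv mh wgw, where M = "norm p0 + 2 * (\<integral>x. norm (f x) \<partial>lborel)"])
      show "norm (w p) \<le> norm p0 + 2 * (\<integral>x. norm (f x) \<partial>lborel) \<or> w p = v p" if "p \<in> half_ball (0, 0) 1" for p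
      proof (cases "0 < snd p \<and> fst (polar_inv p) \<le> S")
        case True
        then have "fst (polar_inv p) \<in> {0<..S}" using fst_polar_inv_pos[of p] by simp
        from comp_bounds(1)[OF this, of "snd (polar_inv p)"] show ?thesis using True by (simp add: w_def)
      qed (auto simp: w_def)
      show "(\<integral>\<^sup>+p\<in>half_ball (0, 0) 1. ennreal (snd p powr a * ((norm (h1 p))\<^sup>2 + (norm (h2 p))\<^sup>2)) \<partial>lebesgue) < \<infinity>"
        unfolding half_ball_energy_polar[OF zero_less_one mh] using compfin rfin by (simp add: dw)
    qed
    have T: "trace_in N w 0 1" unfolding w_def by (rule trace_in_glue[OF S1 N GN m(2) mv v0])
    \<comment> \<open>The closed half disc including its flat side; S < 1 makes it compact inside
      the open half disc together with its flat boundary, as the condition on the support of w - v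
      asks.\<close>
    let ?K = "{p :: real \<times> real. 0 \<le> snd p \<and> (fst p)\<^sup>2 + (snd p)\<^sup>2 \<le> S}"
    have K: "?K \<subseteq> half_ball (0, 0) 1 \<union> flat_part 0 1"
    proof
      fix p assume p: "p \<in> ?K"
      show "p \<in> half_ball (0, 0) 1 \<union> flat_part 0 1"
      proof (cases "snd p = 0")
        case True
        then have "(fst p)\<^sup>2 < 1" using p S1 by simp
        then have "\<bar>fst p\<bar> < 1" by (simp add: abs_square_less_1)
        then show ?thesis using True by (auto simp: flat_part_def mem_Times_iff)
      next
        case False
        then show ?thesis using p S1 by (simp add: half_ball_iff)
      qed
    qed
    have eq: "AE p in lebesgue. p \<in> half_ball (0, 0) 1 - ?K \<longrightarrow> w p = v0 p"
    proof (rule AE_completion)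
      show "AE p in lborel. p \<in> half_ball (0, 0) 1 - ?K \<longrightarrow> w p = v0 p"
        using v0 by eventually_elim (auto simp: w_def polar_inv_def half_ball_iff)
    qed
    from min have "\<forall>w. weighted_H1 (1 - 2 * s) (half_ball (0,0) 1) w \<and> trace_in N w 0 1 \<and>
          (\<exists>K. compact K \<and> K \<subseteq> half_ball (0,0) 1 \<union> flat_part 0 1 \<and>
               (AE p in lebesgue. p \<in> half_ball (0,0) 1 - K \<longrightarrow> w p = v0 p))
        \<longrightarrow> energy_s s v0 (half_ball (0,0) 1) \<le> energy_s s w (half_ball (0,0) 1)"
      unfolding minimizing_whm_free_boundary_def by blast
    then show ?thesis using H T compact_half_disc[of S] K eq unfolding a_def by blast
  qed
  then have le: "enn2real (disc_energy a R A 1) \<le> enn2real (disc_energy a comp_radial comp_angular S + rest)"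
    unfolding energy_s_polar[OF zero_less_one wg0 mg] energy_s_polar[OF zero_less_one wgw mh] using dw
    by (simp add: a_def R_def A_def)
  have "disc_energy a R A 1 \<le> disc_energy a comp_radial comp_angular S + rest"
  \<comment> \<open>Energies are reals obtained by \<open>enn2real\<close>; finiteness of both sides
    allows the inequality to be lifted back to \<open>ennreal\<close>.\<close>
  proof -
    have t: "disc_energy a comp_radial comp_angular S + rest < top" "disc_energy a R A 1 < top" using fin compfin rfin by simp_all
    from ennreal_leI[OF le] show ?thesis unfolding ennreal_enn2real[OF t(1)] ennreal_enn2real[OF t(2)] .
  qed
  then show ?thesis unfolding dv using rfin
    by (metis add.commute ennreal_add_left_cancel_le less_irrefl infinity_ennreal_def)
qed

end

section \<open>Energy decay\<close>

text \<open>S^(-\<kappa>) F(S) has derivative S^(-\<kappa> - 1) (S f - \<kappa> F), nonnegative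
  almost everywhere on (S0, 1). As F is merely absolutely continuous, its monotonicity is obtained
  by integrating by parts against x^(-\<kappa>) on [S0, 1].\<close>

lemma gronwall_ennreal:
  fixes f :: "real \<Rightarrow> ennreal"
  defines "F \<equiv> \<lambda>S. \<integral>\<^sup>+\<sigma>. indicator {0<..<S} \<sigma> * f \<sigma> \<partial>lborel"
  assumes [measurable]: "f \<in> borel_measurable borel" and fin: "F 1 < \<infinity>" and \<kappa>: "0 < \<kappa>" and S0: "0 < S0" "S0 < 1"
    and ineq: "AE S in lborel. S \<in> {S0<..<1} \<longrightarrow> ennreal \<kappa> * F S \<le> ennreal S * f S"
  shows "F S0 \<le> ennreal (S0 powr \<kappa>) * F 1"
proof -
  \<comment> \<open>Finiteness of F 1 makes f finite almost everywhere on (0, 1), so a real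
    integrable representative is available for the integration by parts.\<close>
  define f0 where "f0 \<sigma> = indicator {0<..<1} \<sigma> * enn2real (f \<sigma>)" for \<sigma>
  have [measurable]: "f0 \<in> borel_measurable borel" unfolding f0_def[abs_def] by measurable
  have f0nn: "0 \<le> f0 \<sigma>" for \<sigma> by (simp add: f0_def)
  have "AE \<sigma> in lborel. indicator {0<..<1} \<sigma> * f \<sigma> \<noteq> \<infinity>"
    using fin unfolding F_def by (intro nn_integral_PInf_AE) auto
  then have ff0: "AE \<sigma> in lborel. \<sigma> \<in> {0<..<1} \<longrightarrow> f \<sigma> = ennreal (f0 \<sigma>)"
    by eventually_elim (auto simp: f0_def less_top)
  have nn: "(\<integral>\<^sup>+\<sigma>. ennreal (indicator {0<..x} \<sigma> * f0 \<sigma>) \<partial>lborel) = F x" if "0 < x" "x \<le> 1" for x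
    unfolding F_def
  proof (rule nn_integral_cong_AE)
    show "AE \<sigma> in lborel. ennreal (indicator {0<..x} \<sigma> * f0 \<sigma>) = indicator {0<..<x} \<sigma> * f \<sigma>"
      using ff0 AE_lborel_singleton[of x] by eventually_elim (use that in \<open>auto simp: indicator_def\<close>)
  qed
  have Fmono: "F x \<le> F 1" if "x \<le> 1" for x
    unfolding F_def using that by (intro nn_integral_mono) (auto simp: indicator_def)
  have f0i: "integrable lborel f0"
  proof (rule integrableI_bounded)
    have "(\<integral>\<^sup>+\<sigma>. ennreal (norm (f0 \<sigma>)) \<partial>lborel) = (\<integral>\<^sup>+\<sigma>. ennreal (indicator {0<..1} \<sigma> * f0 \<sigma>) \<partial>lborel)"
      by (intro nn_integral_cong) (auto simp: f0_def indicator_def)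
    then show "(\<integral>\<^sup>+\<sigma>. ennreal (norm (f0 \<sigma>)) \<partial>lborel) < \<infinity>" using nn[of 1] fin by simp
  qed measurable
  define u where "u x = signed_integral 0 x f0" for x
  have um [measurable]: "u \<in> borel_measurable borel"
    unfolding u_def[abs_def] by (rule signed_integral_measurable_fun) measurable
  have uF: "ennreal (u x) = F x" "0 \<le> u x" if "0 < x" "x \<le> 1" for x
  proof -
    have e: "u x = (\<integral>\<sigma>. indicator {0<..x} \<sigma> * f0 \<sigma> \<partial>lborel)"
      unfolding u_def signed_integral_def using that by (intro Bochner_Integration.integral_cong refl) (simp add: sgn_ind_def)
    have "integrable lborel (\<lambda>\<sigma>. indicator {0<..x} \<sigma> * f0 \<sigma>)"
      using integrable_mult_indicator[OF _ f0i, of "{0<..x}"] by simp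
    then show "ennreal (u x) = F x" unfolding e nn[OF that, symmetric]
      by (intro nn_integral_eq_integral[symmetric]) (auto simp: f0nn)
    show "0 \<le> u x" unfolding e by (intro integral_nonneg_AE) (auto simp: f0nn)
  qed
  have key: "AE x in lborel. x \<in> {S0..1} \<longrightarrow> \<kappa> * u x \<le> x * f0 x"
    using ineq ff0 AE_lborel_singleton[of S0] AE_lborel_singleton[of 1]
  proof eventually_elim
    case (elim x)
    show ?case
    proof
      assume "x \<in> {S0..1}"
      then have x: "0 < x" "x \<le> 1" "x \<in> {S0<..<1}" "x \<in> {0<..<1}" using elim S0 by auto
      then have "ennreal \<kappa> * ennreal (u x) \<le> ennreal x * ennreal (f0 x)" using elim uF[of x] by simp
      then show "\<kappa> * u x \<le> x * f0 x" using x \<kappa> f0nn[of x] uF(2)[of x] by (simp add: ennreal_mult[symmetric] ennreal_le_iff)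
    qed
  qed
  let ?\<psi> = "\<lambda>x. x powr (- \<kappa>)" and ?\<psi>' = "\<lambda>x. - \<kappa> * x powr (- \<kappa> - 1)"
  have ibp: "(\<integral>x. (indicator {S0..1} x * ?\<psi>' x) *\<^sub>R u x \<partial>lborel)
      = ?\<psi> 1 *\<^sub>R u 1 - ?\<psi> S0 *\<^sub>R u S0 - (\<integral>x. (indicator {S0..1} x * ?\<psi> x) *\<^sub>R f0 x \<partial>lborel)"
  proof (rule ac_integral_by_parts[where J = UNIV and j = 0 and k = 0])
    show "interval_integrable UNIV f0" by (rule integrable_imp_interval_integrable[OF f0i])
    show "(?\<psi> has_real_derivative ?\<psi>' x) (at x within {S0..1})" if "x \<in> {S0..1}" for x
      using that S0 by (intro has_field_derivative_at_within[OF has_real_derivative_powr]) auto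
    show "continuous_on {S0..1} ?\<psi>'" using S0 by (intro continuous_intros) auto
  qed (use S0 in \<open>auto simp: u_def\<close>)
  have i1: "integrable lborel (\<lambda>x. (indicator {S0..1} x * ?\<psi> x) *\<^sub>R f0 x)"
  proof (rule Bochner_Integration.integrable_bound)
    show "integrable lborel (\<lambda>x. S0 powr (- \<kappa>) * f0 x)" using f0i by simp
    show "AE x in lborel. norm ((indicator {S0..1} x * ?\<psi> x) *\<^sub>R f0 x) \<le> norm (S0 powr (- \<kappa>) * f0 x)"
    proof (rule AE_I2)
      fix x
      show "norm ((indicator {S0..1} x * ?\<psi> x) *\<^sub>R f0 x) \<le> norm (S0 powr (- \<kappa>) * f0 x)"
        using f0nn[of x] S0 \<kappa> by (auto simp: indicator_def abs_mult intro!: mult_right_mono powr_mono2')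
    qed
  qed measurable
  have cmp: "AE x in lborel. 0 \<le> - ((indicator {S0..1} x * ?\<psi>' x) *\<^sub>R u x) \<and> - ((indicator {S0..1} x * ?\<psi>' x) *\<^sub>R u x) \<le> (indicator {S0..1} x * ?\<psi> x) *\<^sub>R f0 x"
    using key
  proof eventually_elim
    case (elim x)
    show ?case
    proof (cases "x \<in> {S0..1}")
      case True
      then have x: "0 < x" "x \<le> 1" using S0 by auto
      have "x powr (- \<kappa> - 1) * (\<kappa> * u x) \<le> x powr (- \<kappa> - 1) * (x * f0 x)" using elim True by (intro mult_left_mono) auto
      also have "\<dots> = x powr (- \<kappa>) * f0 x" using x by (simp add: powr_diff)
      finally show ?thesis using True uF(2)[OF x] \<kappa> by (simp add: mult_ac)
    qed simp
  qed
  have i2: "integrable lborel (\<lambda>x. - ((indicator {S0..1} x * ?\<psi>' x) *\<^sub>R u x))"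
    by (rule Bochner_Integration.integrable_bound[OF i1]) (measurable, use cmp in eventually_elim, auto)
  have "(\<integral>x. - ((indicator {S0..1} x * ?\<psi>' x) *\<^sub>R u x) \<partial>lborel) \<le> (\<integral>x. (indicator {S0..1} x * ?\<psi> x) *\<^sub>R f0 x \<partial>lborel)"
    by (rule integral_mono_AE[OF i2 i1]) (use cmp in eventually_elim, auto)
  then have "?\<psi> S0 * u S0 \<le> u 1" using ibp by simp
  then have "S0 powr \<kappa> * (?\<psi> S0 * u S0) \<le> S0 powr \<kappa> * u 1" by (intro mult_left_mono) auto
  moreover have "S0 powr \<kappa> * (?\<psi> S0 * u S0) = u S0"
    using S0 by (simp add: mult.assoc[symmetric] powr_add[symmetric])
  ultimately have "ennreal (u S0) \<le> ennreal (S0 powr \<kappa> * u 1)" by (simp add: ennreal_leI)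
  then show ?thesis using uF[of S0] uF[of 1] S0 by (simp add: ennreal_mult)
qed

text \<open>The second alternative is the case of large angular energy on the slice; it is excluded by the
  smallness of the total energy.\<close>

lemma energy_decay_AE:
  fixes v0 v g1 g2 :: "real \<times> real \<Rightarrow> real^'d" and s \<beta> \<tau> C0 \<rho> :: real
  defines "a \<equiv> 1 - 2 * s" and "R \<equiv> polar_radial g1 g2" and "A \<equiv> polar_angular g1 g2"
  assumes s: "s < 1/2" and N: "compact N"
    and min: "minimizing_whm_free_boundary s N v0"
    and mv [measurable]: "v \<in> borel_measurable borel" and mg [measurable]: "g1 \<in> borel_measurable borel" "g2 \<in> borel_measurable borel"
    and v0: "AE p in lborel. p \<in> half_ball (0, 0) 1 \<longrightarrow> v0 p = v p"
    and wg0: "is_weak_grad (half_ball (0, 0) 1) v0 g1 g2" and wg: "is_weak_grad (half_ball (0, 0) 1) v g1 g2"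
    and fin: "disc_energy a R A 1 < \<infinity>"
    and C0: "(\<integral>\<^sup>+c. ennreal ((1 + c\<^sup>2) powr (- (1 - a / 2))) \<partial>lborel) = ennreal C0" "0 \<le> C0"
    and \<beta>: "0 < \<beta>" and \<tau>: "0 \<le> \<tau>" "\<tau> \<le> 1" and \<rho>: "0 < \<rho>"
    and gain: "(a / 2 + \<beta>) * (1 + \<tau> * (1 + 2 * C0\<^sup>2) + 16 * \<beta>\<^sup>2 * C0\<^sup>2) \<le> a / 2 + 2 * \<beta>"
    and curves: "\<forall>p\<in>N. \<forall>q\<in>N. norm (q - p) < \<rho> \<longrightarrow> (\<exists>G G'. short_curve N \<tau> p q G G')"
  shows "AE S in lborel. S \<in> {0<..<1} \<longrightarrow>
    ennreal (a / 2 + \<beta>) * disc_energy a R A S \<le> ennreal S * shell_energy a R A S \<or>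
    ennreal (1/2 * S powr (a / 2) * (\<rho>\<^sup>2 / (C0 + 1))) \<le> ennreal S * shell_energy a R A S"
proof -
  have a: "0 < a" using s by (simp add: a_def)
  have mR [measurable]: "R \<in> borel_measurable borel" "A \<in> borel_measurable borel"
    unfolding R_def A_def polar_radial_def polar_angular_def by measurable
  have mA [measurable]: "(\<lambda>c. A (\<sigma>, c)) \<in> borel_measurable borel" for \<sigma> by (rule measurable_compose[OF _ mR(2)]) measurable
  define en where "en \<sigma> = (\<integral>\<^sup>+c. ennreal ((1 + c\<^sup>2) powr (1 - a / 2) * (norm (A (\<sigma>, c)))\<^sup>2) \<partial>lborel)" for \<sigma>
  have shell_ge: "ennreal (1/2 * \<sigma> powr (a / 2 - 1)) * en \<sigma> \<le> shell_energy a R A \<sigma>" if "0 < \<sigma>" for \<sigma>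
    unfolding en_def by (rule shell_energy_ge_angular[OF mR(2) that])
  have "AE \<sigma> in lborel. indicator {0<..<1} \<sigma> * shell_energy a R A \<sigma> \<noteq> \<infinity>"
    using fin unfolding disc_energy_def by (intro nn_integral_PInf_AE) auto
  then have en_fin: "AE \<sigma> in lborel. \<sigma> \<in> {0<..<1} \<longrightarrow> en \<sigma> < \<infinity>"
  proof eventually_elim
    case (elim \<sigma>)
    show ?case
    proof
      assume \<sigma>: "\<sigma> \<in> {0<..<1}"
      then have "ennreal (1/2 * \<sigma> powr (a / 2 - 1)) * en \<sigma> < \<infinity>"
        using shell_ge[of \<sigma>] elim by (auto simp: less_top elim: order_le_less_trans)
      moreover have "ennreal (1/2 * \<sigma> powr (a / 2 - 1)) \<noteq> 0" using \<sigma> by (simp add: ennreal_eq_0_iff)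
      ultimately show "en \<sigma> < \<infinity>" by (auto simp: ennreal_mult_less_top)
    qed
  qed
  have A_int: "integrable lborel (\<lambda>c. A (\<sigma>, c))" "(\<integral>c. norm (A (\<sigma>, c)) \<partial>lborel)\<^sup>2 \<le> C0 * enn2real (en \<sigma>)" if "en \<sigma> < \<infinity>" for \<sigma>
  proof -
    have e: "(\<integral>\<^sup>+c. ennreal ((1 + c\<^sup>2) powr (1 - a / 2) * (norm (A (\<sigma>, c)))\<^sup>2) \<partial>lborel) = ennreal (enn2real (en \<sigma>))"
      using that by (simp add: en_def less_top)
    show "integrable lborel (\<lambda>c. A (\<sigma>, c))" "(\<integral>c. norm (A (\<sigma>, c)) \<partial>lborel)\<^sup>2 \<le> C0 * enn2real (en \<sigma>)"
      by (rule weighted_slice_L1[OF mA C0 e enn2real_nonneg])+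
  qed
  obtain k1 where "AE q in lborel. q \<in> {0<..<1\<^sup>2} \<times> UNIV \<longrightarrow> v (polar_map q) = k1 (fst q) + signed_integral 0 (snd q) (\<lambda>t. A (fst q, t))"
    using polar_ac_angular[OF zero_less_one wg mv mg] unfolding A_def by blast
  from AE_lborel_pair_fst[OF this]
  have rep1: "AE \<sigma> in lborel. \<sigma> \<in> {0<..<1} \<longrightarrow> (AE c in lborel. v (polar_map (\<sigma>, c)) = k1 \<sigma> + signed_integral 0 c (\<lambda>t. A (\<sigma>, t)))"
    by eventually_elim (auto simp: mem_Times_iff)
  \<comment> \<open>The base point 1/2 is arbitrary; it is moved to the slice S later by additivity
    of the oriented integral.\<close>
  obtain k2 where k2: "AE q in lborel. q \<in> {0<..<1\<^sup>2} \<times> UNIV \<longrightarrow> v (polar_map q) = k2 (snd q) + signed_integral (1/2) (fst q) (\<lambda>t. R (t, snd q))"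
    using polar_ac_radial[OF zero_less_one wg mv mg, of "1/2"] unfolding R_def by auto
  from AE_lborel_pair_fst[OF k2]
  have rep2: "AE \<sigma> in lborel. \<sigma> \<in> {0<..<1} \<longrightarrow> (AE c in lborel. v (polar_map (\<sigma>, c)) = k2 c + signed_integral (1/2) \<sigma> (\<lambda>t. R (t, c)))"
    by eventually_elim (auto simp: mem_Times_iff)
  from AE_lborel_pair_snd[OF k2]
  have rep3: "AE c in lborel. AE \<sigma> in lborel. \<sigma> \<in> {0<..<1} \<longrightarrow> v (polar_map (\<sigma>, c)) = k2 c + signed_integral (1/2) \<sigma> (\<lambda>t. R (t, c))"
    by eventually_elim (auto simp: mem_Times_iff)
  have "AE c in lborel. c \<in> UNIV \<longrightarrow> interval_integrable {0<..<1} (\<lambda>t. R (t, c))"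
    using rect_integrable_slice[OF open_UNIV open_greaterThanLessThan rect_integrable_swap[OF polar_rect_integrable(2)[OF zero_less_one wg mv mg]]]
    by (simp add: R_def)
  then have ii: "AE c in lborel. interval_integrable {0<..<1} (\<lambda>t. R (t, c))" by simp
  have endN: "AE \<sigma> in lborel. \<sigma> \<in> {0<..<1} \<longrightarrow> E \<sigma> \<in> N"
    if lim: "AE \<sigma> in lborel. \<sigma> \<in> {0<..<1} \<longrightarrow> ((\<lambda>t. k1 \<sigma> + signed_integral 0 (\<epsilon> * t) (\<lambda>t. A (\<sigma>, t))) \<longlongrightarrow> E \<sigma>) at_top" and \<epsilon>: "\<epsilon> = 1 \<or> \<epsilon> = -1"
    for E :: "real \<Rightarrow> real^'d" and \<epsilon> :: real
  proof -
    have tr: "trace_in N v0 0 1" using min by (simp add: minimizing_whm_free_boundary_def)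
    \<comment> \<open>\<open>trace_slice_end\<close> reaches only \<sigma> < b with b < 1; the
      values b = 1 - 1/(n + 2) exhaust (0, 1).\<close>
    have "AE \<sigma> in lborel. \<forall>n::nat. \<sigma> \<in> {0<..<1 - 1 / (real n + 2)} \<longrightarrow> E \<sigma> \<in> N"
      unfolding AE_all_countable
    proof
      fix n :: nat
      have "0 < 1 - 1 / (real n + 2)" "1 - 1 / (real n + 2) < 1" by (auto simp: divide_simps)
      then show "AE \<sigma> in lborel. \<sigma> \<in> {0<..<1 - 1 / (real n + 2)} \<longrightarrow> E \<sigma> \<in> N"
        by (rule trace_slice_end[OF compact_imp_closed[OF N] tr mv v0 rep1 lim \<epsilon>])
    qed
    then show ?thesis
    proof eventually_elim
      case (elim \<sigma>)
      show ?case
      proof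
        assume \<sigma>: "\<sigma> \<in> {0<..<1}"
        obtain n :: nat where n: "1 / (1 - \<sigma>) < real n" using reals_Archimedean2 by blast
        have "1 < real n * (1 - \<sigma>)" using n \<sigma> by (simp add: pos_divide_less_eq)
        also have "\<dots> \<le> (real n + 2) * (1 - \<sigma>)" using \<sigma> by (intro mult_right_mono) auto
        finally have "1 / (real n + 2) < 1 - \<sigma>" by (simp add: pos_divide_less_eq mult.commute)
        then have "\<sigma> < 1 - 1 / (real n + 2)" by linarith
        then show "E \<sigma> \<in> N" using elim[rule_format, of n] \<sigma> by auto
      qed
    qed
  qed
  have pN: "AE \<sigma> in lborel. \<sigma> \<in> {0<..<1} \<longrightarrow> right_end (k1 \<sigma>) (\<lambda>t. A (\<sigma>, t)) \<in> N"
  proof (rule endN[of 1])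
    show "AE \<sigma> in lborel. \<sigma> \<in> {0<..<1} \<longrightarrow> ((\<lambda>t. k1 \<sigma> + signed_integral 0 (1 * t) (\<lambda>t. A (\<sigma>, t))) \<longlongrightarrow> right_end (k1 \<sigma>) (\<lambda>t. A (\<sigma>, t))) at_top"
      using en_fin
    proof eventually_elim
      case (elim \<sigma>)
      show ?case
      proof
        assume "\<sigma> \<in> {0<..<1}"
        with elim have "en \<sigma> < \<infinity>" by blast
        from slice_end_bounds(3)[OF A_int(1)[OF this]]
        show "((\<lambda>t. k1 \<sigma> + signed_integral 0 (1 * t) (\<lambda>t. A (\<sigma>, t))) \<longlongrightarrow> right_end (k1 \<sigma>) (\<lambda>t. A (\<sigma>, t))) at_top" by simp
      qed
    qed
  qed simp
  have qN: "AE \<sigma> in lborel. \<sigma> \<in> {0<..<1} \<longrightarrow> left_end (k1 \<sigma>) (\<lambda>t. A (\<sigma>, t)) \<in> N"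
  proof (rule endN[of "-1"])
    show "AE \<sigma> in lborel. \<sigma> \<in> {0<..<1} \<longrightarrow> ((\<lambda>t. k1 \<sigma> + signed_integral 0 (-1 * t) (\<lambda>t. A (\<sigma>, t))) \<longlongrightarrow> left_end (k1 \<sigma>) (\<lambda>t. A (\<sigma>, t))) at_top"
      using en_fin
    proof eventually_elim
      case (elim \<sigma>)
      show ?case
      proof
        assume "\<sigma> \<in> {0<..<1}"
        with elim have "((\<lambda>c. k1 \<sigma> + signed_integral 0 c (\<lambda>t. A (\<sigma>, t))) \<longlongrightarrow> left_end (k1 \<sigma>) (\<lambda>t. A (\<sigma>, t))) at_bot"
          by (intro slice_end_bounds(4) A_int) auto
        from filterlim_compose[OF this filterlim_uminus_at_bot_at_top]
        show "((\<lambda>t. k1 \<sigma> + signed_integral 0 (-1 * t) (\<lambda>t. A (\<sigma>, t))) \<longlongrightarrow> left_end (k1 \<sigma>) (\<lambda>t. A (\<sigma>, t))) at_top" by simp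
      qed
    qed
  qed simp
  show ?thesis
    using en_fin rep1 rep2 pN qN
  proof eventually_elim
    case (elim S)
    show ?case
    proof
      assume Sin: "S \<in> {0<..<1}"
      \<comment> \<open>Threshold between small and large angular energy: below it C0 e < \<rho>^2,
        so the two ends are close enough to be joined by a short curve. The denominator C0 + 1 is
        positive even for C0 = 0 and makes the inequality strict.\<close>
      define e0 where "e0 = \<rho>\<^sup>2 / (C0 + 1)"
      have e0: "0 \<le> e0" "C0 * e0 < \<rho>\<^sup>2"
      proof -
        show "0 \<le> e0" using C0 by (simp add: e0_def)
        have "C0 * \<rho>\<^sup>2 < (C0 + 1) * \<rho>\<^sup>2" using \<rho> by (intro mult_strict_right_mono) auto
        then show "C0 * e0 < \<rho>\<^sup>2" using C0(2) by (simp add: e0_def pos_divide_less_eq mult.commute)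
      qed
      have half: "ennreal (1/2 * S powr (a / 2) * x) \<le> ennreal S * shell_energy a R A S" if "ennreal x \<le> en S" "0 \<le> x" for x
      proof -
        have "1/2 * S powr (a / 2) * x = S * ((1/2 * S powr (a / 2 - 1)) * x)" using Sin by (simp add: powr_diff)
        then have "ennreal (1/2 * S powr (a / 2) * x) = ennreal S * (ennreal (1/2 * S powr (a / 2 - 1)) * ennreal x)"
          using Sin that(2) by (simp add: ennreal_mult[symmetric])
        also have "\<dots> \<le> ennreal S * (ennreal (1/2 * S powr (a / 2 - 1)) * en S)" by (intro mult_left_mono that) auto
        also have "\<dots> \<le> ennreal S * shell_energy a R A S" using Sin by (intro mult_left_mono shell_ge) auto
        finally show ?thesis .
      qed
      show "ennreal (a / 2 + \<beta>) * disc_energy a R A S \<le> ennreal S * shell_energy a R A S \<or>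
        ennreal (1/2 * S powr (a / 2) * (\<rho>\<^sup>2 / (C0 + 1))) \<le> ennreal S * shell_energy a R A S"
      proof (cases "ennreal e0 \<le> en S")
        case True
        then show ?thesis using half[OF True e0(1)] by (simp add: e0_def)
      next
        case False
        define f where "f = (\<lambda>c. A (S, c))"
        define e where "e = enn2real (en S)"
        define p0 q0 where "p0 = right_end (k1 S) f" and "q0 = left_end (k1 S) f"
        have ef: "en S < \<infinity>" using elim Sin by auto
        have e: "en S = ennreal e" "0 \<le> e" using ef by (auto simp: e_def less_top)
        have ee0: "e < e0" using False e e0 by (simp add: ennreal_le_iff not_le)
        have fi: "integrable lborel f" and fm: "f \<in> borel_measurable borel" unfolding f_def using A_int(1)[OF ef] by auto
        have pq: "p0 \<in> N" "q0 \<in> N" using elim Sin by (auto simp: p0_def q0_def f_def)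
        have "norm (q0 - p0) < \<rho>"
        proof -
          have "(norm (q0 - p0))\<^sup>2 \<le> (\<integral>x. norm (f x) \<partial>lborel)\<^sup>2"
            using slice_end_bounds(2)[OF fi, of "k1 S"] by (intro power_mono) (auto simp: p0_def q0_def)
          also have "\<dots> \<le> C0 * e" using A_int(2)[OF ef] by (simp add: f_def e_def)
          also have "\<dots> \<le> C0 * e0" using ee0 C0 by (intro mult_left_mono) auto
          also have "\<dots> < \<rho>\<^sup>2" by (rule e0)
          finally show ?thesis using \<rho> by (intro power2_less_imp_less[of _ \<rho>]) auto
        qed
        then obtain G G' where G: "G 0 = p0" "G 1 = q0" "continuous_on UNIV G" "continuous_on UNIV G'"
          "\<forall>t\<in>{0..1::real}. G t \<in> N \<and> (G has_vector_derivative G' t) (at t within {0..1}) \<and> norm (G' t - (q0 - p0)) \<le> \<tau> * norm (q0 - p0)"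
          using curves pq unfolding short_curve_def by blast
        interpret competitor S \<beta> \<tau> "k1 S" p0 q0 f "\<lambda>c. k1 S + signed_integral 0 c f" G G'
          by unfold_locales (use Sin \<beta> \<tau> fi fm G in \<open>auto simp: p0_def q0_def\<close>)
        have en_f: "(\<integral>\<^sup>+c. ennreal ((1 + c\<^sup>2) powr (1 - a / 2) * (norm (f c))\<^sup>2) \<partial>lborel) = ennreal e"
          using e(1) by (simp add: en_def f_def)
        note ce = comp_disc_energy[OF a C0 en_f e(2)]
        \<comment> \<open>For almost every S the angular and the radial representation of v agree at
          almost every c of the slice. Equating them rewrites the radial one with base point S and
          initial value the slice itself, which is the matching condition for gluing.\<close>
        have acR: "AE c in lborel. AE \<sigma> in lborel. \<sigma> \<in> {0<..<1} \<longrightarrow> v (polar_map (\<sigma>, c)) = (k1 S + signed_integral 0 c f) + signed_integral S \<sigma> (\<lambda>t. R (t, c))"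
        proof -
          have s1: "AE c in lborel. v (polar_map (S, c)) = k1 S + signed_integral 0 c f" using elim Sin by (simp add: f_def)
          have s2: "AE c in lborel. v (polar_map (S, c)) = k2 c + signed_integral (1/2) S (\<lambda>t. R (t, c))" using elim Sin by simp
          show ?thesis using s1 s2 rep3 ii
          proof eventually_elim
            case (elim c)
            note e = elim
            from e(3) show ?case
            proof eventually_elim
              case (elim \<sigma>)
              show ?case
              proof
                assume \<sigma>: "\<sigma> \<in> {0<..<1}"
                have sa: "signed_integral (1/2) S (\<lambda>t. R (t, c)) + signed_integral S \<sigma> (\<lambda>t. R (t, c)) = signed_integral (1/2) \<sigma> (\<lambda>t. R (t, c))"
                  by (rule signed_integral_add[OF _ _ _ _ e(4)]) (use Sin \<sigma> in \<open>auto simp: is_interval_oo\<close>)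
                have h1: "k1 S + signed_integral 0 c f = k2 c + signed_integral (1/2) S (\<lambda>t. R (t, c))" using e(1,2) by simp
                have h2: "v (polar_map (\<sigma>, c)) = k2 c + signed_integral (1/2) \<sigma> (\<lambda>t. R (t, c))" using elim \<sigma> by simp
                show "v (polar_map (\<sigma>, c)) = (k1 S + signed_integral 0 c f) + signed_integral S \<sigma> (\<lambda>t. R (t, c))"
                  unfolding h1 h2 sa[symmetric] by (simp add: add.assoc)
              qed
            qed
          qed
        qed
        have acA: "AE \<sigma> in lborel. \<sigma> \<in> {0<..<1} \<longrightarrow> (\<exists>k. AE c in lborel. v (polar_map (\<sigma>, c)) = k + signed_integral 0 c (\<lambda>t. A (\<sigma>, t)))"
          using rep1 by eventually_elim blast
        have "disc_energy a R A S \<le> disc_energy a comp_radial comp_angular S"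
          unfolding a_def R_def A_def
        proof (rule disc_energy_le_comp[OF s _ compact_imp_bounded[OF N] _ min mv mg v0 wg0 wg])
          show "disc_energy (1 - 2 * s) comp_radial comp_angular S < \<infinity>"
            using ce unfolding a_def[symmetric] by (rule order_le_less_trans) simp
        qed (use Sin G(5) fin acR acA in \<open>auto simp: a_def R_def A_def\<close>)
        also note ce
        finally have 1: "disc_energy a R A S \<le> ennreal (1/2 * e * (1 + \<tau> * (1 + 2 * C0\<^sup>2) + 16 * \<beta>\<^sup>2 * C0\<^sup>2) * (S powr (a / 2) / (a / 2 + 2 * \<beta>)))" .
        have b: "0 < a / 2 + 2 * \<beta>" "0 \<le> a / 2 + \<beta>" using a \<beta> by auto
        let ?K = "1 + \<tau> * (1 + 2 * C0\<^sup>2) + 16 * \<beta>\<^sup>2 * C0\<^sup>2"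
        \<comment> \<open>By \<open>gain\<close>, multiplying the competitor's bound by a/2 +
          \<beta> leaves at most (1/2) S^(a/2) e, and this is bounded by S times the shell
          energy.\<close>
        have "ennreal (a / 2 + \<beta>) * disc_energy a R A S \<le> ennreal (a / 2 + \<beta>) * ennreal (1/2 * e * ?K * (S powr (a / 2) / (a / 2 + 2 * \<beta>)))"
          by (intro mult_left_mono 1) simp
        also have "\<dots> = ennreal ((a / 2 + \<beta>) * (1/2 * e * ?K * (S powr (a / 2) / (a / 2 + 2 * \<beta>))))"
          using b e(2) \<tau> by (intro ennreal_mult[symmetric]) auto
        also have "\<dots> \<le> ennreal (1/2 * S powr (a / 2) * e)"
        proof (rule ennreal_leI)
          have "((a / 2 + \<beta>) * ?K) * (1/2 * S powr (a / 2) * e) \<le> (a / 2 + 2 * \<beta>) * (1/2 * S powr (a / 2) * e)"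
            by (intro mult_right_mono gain) (use e in auto)
          then have "((a / 2 + \<beta>) * ?K) * (1/2 * S powr (a / 2) * e) / (a / 2 + 2 * \<beta>) \<le> 1/2 * S powr (a / 2) * e"
            using b(1) by (simp only: pos_divide_le_eq mult.commute)
          also have "((a / 2 + \<beta>) * ?K) * (1/2 * S powr (a / 2) * e) / (a / 2 + 2 * \<beta>) = (a / 2 + \<beta>) * (1/2 * e * ?K * (S powr (a / 2) / (a / 2 + 2 * \<beta>)))" by simp
          finally show "(a / 2 + \<beta>) * (1/2 * e * ?K * (S powr (a / 2) / (a / 2 + 2 * \<beta>))) \<le> 1/2 * S powr (a / 2) * e" .
        qed
        also have "\<dots> \<le> ennreal S * shell_energy a R A S" by (rule half) (use e in auto)
        finally show ?thesis by blast
      qed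
    qed
  qed
qed

text \<open>The radius r0 depends on s alone, through C0 and \<beta>. The manifold enters only
  through \<epsilon>2, by way of the distance \<rho> below which points of N are joined by short
  curves of quality \<tau>.\<close>

theorem theorem3p4:
  fixes s :: real and N :: "(real^'d) set"
  assumes "0 < s" and "s < 1/2"
    and "compact N" and "smooth_submanifold N"
  shows "\<exists>r0 \<epsilon>2. 0 < r0 \<and> r0 < 1/2 \<and> 0 < \<epsilon>2 \<and>
           (\<forall>v. minimizing_whm_free_boundary s N v \<and>
                energy_s s v (half_ball (0,0) 1) \<le> \<epsilon>2\<^sup>2 \<and>
                0 < energy_s s v (half_ball (0,0) 1)
              \<longrightarrow> energy_s s v (half_ball (0,0) r0) / r0 powr (1 - 2 * s)
                    < 1/2 * energy_s s v (half_ball (0,0) 1))"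
proof -
  define a where "a = 1 - 2 * s"
  have a: "0 < a" "a < 1" using assms by (auto simp: a_def)
  define C0 where "C0 = enn2real (\<integral>\<^sup>+c. ennreal ((1 + c\<^sup>2) powr (- (1 - a / 2))) \<partial>lborel)"
  have "(\<integral>\<^sup>+c. ennreal ((1 + c\<^sup>2) powr (- (1 - a / 2))) \<partial>lborel) < \<infinity>"
    by (rule nn_integral_powr_one_plus_sq_finite) (use a in simp)
  then have C0: "(\<integral>\<^sup>+c. ennreal ((1 + c\<^sup>2) powr (- (1 - a / 2))) \<partial>lborel) = ennreal C0" "0 \<le> C0"
    by (auto simp: C0_def less_top)
  \<comment> \<open>Makes 16 \<beta>^2 C0^2 <= \<beta>/2, so the radial cost uses at most half of
    the allowed error \<beta>; also \<beta> <= 1/32, which keeps a/2 + \<beta> below 1.\<close>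
  define \<beta> where "\<beta> = 1 / (32 * (1 + C0\<^sup>2))"
  \<comment> \<open>Makes \<tau> (1 + 2 C0^2) = \<beta>/2, the other half. The total relative error
    is then at most \<beta>, and times a/2 + \<beta> <= 1 it is covered by the surplus \<beta> in
    a/2 + 2 \<beta>.\<close>
  define \<tau> where "\<tau> = \<beta> / (2 * (1 + 2 * C0\<^sup>2))"
  have C1: "1 \<le> 1 + C0\<^sup>2" "1 \<le> 1 + 2 * C0\<^sup>2" by simp_all
  have \<beta>: "0 < \<beta>" "\<beta> \<le> 1 / 32"
  proof -
    show "0 < \<beta>" by (auto simp: \<beta>_def intro!: divide_pos_pos add_pos_nonneg)
    have "\<beta> \<le> 1 / (32 * 1)" unfolding \<beta>_def using C1 by (intro divide_left_mono mult_left_mono) (auto intro!: add_pos_nonneg)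
    then show "\<beta> \<le> 1 / 32" by simp
  qed
  have \<tau>: "0 < \<tau>" "\<tau> \<le> 1"
  proof -
    have d: "1 \<le> 2 * (1 + 2 * C0\<^sup>2)" by simp
    show "0 < \<tau>" unfolding \<tau>_def by (intro divide_pos_pos \<beta>(1) less_le_trans[OF zero_less_one d])
    have "\<tau> \<le> \<beta> / 1" unfolding \<tau>_def using d \<beta>(1) less_le_trans[OF zero_less_one d] by (intro divide_left_mono) auto
    then show "\<tau> \<le> 1" using \<beta> by simp
  qed
  have gain: "(a / 2 + \<beta>) * (1 + \<tau> * (1 + 2 * C0\<^sup>2) + 16 * \<beta>\<^sup>2 * C0\<^sup>2) \<le> a / 2 + 2 * \<beta>"
  proof -
    have "1 \<le> 2 * (1 + 2 * C0\<^sup>2)" by simp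
    then have d: "2 * (1 + 2 * C0\<^sup>2) \<noteq> 0" by (intro less_imp_neq[THEN not_sym] less_le_trans[OF zero_less_one])
    have "\<tau> * (2 * (1 + 2 * C0\<^sup>2)) = \<beta>" unfolding \<tau>_def by (simp only: times_divide_eq_left nonzero_mult_div_cancel_right[OF d])
    then have t: "\<tau> * (1 + 2 * C0\<^sup>2) = \<beta> / 2" by linarith
    have "\<beta> * (16 * C0\<^sup>2) \<le> 1 / 2"
    proof -
      have "1 \<le> 32 * (1 + C0\<^sup>2)" by simp
      then have d: "32 * (1 + C0\<^sup>2) \<noteq> 0" by (intro less_imp_neq[THEN not_sym] less_le_trans[OF zero_less_one])
      have "\<beta> * (32 * (1 + C0\<^sup>2)) = 1" unfolding \<beta>_def by (simp only: times_divide_eq_left nonzero_mult_div_cancel_right[OF d])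
      then have "\<beta> * (16 * C0\<^sup>2) = 1 / 2 - 16 * \<beta>" by (simp add: algebra_simps)
      then show ?thesis using \<beta>(1) by linarith
    qed
    then have "\<beta> * (\<beta> * (16 * C0\<^sup>2)) \<le> \<beta> * (1 / 2)" using \<beta> by (intro mult_left_mono) auto
    then have "\<tau> * (1 + 2 * C0\<^sup>2) + 16 * \<beta>\<^sup>2 * C0\<^sup>2 \<le> \<beta>" unfolding t by (simp add: power2_eq_square mult_ac)
    then have "(a / 2 + \<beta>) * (\<tau> * (1 + 2 * C0\<^sup>2) + 16 * \<beta>\<^sup>2 * C0\<^sup>2) \<le> 1 * \<beta>"
      using a \<beta> \<tau> by (intro mult_mono) auto
    then show ?thesis by (simp add: distrib_left)
  qed
  obtain \<rho> where \<rho>: "0 < \<rho>" and curves: "\<forall>p\<in>N. \<forall>q\<in>N. norm (q - p) < \<rho> \<longrightarrow> (\<exists>G G'. short_curve N \<tau> p q G G')"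
    using submanifold_short_curves[OF assms(3,4) \<tau>(1)] by blast
  \<comment> \<open>Solves r0^(2 \<beta>) = 1/4; since 1/(2 \<beta>) >= 1, this gives r0 <=
    1/4.\<close>
  define r0 where "r0 = (1/4 :: real) powr (1 / (2 * \<beta>))"
  define S0 where "S0 = r0\<^sup>2"
  define e0 where "e0 = \<rho>\<^sup>2 / (C0 + 1)"
  \<comment> \<open>Chosen so that 2 E <= 1/2 S0^(a/2) e0: on slices of large angular energy the
    lower bound for S times the shell energy then exceeds twice the total energy, for every S >
    S0.\<close>
  define \<epsilon>2 where "\<epsilon>2 = sqrt (1/4 * S0 powr (a / 2) * e0)"
  have r0: "0 < r0" "r0 < 1/2"
  proof -
    show "0 < r0" by (simp add: r0_def)
    have "1 \<le> 1 / (2 * \<beta>)" using \<beta> by (simp add: divide_simps)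
    then have "r0 \<le> (1/4) powr 1" unfolding r0_def by (intro powr_mono') auto
    then show "r0 < 1/2" by simp
  qed
  have r0\<beta>: "r0 powr (2 * \<beta>) = 1/4" using \<beta> by (simp add: r0_def powr_powr)
  have S0: "0 < S0" "S0 < 1" using r0 by (auto simp: S0_def power_less_one_iff abs_square_less_1)
  have e0: "0 < e0" using \<rho> C0 by (simp add: e0_def)
  have \<epsilon>2: "0 < \<epsilon>2" "\<epsilon>2\<^sup>2 = 1/4 * S0 powr (a / 2) * e0" using S0 e0 by (auto simp: \<epsilon>2_def)
  show ?thesis
  proof (rule exI[of _ r0], rule exI[of _ \<epsilon>2], intro conjI allI impI r0 \<epsilon>2(1))
    fix v0 :: "real \<times> real \<Rightarrow> real^'d"
    assume "minimizing_whm_free_boundary s N v0 \<and> energy_s s v0 (half_ball (0, 0) 1) \<le> \<epsilon>2\<^sup>2 \<and> 0 < energy_s s v0 (half_ball (0, 0) 1)"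
    then have min: "minimizing_whm_free_boundary s N v0" and small: "energy_s s v0 (half_ball (0, 0) 1) \<le> \<epsilon>2\<^sup>2"
      and pos: "0 < energy_s s v0 (half_ball (0, 0) 1)" by auto
    let ?\<Omega> = "half_ball (0, 0) 1 :: (real \<times> real) set"
    obtain h1 h2 where wh: "is_weak_grad ?\<Omega> v0 h1 h2"
      and hfin: "(\<integral>\<^sup>+ p\<in>?\<Omega>. ennreal (snd p powr a * ((norm (v0 p))\<^sup>2 + (norm (h1 p))\<^sup>2 + (norm (h2 p))\<^sup>2)) \<partial>lebesgue) < \<infinity>"
      using min unfolding minimizing_whm_free_boundary_def weighted_H1_def a_def by blast
    have l: "locally_integrable_on ?\<Omega> v0" "locally_integrable_on ?\<Omega> h1" "locally_integrable_on ?\<Omega> h2" using wh by (auto simp: is_weak_grad_def)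
    obtain v where v [measurable]: "v \<in> borel_measurable borel" and ev: "AE p in lborel. p \<in> ?\<Omega> \<longrightarrow> v0 p = v p"
      using locally_integrable_borel_version[OF open_half_ball l(1)] by blast
    obtain g1 where g1 [measurable]: "g1 \<in> borel_measurable borel" and e1: "AE p in lborel. p \<in> ?\<Omega> \<longrightarrow> h1 p = g1 p"
      using locally_integrable_borel_version[OF open_half_ball l(2)] by blast
    obtain g2 where g2 [measurable]: "g2 \<in> borel_measurable borel" and e2: "AE p in lborel. p \<in> ?\<Omega> \<longrightarrow> h2 p = g2 p"
      using locally_integrable_borel_version[OF open_half_ball l(3)] by blast
    have loc: "(\<lambda>p. indicator ?\<Omega> p *\<^sub>R k p) \<in> borel_measurable lebesgue" if [measurable]: "k \<in> borel_measurable borel" for k :: "real \<times> real \<Rightarrow> real^'d"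
    proof -
      have "(\<lambda>p. indicator ?\<Omega> p *\<^sub>R k p) \<in> borel_measurable lborel" by measurable
      then show ?thesis by (rule measurable_completion)
    qed
    have wg0: "is_weak_grad ?\<Omega> v0 g1 g2"
    proof (rule is_weak_grad_cong[OF open_half_ball wh _ locally_integrable_measurable[OF open_half_ball l(1)] loc[OF g1] loc[OF g2]])
      show "AE p in lborel. p \<in> ?\<Omega> \<longrightarrow> v0 p = v0 p \<and> g1 p = h1 p \<and> g2 p = h2 p" using e1 e2 by eventually_elim auto
    qed
    have wg: "is_weak_grad ?\<Omega> v g1 g2"
    proof (rule is_weak_grad_cong[OF open_half_ball wg0 _ loc[OF v] loc[OF g1] loc[OF g2]])
      show "AE p in lborel. p \<in> ?\<Omega> \<longrightarrow> v p = v0 p \<and> g1 p = g1 p \<and> g2 p = g2 p" using ev by eventually_elim auto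
    qed
    define F where "F = disc_energy a (polar_radial g1 g2) (polar_angular g1 g2)"
    let ?f = "shell_energy a (polar_radial g1 g2) (polar_angular g1 g2)"
    have [measurable]: "polar_radial g1 g2 \<in> borel_measurable borel" "polar_angular g1 g2 \<in> borel_measurable borel"
      unfolding polar_radial_def polar_angular_def by measurable
    have fin: "F 1 < \<infinity>"
    proof -
      have "F 1 = (\<integral>\<^sup>+p\<in>?\<Omega>. ennreal (snd p powr a * ((norm (g1 p))\<^sup>2 + (norm (g2 p))\<^sup>2)) \<partial>lebesgue)"
        unfolding F_def half_ball_energy_polar[OF zero_less_one g1 g2] by simp
      also have "\<dots> \<le> (\<integral>\<^sup>+ p\<in>?\<Omega>. ennreal (snd p powr a * ((norm (v0 p))\<^sup>2 + (norm (h1 p))\<^sup>2 + (norm (h2 p))\<^sup>2)) \<partial>lebesgue)"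
        unfolding nn_integral_completion
      proof (rule nn_integral_mono_AE)
        show "AE p in lborel. ennreal (snd p powr a * ((norm (g1 p))\<^sup>2 + (norm (g2 p))\<^sup>2)) * indicator ?\<Omega> p
          \<le> ennreal (snd p powr a * ((norm (v0 p))\<^sup>2 + (norm (h1 p))\<^sup>2 + (norm (h2 p))\<^sup>2)) * indicator ?\<Omega> p"
          using e1 e2 by eventually_elim (auto simp: indicator_def intro!: ennreal_leI mult_left_mono)
      qed
      finally show ?thesis using hfin by (rule order_le_less_trans)
    qed
    define E where "E = energy_s s v0 ?\<Omega>"
    have E: "E = 1/2 * enn2real (F 1)" unfolding E_def energy_s_polar[OF zero_less_one wg0 g1 g2] by (simp add: F_def a_def)
    have F1: "F 1 = ennreal (2 * E)" unfolding E using fin by (simp add: less_top)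
    have Fmono: "F S \<le> F 1" if "S \<le> 1" for S
      unfolding F_def disc_energy_def using that by (intro nn_integral_mono) (auto simp: indicator_def)
    have dec: "AE S in lborel. S \<in> {0<..<1} \<longrightarrow> ennreal (a / 2 + \<beta>) * F S \<le> ennreal S * ?f S \<or> ennreal (1/2 * S powr (a / 2) * (\<rho>\<^sup>2 / (C0 + 1))) \<le> ennreal S * ?f S"
      using energy_decay_AE[OF assms(2,3) min v g1 g2 ev wg0 wg _ _ C0(2) \<beta>(1) less_imp_le[OF \<tau>(1)] \<tau>(2) \<rho> _ curves] fin C0(1) gain
      unfolding a_def F_def by blast
    have "AE S in lborel. S \<in> {S0<..<1} \<longrightarrow> ennreal (a / 2 + \<beta>) * F S \<le> ennreal S * ?f S"
      using dec
    proof eventually_elim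
      case (elim S)
      show ?case
      proof
        assume S: "S \<in> {S0<..<1}"
        then have S1: "S \<in> {0<..<1}" using S0 by simp
        consider "ennreal (a / 2 + \<beta>) * F S \<le> ennreal S * ?f S" | "ennreal (1/2 * S powr (a / 2) * e0) \<le> ennreal S * ?f S"
          using elim S1 unfolding e0_def by blast
        then show "ennreal (a / 2 + \<beta>) * F S \<le> ennreal S * ?f S"
        proof cases
          case 2
          \<comment> \<open>Large angular energy: a/2 + \<beta> <= 1 bounds the left side by F 1 = 2
            E, and smallness of E together with S > S0 puts this below S times the shell
            energy.\<close>
          have "ennreal (a / 2 + \<beta>) * F S \<le> ennreal 1 * F 1"
            using a \<beta> S by (intro mult_mono Fmono ennreal_leI) auto
          also have "\<dots> = ennreal (2 * E)" by (simp add: F1)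
          also have "\<dots> \<le> ennreal (1/2 * S powr (a / 2) * e0)"
          proof (rule ennreal_leI)
            have "S0 powr (a / 2) \<le> S powr (a / 2)" using S S0 a by (intro powr_mono2) auto
            then have "1/2 * S0 powr (a / 2) * e0 \<le> 1/2 * S powr (a / 2) * e0" using e0 by (intro mult_right_mono) auto
            moreover have "2 * E \<le> 1/2 * S0 powr (a / 2) * e0" using small \<epsilon>2(2) by (simp add: E_def)
            ultimately show "2 * E \<le> 1/2 * S powr (a / 2) * e0" by linarith
          qed
          also note 2
          finally show ?thesis .
        qed
      qed
    qed
    then have "F S0 \<le> ennreal (S0 powr (a / 2 + \<beta>)) * F 1"
      unfolding F_def disc_energy_def
      by (intro gronwall_ennreal) (use fin a \<beta> S0 in \<open>auto simp: F_def disc_energy_def\<close>)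
    also have "\<dots> = ennreal (S0 powr (a / 2 + \<beta>) * (2 * E))" unfolding F1 by (rule ennreal_mult[symmetric]) (use pos in \<open>auto simp: E_def\<close>)
    finally have FS0: "enn2real (F S0) \<le> S0 powr (a / 2 + \<beta>) * (2 * E)"
      using pos by (intro enn2real_leI) (auto simp: E_def)
    have sub: "half_ball (0, 0) r0 \<subseteq> ?\<Omega>" using r0 by (auto simp: half_ball_def)
    have "energy_s s v0 (half_ball (0, 0) r0) = 1/2 * enn2real (F S0)"
      unfolding energy_s_polar[OF r0(1) is_weak_grad_subset[OF wg0 sub] g1 g2] by (simp add: F_def a_def S0_def)
    also have "\<dots> \<le> S0 powr (a / 2 + \<beta>) * E" using FS0 by simp
    also have "S0 powr (a / 2 + \<beta>) = r0 powr a * (1/4)"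
    proof -
      have "S0 = r0 powr 2" using r0 by (simp add: S0_def powr_numeral)
      then have "S0 powr (a / 2 + \<beta>) = r0 powr (a + 2 * \<beta>)" by (simp add: powr_powr distrib_left)
      then show ?thesis by (simp add: powr_add r0\<beta>)
    qed
    finally have "energy_s s v0 (half_ball (0, 0) r0) \<le> r0 powr a * (1/4) * E" .
    moreover have r0a: "0 < r0 powr a" using r0 by simp
    ultimately have "energy_s s v0 (half_ball (0, 0) r0) / r0 powr a \<le> 1/4 * E"
      by (simp add: pos_divide_le_eq mult_ac)
    \<comment> \<open>The factor 1/4 built into r0 leaves room for the strict inequality, by
      positivity of E.\<close>
    also have "\<dots> < 1/2 * E" using pos by (simp add: E_def)
    finally show "energy_s s v0 (half_ball (0, 0) r0) / r0 powr (1 - 2 * s) < 1/2 * energy_s s v0 (half_ball (0, 0) 1)"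
      by (simp add: E_def a_def)
  qed
qed

end
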